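(* Let $N\ge2$, $\alpha\in(0,N)$ and $\frac{N+\alpha}{N}<p<\frac{N+\alpha}{N-1}$. Then there exist infinitely many distinct solutions of the problem $$(-\Delta+\mathrm{id})^{\frac12}u=(I_\alpha*|u|^p)\,|u|^{p-2}u\quad\text{in }\mathbb{R}^N,\qquad u\in H^{\frac12}(\mathbb{R}^N).$$
   Context: Functions are real-valued. The Riesz potential of order $\alpha\in(0,N)$ is $I_\alpha(x)=\dfrac{\Gamma(\frac{N-\alpha}{2})}{2^\alpha\pi^{N/2}\Gamma(\frac{\alpha}{2})|x|^{N-\alpha}}$ for $x\in\mathbb{R}^N\setminus\{0\}$, and $*$ is convolution on $\mathbb{R}^N$. For $s>0$, $(-\Delta+\mathrm{id})^{s}$ is the Fourier multiplier operator with symbol $(1+|\xi|^2)^{s}$. The space $H^{\frac12}(\mathbb{R}^N)=\{u\in L^2(\mathbb{R}^N): (-\Delta+\mathrm{id})^{\frac14}u\in L^2(\mathbb{R}^N)\}$ has norm $\|u\|_{H^{1/2}}=\|(-\Delta+\mathrm{id})^{\frac14}u\|_{L^2(\mathbb{R}^N)}$. A solution is understood in the weak sense: $u\in H^{\frac12}(\mathbb{R}^N)$ and for every $\varphi\in H^{\frac12}(\mathbb{R}^N)$, $\int_{\mathbb{R}^N}(-\Delta+\mathrm{id})^{\frac14}u\,(-\Delta+\mathrm{id})^{\frac14}\varphi\,dx=\int_{\mathbb{R}^N}(I_\alpha*|u|^p)|u|^{p-2}u\,\varphi\,dx$. *)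

theory Defs
  imports "HOL-Analysis.Analysis"
begin

text \<open>
  Functions are represented by Borel measurable representatives, with Lebesgue measure
  \<open>lborel\<close> on \<open>real ^ 'n\<close>, so that the dimension is \<open>N = CARD('n)\<close>.
  Equality of elements of \<open>L\<^sup>2\<close> is equality almost everywhere.
\<close>

definition L2 :: "(real ^ 'n \<Rightarrow> 'b::{real_normed_vector, second_countable_topology}) set" where
  "L2 = {f \<in> borel_measurable lborel. integrable lborel (\<lambda>x. (norm (f x))\<^sup>2)}"

definition fourier_integral :: "(real ^ 'n \<Rightarrow> complex) \<Rightarrow> real ^ 'n \<Rightarrow> complex" where
  "fourier_integral f \<xi> =
     of_real ((2 * pi) powr (- real CARD('n) / 2)) * (\<integral>x. cis (- (x \<bullet> \<xi>)) * f x \<partial>lborel)"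

text \<open>
  \<open>has_L2_fourier f g\<close>: \<open>g\<close> is (a representative of) the Fourier transform of \<open>f\<close> in the sense
  of Plancherel, i.e. under the continuous extension of \<open>fourier_integral\<close> from
  \<open>L\<^sup>1 \<inter> L\<^sup>2\<close> to \<open>L\<^sup>2\<close>.
  With this normalisation \<open>- \<Delta>\<close> has symbol \<open>|\<xi>|\<^sup>2\<close>.
\<close>

definition has_L2_fourier :: "(real ^ 'n \<Rightarrow> complex) \<Rightarrow> (real ^ 'n \<Rightarrow> complex) \<Rightarrow> bool" where
  "has_L2_fourier f g \<longleftrightarrow> f \<in> L2 \<and> g \<in> L2 \<and>
     (\<exists>h :: nat \<Rightarrow> real ^ 'n \<Rightarrow> complex.
        (\<forall>k. h k \<in> L2 \<and> integrable lborel (h k)) \<and>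
        (\<lambda>k. \<integral>\<^sup>+ x. ennreal ((norm (h k x - f x))\<^sup>2) \<partial>lborel) \<longlonglongrightarrow> 0 \<and>
        (\<lambda>k. \<integral>\<^sup>+ \<xi>. ennreal ((norm (fourier_integral (h k) \<xi> - g \<xi>))\<^sup>2) \<partial>lborel) \<longlonglongrightarrow> 0)"

text \<open>
  \<open>fourier_multiplier m u f\<close>: the Fourier multiplier operator with symbol \<open>m\<close> maps
  \<open>u \<in> L\<^sup>2\<close> to \<open>f \<in> L\<^sup>2\<close>; such an \<open>f\<close> is unique up to null sets.
\<close>

definition fourier_multiplier ::
    "(real ^ 'n \<Rightarrow> real) \<Rightarrow> (real ^ 'n \<Rightarrow> real) \<Rightarrow> (real ^ 'n \<Rightarrow> real) \<Rightarrow> bool" where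
  "fourier_multiplier m u f \<longleftrightarrow>
     (\<exists>g. has_L2_fourier (\<lambda>x. of_real (u x)) g \<and>
          has_L2_fourier (\<lambda>x. of_real (f x)) (\<lambda>\<xi>. of_real (m \<xi>) * g \<xi>))"

definition bessel_symbol :: "real \<Rightarrow> real ^ 'n \<Rightarrow> real" where
  "bessel_symbol s \<xi> = (1 + (norm \<xi>)\<^sup>2) powr s"

text \<open>
  A representative of \<open>(- \<Delta> + id)\<^sup>s u\<close>, meaningful for those \<open>u \<in> L\<^sup>2\<close> whose image
  lies in \<open>L\<^sup>2\<close>.
\<close>

definition bessel_op :: "real \<Rightarrow> (real ^ 'n \<Rightarrow> real) \<Rightarrow> real ^ 'n \<Rightarrow> real" where
  "bessel_op s u = (SOME f. fourier_multiplier (bessel_symbol s) u f)"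

definition H_half :: "(real ^ 'n \<Rightarrow> real) set" where
  "H_half = {u \<in> L2. \<exists>f \<in> L2. fourier_multiplier (bessel_symbol (1/4)) u f}"

definition ae_equal_H_half :: "(real ^ 'n \<Rightarrow> real) rel" where
  "ae_equal_H_half = {(u, v). u \<in> H_half \<and> v \<in> H_half \<and> (AE x in lborel. u x = v x)}"

definition riesz_potential :: "real \<Rightarrow> real ^ 'n \<Rightarrow> real" where
  "riesz_potential \<alpha> x =
     Gamma ((real CARD('n) - \<alpha>) / 2) /
     (2 powr \<alpha> * pi powr (real CARD('n) / 2) * Gamma (\<alpha> / 2) * norm x powr (real CARD('n) - \<alpha>))"

definition convolution :: "(real ^ 'n \<Rightarrow> real) \<Rightarrow> (real ^ 'n \<Rightarrow> real) \<Rightarrow> real ^ 'n \<Rightarrow> real" where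
  "convolution f g x = (\<integral>y. f (x - y) * g y \<partial>lborel)"

definition choquard_rhs :: "real \<Rightarrow> real \<Rightarrow> (real ^ 'n \<Rightarrow> real) \<Rightarrow> real ^ 'n \<Rightarrow> real" where
  "choquard_rhs \<alpha> p u x =
     convolution (riesz_potential \<alpha>) (\<lambda>y. \<bar>u y\<bar> powr p) x * \<bar>u x\<bar> powr (p - 2) * u x"

text \<open>
  Weak solutions of \<open>(- \<Delta> + id)\<^sup>1\<^sup>/\<^sup>2 u = (I\<^sub>\<alpha> * |u|\<^sup>p) |u|\<^sup>p\<^sup>-\<^sup>2 u\<close>.
  The Bochner integral of a non-integrable function is \<open>0\<close>; the two integrability clauses say
  that the convolution and the right-hand side of the weak equation are honest integrals.
  For \<open>(N + \<alpha>) / N < p < (N + \<alpha>) / (N - 1)\<close> they hold for all \<open>u, \<phi> \<in> H_half\<close>,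
  by the Hardy-Littlewood-Sobolev and Sobolev inequalities.
\<close>

definition choquard_solution :: "real \<Rightarrow> real \<Rightarrow> (real ^ 'n \<Rightarrow> real) \<Rightarrow> bool" where
  "choquard_solution \<alpha> p u \<longleftrightarrow> u \<in> H_half \<and>
     (AE x in lborel. integrable lborel (\<lambda>y. riesz_potential \<alpha> (x - y) * \<bar>u y\<bar> powr p)) \<and>
     (\<forall>\<phi> \<in> H_half.
        integrable lborel (\<lambda>x. choquard_rhs \<alpha> p u x * \<phi> x) \<and>
        (\<integral>x. bessel_op (1/4) u x * bessel_op (1/4) \<phi> x \<partial>lborel) =
        (\<integral>x. choquard_rhs \<alpha> p u x * \<phi> x \<partial>lborel))"

end

theory Submission
  imports Defs "HOL-Probability.Probability" "HOL-Library.Diagonal_Subsequence"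
begin

text \<open>
  The equation is invariant under translations, and a nonzero \<open>L\<^sup>2\<close> function is not periodic, so
  the translates of a single nontrivial solution are infinitely many solutions.

  To get one, write \<open>u = G * f\<close> with \<open>f \<in> L\<^sup>2\<close> and \<open>G\<close> the kernel of \<open>(- \<Delta> + id)\<^sup>-\<^sup>1\<^sup>/\<^sup>4\<close>, and maximize
  \<open>\<integral> (I\<^sub>\<alpha> * |u|\<^sup>p) |u|\<^sup>p\<close> over radial \<open>f\<close> in the unit ball of \<open>L\<^sup>2\<close>. The energy is bounded there by a
  Riesz energy estimate and Young's inequality for \<open>G\<close>, and \<open>u \<mapsto> energy\<^sup>1\<^sup>/\<^sup>2\<^sup>p\<close> satisfies the triangle
  inequality because \<open>I\<^sub>\<alpha>\<close>, a superposition of Gaussians, is positive definite. A maximizing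
  sequence, weakly convergent, is compact for the energy: a radial \<open>L\<^sup>2\<close> function has little mass on
  a ball far from the origin, since many disjoint rotated copies of the ball carry the same mass.
  Hoelder's inequality for the energy bounds the \<open>L\<^sup>2\<close> norm of \<open>G * ((I\<^sub>\<alpha> * u\<^sup>p) u\<^sup>p\<^sup>-\<^sup>1)\<close>, with equality at the
  maximizer, so that this function is a multiple of \<open>f\<close>; rescaling gives a solution.
\<close>

section \<open>Gaussian integrals and translations\<close>

text \<open>Radial competitors suffice because the Bessel potential of the nonlinearity of a radial
  function is again radial: radial test functions already determine its L2 norm, so neither a
  derivative of the energy nor a principle of symmetric criticality enters. The Riesz kernel lies in
  no Lebesgue space. In place of the Hardy-Littlewood-Sobolev inequality, it is cut at the unit
  sphere into two pieces that are integrable to powers on either side of the critical one, and the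
  strict bounds on \<open>p\<close> leave room for both. Weak convergence is used only in the form
  of weakly Cauchy sequences. Differences of far terms have small energy, so their midpoints are
  almost optimal, and the parallelogram law in the unit ball turns this into strong L2 convergence.
  \<open>H_half\<close> is defined through the L2 Fourier transform; Plancherel, obtained by
  Gaussian damping, identifies it with the range of the convolution with G. Most estimates run in
  the extended nonnegative reals, where iterated integrals exist and may be exchanged before
  finiteness is known.\<close>

lemma lborel_integral_prod:
  fixes f :: "'a::euclidean_space \<Rightarrow> real \<Rightarrow> complex"
  assumes "\<And>b. b \<in> Basis \<Longrightarrow> integrable lborel (f b)"
  shows "(\<integral>x. (\<Prod>b\<in>Basis. f b (x \<bullet> b)) \<partial>lborel) = (\<Prod>b\<in>Basis. (\<integral>x. f b x \<partial>lborel))"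
proof -
  interpret product_sigma_finite "\<lambda>_::'a. lborel :: real measure" ..
  have [measurable]: "f b \<in> borel_measurable borel" if "b \<in> Basis" for b
    using assms[OF that] by auto
  have "(\<integral>x. (\<Prod>b\<in>Basis. f b (x \<bullet> b)) \<partial>lborel) =
      (\<integral>x. (\<Prod>b\<in>Basis. f b (x b)) \<partial>(\<Pi>\<^sub>M b\<in>Basis. lborel))"
    unfolding lborel_eq[where 'a='a]
    by (subst integral_distr) (auto intro!: Bochner_Integration.integral_cong prod.cong)
  also have "\<dots> = (\<Prod>b\<in>Basis. (\<integral>x. f b x \<partial>lborel))"
    by (rule product_integral_prod) (use assms in auto)
  finally show ?thesis .
qed

lemma nn_integral_gaussian_real:
  fixes t :: real
  assumes t: "t > 0"
  shows "(\<integral>\<^sup>+x. ennreal (exp (- t * x\<^sup>2)) \<partial>lborel) = ennreal (sqrt (pi / t))"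
proof -
  define s where "s = 1 / sqrt (2 * t)"
  have s: "s > 0" "2 * s\<^sup>2 = 1 / t" using t by (auto simp: s_def power_divide field_simps)
  have eq: "exp (- t * x\<^sup>2) = sqrt (pi / t) * normal_density 0 s x" for x
  proof -
    have "2 * pi * s\<^sup>2 = pi / t" using s by (simp add: field_simps)
    moreover have "- (x - 0)\<^sup>2 / (2 * s\<^sup>2) = - t * x\<^sup>2" unfolding s(2) by simp
    ultimately show ?thesis using t unfolding normal_density_def by simp
  qed
  have "(\<integral>\<^sup>+x. ennreal (exp (- t * x\<^sup>2)) \<partial>lborel) = ennreal (\<integral>x. exp (- t * x\<^sup>2) \<partial>lborel)"
    unfolding eq by (rule nn_integral_eq_integral) (use s t in auto)
  also have "(\<integral>x. exp (- t * x\<^sup>2) \<partial>lborel) = sqrt (pi / t)"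
    unfolding eq using s by simp
  finally show ?thesis .
qed

lemma exp_norm_sq_prod:
  fixes x :: "'a::euclidean_space"
  shows "exp (- t * (norm x)\<^sup>2) = (\<Prod>b\<in>Basis. exp (- t * (x \<bullet> b)\<^sup>2))"
proof -
  have "(norm x)\<^sup>2 = (\<Sum>b\<in>Basis. (x \<bullet> b)\<^sup>2)"
    unfolding power2_norm_eq_inner by (subst euclidean_inner) (simp add: power2_eq_square)
  then show ?thesis by (simp add: sum_distrib_left flip: exp_sum)
qed

lemma nn_integral_gaussian:
  fixes t :: real
  assumes t: "t > 0"
  shows "(\<integral>\<^sup>+x. ennreal (exp (- t * (norm (x::'a::euclidean_space))\<^sup>2)) \<partial>lborel) =
    ennreal ((pi / t) powr (DIM('a) / 2))"
proof -
  have "(\<integral>\<^sup>+x. ennreal (exp (- t * (norm (x::'a))\<^sup>2)) \<partial>lborel) =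
     (\<integral>\<^sup>+x. (\<Prod>b\<in>Basis. ennreal (exp (- t * ((x::'a) \<bullet> b)\<^sup>2))) \<partial>lborel)"
    by (subst exp_norm_sq_prod) (simp add: prod_ennreal)
  also have "\<dots> = (\<Prod>b\<in>(Basis::'a set). ennreal (sqrt (pi / t)))"
    by (subst nn_integral_lborel_prod) (auto simp: nn_integral_gaussian_real[OF t, simplified])
  also have "\<dots> = ennreal (sqrt (pi / t) ^ DIM('a))"
    using t by (simp add: ennreal_power)
  also have "sqrt (pi / t) ^ DIM('a) = (pi / t) powr (DIM('a) / 2)"
    using t by (simp add: powr_half_sqrt[symmetric] powr_powr flip: powr_realpow)
  finally show ?thesis .
qed

lemma integrable_gaussian:
  fixes t :: real
  assumes t: "t > 0"
  shows "integrable lborel (\<lambda>x::'a::euclidean_space. exp (- t * (norm x)\<^sup>2))"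
  by (rule integrableI_nonneg) (auto simp: nn_integral_gaussian[OF t, simplified])

text \<open>Rescaling by c = 1/sqrt(2t) turns the Gaussian into the standard normal density, whose
  characteristic function is known.\<close>

lemma fourier_gaussian_real:
  fixes t s :: real
  assumes t: "t > 0"
  shows "(\<integral>x. cis (- (x * s)) * of_real (exp (- t * x\<^sup>2)) \<partial>lborel) =
    of_real (sqrt (pi / t) * exp (- s\<^sup>2 / (4 * t)))"
proof -
  define c where "c = 1 / sqrt (2 * t)"
  have c: "c > 0" "c\<^sup>2 = 1 / (2 * t)" using t by (auto simp: c_def power_divide)
  have "(\<integral>x. cis (- (x * s)) * of_real (exp (- t * x\<^sup>2)) \<partial>lborel) =
      c *\<^sub>R (\<integral>x. cis (- ((c * x) * s)) * of_real (exp (- t * (c * x)\<^sup>2)) \<partial>lborel)"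
    using lborel_integral_real_affine[of c "\<lambda>x. cis (- (x * s)) * of_real (exp (- t * x\<^sup>2))" 0] c by simp
  also have "(\<lambda>x. cis (- ((c * x) * s)) * complex_of_real (exp (- t * (c * x)\<^sup>2))) =
      (\<lambda>x. of_real (sqrt (2 * pi)) * (std_normal_density x *\<^sub>R iexp (- (c * s) * x)))"
  proof
    fix x
    have "t * (c * x)\<^sup>2 = x\<^sup>2 / 2" using c t by (simp add: power_mult_distrib)
    then show "cis (- ((c * x) * s)) * complex_of_real (exp (- t * (c * x)\<^sup>2)) =
      of_real (sqrt (2 * pi)) * (std_normal_density x *\<^sub>R iexp (- (c * s) * x))"
      by (simp add: std_normal_density_def cis_conv_exp scaleR_conv_of_real field_simps)
  qed
  also have "(\<integral>x. of_real (sqrt (2 * pi)) * (std_normal_density x *\<^sub>R iexp (- (c * s) * x)) \<partial>lborel) =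
      of_real (sqrt (2 * pi)) * char std_normal_distribution (- (c * s))"
    unfolding char_def by (subst integral_mult_right_zero, subst integral_density) auto
  also have "\<dots> = of_real (sqrt (2 * pi) * exp (- s\<^sup>2 / (4 * t)))"
    unfolding char_std_normal_distribution using c t by (simp add: power_mult_distrib field_simps)
  finally have eq: "(\<integral>x. cis (- (x * s)) * of_real (exp (- t * x\<^sup>2)) \<partial>lborel) =
      c *\<^sub>R complex_of_real (sqrt (2 * pi) * exp (- s\<^sup>2 / (4 * t)))" .
  have "c * sqrt (2 * pi) = sqrt (pi / t)" by (simp add: c_def flip: real_sqrt_divide real_sqrt_mult)
  then show ?thesis unfolding eq scaleR_conv_of_real of_real_mult[symmetric]
    by (simp only: mult.assoc[symmetric])
qed

lemma cis_sum: "finite A \<Longrightarrow> cis (\<Sum>i\<in>A. f i) = (\<Prod>i\<in>A. cis (f i))"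
  by (induction A rule: finite_induct) (auto simp flip: cis_mult)

lemma integrable_cis_mult:
  assumes "integrable M f" "g \<in> borel_measurable M"
  shows "integrable M (\<lambda>x. cis (g x) * (f x :: complex))"
proof (rule Bochner_Integration.integrable_bound[OF assms(1)])
  show "(\<lambda>x. cis (g x) * f x) \<in> borel_measurable M"
    using assms unfolding cis_conv_exp by measurable
qed (simp add: norm_mult)

lemma fourier_gaussian:
  fixes t :: real and \<xi> :: "'a::euclidean_space"
  assumes t: "t > 0"
  shows "(\<integral>x. cis (- (x \<bullet> \<xi>)) * of_real (exp (- t * (norm x)\<^sup>2)) \<partial>lborel) =
    of_real ((pi / t) powr (DIM('a) / 2) * exp (- (norm \<xi>)\<^sup>2 / (4 * t)))"
proof -
  have "(\<integral>x. cis (- (x \<bullet> \<xi>)) * of_real (exp (- t * (norm x)\<^sup>2)) \<partial>lborel) =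
    (\<integral>x. (\<Prod>b\<in>Basis. cis (- ((x \<bullet> b) * (\<xi> \<bullet> b))) * of_real (exp (- t * (x \<bullet> b)\<^sup>2))) \<partial>lborel)"
    by (subst exp_norm_sq_prod, subst euclidean_inner)
      (simp add: prod.distrib cis_sum sum_negf[symmetric] del: mult_minus_left)
  also have "\<dots> = (\<Prod>b\<in>Basis. of_real (sqrt (pi / t) * exp (- (\<xi> \<bullet> b)\<^sup>2 / (4 * t))))"
  proof (subst lborel_integral_prod)
    fix b :: 'a
    show "integrable lborel (\<lambda>x. cis (- (x * (\<xi> \<bullet> b))) * complex_of_real (exp (- t * x\<^sup>2)))"
      using integrable_gaussian[OF t, where 'a=real] by (intro integrable_cis_mult) auto
  qed (subst fourier_gaussian_real[OF t], simp)
  also have "\<dots> = of_real (sqrt (pi / t) ^ DIM('a) * (\<Prod>b\<in>Basis. exp (- (1 / (4 * t)) * (\<xi> \<bullet> b)\<^sup>2)))"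
    by (simp add: prod.distrib)
  also have "(\<Prod>b\<in>Basis. exp (- (1 / (4 * t)) * (\<xi> \<bullet> b)\<^sup>2)) = exp (- (norm \<xi>)\<^sup>2 / (4 * t))"
    by (subst exp_norm_sq_prod[symmetric]) simp
  also have "sqrt (pi / t) ^ DIM('a) = (pi / t) powr (DIM('a) / 2)"
    using t by (simp add: powr_half_sqrt[symmetric] powr_powr flip: powr_realpow)
  finally show ?thesis .
qed

text \<open>The Gamma integral rescaled by \<open>a\<close>. It serves twice for subordination to
  Gaussians: with s = 1/4 and a = 1 + |\<xi>|^2 for the Bessel kernel, and with s = (N - \<alpha>)/2
  and a = |x - y|^2 for the Riesz potential.\<close>

lemma nn_integral_powr_exp:
  fixes s a :: real
  assumes s: "s > 0" and a: "a > 0"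
  shows "(\<integral>\<^sup>+t. ennreal (indicator {0<..} t * (t powr (s - 1) * exp (- (a * t)))) \<partial>lborel) =
    ennreal (Gamma s * a powr (- s))"
proof -
  have "ennreal (Gamma s) = (\<integral>\<^sup>+t. ennreal (indicator {0<..} t * (t powr (s - 1) * exp (- t))) \<partial>lborel)"
    unfolding Gamma_conv_nn_integral_real[OF s]
    by (intro nn_integral_cong) (auto simp: indicator_def exp_minus field_simps)
  also have "\<dots> = ennreal \<bar>a\<bar> * (\<integral>\<^sup>+t. ennreal (indicator {0<..} (0 + a * t) * ((0 + a * t) powr (s - 1) * exp (- (0 + a * t)))) \<partial>lborel)"
    by (rule nn_integral_real_affine) (use a in auto)
  also have "\<dots> = (\<integral>\<^sup>+t. ennreal (a powr s) * ennreal (indicator {0<..} t * (t powr (s - 1) * exp (- (a * t)))) \<partial>lborel)"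
    using a by (subst nn_integral_cmult[symmetric])
     (auto intro!: nn_integral_cong simp: ennreal_mult''[symmetric] indicator_def powr_mult zero_less_mult_iff powr_diff
        simp flip: ennreal_mult' split: if_splits)
  also have "\<dots> = ennreal (a powr s) * (\<integral>\<^sup>+t. ennreal (indicator {0<..} t * (t powr (s - 1) * exp (- (a * t)))) \<partial>lborel)"
    by (rule nn_integral_cmult) auto
  finally have "ennreal (a powr - s) * ennreal (Gamma s) = ennreal (a powr - s * a powr s) * (\<integral>\<^sup>+t. ennreal (indicator {0<..} t * (t powr (s - 1) * exp (- (a * t)))) \<partial>lborel)"
    by (simp add: ennreal_mult' mult.assoc)
  also have "a powr - s * a powr s = 1" using a by (simp add: powr_minus)
  finally show ?thesis using s by (simp add: ennreal_mult'' ennreal_mult' mult.commute Gamma_real_nonneg)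
qed

section \<open>Invariance of Lebesgue measure under reflections and translations\<close>

lemma lborel_distr_reflect: "distr lborel borel (\<lambda>x. a - x) = (lborel :: 'a::euclidean_space measure)"
  using lborel_affine[of "-1" a] by (simp add: density_1)

lemma lborel_distr_translate: "distr lborel borel (\<lambda>x. x + a) = (lborel :: 'a::euclidean_space measure)"
proof -
  have "(\<lambda>x. x + a) = (+) a" by (auto simp: add.commute)
  then show ?thesis using lborel_distr_plus[of a] by simp
qed

lemma nn_integral_reflect:
  fixes f :: "'a::euclidean_space \<Rightarrow> ennreal"
  assumes [measurable]: "f \<in> borel_measurable borel"
  shows "(\<integral>\<^sup>+x. f (a - x) \<partial>lborel) = (\<integral>\<^sup>+x. f x \<partial>lborel)"
  by (subst (2) lborel_distr_reflect[of a, symmetric], subst nn_integral_distr) auto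

lemma nn_integral_translate:
  fixes f :: "'a::euclidean_space \<Rightarrow> ennreal"
  assumes [measurable]: "f \<in> borel_measurable borel"
  shows "(\<integral>\<^sup>+x. f (x + a) \<partial>lborel) = (\<integral>\<^sup>+x. f x \<partial>lborel)"
  by (subst (2) lborel_distr_translate[of a, symmetric], subst nn_integral_distr) auto

lemma nn_integral_translate_diff:
  fixes f :: "'a::euclidean_space \<Rightarrow> ennreal"
  assumes "f \<in> borel_measurable borel"
  shows "(\<integral>\<^sup>+x. f (x - a) \<partial>lborel) = (\<integral>\<^sup>+x. f x \<partial>lborel)"
  using nn_integral_translate[OF assms, of "- a"] by simp

lemma integral_translate:
  fixes f :: "'a::euclidean_space \<Rightarrow> 'b::{banach, second_countable_topology}"
  assumes [measurable]: "f \<in> borel_measurable borel"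
  shows "(\<integral>x. f (x + a) \<partial>lborel) = (\<integral>x. f x \<partial>lborel)"
  by (subst (2) lborel_distr_translate[of a, symmetric], subst integral_distr) auto

lemma integrable_translate:
  fixes f :: "'a::euclidean_space \<Rightarrow> 'b::{banach, second_countable_topology}"
  assumes "integrable lborel f"
  shows "integrable lborel (\<lambda>x. f (x + a))"
proof -
  have [measurable]: "f \<in> borel_measurable borel" using assms by auto
  show ?thesis
    using integrable_distr[of "\<lambda>x. x + a" lborel borel f] assms by (simp add: lborel_distr_translate)
qed

lemma AE_translate:
  fixes P :: "'a::euclidean_space \<Rightarrow> bool"
  assumes "AE x in lborel. P x"
  shows "AE x in lborel. P (x + a)"
proof -
  from AE_E[OF assms] obtain N where N: "{x \<in> space lborel. \<not> P x} \<subseteq> N" "emeasure lborel N = 0" "N \<in> sets (lborel :: 'a measure)"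
    by metis
  have "AE x in distr lborel borel (\<lambda>x. x + a). x \<notin> N"
    unfolding lborel_distr_translate by (rule AE_not_in) (use N in \<open>auto simp: null_sets_def\<close>)
  then have "AE x in lborel. x + a \<notin> N"
    by (subst (asm) AE_distr_iff) (use N in auto)
  then show ?thesis using N(1) by (auto elim!: eventually_mono)
qed

section \<open>Integrability of powers of the norm near the origin and at infinity\<close>

text \<open>The index of the dyadic shell (1/2)^(k+1) <= s < (1/2)^k that contains \<open>s\<close>.
  Summation over such shells replaces polar coordinates below.\<close>

lemma powr_bounded_dyadic_near:
  fixes c s :: real
  assumes c: "c \<ge> 0" and s: "0 < s" "s < 1"
  obtains k :: nat where "s powr (- c) \<le> 2 powr (c * (real k + 1))" "s < (1/2) ^ k"
proof -
  define P where "P k \<longleftrightarrow> (1/2) ^ Suc k \<le> s" for k :: nat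
  have "\<exists>k. P k" 
  proof -
    obtain k where "(1/2) ^ k < s" using real_arch_pow_inv[of s "1/2"] s by auto
    moreover have "(1/2::real) ^ Suc k \<le> (1/2) ^ k" by simp
    ultimately have "P k" unfolding P_def by linarith
    then show ?thesis ..
  qed
  define k where "k = (LEAST k. P k)"
  have k: "P k" unfolding k_def by (rule LeastI_ex) fact
  have less: "s < (1/2) ^ k"
  proof (cases k)
    case (Suc j)
    then have "\<not> P j" using not_less_Least[of j P] by (simp add: k_def)
    then show ?thesis by (simp add: P_def Suc)
  qed (use s in auto)
  have "s powr (- c) \<le> ((1/2) ^ Suc k) powr (- c)"
    by (rule powr_mono2') (use c k in \<open>auto simp: P_def\<close>)
  also have "\<dots> = (2 powr (- real (Suc k))) powr (- c)"
    by (simp only: powr_minus powr_realpow power_one_over inverse_eq_divide zero_less_numeral)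
  also have "\<dots> = 2 powr (c * (real k + 1))" by (simp add: powr_powr algebra_simps)
  finally show ?thesis using less by (rule that)
qed

lemma powr_bounded_dyadic_far:
  fixes c s :: real
  assumes c: "c \<ge> 0" and s: "1 \<le> s"
  obtains k :: nat where "s powr (- c) \<le> 2 powr (- c * k)" "s < 2 ^ Suc k"
proof -
  define P where "P k \<longleftrightarrow> s < 2 ^ Suc k" for k :: nat
  have "\<exists>k. P k" 
  proof -
    obtain k where "s < 2 ^ k" using real_arch_pow[of 2 s] by auto
    moreover have "(2::real) ^ k \<le> 2 ^ Suc k" by simp
    ultimately have "P k" unfolding P_def by linarith
    then show ?thesis ..
  qed
  define k where "k = (LEAST k. P k)"
  have k: "P k" unfolding k_def by (rule LeastI_ex) fact
  have le: "2 ^ k \<le> s"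
  proof (cases k)
    case (Suc j)
    then have "\<not> P j" using not_less_Least[of j P] by (simp add: k_def)
    then show ?thesis by (simp add: P_def Suc)
  qed (use s in auto)
  have "s powr (- c) \<le> (2 ^ k) powr (- c)"
    by (rule powr_mono2') (use c le in auto)
  also have "\<dots> = 2 powr (- c * k)" by (simp only: powr_powr powr_realpow[symmetric] zero_less_numeral mult.commute)
  finally show ?thesis using k that by (auto simp: P_def)
qed

lemma ennreal_le_suminf: "f k \<le> (\<Sum>i. f i)" for f :: "nat \<Rightarrow> ennreal"
  using sum_le_suminf[of f "{k}"] by simp

text \<open>On the k-th shell the integrand is at most 2^(c(k+1)), and the ball around the shell has
  volume of order 2^(-kN). The resulting geometric series has ratio 2^(c-N), which is below 1
  exactly for c < N.\<close>

lemma nn_integral_norm_powr_near: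
  fixes c :: real
  assumes c: "0 \<le> c" "c < DIM('a::euclidean_space)"
  shows "(\<integral>\<^sup>+x. ennreal (indicator (ball 0 1) (x::'a) * norm x powr (- c)) \<partial>lborel) < \<infinity>"
proof -
  define N where "N = DIM('a)"
  define V where "V = unit_ball_vol (real N)"
  have "(\<integral>\<^sup>+x. ennreal (indicator (ball 0 1) (x::'a) * norm x powr (- c)) \<partial>lborel)
      \<le> (\<integral>\<^sup>+x. (\<Sum>k. ennreal (2 powr (c * (real k + 1))) * indicator (ball 0 ((1/2) ^ k)) (x::'a)) \<partial>lborel)"
  proof (rule nn_integral_mono)
    fix x :: 'a
    show "ennreal (indicator (ball 0 1) x * norm x powr (- c)) \<le>
      (\<Sum>k. ennreal (2 powr (c * (real k + 1))) * indicator (ball 0 ((1/2) ^ k)) x)"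
    proof (cases "0 < norm x \<and> norm x < 1")
      case True
      then obtain k :: nat where k: "norm x powr (- c) \<le> 2 powr (c * (real k + 1))" "norm x < (1/2) ^ k"
        using powr_bounded_dyadic_near[of c "norm x"] c by blast
      have "ennreal (indicator (ball 0 1) x * norm x powr (- c)) \<le>
         ennreal (2 powr (c * (real k + 1))) * indicator (ball 0 ((1/2) ^ k)) x"
        using ennreal_leI[OF k(1)] k(2) True by (simp add: indicator_def)
      also have "\<dots> \<le> (\<Sum>k. ennreal (2 powr (c * (real k + 1))) * indicator (ball 0 ((1/2) ^ k)) x)"
        by (rule ennreal_le_suminf)
      finally show ?thesis .
    next
      case False
      then have "indicator (ball 0 1) x * norm x powr (- c) = 0" by (auto simp: indicator_def)
      then show ?thesis by (simp only: ennreal_0 zero_le)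
    qed
  qed
  also have "\<dots> = (\<Sum>k. ennreal (2 powr (c * (real k + 1))) * emeasure lborel (ball (0::'a) ((1/2) ^ k)))"
    by (subst nn_integral_suminf)
      (intro suminf_cong nn_integral_cmult_indicator borel_measurable_times_ennreal
        borel_measurable_const borel_measurable_indicator, simp)+
  also have "\<dots> = (\<Sum>k. ennreal (2 powr c * V * (2 powr (c - N)) ^ k))"
  proof (rule suminf_cong)
    fix k :: nat
    have "(2 powr (c * (real k + 1)) * ((1 / 2) ^ k) ^ N) * V = (2 powr c * (2 powr (c - N)) ^ k) * V"
    proof -
      have "((1 / 2::real) ^ k) ^ N = inverse (2 ^ (k * N))"
        by (simp add: power_one_over power_mult inverse_eq_divide)
      also have "\<dots> = 2 powr (- (real k * real N))"
        by (metis of_nat_mult powr_minus powr_realpow zero_less_numeral)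
      finally have power: "((1 / 2::real) ^ k) ^ N = 2 powr (- (real k * real N))" .
      moreover have "(2 powr (c - N)) ^ k = 2 powr ((c - N) * k)"
        by (subst powr_realpow[symmetric]) (simp_all add: powr_powr)
      moreover have "2 powr (c * (real k + 1)) * 2 powr (- (real k * real N)) = 2 powr c * 2 powr ((c - N) * k)"
        unfolding powr_add[symmetric] by (simp add: algebra_simps)
      ultimately show ?thesis by (simp only:)
    qed
    then show "ennreal (2 powr (c * (real k + 1))) * emeasure lborel (ball (0::'a) ((1/2) ^ k)) =
      ennreal (2 powr c * V * (2 powr (c - N)) ^ k)"
      by (simp add: emeasure_ball V_def N_def mult_ac flip: ennreal_mult)
  qed
  also have "\<dots> < \<infinity>"
  proof -
    have "2 powr (c - N) < 2 powr 0" using c by (intro powr_less_mono) (auto simp: N_def)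
    then have "summable (\<lambda>k. 2 powr c * V * (2 powr (c - N)) ^ k)"
      by (intro summable_mult summable_geometric) auto
    then show ?thesis
      by (subst suminf_ennreal2) (auto simp: V_def)
  qed
  finally show ?thesis .
qed

text \<open>The same comparison with growing shells; now the ratio is 2^(N-c).\<close>

lemma nn_integral_norm_powr_far:
  fixes c :: real
  assumes c: "DIM('a::euclidean_space) < c"
  shows "(\<integral>\<^sup>+x. ennreal (indicator (- ball 0 1) (x::'a) * norm x powr (- c)) \<partial>lborel) < \<infinity>"
proof -
  define N where "N = DIM('a)"
  define V where "V = unit_ball_vol (real N)"
  have c0: "c \<ge> 0" using c by linarith
  have "(\<integral>\<^sup>+x. ennreal (indicator (- ball 0 1) (x::'a) * norm x powr (- c)) \<partial>lborel)
      \<le> (\<integral>\<^sup>+x. (\<Sum>k. ennreal (2 powr (- c * k)) * indicator (ball 0 (2 ^ Suc k)) (x::'a)) \<partial>lborel)"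
  proof (rule nn_integral_mono)
    fix x :: 'a
    show "ennreal (indicator (- ball 0 1) x * norm x powr (- c)) \<le>
      (\<Sum>k. ennreal (2 powr (- c * k)) * indicator (ball 0 (2 ^ Suc k)) x)"
    proof (cases "norm x \<ge> 1")
      case True
      then obtain k :: nat where k: "norm x powr (- c) \<le> 2 powr (- c * k)" "norm x < 2 ^ Suc k"
        using powr_bounded_dyadic_far[of c "norm x"] c0 by blast
      have "ennreal (indicator (- ball 0 1) x * norm x powr (- c)) \<le>
         ennreal (2 powr (- c * k)) * indicator (ball 0 (2 ^ Suc k)) x"
        using ennreal_leI[OF k(1)] k(2) True by (simp add: indicator_def)
      also have "\<dots> \<le> (\<Sum>k. ennreal (2 powr (- c * k)) * indicator (ball 0 (2 ^ Suc k)) x)"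
        by (rule ennreal_le_suminf)
      finally show ?thesis .
    next
      case False
      then have "indicator (- ball 0 1) x * norm x powr (- c) = 0" by (auto simp: indicator_def)
      then show ?thesis by (simp only: ennreal_0 zero_le)
    qed
  qed
  also have "\<dots> = (\<Sum>k. ennreal (2 powr (- c * k)) * emeasure lborel (ball (0::'a) (2 ^ Suc k)))"
    by (subst nn_integral_suminf)
      (intro suminf_cong nn_integral_cmult_indicator borel_measurable_times_ennreal
        borel_measurable_const borel_measurable_indicator, simp)+
  also have "\<dots> = (\<Sum>k. ennreal (2 powr N * V * (2 powr (N - c)) ^ k))"
  proof (rule suminf_cong)
    fix k :: nat
    have "(2 powr (- c * k) * (2 ^ Suc k) ^ N) * V = (2 powr N * (2 powr (N - c)) ^ k) * V"
    proof -
      have "((2::real) ^ Suc k) ^ N = 2 powr (real (Suc k) * real N)"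
        by (metis of_nat_mult power_mult powr_realpow zero_less_numeral)
      moreover have "(2 powr (N - c)) ^ k = 2 powr ((N - c) * k)"
        by (subst powr_realpow[symmetric]) (simp_all add: powr_powr)
      moreover have "2 powr (- c * k) * 2 powr (real (Suc k) * real N) = 2 powr N * 2 powr ((N - c) * k)"
        unfolding powr_add[symmetric] by (simp add: algebra_simps)
      ultimately show ?thesis by (simp only:)
    qed
    then show "ennreal (2 powr (- c * k)) * emeasure lborel (ball (0::'a) (2 ^ Suc k)) =
      ennreal (2 powr N * V * (2 powr (N - c)) ^ k)"
      by (simp add: emeasure_ball V_def N_def mult_ac flip: ennreal_mult)
  qed
  also have "\<dots> < \<infinity>"
  proof -
    have "2 powr (N - c) < 2 powr 0" using c by (intro powr_less_mono) (auto simp: N_def)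
    then have "summable (\<lambda>k. 2 powr N * V * (2 powr (N - c)) ^ k)"
      by (intro summable_mult summable_geometric) auto
    then show ?thesis
      by (subst suminf_ennreal2) (auto simp: V_def)
  qed
  finally show ?thesis .
qed

section \<open>The Bessel kernel\<close>

text \<open>Subordination to the heat kernel: \<open>\<lambda>\<^sup>-\<^sup>1\<^sup>/\<^sup>4 \<Gamma>(1/4)\<close> is the integral of \<open>t\<^sup>-\<^sup>3\<^sup>/\<^sup>4 exp (- t \<lambda>)\<close> over \<open>t > 0\<close>,
  here with \<open>\<lambda> = 1 + |\<xi>|\<^sup>2\<close>.\<close>

definition bessel_density :: "'a::euclidean_space \<Rightarrow> real \<Rightarrow> real" where
  "bessel_density x t = indicator {0<..} t * (t powr (- 3 / 4) * exp (- t) *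
     ((4 * pi * t) powr (- DIM('a) / 2) * exp (- (norm x)\<^sup>2 / (4 * t)))) / Gamma (1 / 4)"

text \<open>At the origin the density behaves like t^(-3/4 - N/2) for small t and is not integrable,
  so the kernel takes the default value 0 there. This is why pointwise statements about the kernel
  assume x \<noteq> 0 and integral identities pass through an almost-everywhere step.\<close>

definition bessel_kernel :: "'a::euclidean_space \<Rightarrow> real" where
  "bessel_kernel x = (\<integral>t. bessel_density x t \<partial>lborel)"

lemma Gamma_quarter_pos: "Gamma (1 / 4 :: real) > 0"
  by (rule Gamma_real_pos) simp

lemma Gamma_quarter_nonzero [simp]: "Gamma (1 / 4 :: real) \<noteq> 0"
  using Gamma_quarter_pos by (rule less_imp_neq[symmetric])

lemma measurable_bessel_density [measurable]:
  "(\<lambda>z. bessel_density (fst z) (snd z)) \<in> borel_measurable (borel \<Otimes>\<^sub>M borel)"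
  unfolding bessel_density_def by measurable

lemma bessel_density_nonneg: "bessel_density x t \<ge> 0"
  unfolding bessel_density_def using Gamma_quarter_pos by (auto simp: indicator_def)

lemma bessel_density_measurable2 [measurable]: "bessel_density x \<in> borel_measurable borel"
  unfolding bessel_density_def by measurable

lemma bessel_kernel_measurable [measurable]: "bessel_kernel \<in> borel_measurable borel"
proof -
  have "(\<lambda>x. \<integral>t. (case (x, t) of (x, t) \<Rightarrow> bessel_density x t) \<partial>lborel) \<in> borel_measurable (borel :: 'a measure)"
    by (rule lborel.borel_measurable_lebesgue_integral) (simp add: case_prod_beta)
  then show ?thesis unfolding bessel_kernel_def[abs_def] by simp
qed

lemma bessel_kernel_nonneg: "bessel_kernel x \<ge> 0"
  unfolding bessel_kernel_def by (intro integral_nonneg_AE AE_I2 bessel_density_nonneg)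

lemma bessel_kernel_cong:
  fixes x y :: "'a::euclidean_space"
  shows "norm x = norm y \<Longrightarrow> bessel_kernel x = bessel_kernel y"
  unfolding bessel_kernel_def bessel_density_def by simp

text \<open>From ln r <= r - 1 at r = s/\<beta>. It lets the factor exp(-|x|^2/(4t)) of the heat
  kernel be traded for a power of |x|^2/t.\<close>

lemma powr_le_exp:
  fixes s \<beta> :: real
  assumes "s > 0" "\<beta> > 0"
  shows "s powr \<beta> \<le> \<beta> powr \<beta> * exp s"
proof -
  have "ln (s / \<beta>) \<le> s / \<beta>" using ln_le_minus_one[of "s / \<beta>"] assms by simp
  then have "\<beta> * ln (s / \<beta>) \<le> s" using assms by (simp add: field_simps)
  then have "(s / \<beta>) powr \<beta> \<le> exp s" using assms by (simp add: powr_def)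
  then show ?thesis using assms by (simp add: powr_divide field_simps)
qed

text \<open>Bounding exp(-|x|^2/(4t)) by a multiple of (|x|^2/t)^(-b/2) extracts |x|^(-b) and leaves
  a Gamma integral with parameter b/2 - N/2 + 1/4. That parameter is positive exactly when b > N -
  1/2, the order of the singularity. Taking b close to this value controls the kernel at 0, and any
  larger b gives decay at infinity.\<close>

lemma nn_integral_bessel_density_le:
  fixes b :: real
  assumes b: "real DIM('a::euclidean_space) - 1 / 2 < b" and x: "(x::'a) \<noteq> 0"
  shows "(\<integral>\<^sup>+t. ennreal (bessel_density x t) \<partial>lborel) \<le>
    ennreal ((b / 2) powr (b / 2) * 4 powr (b / 2) * (4 * pi) powr (- DIM('a) / 2) / Gamma (1 / 4) *
      Gamma (b / 2 - DIM('a) / 2 + 1 / 4) * norm x powr (- b))"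
proof -
  define n :: real where "n = DIM('a)"
  have n: "n \<ge> 1" unfolding n_def using DIM_positive[where 'a='a] by linarith
  have b0: "b > 0" using b n unfolding n_def by linarith
  define K where "K = (b / 2) powr (b / 2) * 4 powr (b / 2) * (4 * pi) powr (- n / 2) / Gamma (1 / 4) * norm x powr (- b)"
  define s where "s = b / 2 - n / 2 + 1 / 4"
  have s: "s > 0" using b by (simp add: s_def n_def)
  have K: "K \<ge> 0" unfolding K_def using Gamma_quarter_pos by simp
  have le: "bessel_density x t \<le> K * (indicator {0<..} t * (t powr (s - 1) * exp (- (1 * t))))" for t
  proof (cases "t > 0")
    case True
    define z where "z = (norm x)\<^sup>2 / (4 * t)"
    have z: "z > 0" using True x by (simp add: z_def)
    have "exp (- z) \<le> (b / 2) powr (b / 2) * z powr (- (b / 2))"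
      using powr_le_exp[OF z, of "b / 2"] b0 z by (simp add: exp_minus powr_minus field_simps)
    also have "z powr (- (b / 2)) = norm x powr (- b) * 4 powr (b / 2) * t powr (b / 2)"
    proof -
      have q: "(norm x)\<^sup>2 powr (- (b / 2)) = norm x powr (- b)"
        using x by (simp add: powr_powr flip: powr_numeral)
      have "z powr (- (b / 2)) = (norm x)\<^sup>2 powr (- (b / 2)) / (4 * t) powr (- (b / 2))"
        using True by (simp add: powr_divide z_def)
      also have "\<dots> = norm x powr (- b) * (4 * t) powr (b / 2)"
        unfolding q by (simp add: powr_minus field_simps)
      also have "\<dots> = norm x powr (- b) * 4 powr (b / 2) * t powr (b / 2)"
        using True by (simp add: powr_mult)
      finally show ?thesis .
    qed
    finally have e: "exp (- z) \<le> (b / 2) powr (b / 2) * (norm x powr (- b) * 4 powr (b / 2) * t powr (b / 2))" .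
    have "bessel_density x t = t powr (- 3 / 4) * exp (- t) * ((4 * pi) powr (- n / 2) * t powr (- n / 2)) / Gamma (1 / 4) * exp (- z)"
      using True by (simp add: bessel_density_def z_def n_def powr_mult)
    also have "\<dots> \<le> t powr (- 3 / 4) * exp (- t) * ((4 * pi) powr (- n / 2) * t powr (- n / 2)) / Gamma (1 / 4) *
       ((b / 2) powr (b / 2) * (norm x powr (- b) * 4 powr (b / 2) * t powr (b / 2)))"
      using Gamma_quarter_pos by (intro mult_left_mono e) auto
    also have "\<dots> = K * ((t powr (- 3 / 4) * t powr (- n / 2) * t powr (b / 2)) * exp (- t))"
      by (simp add: K_def)
    also have "t powr (- 3 / 4) * t powr (- n / 2) * t powr (b / 2) = t powr (s - 1)"
      unfolding powr_add[symmetric] s_def by (simp add: algebra_simps)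
    finally show ?thesis using True by simp
  qed (simp add: bessel_density_def)
  have "(\<integral>\<^sup>+t. ennreal (bessel_density x t) \<partial>lborel) \<le>
    (\<integral>\<^sup>+t. ennreal K * ennreal (indicator {0<..} t * (t powr (s - 1) * exp (- (1 * t)))) \<partial>lborel)"
    by (intro nn_integral_mono) (use le K in \<open>auto simp: ennreal_mult'[symmetric] intro!: ennreal_leI\<close>)
  also have "\<dots> = ennreal K * ennreal (Gamma s * 1 powr (- s))"
    by (subst nn_integral_cmult) (simp_all only: nn_integral_powr_exp[OF s zero_less_one], measurable)
  also have "\<dots> = ennreal (K * Gamma s)"
    using K by (simp add: ennreal_mult')
  finally show ?thesis unfolding K_def s_def n_def by (simp add: mult_ac)
qed

lemma ennreal_bessel_kernel:
  assumes "x \<noteq> 0"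
  shows "ennreal (bessel_kernel x) = (\<integral>\<^sup>+t. ennreal (bessel_density x t) \<partial>lborel)"
proof -
  have "(\<integral>\<^sup>+t. ennreal (bessel_density x t) \<partial>lborel) < \<infinity>"
    by (rule le_less_trans[OF nn_integral_bessel_density_le[of "real DIM('a)"]]) (use assms in auto)
  then show ?thesis unfolding bessel_kernel_def
    by (subst integral_eq_nn_integral) (auto simp: bessel_density_nonneg)
qed

text \<open>The density is positive for every t > 0. Strict positivity of the kernel is what later
  makes the potential of a nonnegative function positive almost everywhere unless the function
  vanishes almost everywhere.\<close>

lemma bessel_kernel_pos:
  assumes "x \<noteq> 0"
  shows "bessel_kernel x > 0"
proof -
  have "\<not> (AE t in lborel. ennreal (bessel_density x t) = 0)"
  proof
    assume "AE t in lborel. ennreal (bessel_density x t) = 0"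
    then have "AE t in lborel. t \<notin> {0<..<1::real}"
      by eventually_elim (use Gamma_quarter_pos in \<open>auto simp: bessel_density_def ennreal_eq_0_iff mult_le_0_iff divide_le_0_iff
          not_le dest!: leD\<close>)
    then have "emeasure lborel {0<..<1::real} = 0"
      by (subst (asm) AE_iff_measurable[OF _ refl]) (auto simp: greaterThanLessThan_def greaterThan_def lessThan_def Int_def)
    then show False by simp
  qed
  then have "(\<integral>\<^sup>+t. ennreal (bessel_density x t) \<partial>lborel) \<noteq> 0"
    by (subst nn_integral_0_iff_AE) auto
  then have "ennreal (bessel_kernel x) \<noteq> 0" using ennreal_bessel_kernel[OF assms] by simp
  then show ?thesis using bessel_kernel_nonneg[of x] by (cases "bessel_kernel x = 0") auto
qed

lemma bessel_kernel_le:
  fixes b :: real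
  assumes b: "real DIM('a::euclidean_space) - 1 / 2 < b"
  obtains C where "C \<ge> 0" "\<And>x::'a. x \<noteq> 0 \<Longrightarrow> bessel_kernel x \<le> C * norm x powr (- b)"
proof -
  define C where "C = (b / 2) powr (b / 2) * 4 powr (b / 2) * (4 * pi) powr (- DIM('a) / 2) / Gamma (1 / 4) *
      Gamma (b / 2 - DIM('a) / 2 + 1 / 4)"
  have "Gamma (b / 2 - DIM('a) / 2 + 1 / 4) > 0" using b by (intro Gamma_real_pos) simp
  then have C: "C \<ge> 0" using Gamma_quarter_pos by (simp add: C_def)
  moreover have "bessel_kernel x \<le> C * norm x powr (- b)" if "x \<noteq> 0" for x :: 'a
    using nn_integral_bessel_density_le[OF b that] C unfolding ennreal_bessel_kernel[OF that, symmetric] C_def[symmetric]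
    by (subst (asm) ennreal_le_iff) auto
  ultimately show ?thesis by (rule that)
qed

lemma nn_integral_bessel_density_space:
  "(\<integral>\<^sup>+x. ennreal (bessel_density (x::'a::euclidean_space) t) \<partial>lborel) =
    ennreal (indicator {0<..} t * (t powr (1 / 4 - 1) * exp (- (1 * t))) / Gamma (1 / 4))"
proof (cases "t > 0")
  case True
  define c where "c = t powr (1 / 4 - 1) * exp (- t) * (4 * pi * t) powr (- DIM('a) / 2) / Gamma (1 / 4)"
  have c: "c \<ge> 0" using Gamma_quarter_pos by (simp add: c_def)
  have "(\<integral>\<^sup>+x. ennreal (bessel_density (x::'a) t) \<partial>lborel) =
      (\<integral>\<^sup>+x. ennreal c * ennreal (exp (- (1 / (4 * t)) * (norm (x::'a))\<^sup>2)) \<partial>lborel)"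
    using True c by (intro nn_integral_cong) (simp add: ennreal_mult'[symmetric] bessel_density_def c_def)
  also have "\<dots> = ennreal c * ennreal ((pi / (1 / (4 * t))) powr (DIM('a) / 2))"
    by (subst nn_integral_cmult, measurable) (subst nn_integral_gaussian, use True in simp_all)
  also have "\<dots> = ennreal (c * (4 * pi * t) powr (DIM('a) / 2))"
    using c by (simp add: ennreal_mult' mult_ac)
  also have "c * (4 * pi * t) powr (DIM('a) / 2) = t powr (1 / 4 - 1) * exp (- t) / Gamma (1 / 4)"
    using True by (simp add: c_def powr_minus field_simps)
  finally show ?thesis using True by simp
qed (simp add: bessel_density_def)

text \<open>By Tonelli: each heat kernel has mass 1, and the remaining weight in t is a normalised
  Gamma density. Since the kernel is a probability density, convolution with it is a contraction on
  L1 and on L2.\<close>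

lemma nn_integral_bessel_kernel:
  "(\<integral>\<^sup>+x. ennreal (bessel_kernel (x::'a::euclidean_space)) \<partial>lborel) = 1"
proof -
  have "(\<integral>\<^sup>+x. ennreal (bessel_kernel (x::'a)) \<partial>lborel) =
      (\<integral>\<^sup>+x. (\<integral>\<^sup>+t. ennreal (bessel_density (x::'a) t) \<partial>lborel) \<partial>lborel)"
  proof (rule nn_integral_cong_AE)
    show "AE x in lborel. ennreal (bessel_kernel (x::'a)) = (\<integral>\<^sup>+t. ennreal (bessel_density (x::'a) t) \<partial>lborel)"
      using AE_lborel_singleton[of "0::'a"] by eventually_elim (rule ennreal_bessel_kernel)
  qed
  also have "\<dots> = (\<integral>\<^sup>+t. (\<integral>\<^sup>+x. ennreal (bessel_density (x::'a) t) \<partial>lborel) \<partial>lborel)"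
    by (rule lborel_pair.Fubini'[symmetric]) (simp add: case_prod_beta)
  also have "\<dots> = (\<integral>\<^sup>+t. ennreal (1 / Gamma (1 / 4)) * ennreal (indicator {0<..} t * (t powr (1 / 4 - 1) * exp (- (1 * t)))) \<partial>lborel)"
    unfolding nn_integral_bessel_density_space
    by (intro nn_integral_cong) (use Gamma_quarter_pos in \<open>simp add: ennreal_mult'[symmetric]\<close>)
  also have "\<dots> = ennreal (1 / Gamma (1 / 4)) * ennreal (Gamma (1 / 4) * 1 powr - (1 / 4))"
    by (subst nn_integral_cmult, measurable) (subst nn_integral_powr_exp, use Gamma_quarter_pos in simp_all)
  also have "\<dots> = 1"
    using Gamma_quarter_pos by (subst ennreal_mult'[symmetric]) auto
  finally show ?thesis .
qed

lemma integral_bessel_weight: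
  fixes a :: real
  assumes a: "a > 0"
  shows "(\<integral>t. indicator {0<..} t * (t powr (1 / 4 - 1) * exp (- (a * t))) / Gamma (1 / 4) \<partial>lborel) = a powr (- 1 / 4)"
proof -
  have "(\<integral>t. indicator {0<..} t * (t powr (1 / 4 - 1) * exp (- (a * t))) \<partial>lborel) = Gamma (1 / 4) * a powr (- (1 / 4))"
  proof (subst integral_eq_nn_integral)
    show "enn2real (\<integral>\<^sup>+t. ennreal (indicator {0<..} t * (t powr (1 / 4 - 1) * exp (- (a * t)))) \<partial>lborel) =
       Gamma (1 / 4) * a powr (- (1 / 4))"
      by (subst nn_integral_powr_exp) (use a Gamma_quarter_pos in auto)
  qed (auto simp: indicator_def)
  then show ?thesis using Gamma_quarter_pos by simp
qed

text \<open>Fubini moves the Fourier integral onto the Gaussian in x, which becomes exp(-t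
  |\<xi>|^2). Together with exp(-t) this is the Gamma integral at a = 1 + |\<xi>|^2.\<close>

lemma fourier_bessel_kernel:
  "(\<integral>x. cis (- (x \<bullet> \<xi>)) * of_real (bessel_kernel x) \<partial>lborel) =
    of_real ((1 + (norm (\<xi>::'a::euclidean_space))\<^sup>2) powr (- 1 / 4))"
proof -
  have int: "integrable (lborel \<Otimes>\<^sub>M lborel) (\<lambda>z::'a \<times> real. bessel_density (fst z) (snd z))"
  proof (rule integrableI_nonneg)
    have "(\<integral>\<^sup>+z. ennreal (bessel_density (fst (z :: 'a \<times> real)) (snd z)) \<partial>(lborel \<Otimes>\<^sub>M lborel)) =
      (\<integral>\<^sup>+x. (\<integral>\<^sup>+t. ennreal (bessel_density (x::'a) t) \<partial>lborel) \<partial>lborel)"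
      by (subst lborel.nn_integral_fst[symmetric]) auto
    also have "\<dots> = (\<integral>\<^sup>+x. ennreal (bessel_kernel (x::'a)) \<partial>lborel)"
    proof (rule nn_integral_cong_AE)
      show "AE x in lborel. (\<integral>\<^sup>+t. ennreal (bessel_density (x::'a) t) \<partial>lborel) = ennreal (bessel_kernel (x::'a))"
        using AE_lborel_singleton[of "0::'a"] by eventually_elim (rule ennreal_bessel_kernel[symmetric])
    qed
    finally show "(\<integral>\<^sup>+z. ennreal (bessel_density (fst (z :: 'a \<times> real)) (snd z)) \<partial>(lborel \<Otimes>\<^sub>M lborel)) < \<infinity>"
      by (simp add: nn_integral_bessel_kernel)
  qed (auto simp: bessel_density_nonneg)
  have int2: "integrable (lborel \<Otimes>\<^sub>M lborel) (\<lambda>z::'a \<times> real. cis (- (fst z \<bullet> \<xi>)) * of_real (bessel_density (fst z) (snd z)))"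
    by (intro integrable_cis_mult integrable_of_real int) measurable
  have "(\<integral>x. cis (- (x \<bullet> \<xi>)) * of_real (bessel_kernel x) \<partial>lborel) =
     (\<integral>x. (\<integral>t. cis (- (x \<bullet> \<xi>)) * of_real (bessel_density x t) \<partial>lborel) \<partial>lborel)"
    by (simp add: bessel_kernel_def)
  also have "\<dots> = (\<integral>t. (\<integral>x. cis (- (x \<bullet> \<xi>)) * of_real (bessel_density x t) \<partial>lborel) \<partial>lborel)"
    by (rule lborel_pair.Fubini_integral[symmetric]) (use int2 in \<open>simp add: case_prod_unfold\<close>)
  also have "\<dots> = (\<integral>t. of_real (indicator {0<..} t * (t powr (1 / 4 - 1) * exp (- ((1 + (norm \<xi>)\<^sup>2) * t))) / Gamma (1 / 4)) \<partial>lborel)"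
  proof (rule Bochner_Integration.integral_cong[OF refl])
    fix t :: real
    show "(\<integral>x. cis (- (x \<bullet> \<xi>)) * of_real (bessel_density x t) \<partial>lborel) =
      complex_of_real (indicator {0<..} t * (t powr (1 / 4 - 1) * exp (- ((1 + (norm \<xi>)\<^sup>2) * t))) / Gamma (1 / 4))"
    proof (cases "t > 0")
      case True
      define c where "c = t powr (1 / 4 - 1) * exp (- t) * (4 * pi * t) powr (- DIM('a) / 2) / Gamma (1 / 4)"
      have "(\<integral>x. cis (- (x \<bullet> \<xi>)) * of_real (bessel_density x t) \<partial>lborel) =
         (\<integral>x. of_real c * (cis (- (x \<bullet> \<xi>)) * of_real (exp (- (1 / (4 * t)) * (norm x)\<^sup>2))) \<partial>lborel)"
        using True by (intro Bochner_Integration.integral_cong) (simp_all add: bessel_density_def c_def)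
      also have "\<dots> = of_real c * of_real ((pi / (1 / (4 * t))) powr (DIM('a) / 2) * exp (- (norm \<xi>)\<^sup>2 / (4 * (1 / (4 * t)))))"
        using True by (subst integral_mult_right_zero, subst fourier_gaussian) auto
      also have "\<dots> = of_real (c * ((4 * pi * t) powr (DIM('a) / 2)) * exp (- t * (norm \<xi>)\<^sup>2))"
        using True by (simp add: mult_ac)
      also have "c * (4 * pi * t) powr (DIM('a) / 2) = t powr (1 / 4 - 1) * exp (- t) / Gamma (1 / 4)"
        using True by (simp add: c_def powr_minus field_simps)
      also have "t powr (1 / 4 - 1) * exp (- t) / Gamma (1 / 4) * exp (- t * (norm \<xi>)\<^sup>2) =
          indicator {0<..} t * (t powr (1 / 4 - 1) * (exp (- t) * exp (- t * (norm \<xi>)\<^sup>2))) / Gamma (1 / 4)"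
        using True by simp
      also have "exp (- t) * exp (- t * (norm \<xi>)\<^sup>2) = exp (- ((1 + (norm \<xi>)\<^sup>2) * t))"
        by (simp add: algebra_simps flip: exp_add)
      finally show ?thesis .
    qed (simp add: bessel_density_def)
  qed
  also have "\<dots> = of_real ((1 + (norm \<xi>)\<^sup>2) powr (- 1 / 4))"
    unfolding integral_complex_of_real by (subst integral_bessel_weight) (auto intro: add_pos_nonneg)
  finally show ?thesis .
qed

text \<open>The second hypothesis on \<open>r\<close> says N - 1/2 < N/r, so some exponent b with N
  - 1/2 < b < N/r bounds the kernel near 0 while |x|^(-br) is still integrable there. Outside the
  unit ball the exponent N + 1 is used.\<close>

lemma nn_integral_bessel_kernel_powr:
  fixes r :: real
  assumes r: "1 \<le> r" "r * (2 * real DIM('a::euclidean_space) - 1) < 2 * real DIM('a)"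
  shows "(\<integral>\<^sup>+x. ennreal (bessel_kernel (x::'a) powr r) \<partial>lborel) < \<infinity>"
proof -
  define n :: real where "n = DIM('a)"
  have n: "n \<ge> 1" unfolding n_def using DIM_positive[where 'a='a] by linarith
  \<comment> \<open>The midpoint of the admissible interval between n - 1/2 and n/r.\<close>
  define b where "b = (n - 1 / 2 + n / r) / 2"
  have lt: "n - 1 / 2 < n / r" using r by (simp add: n_def field_simps)
  have b: "n - 1 / 2 < b" "b < n / r" using lt by (auto simp: b_def)
  have br: "b * r < n" "0 \<le> b * r" using b r n by (auto simp: field_simps)
  obtain C1 where C1: "C1 \<ge> 0" "\<And>x::'a. x \<noteq> 0 \<Longrightarrow> bessel_kernel x \<le> C1 * norm x powr (- b)"
    using bessel_kernel_le[of b] b unfolding n_def by blast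
  obtain C2 where C2: "C2 \<ge> 0" "\<And>x::'a. x \<noteq> 0 \<Longrightarrow> bessel_kernel x \<le> C2 * norm x powr (- (n + 1))"
    using bessel_kernel_le[of "n + 1", where 'a='a] unfolding n_def by auto
  have pw: "bessel_kernel x powr r \<le> C1 powr r * (indicator (ball 0 1) x * norm x powr (- (b * r))) +
      C2 powr r * (indicator (- ball 0 1) x * norm x powr (- ((n + 1) * r)))" if x: "x \<noteq> 0" for x :: 'a
  proof (cases "x \<in> ball 0 1")
    case True
    have "bessel_kernel x powr r \<le> (C1 * norm x powr (- b)) powr r"
      by (rule powr_mono2) (use r C1 x bessel_kernel_nonneg in auto)
    also have "\<dots> = C1 powr r * norm x powr (- (b * r))" using C1 by (simp add: powr_mult powr_powr)
    finally show ?thesis using True by simp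
  next
    case False
    have "bessel_kernel x powr r \<le> (C2 * norm x powr (- (n + 1))) powr r"
      by (rule powr_mono2) (use r C2 x bessel_kernel_nonneg in auto)
    also have "\<dots> = C2 powr r * norm x powr (- ((n + 1) * r))" using C2(1) by (simp only: powr_mult powr_powr powr_ge_zero mult_minus_left)
    finally show ?thesis using False by simp
  qed
  define f where "f x = ennreal (indicator (ball 0 1) x * norm x powr (- (b * r)))" for x :: 'a
  define g where "g x = ennreal (indicator (- ball 0 1) x * norm x powr (- ((n + 1) * r)))" for x :: 'a
  have m: "(\<lambda>x. ennreal (indicator A x * norm x powr c)) \<in> borel_measurable borel"
    if "A \<in> sets borel" for A :: "'a set" and c :: real
    using that by measurable
  have [measurable]: "f \<in> borel_measurable borel" "g \<in> borel_measurable borel"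
    unfolding f_def[abs_def] g_def[abs_def] by (rule m; simp)+
  have "(\<integral>\<^sup>+x. ennreal (bessel_kernel (x::'a) powr r) \<partial>lborel) \<le>
    (\<integral>\<^sup>+x. ennreal (C1 powr r) * f x + ennreal (C2 powr r) * g x \<partial>lborel)"
  proof (rule nn_integral_mono_AE)
    show "AE x in lborel. ennreal (bessel_kernel x powr r) \<le> ennreal (C1 powr r) * f x + ennreal (C2 powr r) * g x"
      using AE_lborel_singleton[of "0::'a"]
    proof eventually_elim
      case (elim x)
      show ?case using ennreal_leI[OF pw[OF elim]] unfolding f_def g_def
        by (simp only: ennreal_plus ennreal_mult' powr_ge_zero mult_nonneg_nonneg indicator_pos_le)
    qed
  qed
  also have "\<dots> = ennreal (C1 powr r) * (\<integral>\<^sup>+x. f x \<partial>lborel) + ennreal (C2 powr r) * (\<integral>\<^sup>+x. g x \<partial>lborel)"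
    by (simp add: nn_integral_add nn_integral_cmult)
  also have "\<dots> < \<infinity>"
  proof -
    have "n + 1 \<le> (n + 1) * r" using r n by simp
    then have "DIM('a) < (n + 1) * r" unfolding n_def by linarith
    then have "(\<integral>\<^sup>+x. g x \<partial>lborel) < \<infinity>"
      unfolding g_def by (rule nn_integral_norm_powr_far)
    moreover have "(\<integral>\<^sup>+x. f x \<partial>lborel) < \<infinity>"
      unfolding f_def by (rule nn_integral_norm_powr_near) (use br in \<open>auto simp: n_def\<close>)
    ultimately show ?thesis by (auto simp: ennreal_mult_less_top)
  qed
  finally show ?thesis .
qed

section \<open>Plancherel\<close>

text \<open>The square of the L2 norm, possibly infinite, so that Fatou and Tonelli arguments may
  precede membership in \<open>L2\<close>. The triangle inequality appears with constants 2, which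
  is enough for convergence.\<close>

definition sq_norm :: "('a::euclidean_space \<Rightarrow> 'b::real_normed_vector) \<Rightarrow> ennreal" where
  "sq_norm f = (\<integral>\<^sup>+x. ennreal ((norm (f x))\<^sup>2) \<partial>lborel)"

lemma sq_norm_cong_AE:
  assumes "AE x in lborel. f x = g x"
  shows "sq_norm f = sq_norm g"
  unfolding sq_norm_def by (rule nn_integral_cong_AE) (use assms in eventually_elim, simp)

lemma sq_norm_commute: "sq_norm (\<lambda>x. f x - g x) = sq_norm (\<lambda>x. g x - f x)"
  by (simp add: sq_norm_def norm_minus_commute)

lemma norm_add_sq_le: "(norm (a + b))\<^sup>2 \<le> 2 * (norm a)\<^sup>2 + 2 * (norm (b::'a::real_normed_vector))\<^sup>2"
proof -
  have "(norm (a + b))\<^sup>2 \<le> (norm a + norm b)\<^sup>2" by (intro power_mono norm_triangle_ineq) simp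
  also have "\<dots> \<le> 2 * (norm a)\<^sup>2 + 2 * (norm b)\<^sup>2"
    using sum_squares_bound[of "norm a" "norm b"] by (simp add: power2_sum)
  finally show ?thesis .
qed

lemma sq_norm_add_le:
  fixes f g :: "'a::euclidean_space \<Rightarrow> 'b::{real_normed_vector, second_countable_topology}"
  assumes [measurable]: "f \<in> borel_measurable borel" "g \<in> borel_measurable borel"
  shows "sq_norm (\<lambda>x. f x + g x) \<le> 2 * sq_norm f + 2 * sq_norm g"
proof -
  have "sq_norm (\<lambda>x. f x + g x) \<le> (\<integral>\<^sup>+x. 2 * ennreal ((norm (f x))\<^sup>2) + 2 * ennreal ((norm (g x))\<^sup>2) \<partial>lborel)"
    unfolding sq_norm_def
  proof (rule nn_integral_mono)
    fix x
    show "ennreal ((norm (f x + g x))\<^sup>2) \<le> 2 * ennreal ((norm (f x))\<^sup>2) + 2 * ennreal ((norm (g x))\<^sup>2)"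
      using ennreal_leI[OF norm_add_sq_le[of "f x" "g x"]] by (simp add: ennreal_mult'')
  qed
  also have "\<dots> = 2 * sq_norm f + 2 * sq_norm g"
    unfolding sq_norm_def by (simp add: nn_integral_add nn_integral_cmult)
  finally show ?thesis .
qed

lemma sq_norm_diff_le:
  fixes f g :: "'a::euclidean_space \<Rightarrow> 'b::{real_normed_vector, second_countable_topology}"
  assumes [measurable]: "f \<in> borel_measurable borel" "g \<in> borel_measurable borel"
  shows "sq_norm (\<lambda>x. f x - g x) \<le> 2 * sq_norm f + 2 * sq_norm g"
  using sq_norm_add_le[of f "\<lambda>x. - g x"] by (simp add: sq_norm_def)

lemma sq_norm_triangle:
  fixes f g h :: "'a::euclidean_space \<Rightarrow> 'b::{real_normed_vector, second_countable_topology}"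
  assumes [measurable]: "f \<in> borel_measurable borel" "g \<in> borel_measurable borel" "h \<in> borel_measurable borel"
  shows "sq_norm (\<lambda>x. f x - h x) \<le> 2 * sq_norm (\<lambda>x. f x - g x) + 2 * sq_norm (\<lambda>x. g x - h x)"
  using sq_norm_add_le[of "\<lambda>x. f x - g x" "\<lambda>x. g x - h x"] by simp

lemma sq_norm_eq_0:
  fixes f :: "'a::euclidean_space \<Rightarrow> 'b::{real_normed_vector, second_countable_topology}"
  assumes [measurable]: "f \<in> borel_measurable borel"
  shows "sq_norm f = 0 \<longleftrightarrow> (AE x in lborel. f x = 0)"
  unfolding sq_norm_def by (subst nn_integral_0_iff_AE) (auto simp: ennreal_eq_0_iff)

section \<open>Completeness of L2, and density of continuous functions of bounded support\<close>

lemma tendsto_ennreal_zeroI: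
  fixes f :: "nat \<Rightarrow> ennreal"
  assumes "\<And>e. e > 0 \<Longrightarrow> eventually (\<lambda>n. f n \<le> ennreal e) sequentially"
  shows "f \<longlonglongrightarrow> 0"
proof (rule order_tendstoI)
  fix a :: ennreal assume "0 < a"
  then obtain e where e: "e > 0" "ennreal e < a"
    by (metis ennreal_less_zero_iff ennreal_eq_0_iff dense ennreal_enn2real less_top not_gr_zero order.strict_trans1 top_greatest enn2real_positive_iff leI order_less_le_trans)
  show "eventually (\<lambda>n. f n < a) sequentially"
    using assms[OF e(1)] by eventually_elim (use e in auto)
qed auto

text \<open>The Riesz-Fischer argument: a rapidly Cauchy subsequence converges almost everywhere,
  and Fatou gives convergence in norm. The limit is exposed as the pointwise \<open>lim\<close> of
  that subsequence at every point, so a property that forces equal sequences at two points, such as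
  radial symmetry, passes to the limit without exceptional sets.\<close>

lemma sq_norm_cauchy_limit:
  fixes f :: "nat \<Rightarrow> 'a::euclidean_space \<Rightarrow> 'b::{banach, second_countable_topology}"
  assumes [measurable]: "\<And>n. f n \<in> borel_measurable borel"
    and cauchy: "\<And>e. e > 0 \<Longrightarrow> \<exists>M. \<forall>m\<ge>M. \<forall>n\<ge>M. sq_norm (\<lambda>x. f m x - f n x) \<le> ennreal e"
  obtains r where "strict_mono r" "(\<lambda>x. lim (\<lambda>k. f (r k) x)) \<in> borel_measurable borel"
    "(\<lambda>n. sq_norm (\<lambda>x. f n x - lim (\<lambda>k. f (r k) x))) \<longlonglongrightarrow> 0"
    "AE x in lborel. convergent (\<lambda>k. f (r k) x)"
proof -
  \<comment> \<open>The rate 1/8 leaves room for the weights 4^k: the weighted squares of the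
    increments still sum like (1/2)^k, and finiteness of this sum at a point bounds the k-th
    increment there by a multiple of (1/2)^k.\<close>
  define P where "P k m \<longleftrightarrow> (\<forall>i\<ge>m. \<forall>j\<ge>m. sq_norm (\<lambda>x. f i x - f j x) \<le> ennreal ((1/8) ^ k))" for k m
  have ex: "\<exists>m. P k m" for k unfolding P_def by (rule cauchy) simp
  obtain r where r: "strict_mono r" "\<And>k. P k (r k)"
  proof -
    define M where "M k = (SOME m. P k m)" for k
    have M: "P k (M k)" for k unfolding M_def using ex by (rule someI_ex)
    define r where "r = rec_nat (M 0) (\<lambda>k s. max (Suc s) (M (Suc k)))"
    have "r k < r (Suc k)" for k by (simp add: r_def)
    then have "strict_mono r" by (simp add: strict_mono_Suc_iff)
    moreover have "M k \<le> r k" for k by (cases k) (auto simp: r_def)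
    then have "P k (r k)" for k using M[of k] unfolding P_def by (meson order_trans)
    ultimately show ?thesis by (rule that)
  qed
  have [measurable]: "(\<lambda>x. lim (\<lambda>k. f (r k) x)) \<in> borel_measurable borel"
    by (rule borel_measurable_lim_metric) simp
  define d where "d k x = f (r (Suc k)) x - f (r k) x" for k x
  have [measurable]: "d k \<in> borel_measurable borel" for k unfolding d_def by measurable
  have dk: "sq_norm (d k) \<le> ennreal ((1/8) ^ k)" for k
    using r(2)[of k] strict_mono_less_eq[OF r(1), of k "Suc k"] unfolding P_def d_def[abs_def] by auto
  have "(\<integral>\<^sup>+x. (\<Sum>k. ennreal (4 ^ k) * ennreal ((norm (d k x))\<^sup>2)) \<partial>lborel) = (\<Sum>k. ennreal (4 ^ k) * sq_norm (d k))"
    by (subst nn_integral_suminf) (simp_all add: nn_integral_cmult sq_norm_def)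
  also have "\<dots> \<le> (\<Sum>k. ennreal ((1/2) ^ k))"
  proof (rule suminf_le)
    fix k :: nat
    have "ennreal (4 ^ k) * sq_norm (d k) \<le> ennreal (4 ^ k) * ennreal ((1/8) ^ k)"
      by (intro mult_left_mono dk) auto
    also have "\<dots> = ennreal ((1/2) ^ k)"
      by (simp add: ennreal_mult''[symmetric] power_mult_distrib[symmetric])
    finally show "ennreal (4 ^ k) * sq_norm (d k) \<le> ennreal ((1/2) ^ k)" .
  qed auto
  also have "\<dots> < \<infinity>"
    by (subst suminf_ennreal2) (auto intro: summable_geometric)
  finally have "AE x in lborel. (\<Sum>k. ennreal (4 ^ k) * ennreal ((norm (d k x))\<^sup>2)) \<noteq> \<infinity>"
    by (intro nn_integral_PInf_AE) auto
  then have conv: "AE x in lborel. convergent (\<lambda>k. f (r k) x)"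
  proof eventually_elim
    case (elim x)
    define S where "S = enn2real (\<Sum>k. ennreal (4 ^ k) * ennreal ((norm (d k x))\<^sup>2))"
    have S: "S \<ge> 0" by (simp add: S_def)
    have dS: "norm (d k x) \<le> sqrt S * (1/2) ^ k" for k
    proof -
      have "ennreal (4 ^ k * (norm (d k x))\<^sup>2) \<le> (\<Sum>k. ennreal (4 ^ k) * ennreal ((norm (d k x))\<^sup>2))"
        using ennreal_le_suminf[of "\<lambda>k. ennreal (4 ^ k) * ennreal ((norm (d k x))\<^sup>2)" k] by (simp add: ennreal_mult'')
      also have "\<dots> = ennreal S" using elim by (simp add: S_def less_top)
      finally have "4 ^ k * (norm (d k x))\<^sup>2 \<le> S" using S by simp
      moreover have "(4::real) ^ k = (2 ^ k)\<^sup>2" by (simp add: power2_eq_square flip: power_mult_distrib)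
      ultimately have "(2 ^ k * norm (d k x))\<^sup>2 \<le> S" by (simp add: power_mult_distrib)
      then have "2 ^ k * norm (d k x) \<le> sqrt S" by (rule real_le_rsqrt)
      then show ?thesis by (simp add: field_simps power_one_over)
    qed
    have "summable (\<lambda>k. norm (d k x))"
    proof (rule summable_comparison_test'[where N=0])
      show "summable (\<lambda>k. sqrt S * (1/2) ^ k)" by (intro summable_mult summable_geometric) simp
      show "norm (norm (d k x)) \<le> sqrt S * (1/2) ^ k" for k using dS[of k] by (simp only: real_norm_def abs_norm_cancel)
    qed
    then have "summable (\<lambda>k. d k x)" by (rule summable_norm_cancel)
    then have "convergent (\<lambda>n. \<Sum>k<n. d k x)" by (simp add: summable_iff_convergent)
    moreover have "(\<Sum>k<n. d k x) = f (r n) x - f (r 0) x" for n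
      unfolding d_def by (rule sum_lessThan_telescope)
    ultimately have "convergent (\<lambda>n. (f (r n) x - f (r 0) x) + f (r 0) x)"
      by (intro convergent_add convergent_const) simp
    then show ?case by simp
  qed
  have "(\<lambda>n. sq_norm (\<lambda>x. f n x - lim (\<lambda>k. f (r k) x))) \<longlonglongrightarrow> 0"
  proof (rule tendsto_ennreal_zeroI)
    fix e :: real assume "e > 0"
    then obtain M where M: "\<And>m n. m \<ge> M \<Longrightarrow> n \<ge> M \<Longrightarrow> sq_norm (\<lambda>x. f m x - f n x) \<le> ennreal e"
      using cauchy by blast
    have "sq_norm (\<lambda>x. f n x - lim (\<lambda>k. f (r k) x)) \<le> ennreal e" if "n \<ge> M" for n
    proof -
      have "sq_norm (\<lambda>x. f n x - lim (\<lambda>k. f (r k) x)) =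
        (\<integral>\<^sup>+x. liminf (\<lambda>k. ennreal ((norm (f n x - f (r k) x))\<^sup>2)) \<partial>lborel)"
        unfolding sq_norm_def
      proof (rule nn_integral_cong_AE, use conv in eventually_elim)
        fix x assume "convergent (\<lambda>k. f (r k) x)"
        then have "(\<lambda>k. f (r k) x) \<longlonglongrightarrow> lim (\<lambda>k. f (r k) x)" by (simp add: convergent_LIMSEQ_iff)
        then have "(\<lambda>k. ennreal ((norm (f n x - f (r k) x))\<^sup>2)) \<longlonglongrightarrow> ennreal ((norm (f n x - lim (\<lambda>k. f (r k) x)))\<^sup>2)"
          by (intro tendsto_intros)
        from lim_imp_Liminf[OF sequentially_bot this] show "ennreal ((norm (f n x - lim (\<lambda>k. f (r k) x)))\<^sup>2) = liminf (\<lambda>k. ennreal ((norm (f n x - f (r k) x))\<^sup>2))"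
          by (rule sym)
      qed
      also have "\<dots> \<le> liminf (\<lambda>k. sq_norm (\<lambda>x. f n x - f (r k) x))"
        unfolding sq_norm_def by (rule nn_integral_liminf) simp
      also have "\<dots> \<le> ennreal e"
      proof -
        have "eventually (\<lambda>k. sq_norm (\<lambda>x. f n x - f (r k) x) \<le> ennreal e) sequentially"
          using eventually_ge_at_top[of M]
          by eventually_elim (use M that seq_suble[OF r(1)] in \<open>meson order_trans\<close>)
        then have "liminf (\<lambda>k. sq_norm (\<lambda>x. f n x - f (r k) x)) \<le> liminf (\<lambda>k. ennreal e)"
          by (rule Liminf_mono)
        then show ?thesis by (simp add: Liminf_const)
      qed
      finally show ?thesis .
    qed
    then show "eventually (\<lambda>n. sq_norm (\<lambda>x. f n x - lim (\<lambda>k. f (r k) x)) \<le> ennreal e) sequentially"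
      by (auto simp: eventually_sequentially)
  qed
  from r(1) _ this conv show ?thesis by (rule that) simp
qed

lemma sq_norm_truncate_tendsto:
  fixes f :: "'a::euclidean_space \<Rightarrow> 'b::{real_normed_vector, second_countable_topology}"
  assumes [measurable]: "f \<in> borel_measurable borel" and fin: "sq_norm f < \<infinity>"
  shows "(\<lambda>n. sq_norm (\<lambda>x. f x - (if norm x \<le> real n \<and> norm (f x) \<le> real n then f x else 0))) \<longlonglongrightarrow> 0"
proof -
  have "(\<lambda>n. \<integral>\<^sup>+x. ennreal ((norm (f x - (if norm x \<le> real n \<and> norm (f x) \<le> real n then f x else 0)))\<^sup>2) \<partial>lborel)
     \<longlonglongrightarrow> (\<integral>\<^sup>+x. 0 \<partial>(lborel :: 'a measure))"
  proof (rule nn_integral_dominated_convergence[where w="\<lambda>x. ennreal ((norm (f x))\<^sup>2)"])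
    show "AE x in lborel. (\<lambda>n. ennreal ((norm (f x - (if norm x \<le> real n \<and> norm (f x) \<le> real n then f x else 0)))\<^sup>2)) \<longlonglongrightarrow> 0"
    proof (rule AE_I2, rule tendsto_eventually)
      fix x :: 'a
      obtain n0 :: nat where n0: "max (norm x) (norm (f x)) \<le> real n0" using real_arch_simple by blast
      show "\<forall>\<^sub>F n in sequentially. ennreal ((norm (f x - (if norm x \<le> real n \<and> norm (f x) \<le> real n then f x else 0)))\<^sup>2) = 0"
        using eventually_ge_at_top[of n0] by eventually_elim (use n0 in auto)
    qed
  qed (use fin in \<open>auto simp: sq_norm_def\<close>)
  then show ?thesis by (simp add: sq_norm_def)
qed

text \<open>Truncation gives a bounded function of bounded support. A Lebesgue measurable function
  is an almost everywhere limit of continuous functions, and forcing these to obey the same bounds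
  makes dominated convergence applicable.\<close>

lemma sq_norm_approx_continuous:
  fixes f :: "'a::euclidean_space \<Rightarrow> 'b::euclidean_space"
  assumes [measurable]: "f \<in> borel_measurable borel" and fin: "sq_norm f < \<infinity>" and e: "e > 0"
  obtains g B R where "continuous_on UNIV g" "\<And>x. norm (g x) \<le> B" "\<And>x. R \<le> norm x \<Longrightarrow> g x = 0"
    "sq_norm (\<lambda>x. f x - g x) \<le> ennreal e"
proof -
  have e4: "ennreal (e / 4) > 0" using e by simp
  obtain n where n: "sq_norm (\<lambda>x. f x - (if norm x \<le> real n \<and> norm (f x) \<le> real n then f x else 0)) < ennreal (e / 4)"
    using order_tendstoD(2)[OF sq_norm_truncate_tendsto[OF assms(1) fin] e4] by (auto simp: eventually_sequentially)
  define h where "h x = (if norm x \<le> real n \<and> norm (f x) \<le> real n then f x else 0)" for x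
  have [measurable]: "h \<in> borel_measurable borel" unfolding h_def by measurable
  define B where "B = real n + 1"
  have B: "B > 0" by (simp add: B_def)
  have hB: "norm (h x) \<le> B" for x by (auto simp: h_def B_def)
  have hR: "h x = 0" if "norm x \<ge> B" for x using that by (auto simp: h_def B_def)
  have "h \<in> borel_measurable lebesgue"
    by (rule measurable_completion) simp
  then have "h measurable_on UNIV" by (rule lebesgue_measurable_imp_measurable_on) simp
  then obtain N g where N: "negligible N" and gc: "\<And>k. continuous_on UNIV (g k)"
    and gl: "\<And>x. x \<notin> N \<Longrightarrow> (\<lambda>k. g k x) \<longlonglongrightarrow> h x"
    unfolding measurable_on_def by auto
  \<comment> \<open>\<open>p\<close> is the continuous retraction onto the ball of radius B, and
    \<open>q\<close> adds a cut-off that equals 1 for |x| <= B and vanishes for |x| >= B + 1.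
    Neither changes the limit, as h has values in that ball and vanishes for |x| >= B.\<close>
  define p :: "'b \<Rightarrow> 'b" where "p z = (B / max B (norm z)) *\<^sub>R z" for z
  define q where "q k x = max 0 (min 1 (B + 1 - norm x)) *\<^sub>R p (g k x)" for k x
  have pc: "continuous_on UNIV p" unfolding p_def using B by (intro continuous_intros) auto
  have qc: "continuous_on UNIV (q k)" for k unfolding q_def
    by (intro continuous_intros continuous_on_compose2[OF pc gc]) auto
  have pB: "norm (p z) \<le> B" for z using B by (auto simp: p_def max_def field_simps)
  have qB: "norm (q k x) \<le> B" for k x
  proof -
    have "norm (q k x) \<le> 1 * norm (p (g k x))" unfolding q_def norm_scaleR by (intro mult_right_mono) auto
    then show ?thesis using pB[of "g k x"] by simp
  qed
  have qR: "q k x = 0" if "norm x \<ge> B + 1" for k x using that by (simp add: q_def)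
  have [measurable]: "q k \<in> borel_measurable borel" for k using qc by (rule borel_measurable_continuous_onI)
  have ql: "(\<lambda>k. q k x) \<longlonglongrightarrow> h x" if "x \<notin> N" for x
  proof -
    have "isCont p (h x)" using pc by (simp add: continuous_on_eq_continuous_at)
    then have "(\<lambda>k. p (g k x)) \<longlonglongrightarrow> p (h x)" using gl[OF that] by (rule isCont_tendsto_compose)
    then have "(\<lambda>k. q k x) \<longlonglongrightarrow> max 0 (min 1 (B + 1 - norm x)) *\<^sub>R p (h x)"
      unfolding q_def by (intro tendsto_intros)
    moreover have "p (h x) = h x" using hB[of x] B by (simp add: p_def max_def)
    moreover have "max 0 (min 1 (B + 1 - norm x)) *\<^sub>R h x = h x"
      using hR[of x] by (cases "norm x \<ge> B") (auto simp: max_def min_def)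
    ultimately show ?thesis by simp
  qed
  have "(\<lambda>k. \<integral>\<^sup>+x. ennreal ((norm (h x - q k x))\<^sup>2) \<partial>lborel) \<longlonglongrightarrow> (\<integral>\<^sup>+x. 0 \<partial>(lborel :: 'a measure))"
  proof (rule nn_integral_dominated_convergence[where w="\<lambda>x. ennreal ((2 * B)\<^sup>2) * indicator (ball 0 (B + 1)) x"])
    show "AE x in lborel. (\<lambda>k. ennreal ((norm (h x - q k x))\<^sup>2)) \<longlonglongrightarrow> 0"
    proof -
      have "AE x in lebesgue. x \<notin> N" using N by (intro AE_not_in) (simp add: negligible_iff_null_sets)
      then have "AE x in lborel. x \<notin> N" by (simp add: AE_completion_iff)
      then show ?thesis
      proof eventually_elim
        case (elim x)
        have "(\<lambda>k. ennreal ((norm (h x - q k x))\<^sup>2)) \<longlonglongrightarrow> ennreal ((norm (h x - h x))\<^sup>2)"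
          by (intro tendsto_intros ql elim)
        then show ?case by simp
      qed
    qed
    show "AE x in lborel. ennreal ((norm (h x - q k x))\<^sup>2) \<le> ennreal ((2 * B)\<^sup>2) * indicator (ball 0 (B + 1)) x" for k
    proof (rule AE_I2)
      fix x :: 'a
      show "ennreal ((norm (h x - q k x))\<^sup>2) \<le> ennreal ((2 * B)\<^sup>2) * indicator (ball 0 (B + 1)) x"
      proof (cases "x \<in> ball 0 (B + 1)")
        case True
        have "norm (h x - q k x) \<le> 2 * B" using norm_triangle_ineq4[of "h x" "q k x"] hB[of x] qB[of k x] by simp
        then have "(norm (h x - q k x))\<^sup>2 \<le> (2 * B)\<^sup>2" by (intro power_mono) auto
        then show ?thesis using True by (simp add: ennreal_leI)
      qed (use hR[of x] qR[of x k] in auto)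
    qed
    show "(\<integral>\<^sup>+x. ennreal ((2 * B)\<^sup>2) * indicator (ball 0 (B + 1)) x \<partial>(lborel::'a measure)) < \<infinity>"
      using B by (simp add: nn_integral_cmult_indicator emeasure_ball ennreal_mult_less_top)
    show "(\<lambda>x. ennreal ((2 * B)\<^sup>2) * indicator (ball 0 (B + 1)) x) \<in> borel_measurable (lborel :: 'a measure)"
      by (intro borel_measurable_times_ennreal borel_measurable_const borel_measurable_indicator) simp
  qed auto
  then have "(\<lambda>k. sq_norm (\<lambda>x. h x - q k x)) \<longlonglongrightarrow> 0" by (simp add: sq_norm_def)
  from order_tendstoD(2)[OF this e4] obtain k where k: "sq_norm (\<lambda>x. h x - q k x) < ennreal (e / 4)"
    by (auto simp: eventually_sequentially)
  have "sq_norm (\<lambda>x. f x - q k x) \<le> 2 * sq_norm (\<lambda>x. f x - h x) + 2 * sq_norm (\<lambda>x. h x - q k x)"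
    by (rule sq_norm_triangle) auto
  also have "\<dots> \<le> 2 * ennreal (e / 4) + 2 * ennreal (e / 4)"
    using n k unfolding h_def[symmetric] by (intro add_mono mult_left_mono) auto
  also have "\<dots> = ennreal e" using e by (simp add: ennreal_mult''[symmetric] flip: ennreal_plus ennreal_numeral)
  finally show ?thesis using qc qB qR by (intro that) auto
qed

section \<open>The heat kernel and the energy of Gaussian damping\<close>

definition heat_kernel :: "real \<Rightarrow> 'a::euclidean_space \<Rightarrow> real" where
  "heat_kernel t x = (4 * pi * t) powr (- DIM('a) / 2) * exp (- (norm x)\<^sup>2 / (4 * t))"

lemma heat_kernel_nonneg [simp]: "heat_kernel t x \<ge> 0"
  by (simp add: heat_kernel_def)

lemma heat_kernel_measurable [measurable]: "heat_kernel t \<in> borel_measurable borel"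
  unfolding heat_kernel_def by measurable

lemma heat_kernel_minus: "heat_kernel t (x - y) = heat_kernel t (y - x)"
  by (simp add: heat_kernel_def norm_minus_commute)

lemma nn_integral_heat_kernel:
  assumes t: "t > 0"
  shows "(\<integral>\<^sup>+x. ennreal (heat_kernel t (x::'a::euclidean_space)) \<partial>lborel) = 1"
proof -
  have "(\<integral>\<^sup>+x. ennreal (heat_kernel t (x::'a)) \<partial>lborel) =
      (\<integral>\<^sup>+x. ennreal ((4 * pi * t) powr (- DIM('a) / 2)) * ennreal (exp (- (1 / (4 * t)) * (norm (x::'a))\<^sup>2)) \<partial>lborel)"
    by (intro nn_integral_cong) (simp add: ennreal_mult'[symmetric] heat_kernel_def)
  also have "\<dots> = ennreal ((4 * pi * t) powr (- DIM('a) / 2)) * ennreal ((pi / (1 / (4 * t))) powr (DIM('a) / 2))"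
    by (subst nn_integral_cmult, measurable) (subst nn_integral_gaussian, use t in simp_all)
  also have "\<dots> = ennreal ((4 * pi * t) powr (- DIM('a) / 2) * (4 * pi * t) powr (DIM('a) / 2))"
    by (simp add: ennreal_mult' mult_ac)
  also have "\<dots> = 1" using t by (simp add: powr_minus)
  finally show ?thesis .
qed

lemma nn_integral_heat_kernel_shift:
  assumes t: "t > 0"
  shows "(\<integral>\<^sup>+y. ennreal (heat_kernel t (x - y)) \<partial>lborel) = 1"
  using nn_integral_reflect[of "\<lambda>z. ennreal (heat_kernel t z)" x] nn_integral_heat_kernel[OF t, where 'a='a] by simp

lemma nn_integral_scale:
  fixes f :: "'a::euclidean_space \<Rightarrow> ennreal"
  assumes [measurable]: "f \<in> borel_measurable borel" and c: "c > 0"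
  shows "(\<integral>\<^sup>+x. f x \<partial>lborel) = (\<integral>\<^sup>+x. ennreal (c ^ DIM('a)) * f (c *\<^sub>R x) \<partial>lborel)"
  by (subst lborel_affine[of c 0], use c in simp)
    (use c in \<open>simp add: nn_integral_density nn_integral_distr nn_integral_cmult\<close>)

text \<open>The energy \<open>\<integral>\<integral> k(x - y) |h(x) - h(y)|\<^sup>2\<close> measures the defect in Plancherel's identity after
  a Gaussian cut-off of the frequencies.\<close>

definition heat_defect :: "real \<Rightarrow> ('a::euclidean_space \<Rightarrow> 'b::real_normed_vector) \<Rightarrow> ennreal" where
  "heat_defect t h = (\<integral>\<^sup>+x. (\<integral>\<^sup>+y. ennreal (heat_kernel t (x - y) * (norm (h x - h y))\<^sup>2) \<partial>lborel) \<partial>lborel)"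

lemma nn_integral_heat_fst:
  fixes h :: "'a::euclidean_space \<Rightarrow> 'b::{real_normed_vector, second_countable_topology}"
  assumes [measurable]: "h \<in> borel_measurable borel" and t: "t > 0"
  shows "(\<integral>\<^sup>+x. (\<integral>\<^sup>+y. ennreal (heat_kernel t (x - y) * (norm (h x))\<^sup>2) \<partial>lborel) \<partial>lborel) = sq_norm h"
proof -
  have "(\<integral>\<^sup>+y. ennreal (heat_kernel t (x - y) * (norm (h x))\<^sup>2) \<partial>lborel) = ennreal ((norm (h x))\<^sup>2)" for x
    by (simp add: ennreal_mult'' nn_integral_multc nn_integral_heat_kernel_shift[OF t])
  then show ?thesis by (simp add: sq_norm_def)
qed

lemma nn_integral_heat_snd:
  fixes h :: "'a::euclidean_space \<Rightarrow> 'b::{real_normed_vector, second_countable_topology}"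
  assumes [measurable]: "h \<in> borel_measurable borel" and t: "t > 0"
  shows "(\<integral>\<^sup>+x. (\<integral>\<^sup>+y. ennreal (heat_kernel t (x - y) * (norm (h y))\<^sup>2) \<partial>lborel) \<partial>lborel) = sq_norm h"
proof -
  have "(\<integral>\<^sup>+x. (\<integral>\<^sup>+y. ennreal (heat_kernel t (x - y) * (norm (h y))\<^sup>2) \<partial>lborel) \<partial>lborel) =
     (\<integral>\<^sup>+y. (\<integral>\<^sup>+x. ennreal (heat_kernel t (x - y) * (norm (h y))\<^sup>2) \<partial>lborel) \<partial>lborel)"
    by (rule lborel_pair.Fubini') measurable
  also have "\<dots> = (\<integral>\<^sup>+y. (\<integral>\<^sup>+x. ennreal (heat_kernel t (y - x) * (norm (h y))\<^sup>2) \<partial>lborel) \<partial>lborel)"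
    by (subst heat_kernel_minus) (rule refl)
  also have "\<dots> = sq_norm h" by (rule nn_integral_heat_fst) (use t in auto)
  finally show ?thesis .
qed

text \<open>The defect is bounded by the L2 distance uniformly in \<open>t\<close>, because the heat
  kernel has mass 1 in either variable. Hence its decay as t tends to 0 need only be proved for a
  dense class.\<close>

lemma heat_defect_le:
  fixes h g :: "'a::euclidean_space \<Rightarrow> 'b::{real_normed_vector, second_countable_topology}"
  assumes [measurable]: "h \<in> borel_measurable borel" "g \<in> borel_measurable borel" and t: "t > 0"
  shows "heat_defect t h \<le> 8 * sq_norm (\<lambda>x. h x - g x) + 2 * heat_defect t g"
proof -
  define d where "d x = h x - g x" for x
  have [measurable]: "d \<in> borel_measurable borel" unfolding d_def by measurable
  have pw: "(norm (h x - h y))\<^sup>2 \<le> 4 * (norm (d x))\<^sup>2 + 4 * (norm (d y))\<^sup>2 + 2 * (norm (g x - g y))\<^sup>2" for x y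
  proof -
    have "(norm (h x - h y))\<^sup>2 \<le> 2 * (norm (d x - d y))\<^sup>2 + 2 * (norm (g x - g y))\<^sup>2"
      using norm_add_sq_le[of "d x - d y" "g x - g y"] by (simp add: d_def)
    moreover have "(norm (d x - d y))\<^sup>2 \<le> 2 * (norm (d x))\<^sup>2 + 2 * (norm (d y))\<^sup>2"
      using norm_add_sq_le[of "d x" "- d y"] by simp
    ultimately show ?thesis by linarith
  qed
  have "heat_defect t h \<le> (\<integral>\<^sup>+x. (\<integral>\<^sup>+y. (4 * ennreal (heat_kernel t (x - y) * (norm (d x))\<^sup>2) +
      4 * ennreal (heat_kernel t (x - y) * (norm (d y))\<^sup>2)) + 2 * ennreal (heat_kernel t (x - y) * (norm (g x - g y))\<^sup>2) \<partial>lborel) \<partial>lborel)"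
    unfolding heat_defect_def
  proof (intro nn_integral_mono)
    fix x y
    have "heat_kernel t (x - y) * (norm (h x - h y))\<^sup>2 \<le> heat_kernel t (x - y) * (4 * (norm (d x))\<^sup>2 + 4 * (norm (d y))\<^sup>2 + 2 * (norm (g x - g y))\<^sup>2)"
      by (intro mult_left_mono pw) simp
    also have "\<dots> = (4 * (heat_kernel t (x - y) * (norm (d x))\<^sup>2) + 4 * (heat_kernel t (x - y) * (norm (d y))\<^sup>2)) + 2 * (heat_kernel t (x - y) * (norm (g x - g y))\<^sup>2)"
      by (simp add: algebra_simps)
    finally have "ennreal (heat_kernel t (x - y) * (norm (h x - h y))\<^sup>2) \<le> ennreal \<dots>" by (rule ennreal_leI)
    then show "ennreal (heat_kernel t (x - y) * (norm (h x - h y))\<^sup>2) \<le> 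
       (4 * ennreal (heat_kernel t (x - y) * (norm (d x))\<^sup>2) +
      4 * ennreal (heat_kernel t (x - y) * (norm (d y))\<^sup>2)) + 2 * ennreal (heat_kernel t (x - y) * (norm (g x - g y))\<^sup>2)"
      by (simp add: ennreal_mult'')
  qed
  also have "\<dots> = 4 * (\<integral>\<^sup>+x. (\<integral>\<^sup>+y. ennreal (heat_kernel t (x - y) * (norm (d x))\<^sup>2) \<partial>lborel) \<partial>lborel) +
      4 * (\<integral>\<^sup>+x. (\<integral>\<^sup>+y. ennreal (heat_kernel t (x - y) * (norm (d y))\<^sup>2) \<partial>lborel) \<partial>lborel) + 2 * heat_defect t g"
    unfolding heat_defect_def by (simp add: nn_integral_add nn_integral_cmult)
  also have "\<dots> = 8 * sq_norm d + 2 * heat_defect t g"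
    unfolding nn_integral_heat_fst[OF \<open>d \<in> _\<close> t] nn_integral_heat_snd[OF \<open>d \<in> _\<close> t]
    by (simp flip: distrib_right)
  finally show ?thesis unfolding d_def .
qed

text \<open>The substitution x - y = s z with t = s^2 writes the defect as the Gaussian average in z
  of the squared L2 distance between g and its translate by s z. That distance tends to 0 by
  continuity and is at most 4 \<open>sq_norm g\<close>, so dominated convergence applies
  twice.\<close>

lemma heat_defect_continuous_tendsto:
  fixes g :: "'a::euclidean_space \<Rightarrow> 'b::{real_normed_vector, second_countable_topology}"
  assumes g: "continuous_on UNIV g" "\<And>x. norm (g x) \<le> B" "\<And>x. R \<le> norm x \<Longrightarrow> g x = 0"
  shows "(\<lambda>n. heat_defect ((1 / Suc n)\<^sup>2) g) \<longlonglongrightarrow> 0"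
proof -
  have [measurable]: "g \<in> borel_measurable borel" using g(1) by (rule borel_measurable_continuous_onI)
  define s where "s n = 1 / real (Suc n)" for n
  have s: "s n > 0" "s n \<le> 1" for n by (auto simp: s_def)
  have s0: "s \<longlonglongrightarrow> 0" unfolding s_def by (rule LIMSEQ_Suc) (rule lim_1_over_n)
  \<comment> \<open>The squared L2 modulus of continuity of g under the translation by z.\<close>
  define w where "w z = (\<integral>\<^sup>+x. ennreal ((norm (g x - g (x - z)))\<^sup>2) \<partial>lborel)" for z
  have [measurable]: "w \<in> borel_measurable borel" unfolding w_def by measurable
  have eq: "heat_defect ((s n)\<^sup>2) g = (\<integral>\<^sup>+z. ennreal (heat_kernel 1 z) * w (s n *\<^sub>R z) \<partial>lborel)" for n
  proof -
    have "heat_defect ((s n)\<^sup>2) g = (\<integral>\<^sup>+x. (\<integral>\<^sup>+z. ennreal (heat_kernel ((s n)\<^sup>2) z * (norm (g x - g (x - z)))\<^sup>2) \<partial>lborel) \<partial>lborel)"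
      unfolding heat_defect_def
    proof (rule nn_integral_cong)
      fix x
      show "(\<integral>\<^sup>+y. ennreal (heat_kernel ((s n)\<^sup>2) (x - y) * (norm (g x - g y))\<^sup>2) \<partial>lborel) =
        (\<integral>\<^sup>+z. ennreal (heat_kernel ((s n)\<^sup>2) z * (norm (g x - g (x - z)))\<^sup>2) \<partial>lborel)"
        using nn_integral_reflect[of "\<lambda>y. ennreal (heat_kernel ((s n)\<^sup>2) (x - y) * (norm (g x - g y))\<^sup>2)" x] by simp
    qed
    also have "\<dots> = (\<integral>\<^sup>+z. (\<integral>\<^sup>+x. ennreal (heat_kernel ((s n)\<^sup>2) z * (norm (g x - g (x - z)))\<^sup>2) \<partial>lborel) \<partial>lborel)"
      by (rule lborel_pair.Fubini') measurable
    also have "\<dots> = (\<integral>\<^sup>+z. ennreal (heat_kernel ((s n)\<^sup>2) z) * w z \<partial>lborel)"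
      unfolding w_def by (simp add: ennreal_mult'' ennreal_mult' nn_integral_cmult)
    also have "\<dots> = (\<integral>\<^sup>+z. ennreal (s n ^ DIM('a)) * (ennreal (heat_kernel ((s n)\<^sup>2) (s n *\<^sub>R z)) * w (s n *\<^sub>R z)) \<partial>lborel)"
      by (rule nn_integral_scale) (use s in auto)
    also have "\<dots> = (\<integral>\<^sup>+z. ennreal (heat_kernel 1 z) * w (s n *\<^sub>R z) \<partial>lborel)"
    proof (rule nn_integral_cong)
      fix z :: 'a
      have "s n ^ DIM('a) * heat_kernel ((s n)\<^sup>2) (s n *\<^sub>R z) = heat_kernel 1 z"
      proof -
        have "(4 * pi * (s n)\<^sup>2) powr (- DIM('a) / 2) = (4 * pi) powr (- DIM('a) / 2) * ((s n)\<^sup>2) powr (- DIM('a) / 2)"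
          by (rule powr_mult)
        also have "((s n)\<^sup>2) powr (- DIM('a) / 2) = (s n) powr (- real DIM('a))"
          using s(1)[of n] by (simp add: powr_powr flip: powr_numeral)
        also have "\<dots> = inverse (s n ^ DIM('a))"
          using s(1)[of n] by (simp add: powr_minus powr_realpow)
        finally show ?thesis using s(1)[of n] by (simp add: heat_kernel_def power_mult_distrib)
      qed
      then show "ennreal (s n ^ DIM('a)) * (ennreal (heat_kernel ((s n)\<^sup>2) (s n *\<^sub>R z)) * w (s n *\<^sub>R z)) = ennreal (heat_kernel 1 z) * w (s n *\<^sub>R z)"
        using s(1)[of n] by (simp add: mult.assoc[symmetric] ennreal_mult'[symmetric])
    qed
    finally show ?thesis .
  qed
  have B: "B \<ge> 0" using g(2)[of 0] norm_ge_zero order_trans by blast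
  have diffB: "(norm (g x - g y))\<^sup>2 \<le> (2 * B)\<^sup>2" for x y
    by (intro power_mono order_trans[OF norm_triangle_ineq4]) (use g(2)[of x] g(2)[of y] in auto)
  have fin: "(\<integral>\<^sup>+x. ennreal ((2 * B)\<^sup>2) * indicator (ball 0 S) x \<partial>(lborel::'a measure)) < \<infinity>" for S
    using emeasure_bounded_finite[OF bounded_ball, of 0 S]
    by (subst nn_integral_cmult_indicator) (auto simp: ennreal_mult_less_top)
  have meas: "(\<lambda>x. ennreal ((2 * B)\<^sup>2) * indicator (ball 0 S) x) \<in> borel_measurable (lborel :: 'a measure)" for S
    by (intro borel_measurable_times_ennreal borel_measurable_const borel_measurable_indicator) simp
  have wlim: "(\<lambda>n. w (s n *\<^sub>R z)) \<longlonglongrightarrow> 0" for z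
  proof -
    have "(\<lambda>n. \<integral>\<^sup>+x. ennreal ((norm (g x - g (x - s n *\<^sub>R z)))\<^sup>2) \<partial>lborel) \<longlonglongrightarrow> (\<integral>\<^sup>+x. 0 \<partial>(lborel :: 'a measure))"
    proof (rule nn_integral_dominated_convergence[where w="\<lambda>x. ennreal ((2 * B)\<^sup>2) * indicator (ball 0 (\<bar>R\<bar> + norm z + 1)) x"])
      show "AE x in lborel. (\<lambda>n. ennreal ((norm (g x - g (x - s n *\<^sub>R z)))\<^sup>2)) \<longlonglongrightarrow> 0"
      proof (rule AE_I2)
        fix x :: 'a
        have "isCont g x" using g(1) by (simp add: continuous_on_eq_continuous_at)
        moreover have "(\<lambda>n. x - s n *\<^sub>R z) \<longlonglongrightarrow> x - 0 *\<^sub>R z" by (intro tendsto_intros s0)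
        then have "(\<lambda>n. x - s n *\<^sub>R z) \<longlonglongrightarrow> x" by simp
        ultimately have "(\<lambda>n. g (x - s n *\<^sub>R z)) \<longlonglongrightarrow> g x" by (rule isCont_tendsto_compose)
        then have "(\<lambda>n. ennreal ((norm (g x - g (x - s n *\<^sub>R z)))\<^sup>2)) \<longlonglongrightarrow> ennreal ((norm (g x - g x))\<^sup>2)"
          by (intro tendsto_intros)
        then show "(\<lambda>n. ennreal ((norm (g x - g (x - s n *\<^sub>R z)))\<^sup>2)) \<longlonglongrightarrow> 0" by simp
      qed
      show "AE x in lborel. ennreal ((norm (g x - g (x - s n *\<^sub>R z)))\<^sup>2) \<le> ennreal ((2 * B)\<^sup>2) * indicator (ball 0 (\<bar>R\<bar> + norm z + 1)) x" for n
      proof (rule AE_I2)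
        fix x :: 'a
        show "ennreal ((norm (g x - g (x - s n *\<^sub>R z)))\<^sup>2) \<le> ennreal ((2 * B)\<^sup>2) * indicator (ball 0 (\<bar>R\<bar> + norm z + 1)) x"
        proof (cases "x \<in> ball 0 (\<bar>R\<bar> + norm z + 1)")
          case True
          then show ?thesis using ennreal_leI[OF diffB] by simp
        next
          case False
          then have x: "norm x \<ge> \<bar>R\<bar> + norm z + 1" by simp
          have "norm (s n *\<^sub>R z) \<le> 1 * norm z" unfolding norm_scaleR using s[of n] by (intro mult_right_mono) auto
          then have "norm (x - s n *\<^sub>R z) \<ge> R" using norm_triangle_ineq2[of x "s n *\<^sub>R z"] x by linarith
          moreover have "norm x \<ge> R" using x norm_ge_zero[of z] by linarith
          ultimately show ?thesis using g(3) by simp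
        qed
      qed
    qed (use fin meas in auto)
    then show ?thesis by (simp add: w_def)
  qed
  have "sq_norm g \<le> (\<integral>\<^sup>+x. ennreal ((2 * B)\<^sup>2) * indicator (ball 0 \<bar>R\<bar>) x \<partial>(lborel::'a measure))"
    unfolding sq_norm_def
  proof (rule nn_integral_mono)
    fix x :: 'a
    show "ennreal ((norm (g x))\<^sup>2) \<le> ennreal ((2 * B)\<^sup>2) * indicator (ball 0 \<bar>R\<bar>) x"
    proof (cases "x \<in> ball 0 \<bar>R\<bar>")
      case True
      have "(norm (g x))\<^sup>2 \<le> (2 * B)\<^sup>2" by (intro power_mono) (use g(2)[of x] B in auto)
      then show ?thesis using True by (simp add: ennreal_leI)
    qed (use g(3)[of x] in auto)
  qed
  then have gfin: "sq_norm g < \<infinity>" using fin le_less_trans by blast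
  have wle: "w z \<le> 4 * sq_norm g" for z
  proof -
    have "w z \<le> 2 * sq_norm g + 2 * sq_norm (\<lambda>x. g (x - z))"
      using sq_norm_diff_le[of g "\<lambda>x. g (x - z)"] by (simp add: w_def sq_norm_def)
    also have "sq_norm (\<lambda>x. g (x - z)) = sq_norm g"
      unfolding sq_norm_def by (rule nn_integral_translate_diff[of "\<lambda>x. ennreal ((norm (g x))\<^sup>2)"]) simp
    finally show ?thesis by (simp flip: distrib_right)
  qed
  have "(\<lambda>n. \<integral>\<^sup>+z. ennreal (heat_kernel 1 z) * w (s n *\<^sub>R z) \<partial>lborel) \<longlonglongrightarrow> (\<integral>\<^sup>+x. 0 \<partial>(lborel :: 'a measure))"
  proof (rule nn_integral_dominated_convergence[where w="\<lambda>z. ennreal (heat_kernel 1 z) * (4 * sq_norm g)"])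
    show "AE z in lborel. (\<lambda>n. ennreal (heat_kernel 1 z) * w (s n *\<^sub>R z)) \<longlonglongrightarrow> 0"
    proof (rule AE_I2)
      fix z :: 'a
      have "(\<lambda>n. ennreal (heat_kernel 1 z) * w (s n *\<^sub>R z)) \<longlonglongrightarrow> ennreal (heat_kernel 1 z) * 0"
        by (intro tendsto_mult_ennreal tendsto_const wlim) auto
      then show "(\<lambda>n. ennreal (heat_kernel 1 z) * w (s n *\<^sub>R z)) \<longlonglongrightarrow> 0" by simp
    qed
    show "(\<integral>\<^sup>+z. ennreal (heat_kernel 1 z) * (4 * sq_norm g) \<partial>(lborel::'a measure)) < \<infinity>"
      using gfin by (simp add: nn_integral_multc nn_integral_heat_kernel ennreal_mult_less_top)
  qed (auto intro!: mult_left_mono wle)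
  then show ?thesis unfolding eq[symmetric] by (simp add: s_def)
qed

lemma heat_defect_tendsto:
  fixes h :: "'a::euclidean_space \<Rightarrow> 'b::euclidean_space"
  assumes [measurable]: "h \<in> borel_measurable borel" and fin: "sq_norm h < \<infinity>"
  shows "(\<lambda>n. heat_defect ((1 / Suc n)\<^sup>2) h) \<longlonglongrightarrow> 0"
proof (rule tendsto_ennreal_zeroI)
  fix e :: real assume e: "e > 0"
  obtain g B R where g: "continuous_on UNIV g" "\<And>x. norm (g x) \<le> B" "\<And>x. R \<le> norm x \<Longrightarrow> g x = 0"
    "sq_norm (\<lambda>x. h x - g x) \<le> ennreal (e / 16)"
    using sq_norm_approx_continuous[of h "e / 16"] fin e by auto
  have [measurable]: "g \<in> borel_measurable borel" using g(1) by (rule borel_measurable_continuous_onI)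
  have "eventually (\<lambda>n. heat_defect ((1 / Suc n)\<^sup>2) g < ennreal (e / 4)) sequentially"
    by (rule order_tendstoD(2)[OF heat_defect_continuous_tendsto[OF g(1-3)]]) (use e in auto)
  then show "eventually (\<lambda>n. heat_defect ((1 / Suc n)\<^sup>2) h \<le> ennreal e) sequentially"
  proof eventually_elim
    case (elim n)
    have "heat_defect ((1 / Suc n)\<^sup>2) h \<le> 8 * sq_norm (\<lambda>x. h x - g x) + 2 * heat_defect ((1 / Suc n)\<^sup>2) g"
      by (rule heat_defect_le) auto
    also have "\<dots> \<le> 8 * ennreal (e / 16) + 2 * ennreal (e / 4)"
      using elim g(4) by (intro add_mono mult_left_mono) auto
    also have "\<dots> = ennreal e"
      using e by (simp add: ennreal_mult''[symmetric] flip: ennreal_plus ennreal_numeral)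
    finally show ?case .
  qed
qed

section \<open>Plancherel's identity for functions in both L1 and L2\<close>

lemma integrable_pair_bound:
  fixes f :: "'a::euclidean_space \<Rightarrow> real" and g :: "'b::euclidean_space \<Rightarrow> real"
    and u :: "'a \<times> 'b \<Rightarrow> 'c::{banach, second_countable_topology}"
  assumes f: "integrable lborel f" and g: "integrable lborel g"
    and [measurable]: "u \<in> borel_measurable (borel \<Otimes>\<^sub>M borel)"
    and le: "\<And>x y. norm (u (x, y)) \<le> f x * g y"
  shows "integrable (lborel \<Otimes>\<^sub>M lborel) u"
proof (rule integrableI_bounded)
  have [measurable]: "f \<in> borel_measurable borel" "g \<in> borel_measurable borel" using f g by auto
  have "(\<integral>\<^sup>+z. ennreal (norm (u z)) \<partial>(lborel \<Otimes>\<^sub>M lborel)) \<le>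
      (\<integral>\<^sup>+z. ennreal (norm (f (fst z))) * ennreal (norm (g (snd z))) \<partial>(lborel \<Otimes>\<^sub>M lborel))"
  proof (rule nn_integral_mono)
    fix z :: "'a \<times> 'b"
    have "norm (u z) \<le> norm (f (fst z)) * norm (g (snd z))"
      using le[of "fst z" "snd z"] by (simp add: abs_mult[symmetric])
    then show "ennreal (norm (u z)) \<le> ennreal (norm (f (fst z))) * ennreal (norm (g (snd z)))"
      by (subst ennreal_mult[symmetric]) (auto intro: ennreal_leI)
  qed
  also have "\<dots> = (\<integral>\<^sup>+x. (\<integral>\<^sup>+y. ennreal (norm (f x)) * ennreal (norm (g y)) \<partial>lborel) \<partial>lborel)"
    by (subst lborel.nn_integral_fst[symmetric]) auto
  also have "\<dots> = (\<integral>\<^sup>+x. ennreal (norm (f x)) \<partial>lborel) * (\<integral>\<^sup>+y. ennreal (norm (g y)) \<partial>lborel)"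
    by (simp add: nn_integral_cmult nn_integral_multc)
  also have "\<dots> < \<infinity>" using f g by (simp add: integrable_iff_bounded ennreal_mult_less_top)
  finally show "(\<integral>\<^sup>+z. ennreal (norm (u z)) \<partial>(lborel \<Otimes>\<^sub>M lborel)) < \<infinity>" .
qed simp

lemma Fubini_bound:
  fixes f :: "'a::euclidean_space \<Rightarrow> real" and g :: "'b::euclidean_space \<Rightarrow> real"
    and u :: "'a \<Rightarrow> 'b \<Rightarrow> 'c::{banach, second_countable_topology}"
  assumes "integrable lborel f" "integrable lborel g"
    and "(\<lambda>z. u (fst z) (snd z)) \<in> borel_measurable (borel \<Otimes>\<^sub>M borel)"
    and "\<And>x y. norm (u x y) \<le> f x * g y"
  shows "(\<integral>x. (\<integral>y. u x y \<partial>lborel) \<partial>lborel) = (\<integral>y. (\<integral>x. u x y \<partial>lborel) \<partial>lborel)"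
proof -
  have "integrable (lborel \<Otimes>\<^sub>M lborel) (\<lambda>z. u (fst z) (snd z))"
    by (rule integrable_pair_bound[OF assms(1,2)]) (use assms in auto)
  then show ?thesis
    by (intro lborel_pair.Fubini_integral[symmetric]) (simp add: case_prod_unfold)
qed

lemma cis_measurable [measurable (raw)]:
  "f \<in> borel_measurable M \<Longrightarrow> (\<lambda>x. cis (f x)) \<in> borel_measurable M"
  unfolding cis_conv_exp by measurable

lemma cnj_measurable [measurable (raw)]:
  "f \<in> borel_measurable M \<Longrightarrow> (\<lambda>x. cnj (f x)) \<in> borel_measurable M"
  by (rule borel_measurable_continuous_on[where f=cnj]) (auto intro: continuous_intros)

lemma fourier_integral_measurable [measurable]:
  assumes [measurable]: "h \<in> borel_measurable borel"
  shows "fourier_integral h \<in> borel_measurable borel"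
  unfolding fourier_integral_def by measurable

lemma norm_fourier_integral_le:
  "norm (fourier_integral (h :: real ^ 'n \<Rightarrow> complex) \<xi>) \<le>
    (2 * pi) powr (- real CARD('n) / 2) * (\<integral>x. norm (h x) \<partial>lborel)"
proof -
  have "norm (\<integral>x. cis (- (x \<bullet> \<xi>)) * h x \<partial>lborel) \<le> (\<integral>x. norm (cis (- (x \<bullet> \<xi>)) * h x) \<partial>lborel)"
    by (rule integral_norm_bound)
  then show ?thesis unfolding fourier_integral_def by (simp add: norm_mult mult_left_mono)
qed

lemma fourier_integral_diff:
  assumes "integrable lborel f" "integrable lborel g"
  shows "fourier_integral (\<lambda>x. f x - g x) \<xi> = fourier_integral f \<xi> - fourier_integral g \<xi>"
proof -
  have i: "integrable lborel (\<lambda>x. cis (- (x \<bullet> \<xi>)) * f x)" "integrable lborel (\<lambda>x. cis (- (x \<bullet> \<xi>)) * g x)"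
    using assms by (auto intro!: integrable_cis_mult)
  show ?thesis using Bochner_Integration.integral_diff[OF i] by (simp add: fourier_integral_def right_diff_distrib)
qed

text \<open>The Gaussian factor makes the triple integral in \<xi>, x and y absolutely convergent
  for integrable h. Integrating over \<xi> first produces the transform of a Gaussian at x - y,
  which is the heat kernel.\<close>

lemma fourier_integral_gauss_pairing:
  fixes h :: "real ^ 'n \<Rightarrow> complex"
  assumes h: "integrable lborel h" and t: "t > 0"
  shows "(\<integral>\<xi>. of_real (exp (- t * (norm \<xi>)\<^sup>2)) * (fourier_integral h \<xi> * cnj (fourier_integral h \<xi>)) \<partial>lborel) =
    (\<integral>x. (\<integral>y. of_real (heat_kernel t (x - y)) * (h x * cnj (h y)) \<partial>lborel) \<partial>lborel)"
proof -
  define c where "c = (2 * pi) powr (- real CARD('n) / 2)"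
  have [measurable]: "h \<in> borel_measurable borel" using h by auto
  define C where "C = c * (\<integral>x. norm (h x) \<partial>lborel)"
  have C: "norm (fourier_integral h \<xi>) \<le> C" for \<xi>
    unfolding C_def c_def by (rule norm_fourier_integral_le)
  have c0: "c > 0" by (simp add: c_def)
  have hn: "integrable lborel (\<lambda>x. norm (h x))" using h by (rule integrable_norm)
  have ig: "integrable lborel (\<lambda>\<xi>. exp (- t * (norm (\<xi> :: real ^ 'n))\<^sup>2))" by (rule integrable_gaussian[OF t])
  have F: "fourier_integral h \<xi> = of_real c * (\<integral>x. cis (- (x \<bullet> \<xi>)) * h x \<partial>lborel)" for \<xi>
    by (simp add: fourier_integral_def c_def)
  have cF: "cnj (fourier_integral h \<xi>) = of_real c * (\<integral>y. cis (y \<bullet> \<xi>) * cnj (h y) \<partial>lborel)" for \<xi>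
    unfolding F by (simp add: Bochner_Integration.integral_cnj[symmetric] cis_cnj del: Bochner_Integration.integral_cnj)
  \<comment> \<open>The two normalising factors of the transform and the mass of the Gaussian
    combine to the constant of the heat kernel.\<close>
  have cc: "c * c * (pi / t) powr (CARD('n) / 2) = (4 * pi * t) powr (- real CARD('n) / 2)"
  proof -
    have "c * c = (4 * pi * pi) powr (- real CARD('n) / 2)"
      by (simp add: c_def mult.assoc flip: powr_mult)
    then have "c * c * (pi / t) powr (CARD('n) / 2) = (4 * pi * pi) powr (- real CARD('n) / 2) * (t / pi) powr (- real CARD('n) / 2)"
      using t by (simp add: powr_minus_divide powr_divide)
    also have "\<dots> = (4 * pi * t) powr (- real CARD('n) / 2)"
      by (simp add: mult.assoc flip: powr_mult)
    finally show ?thesis .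
  qed
  have hk: "heat_kernel t z = (c * c) * ((pi / t) powr (CARD('n) / 2) * exp (- (norm z)\<^sup>2 / (4 * t)))" for z :: "real ^ 'n"
  proof -
    have e: "real_of_int (- int CARD('n)) = - real CARD('n)" by simp
    show ?thesis unfolding heat_kernel_def DIM_cart DIM_real mult_1_right e cc[symmetric]
      by (rule mult.assoc)
  qed
  have pull1: "(\<integral>x. b * (a * E x) \<partial>M) = a * (b * (\<integral>x. E x \<partial>M))"
    for a b :: complex and E and M :: "(real ^ 'n) measure"
    by (simp only: integral_mult_right_zero mult.left_commute)
  have pull2: "a * (\<integral>x. k x * E x \<partial>M) = (\<integral>x. k x * (a * E x) \<partial>M)"
    for a :: complex and k E and M :: "(real ^ 'n) measure"
    by (subst integral_mult_right_zero[symmetric]) (simp only: mult.left_commute)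
  have inner: "of_real c * (\<integral>\<xi>. cis (- (x \<bullet> \<xi>)) * (of_real (exp (- t * (norm \<xi>)\<^sup>2)) * cnj (fourier_integral h \<xi>)) \<partial>lborel) =
      (\<integral>y. of_real (heat_kernel t (x - y)) * cnj (h y) \<partial>lborel)" for x
  proof -
    have "of_real c * (\<integral>\<xi>. cis (- (x \<bullet> \<xi>)) * (of_real (exp (- t * (norm \<xi>)\<^sup>2)) * cnj (fourier_integral h \<xi>)) \<partial>lborel) =
      of_real (c * c) * (\<integral>\<xi>. (\<integral>y. cis (- (\<xi> \<bullet> (x - y))) * of_real (exp (- t * (norm \<xi>)\<^sup>2)) * cnj (h y) \<partial>lborel) \<partial>lborel)"
    proof -
      have "cis (- (x \<bullet> \<xi>)) * (of_real (exp (- t * (norm \<xi>)\<^sup>2)) * cnj (fourier_integral h \<xi>)) =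
         of_real c * (\<integral>y. cis (- (\<xi> \<bullet> (x - y))) * of_real (exp (- t * (norm \<xi>)\<^sup>2)) * cnj (h y) \<partial>lborel)" for \<xi>
      proof -
        have "cis (- (x \<bullet> \<xi>)) * (of_real (exp (- t * (norm \<xi>)\<^sup>2)) * cnj (fourier_integral h \<xi>)) =
          of_real c * ((cis (- (x \<bullet> \<xi>)) * of_real (exp (- t * (norm \<xi>)\<^sup>2))) * (\<integral>y. cis (y \<bullet> \<xi>) * cnj (h y) \<partial>lborel))"
          unfolding cF by simp
        also have "(cis (- (x \<bullet> \<xi>)) * of_real (exp (- t * (norm \<xi>)\<^sup>2))) * (\<integral>y. cis (y \<bullet> \<xi>) * cnj (h y) \<partial>lborel) =
          (\<integral>y. (cis (- (x \<bullet> \<xi>)) * of_real (exp (- t * (norm \<xi>)\<^sup>2))) * (cis (y \<bullet> \<xi>) * cnj (h y)) \<partial>lborel)"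
          by (rule integral_mult_right_zero[symmetric])
        also have "\<dots> = (\<integral>y. cis (- (\<xi> \<bullet> (x - y))) * of_real (exp (- t * (norm \<xi>)\<^sup>2)) * cnj (h y) \<partial>lborel)"
        proof (rule Bochner_Integration.integral_cong[OF refl])
          fix y
          have "(cis (- (x \<bullet> \<xi>)) * of_real (exp (- t * (norm \<xi>)\<^sup>2))) * (cis (y \<bullet> \<xi>) * cnj (h y)) =
            (cis (- (x \<bullet> \<xi>)) * cis (y \<bullet> \<xi>)) * of_real (exp (- t * (norm \<xi>)\<^sup>2)) * cnj (h y)"
            by (simp only: mult_ac)
          also have "cis (- (x \<bullet> \<xi>)) * cis (y \<bullet> \<xi>) = cis (- (\<xi> \<bullet> (x - y)))"
            by (simp add: cis_mult inner_diff_right inner_commute)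
          finally show "(cis (- (x \<bullet> \<xi>)) * of_real (exp (- t * (norm \<xi>)\<^sup>2))) * (cis (y \<bullet> \<xi>) * cnj (h y)) =
            cis (- (\<xi> \<bullet> (x - y))) * of_real (exp (- t * (norm \<xi>)\<^sup>2)) * cnj (h y)" .
        qed
        finally show ?thesis .
      qed
      then show ?thesis by (simp add: mult.assoc)
    qed
    also have "(\<integral>\<xi>. (\<integral>y. cis (- (\<xi> \<bullet> (x - y))) * of_real (exp (- t * (norm \<xi>)\<^sup>2)) * cnj (h y) \<partial>lborel) \<partial>lborel) =
       (\<integral>y. (\<integral>\<xi>. cis (- (\<xi> \<bullet> (x - y))) * of_real (exp (- t * (norm \<xi>)\<^sup>2)) * cnj (h y) \<partial>lborel) \<partial>lborel)"
      by (rule Fubini_bound[OF ig hn]) (measurable, simp add: norm_mult)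
    also have "\<dots> = (\<integral>y. of_real ((pi / t) powr (CARD('n) / 2) * exp (- (norm (x - y))\<^sup>2 / (4 * t))) * cnj (h y) \<partial>lborel)"
      unfolding integral_mult_left_zero by (simp only: fourier_gaussian[OF t] DIM_cart DIM_real mult_1_right)
    also have "of_real (c * c) * \<dots> = (\<integral>y. of_real (heat_kernel t (x - y)) * cnj (h y) \<partial>lborel)"
      by (subst integral_mult_right_zero[symmetric])
        (simp only: hk of_real_mult mult.assoc)
    finally show ?thesis .
  qed
  have "(\<integral>\<xi>. of_real (exp (- t * (norm \<xi>)\<^sup>2)) * (fourier_integral h \<xi> * cnj (fourier_integral h \<xi>)) \<partial>lborel) =
    (\<integral>\<xi>. (\<integral>x. of_real c * (h x * (cis (- (x \<bullet> \<xi>)) * (of_real (exp (- t * (norm \<xi>)\<^sup>2)) * cnj (fourier_integral h \<xi>)))) \<partial>lborel) \<partial>lborel)"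
  proof (rule Bochner_Integration.integral_cong[OF refl])
    fix \<xi> :: "real ^ 'n"
    have "of_real (exp (- t * (norm \<xi>)\<^sup>2)) * (fourier_integral h \<xi> * cnj (fourier_integral h \<xi>)) =
      (of_real c * (of_real (exp (- t * (norm \<xi>)\<^sup>2)) * cnj (fourier_integral h \<xi>))) * (\<integral>x. cis (- (x \<bullet> \<xi>)) * h x \<partial>lborel)"
      by (subst F) (simp add: mult_ac)
    also have "\<dots> = (\<integral>x. (of_real c * (of_real (exp (- t * (norm \<xi>)\<^sup>2)) * cnj (fourier_integral h \<xi>))) * (cis (- (x \<bullet> \<xi>)) * h x) \<partial>lborel)"
      by (rule integral_mult_right_zero[symmetric])
    also have "\<dots> = (\<integral>x. of_real c * (h x * (cis (- (x \<bullet> \<xi>)) * (of_real (exp (- t * (norm \<xi>)\<^sup>2)) * cnj (fourier_integral h \<xi>)))) \<partial>lborel)"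
      by (intro Bochner_Integration.integral_cong refl) (simp only: mult_ac)
    finally show "of_real (exp (- t * (norm \<xi>)\<^sup>2)) * (fourier_integral h \<xi> * cnj (fourier_integral h \<xi>)) = \<dots>" .
  qed
  also have "\<dots> = (\<integral>x. (\<integral>\<xi>. of_real c * (h x * (cis (- (x \<bullet> \<xi>)) * (of_real (exp (- t * (norm \<xi>)\<^sup>2)) * cnj (fourier_integral h \<xi>)))) \<partial>lborel) \<partial>lborel)"
  proof (rule Fubini_bound)
    show "integrable lborel (\<lambda>\<xi>. (c * C) * exp (- t * (norm (\<xi> :: real ^ 'n))\<^sup>2))"
      using ig by (rule integrable_mult_right)
    show "integrable lborel (\<lambda>x. norm (h x))" by (rule hn)
    fix \<xi> x :: "real ^ 'n"
    have "norm (h x) * (exp (- t * (norm \<xi>)\<^sup>2) * norm (fourier_integral h \<xi>)) \<le> norm (h x) * (exp (- t * (norm \<xi>)\<^sup>2) * C)"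
      by (intro mult_left_mono C) auto
    then show "norm (of_real c * (h x * (cis (- (x \<bullet> \<xi>)) * (of_real (exp (- t * (norm \<xi>)\<^sup>2)) * cnj (fourier_integral h \<xi>)))))
        \<le> (c * C) * exp (- t * (norm \<xi>)\<^sup>2) * norm (h x)"
      using c0 by (simp add: norm_mult mult_ac)
  qed measurable
  also have "\<dots> = (\<integral>x. h x * (of_real c * (\<integral>\<xi>. cis (- (x \<bullet> \<xi>)) * (of_real (exp (- t * (norm \<xi>)\<^sup>2)) * cnj (fourier_integral h \<xi>)) \<partial>lborel)) \<partial>lborel)"
    by (rule Bochner_Integration.integral_cong[OF refl]) (rule pull1)
  also have "\<dots> = (\<integral>x. (\<integral>y. of_real (heat_kernel t (x - y)) * (h x * cnj (h y)) \<partial>lborel) \<partial>lborel)"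
    unfolding inner by (rule Bochner_Integration.integral_cong[OF refl]) (rule pull2)
  finally show ?thesis .
qed

lemma integrable_heat_pair:
  fixes h :: "real ^ 'n \<Rightarrow> complex"
  assumes [measurable]: "h \<in> borel_measurable borel" and h2: "sq_norm h < \<infinity>" and t: "t > 0"
  shows "integrable (lborel \<Otimes>\<^sub>M lborel) (\<lambda>z. heat_kernel t (fst z - snd z) * (norm (h (fst z)))\<^sup>2)"
    and "integrable (lborel \<Otimes>\<^sub>M lborel) (\<lambda>z. heat_kernel t (fst z - snd z) * (norm (h (snd z)))\<^sup>2)"
    and "integrable (lborel \<Otimes>\<^sub>M lborel) (\<lambda>z. heat_kernel t (fst z - snd z) * (norm (h (fst z) - h (snd z)))\<^sup>2)"
proof -
  show "integrable (lborel \<Otimes>\<^sub>M lborel) (\<lambda>z. heat_kernel t (fst z - snd z) * (norm (h (fst z)))\<^sup>2)"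
    by (rule integrableI_nonneg) (use h2 in \<open>auto simp: nn_integral_heat_fst[OF assms(1) t] lborel.nn_integral_fst[symmetric]\<close>)
  show "integrable (lborel \<Otimes>\<^sub>M lborel) (\<lambda>z. heat_kernel t (fst z - snd z) * (norm (h (snd z)))\<^sup>2)"
    by (rule integrableI_nonneg) (use h2 in \<open>auto simp: nn_integral_heat_snd[OF assms(1) t] lborel.nn_integral_fst[symmetric]\<close>)
  have "heat_defect t h < \<infinity>"
  proof (rule le_less_trans)
    show "heat_defect t h \<le> 8 * sq_norm (\<lambda>x. h x - 0) + 2 * heat_defect t (\<lambda>x::real^'n. 0 :: complex)"
      by (rule heat_defect_le) (use t in auto)
    show "8 * sq_norm (\<lambda>x. h x - 0) + 2 * heat_defect t (\<lambda>x::real^'n. 0 :: complex) < \<infinity>"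
      using h2 by (simp add: heat_defect_def ennreal_mult_less_top)
  qed
  then show "integrable (lborel \<Otimes>\<^sub>M lborel) (\<lambda>z. heat_kernel t (fst z - snd z) * (norm (h (fst z) - h (snd z)))\<^sup>2)"
    by (intro integrableI_nonneg) (auto simp: heat_defect_def lborel.nn_integral_fst[symmetric])
qed

text \<open>Polarization, 2 Re(a cnj(b)) = |a|^2 + |b|^2 - |a - b|^2, applied inside the pairing
  with the heat kernel: the two squares give \<open>sq_norm h\<close> each and the difference gives
  the defect. The identity is written additively because subtraction of extended reals
  truncates.\<close>

lemma fourier_integral_gauss_norm:
  fixes h :: "real ^ 'n \<Rightarrow> complex"
  assumes h: "integrable lborel h" and h2: "sq_norm h < \<infinity>" and t: "t > 0"
  shows "2 * (\<integral>\<^sup>+\<xi>. ennreal (exp (- t * (norm \<xi>)\<^sup>2) * (norm (fourier_integral h \<xi>))\<^sup>2) \<partial>lborel) + heat_defect t h = 2 * sq_norm h"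
proof -
  have [measurable]: "h \<in> borel_measurable borel" using h by auto
  note I = integrable_heat_pair[OF \<open>h \<in> _\<close> h2 t]
  define C where "C = (2 * pi) powr (- real CARD('n) / 2) * (\<integral>x. norm (h x) \<partial>lborel)"
  have C: "norm (fourier_integral h \<xi>) \<le> C" for \<xi>
    unfolding C_def by (rule norm_fourier_integral_le)
  define L where "L = (\<integral>\<xi>. exp (- t * (norm \<xi>)\<^sup>2) * (norm (fourier_integral h \<xi>))\<^sup>2 \<partial>lborel)"
  have iL: "integrable lborel (\<lambda>\<xi>. exp (- t * (norm \<xi>)\<^sup>2) * (norm (fourier_integral h \<xi>))\<^sup>2)"
  proof (rule Bochner_Integration.integrable_bound)
    show "integrable lborel (\<lambda>\<xi>. exp (- t * (norm (\<xi> :: real^'n))\<^sup>2) * C\<^sup>2)"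
      by (intro integrable_mult_left integrable_gaussian t)
    show "AE \<xi> in lborel. norm (exp (- t * (norm \<xi>)\<^sup>2) * (norm (fourier_integral h \<xi>))\<^sup>2) \<le> norm (exp (- t * (norm \<xi>)\<^sup>2) * C\<^sup>2)"
      using C by (auto intro!: AE_I2 mult_left_mono power_mono)
  qed measurable
  have nnL: "(\<integral>\<^sup>+\<xi>. ennreal (exp (- t * (norm \<xi>)\<^sup>2) * (norm (fourier_integral h \<xi>))\<^sup>2) \<partial>lborel) = ennreal L"
    unfolding L_def by (rule nn_integral_eq_integral[OF iL]) auto
  define A1 where "A1 = (\<integral>z. heat_kernel t (fst z - snd z) * (norm (h (fst z)))\<^sup>2 \<partial>(lborel \<Otimes>\<^sub>M lborel))"
  define A2 where "A2 = (\<integral>z. heat_kernel t (fst z - snd z) * (norm (h (snd z)))\<^sup>2 \<partial>(lborel \<Otimes>\<^sub>M lborel))"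
  define A3 where "A3 = (\<integral>z. heat_kernel t (fst z - snd z) * (norm (h (fst z) - h (snd z)))\<^sup>2 \<partial>(lborel \<Otimes>\<^sub>M lborel))"
  have nn1: "ennreal A1 = sq_norm h"
    unfolding A1_def by (subst nn_integral_eq_integral[OF I(1), symmetric])
      (auto simp: nn_integral_heat_fst[OF \<open>h \<in> _\<close> t] lborel.nn_integral_fst[symmetric])
  have nn2: "ennreal A2 = sq_norm h"
    unfolding A2_def by (subst nn_integral_eq_integral[OF I(2), symmetric])
      (auto simp: nn_integral_heat_snd[OF \<open>h \<in> _\<close> t] lborel.nn_integral_fst[symmetric])
  have nn3: "ennreal A3 = heat_defect t h"
    unfolding A3_def by (subst nn_integral_eq_integral[OF I(3), symmetric])
      (auto simp: heat_defect_def lborel.nn_integral_fst[symmetric])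
  have pos: "A1 \<ge> 0" "A2 \<ge> 0" "A3 \<ge> 0" "L \<ge> 0"
    unfolding A1_def A2_def A3_def L_def by (auto intro!: integral_nonneg_AE)
  have polar: "2 * Re (a * cnj b) = (norm a)\<^sup>2 + (norm b)\<^sup>2 - (norm (a - b))\<^sup>2" for a b :: complex
    unfolding cmod_power2 by (simp add: power2_eq_square algebra_simps)
  have ic: "integrable (lborel \<Otimes>\<^sub>M lborel) (\<lambda>z. of_real (heat_kernel t (fst z - snd z)) * (h (fst z) * cnj (h (snd z))))"
  proof (rule Bochner_Integration.integrable_bound[OF Bochner_Integration.integrable_add[OF I(1) I(2)]])
    show "AE z in lborel \<Otimes>\<^sub>M lborel. norm (of_real (heat_kernel t (fst z - snd z)) * (h (fst z) * cnj (h (snd z)))) \<le>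
      norm (heat_kernel t (fst z - snd z) * (norm (h (fst z)))\<^sup>2 + heat_kernel t (fst z - snd z) * (norm (h (snd z)))\<^sup>2)"
    proof (rule AE_I2)
      fix z :: "(real ^ 'n) \<times> (real ^ 'n)"
      have "norm (h (fst z)) * norm (h (snd z)) \<le> (norm (h (fst z)))\<^sup>2 + (norm (h (snd z)))\<^sup>2"
        using sum_squares_bound[of "norm (h (fst z))" "norm (h (snd z))"]
          mult_nonneg_nonneg[OF norm_ge_zero[of "h (fst z)"] norm_ge_zero[of "h (snd z)"]] by linarith
      then have "heat_kernel t (fst z - snd z) * (norm (h (fst z)) * norm (h (snd z))) \<le> heat_kernel t (fst z - snd z) * ((norm (h (fst z)))\<^sup>2 + (norm (h (snd z)))\<^sup>2)"
        by (intro mult_left_mono) auto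
      then show "norm (of_real (heat_kernel t (fst z - snd z)) * (h (fst z) * cnj (h (snd z)))) \<le>
      norm (heat_kernel t (fst z - snd z) * (norm (h (fst z)))\<^sup>2 + heat_kernel t (fst z - snd z) * (norm (h (snd z)))\<^sup>2)"
        by (simp add: norm_mult distrib_left[symmetric] del: distrib_left_numeral)
    qed
  qed measurable
  have "of_real L = (\<integral>\<xi>. of_real (exp (- t * (norm \<xi>)\<^sup>2)) * (fourier_integral h \<xi> * cnj (fourier_integral h \<xi>)) \<partial>lborel)"
    unfolding L_def integral_complex_of_real[symmetric]
    by (intro Bochner_Integration.integral_cong refl) (simp only: of_real_mult complex_norm_square)
  also have "\<dots> = (\<integral>z. of_real (heat_kernel t (fst z - snd z)) * (h (fst z) * cnj (h (snd z))) \<partial>(lborel \<Otimes>\<^sub>M lborel))"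
    unfolding fourier_integral_gauss_pairing[OF h t]
    using lborel_pair.integral_fst'[of "\<lambda>z. of_real (heat_kernel t (fst z - snd z)) * (h (fst z) * cnj (h (snd z)))"] ic by simp
  finally have "2 * Re (complex_of_real L) = 2 * Re \<dots>" by simp
  also have "\<dots> = 2 * (\<integral>z. Re (of_real (heat_kernel t (fst z - snd z)) * (h (fst z) * cnj (h (snd z)))) \<partial>(lborel \<Otimes>\<^sub>M lborel))"
    using ic by (subst integral_Re) auto
  also have "\<dots> = (\<integral>z. 2 * Re (of_real (heat_kernel t (fst z - snd z)) * (h (fst z) * cnj (h (snd z)))) \<partial>(lborel \<Otimes>\<^sub>M lborel))"
    by (rule integral_mult_right_zero[symmetric])
  also have "\<dots> = (\<integral>z. (heat_kernel t (fst z - snd z) * (norm (h (fst z)))\<^sup>2 + heat_kernel t (fst z - snd z) * (norm (h (snd z)))\<^sup>2)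
     - heat_kernel t (fst z - snd z) * (norm (h (fst z) - h (snd z)))\<^sup>2 \<partial>(lborel \<Otimes>\<^sub>M lborel))"
  proof (rule Bochner_Integration.integral_cong[OF refl])
    fix z
    have "2 * Re (of_real (heat_kernel t (fst z - snd z)) * (h (fst z) * cnj (h (snd z)))) =
      heat_kernel t (fst z - snd z) * (2 * Re (h (fst z) * cnj (h (snd z))))" by simp
    also have "\<dots> = heat_kernel t (fst z - snd z) * (norm (h (fst z)))\<^sup>2 + heat_kernel t (fst z - snd z) * (norm (h (snd z)))\<^sup>2
     - heat_kernel t (fst z - snd z) * (norm (h (fst z) - h (snd z)))\<^sup>2"
      unfolding polar by (simp only: right_diff_distrib distrib_left)
    finally show "2 * Re (of_real (heat_kernel t (fst z - snd z)) * (h (fst z) * cnj (h (snd z)))) = \<dots>" .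
  qed
  also have "\<dots> = A1 + A2 - A3"
    unfolding A1_def A2_def A3_def
    by (subst Bochner_Integration.integral_diff, intro Bochner_Integration.integrable_add I, rule I,
        subst Bochner_Integration.integral_add[OF I(1,2)], rule refl)
  finally have "2 * L + A3 = A1 + A2" by simp
  then have "ennreal (2 * L + A3) = ennreal (A1 + A2)" by simp
  then have "2 * ennreal L + ennreal A3 = ennreal A1 + ennreal A2"
    using pos by (simp add: ennreal_mult'')
  then show ?thesis unfolding nn1 nn2 nn3 nnL by (simp flip: mult_2)
qed

text \<open>As t decreases to 0 the damped integral increases to
  \<open>sq_norm (fourier_integral h)\<close> by monotone convergence, while the defect vanishes;
  the sum of the two, suitably weighted, is constant in t.\<close>

theorem plancherel_L1_L2:
  fixes h :: "real ^ 'n \<Rightarrow> complex"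
  assumes h: "integrable lborel h" and h2: "sq_norm h < \<infinity>"
  shows "sq_norm (fourier_integral h) = sq_norm h"
proof -
  have [measurable]: "h \<in> borel_measurable borel" using h by auto
  define t where "t n = (1 / real (Suc n))\<^sup>2" for n
  have t: "t n > 0" for n by (simp add: t_def)
  have tdec: "t (Suc n) \<le> t n" for n
    unfolding t_def by (intro power_mono divide_left_mono) auto
  have t0: "t \<longlonglongrightarrow> 0"
  proof -
    have "(\<lambda>n. 1 / real (Suc n)) \<longlonglongrightarrow> 0" by (rule LIMSEQ_Suc) (rule lim_1_over_n)
    from tendsto_power[OF this, of 2] show ?thesis by (simp add: t_def[abs_def])
  qed
  define G where "G n = (\<integral>\<^sup>+\<xi>. ennreal (exp (- t n * (norm \<xi>)\<^sup>2) * (norm (fourier_integral h \<xi>))\<^sup>2) \<partial>lborel)" for n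
  have "G \<longlonglongrightarrow> sq_norm (fourier_integral h)"
    unfolding G_def sq_norm_def
  proof (rule nn_integral_LIMSEQ)
    show "incseq (\<lambda>n \<xi>. ennreal (exp (- t n * (norm \<xi>)\<^sup>2) * (norm (fourier_integral h \<xi>))\<^sup>2))"
      by (intro incseq_SucI le_funI ennreal_leI mult_right_mono) (auto intro!: mult_right_mono tdec)
    fix \<xi> :: "real ^ 'n"
    have "(\<lambda>n. ennreal (exp (- t n * (norm \<xi>)\<^sup>2) * (norm (fourier_integral h \<xi>))\<^sup>2)) \<longlonglongrightarrow>
       ennreal (exp (- 0 * (norm \<xi>)\<^sup>2) * (norm (fourier_integral h \<xi>))\<^sup>2)"
      by (intro tendsto_intros t0)
    then show "(\<lambda>n. ennreal (exp (- t n * (norm \<xi>)\<^sup>2) * (norm (fourier_integral h \<xi>))\<^sup>2)) \<longlonglongrightarrow> ennreal ((norm (fourier_integral h \<xi>))\<^sup>2)"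
      by simp
  qed measurable
  then have "(\<lambda>n. 2 * G n + heat_defect (t n) h) \<longlonglongrightarrow> 2 * sq_norm (fourier_integral h) + 0"
    unfolding t_def by (intro tendsto_add tendsto_mult_ennreal tendsto_const heat_defect_tendsto) (use h2 in auto)
  moreover have "2 * G n + heat_defect (t n) h = 2 * sq_norm h" for n
    unfolding G_def by (rule fourier_integral_gauss_norm[OF h h2 t])
  ultimately have "(\<lambda>n. 2 * sq_norm h) \<longlonglongrightarrow> 2 * sq_norm (fourier_integral h)" by simp
  then have "2 * sq_norm h = 2 * sq_norm (fourier_integral h)" by (rule LIMSEQ_unique[OF tendsto_const])
  then show ?thesis by (simp add: ennreal_mult_cancel_left)
qed

section \<open>\<open>H_half\<close> as the space of Bessel potentials\<close>

text \<open>Scalar multiplication lets one definition serve real functions and their complex copies,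
  on which the Fourier transform acts.\<close>

definition bessel_potential :: "('a::euclidean_space \<Rightarrow> 'b::{banach, second_countable_topology}) \<Rightarrow> 'a \<Rightarrow> 'b" where
  "bessel_potential f x = (\<integral>y. bessel_kernel (x - y) *\<^sub>R f y \<partial>lborel)"

lemma bessel_kernel_minus: "bessel_kernel (x - y) = bessel_kernel (y - x)"
  by (rule bessel_kernel_cong) (rule norm_minus_commute)

declare bessel_kernel_nonneg [simp]

lemma bessel_potential_measurable [measurable]:
  assumes [measurable]: "f \<in> borel_measurable borel"
  shows "bessel_potential f \<in> borel_measurable borel"
  unfolding bessel_potential_def[abs_def] by measurable

lemma nn_integral_bessel_kernel_shift: "(\<integral>\<^sup>+y. ennreal (bessel_kernel (x - y)) \<partial>lborel) = 1"
  using nn_integral_reflect[of "\<lambda>z. ennreal (bessel_kernel z)" x] nn_integral_bessel_kernel by simp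

lemma nn_integral_bessel_kernel_shift': "(\<integral>\<^sup>+x. ennreal (bessel_kernel (x - y)) \<partial>lborel) = 1"
  unfolding bessel_kernel_minus[of _ y] by (rule nn_integral_bessel_kernel_shift)

lemma nn_integral_bessel_kernel_conv:
  assumes [measurable]: "f \<in> borel_measurable borel"
  shows "(\<integral>\<^sup>+x. (\<integral>\<^sup>+y. ennreal (bessel_kernel (x - y)) * f y \<partial>lborel) \<partial>lborel) = (\<integral>\<^sup>+y. f y \<partial>lborel)"
proof -
  have "(\<integral>\<^sup>+x. (\<integral>\<^sup>+y. ennreal (bessel_kernel (x - y)) * f y \<partial>lborel) \<partial>lborel) =
    (\<integral>\<^sup>+y. (\<integral>\<^sup>+x. ennreal (bessel_kernel (x - y)) * f y \<partial>lborel) \<partial>lborel)"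
    by (rule lborel_pair.Fubini') measurable
  then show ?thesis by (simp add: nn_integral_multc nn_integral_bessel_kernel_shift')
qed

text \<open>Jensen's inequality for the probability density y \<mapsto>
  \<open>bessel_kernel (x - y)\<close>, in the form of Cauchy-Schwarz with the kernel split into two
  square roots.\<close>

lemma bessel_kernel_conv_sq_le:
  fixes f :: "'a::euclidean_space \<Rightarrow> real"
  assumes [measurable]: "f \<in> borel_measurable borel" and nn: "\<And>x. f x \<ge> 0"
  shows "(\<integral>\<^sup>+y. ennreal (bessel_kernel (x - y) * f y) \<partial>lborel)\<^sup>2 \<le> (\<integral>\<^sup>+y. ennreal (bessel_kernel (x - y)) * ennreal ((f y)\<^sup>2) \<partial>lborel)"
proof -
  have "(\<integral>\<^sup>+y. ennreal (bessel_kernel (x - y) * f y) \<partial>lborel) =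
     (\<integral>\<^sup>+y. ennreal (sqrt (bessel_kernel (x - y))) * ennreal (sqrt (bessel_kernel (x - y)) * f y) \<partial>lborel)"
    by (intro nn_integral_cong, subst ennreal_mult[symmetric]) (use nn in \<open>auto simp flip: mult.assoc\<close>)
  also have "\<dots>\<^sup>2 \<le> (\<integral>\<^sup>+y. (ennreal (sqrt (bessel_kernel (x - y))))\<^sup>2 \<partial>lborel) *
      (\<integral>\<^sup>+y. (ennreal (sqrt (bessel_kernel (x - y)) * f y))\<^sup>2 \<partial>lborel)"
    by (rule Cauchy_Schwarz_nn_integral) measurable
  also have "\<dots> = (\<integral>\<^sup>+y. ennreal (bessel_kernel (x - y)) * ennreal ((f y)\<^sup>2) \<partial>lborel)"
    using nn bessel_kernel_nonneg by (simp add: ennreal_power nn_integral_bessel_kernel_shift power_mult_distrib ennreal_mult')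
  finally show ?thesis .
qed

text \<open>Both claims follow by integrating Jensen's bound over x. Where the convolution integral
  fails to exist the Bochner integral is 0, so the norm bound holds at every point.\<close>

lemma
  fixes f :: "'a::euclidean_space \<Rightarrow> 'b::{banach, second_countable_topology}"
  assumes [measurable]: "f \<in> borel_measurable borel" and fin: "sq_norm f < \<infinity>"
  shows sq_norm_bessel_potential_le: "sq_norm (bessel_potential f) \<le> sq_norm f"
    and AE_integrable_bessel_potential: "AE x in lborel. integrable lborel (\<lambda>y. bessel_kernel (x - y) *\<^sub>R f y)"
proof -
  define S where "S x = (\<integral>\<^sup>+y. ennreal (bessel_kernel (x - y)) * ennreal ((norm (f y))\<^sup>2) \<partial>lborel)" for x
  have [measurable]: "S \<in> borel_measurable borel" unfolding S_def by measurable
  have S: "(\<integral>\<^sup>+x. S x \<partial>lborel) = sq_norm f"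
    unfolding S_def sq_norm_def by (rule nn_integral_bessel_kernel_conv) measurable
  have le: "(\<integral>\<^sup>+y. ennreal (norm (bessel_kernel (x - y) *\<^sub>R f y)) \<partial>lborel)\<^sup>2 \<le> S x" for x
    using bessel_kernel_conv_sq_le[of "\<lambda>y. norm (f y)" x] bessel_kernel_nonneg by (simp add: S_def)
  have "AE x in lborel. S x \<noteq> \<infinity>"
    by (rule nn_integral_PInf_AE) (use S fin in auto)
  then show "AE x in lborel. integrable lborel (\<lambda>y. bessel_kernel (x - y) *\<^sub>R f y)"
  proof eventually_elim
    case (elim x)
    have "S x < \<infinity>" using elim by (simp add: less_top)
    then have "(\<integral>\<^sup>+y. ennreal (norm (bessel_kernel (x - y) *\<^sub>R f y)) \<partial>lborel)\<^sup>2 < \<infinity>"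
      by (rule le_less_trans[OF le])
    then have "(\<integral>\<^sup>+y. ennreal (norm (bessel_kernel (x - y) *\<^sub>R f y)) \<partial>lborel) < \<infinity>"
      by (simp add: power_less_top_ennreal)
    then show ?case by (intro integrableI_bounded) auto
  qed
  have "ennreal ((norm (bessel_potential f x))\<^sup>2) \<le> S x" for x
  proof -
    have "ennreal (norm (bessel_potential f x)) \<le> (\<integral>\<^sup>+y. ennreal (norm (bessel_kernel (x - y) *\<^sub>R f y)) \<partial>lborel)"
    proof (cases "integrable lborel (\<lambda>y. bessel_kernel (x - y) *\<^sub>R f y)")
      case True
      then show ?thesis unfolding bessel_potential_def by (rule integral_norm_bound_ennreal)
    qed (simp add: bessel_potential_def not_integrable_integral_eq)
    then have "(ennreal (norm (bessel_potential f x)))\<^sup>2 \<le> (\<integral>\<^sup>+y. ennreal (norm (bessel_kernel (x - y) *\<^sub>R f y)) \<partial>lborel)\<^sup>2"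
      by (rule power_mono) simp
    then show ?thesis using le[of x] by (simp add: ennreal_power)
  qed
  then show "sq_norm (bessel_potential f) \<le> sq_norm f"
    unfolding S[symmetric] sq_norm_def[of "bessel_potential f"] by (intro nn_integral_mono)
qed

lemma bessel_potential_diff_AE:
  fixes f g :: "'a::euclidean_space \<Rightarrow> 'b::{banach, second_countable_topology}"
  assumes [measurable]: "f \<in> borel_measurable borel" "g \<in> borel_measurable borel"
    and fin: "sq_norm f < \<infinity>" "sq_norm g < \<infinity>"
  shows "AE x in lborel. bessel_potential (\<lambda>y. f y - g y) x = bessel_potential f x - bessel_potential g x"
  using AE_integrable_bessel_potential[OF assms(1) fin(1)] AE_integrable_bessel_potential[OF assms(2) fin(2)]
  by eventually_elim (simp add: bessel_potential_def scaleR_diff_right)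

lemma bessel_potential_cong_AE:
  assumes [measurable]: "f \<in> borel_measurable borel" "g \<in> borel_measurable borel"
    and "AE y in lborel. f y = g y"
  shows "bessel_potential f = bessel_potential g"
  unfolding bessel_potential_def[abs_def]
  by (intro ext integral_cong_AE) (use assms in \<open>auto elim: eventually_mono\<close>)

lemma bessel_potential_of_real:
  "bessel_potential (\<lambda>y. complex_of_real (f y)) x = complex_of_real (bessel_potential f x)"
  unfolding bessel_potential_def by (simp add: scaleR_conv_of_real flip: of_real_mult)

lemma integrable_bessel_potential:
  fixes f :: "'a::euclidean_space \<Rightarrow> 'b::{banach, second_countable_topology}"
  assumes f: "integrable lborel f"
  shows "integrable lborel (bessel_potential f)"
proof (rule integrableI_bounded)
  have [measurable]: "f \<in> borel_measurable borel" using f by auto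
  have "(\<integral>\<^sup>+x. ennreal (norm (bessel_potential f x)) \<partial>lborel) \<le>
     (\<integral>\<^sup>+x. (\<integral>\<^sup>+y. ennreal (bessel_kernel (x - y)) * ennreal (norm (f y)) \<partial>lborel) \<partial>lborel)"
  proof (rule nn_integral_mono)
    fix x
    have "ennreal (norm (bessel_potential f x)) \<le> (\<integral>\<^sup>+y. ennreal (norm (bessel_kernel (x - y) *\<^sub>R f y)) \<partial>lborel)"
    proof (cases "integrable lborel (\<lambda>y. bessel_kernel (x - y) *\<^sub>R f y)")
      case True
      then show ?thesis unfolding bessel_potential_def by (rule integral_norm_bound_ennreal)
    qed (simp add: bessel_potential_def not_integrable_integral_eq)
    then show "ennreal (norm (bessel_potential f x)) \<le> (\<integral>\<^sup>+y. ennreal (bessel_kernel (x - y)) * ennreal (norm (f y)) \<partial>lborel)"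
      using bessel_kernel_nonneg by (simp add: ennreal_mult')
  qed
  also have "\<dots> = (\<integral>\<^sup>+y. ennreal (norm (f y)) \<partial>lborel)" by (rule nn_integral_bessel_kernel_conv) measurable
  also have "\<dots> < \<infinity>" using f by (simp add: integrable_iff_bounded)
  finally show "(\<integral>\<^sup>+x. ennreal (norm (bessel_potential f x)) \<partial>lborel) < \<infinity>" .
  show "bessel_potential f \<in> borel_measurable lborel" by simp
qed

text \<open>The convolution theorem for an integrable f; Fubini is justified by the mass 1 of the
  kernel.\<close>

lemma fourier_integral_bessel_potential:
  fixes f :: "real ^ 'n \<Rightarrow> complex"
  assumes f: "integrable lborel f"
  shows "fourier_integral (bessel_potential f) \<xi> = of_real ((1 + (norm \<xi>)\<^sup>2) powr (- 1 / 4)) * fourier_integral f \<xi>"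
proof -
  have [measurable]: "f \<in> borel_measurable borel" using f by auto
  have int: "integrable (lborel \<Otimes>\<^sub>M lborel) (\<lambda>z. cis (- (fst z \<bullet> \<xi>)) * (bessel_kernel (fst z - snd z) *\<^sub>R f (snd z)))"
  proof (rule integrableI_bounded)
    have "(\<integral>\<^sup>+z. ennreal (norm (cis (- (fst z \<bullet> \<xi>)) * (bessel_kernel (fst z - snd z) *\<^sub>R f (snd z)))) \<partial>(lborel \<Otimes>\<^sub>M lborel)) =
      (\<integral>\<^sup>+x. (\<integral>\<^sup>+y. ennreal (bessel_kernel (x - y)) * ennreal (norm (f y)) \<partial>lborel) \<partial>lborel)"
      using bessel_kernel_nonneg by (subst lborel.nn_integral_fst[symmetric]) (auto simp: norm_mult ennreal_mult')
    also have "\<dots> = (\<integral>\<^sup>+y. ennreal (norm (f y)) \<partial>lborel)" by (rule nn_integral_bessel_kernel_conv) measurable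
    also have "\<dots> < \<infinity>" using f by (simp add: integrable_iff_bounded)
    finally show "(\<integral>\<^sup>+z. ennreal (norm (cis (- (fst z \<bullet> \<xi>)) * (bessel_kernel (fst z - snd z) *\<^sub>R f (snd z)))) \<partial>(lborel \<Otimes>\<^sub>M lborel)) < \<infinity>" .
  qed measurable
  have "(\<integral>x. cis (- (x \<bullet> \<xi>)) * bessel_potential f x \<partial>lborel) =
    (\<integral>x. (\<integral>y. cis (- (x \<bullet> \<xi>)) * (bessel_kernel (x - y) *\<^sub>R f y) \<partial>lborel) \<partial>lborel)"
    unfolding bessel_potential_def by (simp only: integral_mult_right_zero)
  also have "\<dots> = (\<integral>y. (\<integral>x. cis (- (x \<bullet> \<xi>)) * (bessel_kernel (x - y) *\<^sub>R f y) \<partial>lborel) \<partial>lborel)"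
    by (rule lborel_pair.Fubini_integral[symmetric]) (use int in \<open>simp add: case_prod_unfold\<close>)
  also have "\<dots> = (\<integral>y. of_real ((1 + (norm \<xi>)\<^sup>2) powr (- 1 / 4)) * (cis (- (y \<bullet> \<xi>)) * f y) \<partial>lborel)"
  proof (rule Bochner_Integration.integral_cong[OF refl])
    fix y :: "real ^ 'n"
    have "(\<integral>x. cis (- (x \<bullet> \<xi>)) * (bessel_kernel (x - y) *\<^sub>R f y) \<partial>lborel) =
      (\<integral>x. cis (- ((x + y) \<bullet> \<xi>)) * (bessel_kernel (x + y - y) *\<^sub>R f y) \<partial>lborel)"
      by (rule integral_translate[symmetric]) measurable
    also have "\<dots> = (\<integral>x. (cis (- (x \<bullet> \<xi>)) * of_real (bessel_kernel x)) * (cis (- (y \<bullet> \<xi>)) * f y) \<partial>lborel)"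
    proof (rule Bochner_Integration.integral_cong[OF refl])
      fix x
      have "cis (- ((x + y) \<bullet> \<xi>)) = cis (- (x \<bullet> \<xi>)) * cis (- (y \<bullet> \<xi>))"
        by (simp add: cis_mult inner_add_left)
      then show "cis (- ((x + y) \<bullet> \<xi>)) * (bessel_kernel (x + y - y) *\<^sub>R f y) = (cis (- (x \<bullet> \<xi>)) * of_real (bessel_kernel x)) * (cis (- (y \<bullet> \<xi>)) * f y)"
        by (simp add: scaleR_conv_of_real)
    qed
    also have "\<dots> = of_real ((1 + (norm \<xi>)\<^sup>2) powr (- 1 / 4)) * (cis (- (y \<bullet> \<xi>)) * f y)"
      unfolding integral_mult_left_zero fourier_bessel_kernel ..
    finally show "(\<integral>x. cis (- (x \<bullet> \<xi>)) * (bessel_kernel (x - y) *\<^sub>R f y) \<partial>lborel) = \<dots>" .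
  qed
  also have "\<dots> = of_real ((1 + (norm \<xi>)\<^sup>2) powr (- 1 / 4)) * (\<integral>y. cis (- (y \<bullet> \<xi>)) * f y \<partial>lborel)"
    by (rule integral_mult_right_zero)
  finally show ?thesis unfolding fourier_integral_def by (simp only: mult.left_commute)
qed

section \<open>The Fourier transform on L2\<close>

lemma L2_iff:
  fixes f :: "real ^ 'n \<Rightarrow> 'b::{banach, second_countable_topology}"
  shows "f \<in> L2 \<longleftrightarrow> f \<in> borel_measurable borel \<and> sq_norm f < \<infinity>"
  by (auto simp: L2_def sq_norm_def integrable_iff_bounded)

lemma has_L2_fourier_iff:
  "has_L2_fourier f g \<longleftrightarrow> f \<in> L2 \<and> g \<in> L2 \<and>
     (\<exists>h. (\<forall>k. h k \<in> L2 \<and> integrable lborel (h k)) \<and> (\<lambda>k. sq_norm (\<lambda>x. h k x - f x)) \<longlonglongrightarrow> 0 \<and>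
        (\<lambda>k. sq_norm (\<lambda>x. fourier_integral (h k) x - g x)) \<longlonglongrightarrow> 0)"
  unfolding has_L2_fourier_def sq_norm_def ..

lemma sq_norm_split3:
  fixes f f' h h' :: "'a::euclidean_space \<Rightarrow> 'b::{real_normed_vector, second_countable_topology}"
  assumes [measurable]: "f \<in> borel_measurable borel" "f' \<in> borel_measurable borel" "h \<in> borel_measurable borel" "h' \<in> borel_measurable borel"
  shows "sq_norm (\<lambda>x. f x - f' x) \<le> 2 * sq_norm (\<lambda>x. h x - f x) + 4 * sq_norm (\<lambda>x. h' x - f' x) + 4 * sq_norm (\<lambda>x. h x - h' x)"
proof -
  have "sq_norm (\<lambda>x. f x - f' x) \<le> 2 * sq_norm (\<lambda>x. f x - h x) + 2 * sq_norm (\<lambda>x. h x - f' x)"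
    by (rule sq_norm_triangle) measurable
  also have "sq_norm (\<lambda>x. h x - f' x) \<le> 2 * sq_norm (\<lambda>x. h x - h' x) + 2 * sq_norm (\<lambda>x. h' x - f' x)"
    by (rule sq_norm_triangle) measurable
  also have "2 * sq_norm (\<lambda>x. f x - h x) + 2 * (2 * sq_norm (\<lambda>x. h x - h' x) + 2 * sq_norm (\<lambda>x. h' x - f' x)) =
     2 * sq_norm (\<lambda>x. h x - f x) + 4 * sq_norm (\<lambda>x. h' x - f' x) + 4 * sq_norm (\<lambda>x. h x - h' x)"
    by (simp add: distrib_left mult.assoc[symmetric] sq_norm_commute[of f h] add_ac)
  finally show ?thesis by (simp add: mult_left_mono add_left_mono)
qed

text \<open>By Plancherel, two approximating sequences are exactly as far apart as their transforms,
  so a zero distance between the limits is carried across in either direction. From left to right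
  this is uniqueness of the transform, from right to left its injectivity.\<close>

lemma has_L2_fourier_unique:
  assumes "has_L2_fourier f g" "has_L2_fourier f' g'"
  shows "sq_norm (\<lambda>x. f x - f' x) = 0 \<longleftrightarrow> sq_norm (\<lambda>x. g x - g' x) = 0"
proof -
  obtain h where h: "\<And>k. h k \<in> L2" "\<And>k. integrable lborel (h k)" "(\<lambda>k. sq_norm (\<lambda>x. h k x - f x)) \<longlonglongrightarrow> 0"
    "(\<lambda>k. sq_norm (\<lambda>x. fourier_integral (h k) x - g x)) \<longlonglongrightarrow> 0"
    using assms(1) unfolding has_L2_fourier_iff by blast
  obtain h' where h': "\<And>k. h' k \<in> L2" "\<And>k. integrable lborel (h' k)" "(\<lambda>k. sq_norm (\<lambda>x. h' k x - f' x)) \<longlonglongrightarrow> 0"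
    "(\<lambda>k. sq_norm (\<lambda>x. fourier_integral (h' k) x - g' x)) \<longlonglongrightarrow> 0"
    using assms(2) unfolding has_L2_fourier_iff by blast
  have [measurable]: "f \<in> borel_measurable borel" "f' \<in> borel_measurable borel" "g \<in> borel_measurable borel" "g' \<in> borel_measurable borel"
    "h k \<in> borel_measurable borel" "h' k \<in> borel_measurable borel" for k
    using assms h(1) h'(1) by (auto simp: has_L2_fourier_iff L2_iff)
  have eq: "sq_norm (\<lambda>x. h k x - h' k x) = sq_norm (\<lambda>x. fourier_integral (h k) x - fourier_integral (h' k) x)" for k
  proof -
    have "sq_norm (\<lambda>x. h k x - h' k x) \<le> 2 * sq_norm (h k) + 2 * sq_norm (h' k)" by (rule sq_norm_diff_le) auto
    also have "\<dots> < \<infinity>" using h(1) h'(1) by (simp add: L2_iff ennreal_mult_less_top)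
    finally have "sq_norm (fourier_integral (\<lambda>x. h k x - h' k x)) = sq_norm (\<lambda>x. h k x - h' k x)"
      by (intro plancherel_L1_L2 Bochner_Integration.integrable_diff h(2) h'(2))
    moreover have "fourier_integral (\<lambda>x. h k x - h' k x) = (\<lambda>x. fourier_integral (h k) x - fourier_integral (h' k) x)"
      by (intro ext fourier_integral_diff h(2) h'(2))
    ultimately show ?thesis by simp
  qed
  \<comment> \<open>Both directions at once: \<open>b\<close> is the distance known to vanish,
    \<open>a\<close> the one in question, \<open>d\<close> the common distance of the approximants,
    and p, q, r, s are approximation errors.\<close>
  have key: "a = 0" if b: "b = (0::ennreal)" and le1: "\<And>k. a \<le> 2 * p k + 4 * q k + 4 * d k"
    and le2: "\<And>k. d k \<le> 2 * r k + 4 * s k + 4 * b" and lim: "p \<longlonglongrightarrow> 0" "q \<longlonglongrightarrow> 0" "r \<longlonglongrightarrow> 0" "s \<longlonglongrightarrow> 0" for a b p q r s d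
  proof -
    have "a \<le> 2 * p k + 4 * q k + 4 * (2 * r k + 4 * s k)" for k
    proof -
      have "4 * d k \<le> 4 * (2 * r k + 4 * s k)" using le2[of k] b by (intro mult_left_mono) auto
      then show ?thesis using le1[of k] by (rule order_trans[rotated, OF add_left_mono])
    qed
    moreover have "(\<lambda>k. 2 * p k + 4 * q k + 4 * (2 * r k + 4 * s k)) \<longlonglongrightarrow> 2 * 0 + 4 * 0 + 4 * (2 * 0 + 4 * 0)"
      by (intro tendsto_add tendsto_mult_ennreal tendsto_const lim) auto
    ultimately have "a \<le> 2 * 0 + 4 * 0 + 4 * (2 * 0 + 4 * 0)" by (intro LIMSEQ_le_const) auto
    then show ?thesis by simp
  qed
  have comm: "sq_norm (\<lambda>x. (u x :: complex) - v x) = sq_norm (\<lambda>x. v x - u x)" for u v :: "real ^ 'a \<Rightarrow> complex"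
    by (rule sq_norm_commute)
  have s1: "sq_norm (\<lambda>x. f x - f' x) \<le> 2 * sq_norm (\<lambda>x. h k x - f x) + 4 * sq_norm (\<lambda>x. h' k x - f' x) + 4 * sq_norm (\<lambda>x. h k x - h' k x)" for k
    by (rule sq_norm_split3) measurable
  have s2: "sq_norm (\<lambda>x. g x - g' x) \<le> 2 * sq_norm (\<lambda>x. fourier_integral (h k) x - g x) + 4 * sq_norm (\<lambda>x. fourier_integral (h' k) x - g' x) + 4 * sq_norm (\<lambda>x. h k x - h' k x)" for k
    unfolding eq by (rule sq_norm_split3) measurable
  have s3: "sq_norm (\<lambda>x. h k x - h' k x) \<le> 2 * sq_norm (\<lambda>x. h k x - f x) + 4 * sq_norm (\<lambda>x. h' k x - f' x) + 4 * sq_norm (\<lambda>x. f x - f' x)" for k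
    using sq_norm_split3[of "h k" "h' k" f f'] by (simp add: comm[of f "h k"] comm[of f' "h' k"])
  have s4: "sq_norm (\<lambda>x. h k x - h' k x) \<le> 2 * sq_norm (\<lambda>x. fourier_integral (h k) x - g x) + 4 * sq_norm (\<lambda>x. fourier_integral (h' k) x - g' x) + 4 * sq_norm (\<lambda>x. g x - g' x)" for k
    unfolding eq using sq_norm_split3[of "fourier_integral (h k)" "fourier_integral (h' k)" g g']
    by (simp add: comm[of g "fourier_integral (h k)"] comm[of g' "fourier_integral (h' k)"])
  show ?thesis
  proof
    assume "sq_norm (\<lambda>x. f x - f' x) = 0"
    then show "sq_norm (\<lambda>x. g x - g' x) = 0" by (rule key[OF _ s2 s3]) (fact h h')+
  next
    assume "sq_norm (\<lambda>x. g x - g' x) = 0"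
    then show "sq_norm (\<lambda>x. f x - f' x) = 0" by (rule key[OF _ s1 s4]) (fact h h')+
  qed
qed

lemma tendsto_zero_le_ennreal:
  fixes f g :: "nat \<Rightarrow> ennreal"
  assumes "g \<longlonglongrightarrow> 0" "\<And>n. f n \<le> g n"
  shows "f \<longlonglongrightarrow> 0"
  by (rule tendsto_sandwich[OF _ _ tendsto_const assms(1)]) (use assms(2) in auto)

lemma sq_norm_commute_tendsto:
  "(\<lambda>n. sq_norm (\<lambda>x. f n x - g x)) \<longlonglongrightarrow> 0 \<longleftrightarrow> (\<lambda>n. sq_norm (\<lambda>x. g x - f n x)) \<longlonglongrightarrow> 0"
  by (subst sq_norm_commute) (rule refl)

lemma sq_norm_cauchy_of_tendsto:
  fixes h :: "nat \<Rightarrow> 'a::euclidean_space \<Rightarrow> 'b::{real_normed_vector, second_countable_topology}"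
  assumes [measurable]: "\<And>n. h n \<in> borel_measurable borel" "f \<in> borel_measurable borel"
    and lim: "(\<lambda>n. sq_norm (\<lambda>x. h n x - f x)) \<longlonglongrightarrow> 0" and e: "e > 0"
  shows "\<exists>M. \<forall>m\<ge>M. \<forall>n\<ge>M. sq_norm (\<lambda>x. h m x - h n x) \<le> ennreal e"
proof -
  have "eventually (\<lambda>n. sq_norm (\<lambda>x. h n x - f x) < ennreal (e / 4)) sequentially"
    by (rule order_tendstoD(2)[OF lim]) (use e in auto)
  then obtain M where M: "\<And>n. n \<ge> M \<Longrightarrow> sq_norm (\<lambda>x. h n x - f x) < ennreal (e / 4)"
    by (auto simp: eventually_sequentially)
  have "sq_norm (\<lambda>x. h m x - h n x) \<le> ennreal e" if "m \<ge> M" "n \<ge> M" for m n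
  proof -
    have "sq_norm (\<lambda>x. h m x - h n x) \<le> 2 * sq_norm (\<lambda>x. h m x - f x) + 2 * sq_norm (\<lambda>x. f x - h n x)"
      by (rule sq_norm_triangle) measurable
    also have "\<dots> \<le> 2 * ennreal (e / 4) + 2 * ennreal (e / 4)"
      using M[OF that(1)] M[OF that(2)] unfolding sq_norm_commute[of f "h n"]
      by (intro add_mono mult_left_mono) auto
    also have "\<dots> = ennreal e"
      using e by (simp add: ennreal_mult''[symmetric] flip: ennreal_plus ennreal_numeral)
    finally show ?thesis .
  qed
  then show ?thesis by blast
qed

text \<open>Truncations of f lie in L1 and L2 and converge to f in L2; by Plancherel their
  transforms form a Cauchy sequence, whose limit is the transform of f.\<close>

lemma has_L2_fourier_exists:
  fixes f :: "real ^ 'n \<Rightarrow> complex"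
  assumes f: "f \<in> L2"
  obtains g where "has_L2_fourier f g"
proof -
  have [measurable]: "f \<in> borel_measurable borel" and fin: "sq_norm f < \<infinity>" using f by (auto simp: L2_iff)
  define h where "h n x = (if norm x \<le> real n \<and> norm (f x) \<le> real n then f x else 0)" for n x
  have [measurable]: "h n \<in> borel_measurable borel" for n unfolding h_def by measurable
  have h2: "sq_norm (h n) < \<infinity>" for n
  proof -
    have "sq_norm (h n) \<le> sq_norm f" unfolding sq_norm_def h_def by (intro nn_integral_mono) auto
    then show ?thesis using fin by (rule le_less_trans)
  qed
  have hi: "integrable lborel (h n)" for n
  proof (rule integrableI_bounded_set[where A="cball 0 (real n)" and B="real n"])
    show "emeasure lborel (cball (0::real ^ 'n) (real n)) < \<infinity>" by (rule emeasure_bounded_finite) simp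
  qed (auto simp: h_def)
  have lim: "(\<lambda>n. sq_norm (\<lambda>x. h n x - f x)) \<longlonglongrightarrow> 0"
    unfolding sq_norm_commute_tendsto using sq_norm_truncate_tendsto[OF \<open>f \<in> borel_measurable borel\<close> fin] by (simp add: h_def)
  have eq: "sq_norm (\<lambda>\<xi>. fourier_integral (h m) \<xi> - fourier_integral (h n) \<xi>) = sq_norm (\<lambda>x. h m x - h n x)" for m n
  proof -
    have "sq_norm (\<lambda>x. h m x - h n x) \<le> 2 * sq_norm (h m) + 2 * sq_norm (h n)" by (rule sq_norm_diff_le) auto
    also have "\<dots> < \<infinity>" using h2 by (simp add: ennreal_mult_less_top)
    finally have "sq_norm (fourier_integral (\<lambda>x. h m x - h n x)) = sq_norm (\<lambda>x. h m x - h n x)"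
      by (intro plancherel_L1_L2 Bochner_Integration.integrable_diff hi)
    moreover have "fourier_integral (\<lambda>x. h m x - h n x) = (\<lambda>x. fourier_integral (h m) x - fourier_integral (h n) x)"
      by (intro ext fourier_integral_diff hi)
    ultimately show ?thesis by simp
  qed
  have "\<exists>M. \<forall>m\<ge>M. \<forall>n\<ge>M. sq_norm (\<lambda>\<xi>. fourier_integral (h m) \<xi> - fourier_integral (h n) \<xi>) \<le> ennreal e" if "e > 0" for e
    unfolding eq by (rule sq_norm_cauchy_of_tendsto[OF _ _ lim that]) auto
  then obtain r where r: "(\<lambda>x. lim (\<lambda>k. fourier_integral (h (r k)) x)) \<in> borel_measurable borel"
    "(\<lambda>n. sq_norm (\<lambda>x. fourier_integral (h n) x - lim (\<lambda>k. fourier_integral (h (r k)) x))) \<longlonglongrightarrow> 0"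
    by (rule sq_norm_cauchy_limit[where f="\<lambda>n. fourier_integral (h n)", rotated]) auto
  define g where "g x = lim (\<lambda>k. fourier_integral (h (r k)) x)" for x
  have [measurable]: "g \<in> borel_measurable borel" unfolding g_def by (rule r)
  have glim: "(\<lambda>n. sq_norm (\<lambda>x. fourier_integral (h n) x - g x)) \<longlonglongrightarrow> 0" unfolding g_def by (rule r)
  have g2: "sq_norm g < \<infinity>"
  proof -
    have "eventually (\<lambda>n. sq_norm (\<lambda>x. fourier_integral (h n) x - g x) < 1) sequentially"
      by (rule order_tendstoD(2)[OF glim]) simp
    then obtain n where n: "sq_norm (\<lambda>x. fourier_integral (h n) x - g x) < 1" by (auto simp: eventually_sequentially)
    have "sq_norm (\<lambda>x. fourier_integral (h n) x - (fourier_integral (h n) x - g x)) \<le>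
       2 * sq_norm (fourier_integral (h n)) + 2 * sq_norm (\<lambda>x. fourier_integral (h n) x - g x)"
      by (rule sq_norm_diff_le) measurable
    also have "\<dots> < \<infinity>"
      using plancherel_L1_L2[OF hi h2, of n] h2[of n] order_less_trans[OF n ennreal_one_less_top] by (simp add: ennreal_mult_less_top)
    finally show ?thesis by simp
  qed
  have "has_L2_fourier f g"
    unfolding has_L2_fourier_iff using f g2 h2 hi lim glim by (auto simp: L2_iff intro!: exI[of _ h])
  then show ?thesis by (rule that)
qed

lemma bessel_potential_L2: "f \<in> L2 \<Longrightarrow> bessel_potential f \<in> L2"
  for f :: "real ^ 'n \<Rightarrow> 'b::{banach, second_countable_topology}"
  using sq_norm_bessel_potential_le[of f] by (auto simp: L2_iff intro: le_less_trans)

text \<open>The potential and the multiplication by (1 + |\<xi>|^2)^(-1/4) are both L2 contractions,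
  so the identity for the integrable approximants survives in the limit.\<close>

lemma has_L2_fourier_bessel_potential:
  fixes f :: "real ^ 'n \<Rightarrow> complex"
  assumes fg: "has_L2_fourier f g"
  shows "has_L2_fourier (bessel_potential f) (\<lambda>\<xi>. of_real ((1 + (norm \<xi>)\<^sup>2) powr (- 1 / 4)) * g \<xi>)"
proof -
  obtain h where h: "\<And>k. h k \<in> L2" "\<And>k. integrable lborel (h k)" "(\<lambda>k. sq_norm (\<lambda>x. h k x - f x)) \<longlonglongrightarrow> 0"
    "(\<lambda>k. sq_norm (\<lambda>x. fourier_integral (h k) x - g x)) \<longlonglongrightarrow> 0"
    using fg unfolding has_L2_fourier_iff by blast
  have f: "f \<in> L2" and g: "g \<in> L2" using fg by (auto simp: has_L2_fourier_iff)
  have [measurable]: "f \<in> borel_measurable borel" "g \<in> borel_measurable borel" "h k \<in> borel_measurable borel" for k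
    using f g h(1) by (auto simp: L2_iff)
  have m1: "(1 + (norm \<xi>)\<^sup>2) powr (- 1 / 4) \<le> 1" for \<xi> :: "real ^ 'n"
  proof -
    have "(1 + (norm \<xi>)\<^sup>2) powr (- 1 / 4) \<le> (1 + (norm \<xi>)\<^sup>2) powr 0" by (rule powr_mono) auto
    moreover have "1 + (norm \<xi>)\<^sup>2 > 0" by (simp add: add_pos_nonneg)
    ultimately show ?thesis by simp
  qed
  have mle: "sq_norm (\<lambda>\<xi>. of_real ((1 + (norm \<xi>)\<^sup>2) powr (- 1 / 4)) * u \<xi>) \<le> sq_norm u" for u :: "real ^ 'n \<Rightarrow> complex"
    unfolding sq_norm_def
  proof (intro nn_integral_mono ennreal_leI power_mono norm_ge_zero)
    fix \<xi> :: "real ^ 'n"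
    have "(1 + (norm \<xi>)\<^sup>2) powr (- 1 / 4) * norm (u \<xi>) \<le> 1 * norm (u \<xi>)" by (intro mult_right_mono m1) simp
    then show "norm (of_real ((1 + (norm \<xi>)\<^sup>2) powr (- 1 / 4)) * u \<xi>) \<le> norm (u \<xi>)" by (simp add: norm_mult)
  qed
  show ?thesis
    unfolding has_L2_fourier_iff
  proof (intro conjI exI[of _ "\<lambda>k. bessel_potential (h k)"] allI)
    show "bessel_potential f \<in> L2" by (rule bessel_potential_L2[OF f])
    show "(\<lambda>\<xi>. of_real ((1 + (norm \<xi>)\<^sup>2) powr (- 1 / 4)) * g \<xi>) \<in> L2"
      using le_less_trans[OF mle[of g]] g by (auto simp: L2_iff)
    show "bessel_potential (h k) \<in> L2" "integrable lborel (bessel_potential (h k))" for k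
      by (intro bessel_potential_L2 integrable_bessel_potential h)+
    show "(\<lambda>k. sq_norm (\<lambda>x. bessel_potential (h k) x - bessel_potential f x)) \<longlonglongrightarrow> 0"
    proof (rule tendsto_zero_le_ennreal[OF h(3)])
      fix k
      have s: "sq_norm (\<lambda>x. h k x - f x) < \<infinity>"
        using sq_norm_diff_le[of "h k" f] h(1)[of k] f by (auto simp: L2_iff ennreal_mult_less_top intro: le_less_trans)
      have "sq_norm (\<lambda>x. bessel_potential (h k) x - bessel_potential f x) = sq_norm (bessel_potential (\<lambda>x. h k x - f x))"
        by (rule sq_norm_cong_AE, use bessel_potential_diff_AE[of "h k" f] h(1)[of k] f in \<open>auto simp: L2_iff elim: eventually_mono\<close>)
      also have "\<dots> \<le> sq_norm (\<lambda>x. h k x - f x)" by (rule sq_norm_bessel_potential_le) (use s in auto)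
      finally show "sq_norm (\<lambda>x. bessel_potential (h k) x - bessel_potential f x) \<le> sq_norm (\<lambda>x. h k x - f x)" .
    qed
    show "(\<lambda>k. sq_norm (\<lambda>\<xi>. fourier_integral (bessel_potential (h k)) \<xi> - of_real ((1 + (norm \<xi>)\<^sup>2) powr (- 1 / 4)) * g \<xi>)) \<longlonglongrightarrow> 0"
    proof (rule tendsto_zero_le_ennreal[OF h(4)])
      fix k
      show "sq_norm (\<lambda>\<xi>. fourier_integral (bessel_potential (h k)) \<xi> - of_real ((1 + (norm \<xi>)\<^sup>2) powr (- 1 / 4)) * g \<xi>)
          \<le> sq_norm (\<lambda>x. fourier_integral (h k) x - g x)"
        unfolding fourier_integral_bessel_potential[OF h(2)] right_diff_distrib[symmetric] by (rule mle)
    qed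
  qed
qed

lemma has_L2_fourier_cong_AE:
  assumes "has_L2_fourier f g" "AE x in lborel. f x = f' x" "f' \<in> borel_measurable borel"
  shows "has_L2_fourier f' g"
proof -
  have "sq_norm (\<lambda>x. h x - f x) = sq_norm (\<lambda>x. h x - f' x)" for h :: "real ^ 'a \<Rightarrow> complex"
    by (rule sq_norm_cong_AE) (use assms(2) in \<open>auto elim: eventually_mono\<close>)
  moreover have "sq_norm f = sq_norm f'" by (rule sq_norm_cong_AE) (rule assms)
  ultimately show ?thesis using assms unfolding has_L2_fourier_iff by (auto simp: L2_iff)
qed

lemma has_L2_fourier_AE_eq:
  assumes "has_L2_fourier f g" "has_L2_fourier f' g'"
  shows "(AE x in lborel. f x = f' x) \<longleftrightarrow> (AE x in lborel. g x = g' x)"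
proof -
  have [measurable]: "f \<in> borel_measurable borel" "g \<in> borel_measurable borel" "f' \<in> borel_measurable borel" "g' \<in> borel_measurable borel"
    using assms by (auto simp: has_L2_fourier_iff L2_iff)
  show ?thesis using has_L2_fourier_unique[OF assms] by (simp add: sq_norm_eq_0)
qed

lemma of_real_L2_iff:
  fixes f :: "real ^ 'n \<Rightarrow> real"
  shows "(\<lambda>x. complex_of_real (f x)) \<in> L2 \<longleftrightarrow> f \<in> L2"
proof -
  have "f \<in> borel_measurable borel" if "(\<lambda>x. complex_of_real (f x)) \<in> borel_measurable borel"
    using measurable_compose[OF that, of Re borel] by simp
  moreover have "(\<lambda>x. complex_of_real (f x)) \<in> borel_measurable borel" if [measurable]: "f \<in> borel_measurable borel"
    by measurable
  ultimately have "(\<lambda>x. complex_of_real (f x)) \<in> borel_measurable borel \<longleftrightarrow> f \<in> borel_measurable borel"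
    by blast
  moreover have "sq_norm (\<lambda>x. complex_of_real (f x)) = sq_norm f" by (simp add: sq_norm_def)
  ultimately show ?thesis by (simp only: L2_iff)
qed

section \<open>The multiplier of order 1/4 as the inverse of the Bessel potential\<close>

lemma bessel_symbol_cancel:
  "complex_of_real (bessel_symbol (1 / 4) \<xi>) * (of_real ((1 + (norm \<xi>)\<^sup>2) powr (- 1 / 4)) * z) = z"
  "of_real ((1 + (norm \<xi>)\<^sup>2) powr (- 1 / 4)) * (complex_of_real (bessel_symbol (1 / 4) \<xi>) * z) = z"
proof -
  have "1 + (norm \<xi>)\<^sup>2 > 0" by (simp add: add_pos_nonneg)
  then have "bessel_symbol (1 / 4) \<xi> * (1 + (norm \<xi>)\<^sup>2) powr (- 1 / 4) = 1"
    by (simp add: bessel_symbol_def flip: powr_add)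
  then have "complex_of_real (bessel_symbol (1 / 4) \<xi>) * of_real ((1 + (norm \<xi>)\<^sup>2) powr (- 1 / 4)) = 1"
    by (metis of_real_1 of_real_mult)
  then show "complex_of_real (bessel_symbol (1 / 4) \<xi>) * (of_real ((1 + (norm \<xi>)\<^sup>2) powr (- 1 / 4)) * z) = z"
    by (simp only: mult.assoc[symmetric] mult_1_left)
  then show "of_real ((1 + (norm \<xi>)\<^sup>2) powr (- 1 / 4)) * (complex_of_real (bessel_symbol (1 / 4) \<xi>) * z) = z"
    by (simp only: mult.left_commute)
qed

text \<open>On the Fourier side the potential multiplies by the inverse of the symbol, so the symbol
  recovers the transform of f from that of u. Agreement almost everywhere is the right assumption
  since elements of \<open>H_half\<close> are representatives.\<close>

lemma fourier_multiplier_bessel: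
  fixes u f :: "real ^ 'n \<Rightarrow> real"
  assumes f: "f \<in> L2" and u: "u \<in> borel_measurable borel" "AE x in lborel. u x = bessel_potential f x"
  shows "fourier_multiplier (bessel_symbol (1 / 4)) u f"
proof -
  have "(\<lambda>x. complex_of_real (f x)) \<in> L2" using f by (simp add: of_real_L2_iff)
  then obtain g where g: "has_L2_fourier (\<lambda>x. complex_of_real (f x)) g" by (rule has_L2_fourier_exists)
  define g' where "g' \<xi> = of_real ((1 + (norm \<xi>)\<^sup>2) powr (- 1 / 4)) * g \<xi>" for \<xi>
  have "has_L2_fourier (\<lambda>x. complex_of_real (u x)) g'"
    by (rule has_L2_fourier_cong_AE[OF has_L2_fourier_bessel_potential[OF g, folded g'_def]])
      (use u in \<open>auto simp: bessel_potential_of_real elim: eventually_mono\<close>)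
  moreover have "(\<lambda>\<xi>. of_real (bessel_symbol (1 / 4) \<xi>) * g' \<xi>) = g"
    unfolding g'_def bessel_symbol_cancel ..
  ultimately show ?thesis unfolding fourier_multiplier_def using g by (intro exI[of _ g']) simp
qed

lemma fourier_multiplier_bessel_imp:
  fixes u f :: "real ^ 'n \<Rightarrow> real"
  assumes "fourier_multiplier (bessel_symbol (1 / 4)) u f"
  shows "f \<in> L2" "u \<in> L2" "AE x in lborel. u x = bessel_potential f x"
proof -
  obtain g where g: "has_L2_fourier (\<lambda>x. complex_of_real (u x)) g"
    "has_L2_fourier (\<lambda>x. complex_of_real (f x)) (\<lambda>\<xi>. of_real (bessel_symbol (1 / 4) \<xi>) * g \<xi>)"
    using assms by (auto simp: fourier_multiplier_def)
  show "f \<in> L2" "u \<in> L2" using g by (simp_all add: has_L2_fourier_iff of_real_L2_iff)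
  have "has_L2_fourier (bessel_potential (\<lambda>x. complex_of_real (f x))) g"
    using has_L2_fourier_bessel_potential[OF g(2)] unfolding bessel_symbol_cancel .
  from has_L2_fourier_AE_eq[OF g(1) this] show "AE x in lborel. u x = bessel_potential f x"
    by (simp add: bessel_potential_of_real)
qed

text \<open>The transform of the kernel vanishes nowhere, so it can be divided out.\<close>

lemma bessel_potential_injective:
  fixes f f' :: "real ^ 'n \<Rightarrow> real"
  assumes f: "f \<in> L2" "f' \<in> L2" and eq: "AE x in lborel. bessel_potential f x = bessel_potential f' x"
  shows "AE x in lborel. f x = f' x"
proof -
  obtain g where g: "has_L2_fourier (\<lambda>x. complex_of_real (f x)) g"
    using f by (metis of_real_L2_iff has_L2_fourier_exists)
  obtain g' where g': "has_L2_fourier (\<lambda>x. complex_of_real (f' x)) g'"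
    using f by (metis of_real_L2_iff has_L2_fourier_exists)
  have "AE x in lborel. bessel_potential (\<lambda>x. complex_of_real (f x)) x = bessel_potential (\<lambda>x. complex_of_real (f' x)) x"
    using eq by eventually_elim (simp add: bessel_potential_of_real)
  then have "AE \<xi> in lborel. of_real ((1 + (norm \<xi>)\<^sup>2) powr (- 1 / 4)) * g \<xi> = of_real ((1 + (norm \<xi>)\<^sup>2) powr (- 1 / 4)) * g' \<xi>"
    using has_L2_fourier_AE_eq[OF has_L2_fourier_bessel_potential[OF g] has_L2_fourier_bessel_potential[OF g']] by simp
  then have "AE \<xi> in lborel. g \<xi> = g' \<xi>"
    by eventually_elim (metis bessel_symbol_cancel(1))
  then show ?thesis using has_L2_fourier_AE_eq[OF g g'] by simp
qed

lemma H_half_iff: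
  fixes u :: "real ^ 'n \<Rightarrow> real"
  shows "u \<in> H_half \<longleftrightarrow> u \<in> L2 \<and> (\<exists>f\<in>L2. AE x in lborel. u x = bessel_potential f x)"
proof
  assume "u \<in> H_half"
  then obtain f where "fourier_multiplier (bessel_symbol (1 / 4)) u f" unfolding H_half_def by blast
  from fourier_multiplier_bessel_imp[OF this] show "u \<in> L2 \<and> (\<exists>f\<in>L2. AE x in lborel. u x = bessel_potential f x)" by blast
next
  assume "u \<in> L2 \<and> (\<exists>f\<in>L2. AE x in lborel. u x = bessel_potential f x)"
  then obtain f where u: "u \<in> L2" and f: "f \<in> L2" "AE x in lborel. u x = bessel_potential f x" by blast
  have "u \<in> borel_measurable borel" using u by (simp add: L2_iff)
  from fourier_multiplier_bessel[OF f(1) this f(2)] u f(1) show "u \<in> H_half" unfolding H_half_def by blast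
qed

lemma bessel_op_L2_potential:
  fixes u :: "real ^ 'n \<Rightarrow> real"
  assumes "u \<in> H_half"
  shows "bessel_op (1 / 4) u \<in> L2" "AE x in lborel. u x = bessel_potential (bessel_op (1 / 4) u) x"
proof -
  have "fourier_multiplier (bessel_symbol (1 / 4)) u (bessel_op (1 / 4) u)"
  proof -
    obtain f where "fourier_multiplier (bessel_symbol (1 / 4)) u f" using assms unfolding H_half_def by blast
    then show ?thesis unfolding bessel_op_def
      by (rule someI[where P="fourier_multiplier (bessel_symbol (1 / 4)) u"])
  qed
  from fourier_multiplier_bessel_imp[OF this]
  show "bessel_op (1 / 4) u \<in> L2" "AE x in lborel. u x = bessel_potential (bessel_op (1 / 4) u) x" by auto
qed

text \<open>\<open>bessel_op\<close> picks an arbitrary representative; injectivity of the potential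
  fixes that choice up to a null set.\<close>

lemma bessel_op_AE_eq:
  fixes u f :: "real ^ 'n \<Rightarrow> real"
  assumes u: "u \<in> L2" and f: "f \<in> L2" and eq: "AE x in lborel. u x = bessel_potential f x"
  shows "u \<in> H_half" "AE x in lborel. bessel_op (1 / 4) u x = f x"
proof -
  show *: "u \<in> H_half" using assms by (auto simp: H_half_iff)
  show "AE x in lborel. bessel_op (1 / 4) u x = f x"
    by (rule bessel_potential_injective[OF bessel_op_L2_potential(1)[OF *] f])
      (use bessel_op_L2_potential(2)[OF *] eq in eventually_elim, simp)
qed

section \<open>Young's inequality and interaction energies\<close>

text \<open>Concavity of the logarithm: ln r <= r - 1 for the three ratios to the weighted mean S,
  whose weighted right-hand sides sum to 0.\<close>

lemma weighted_AM_GM3: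
  fixes a b c x y z :: real
  assumes w: "0 \<le> a" "0 \<le> b" "0 \<le> c" "a + b + c = 1" and nn: "0 \<le> x" "0 \<le> y" "0 \<le> z"
  shows "x powr a * y powr b * z powr c \<le> a * x + b * y + c * z"
proof (cases "x = 0 \<or> y = 0 \<or> z = 0")
  case True
  then show ?thesis using w nn by auto
next
  case False
  then have p: "x > 0" "y > 0" "z > 0" using nn by auto
  define S where "S = a * x + b * y + c * z"
  have S: "S > 0"
  proof -
    have "a > 0 \<or> b > 0 \<or> c > 0" using w by linarith
    then have "a * x > 0 \<or> b * y > 0 \<or> c * z > 0" using p mult_pos_pos by blast
    moreover have "a * x \<ge> 0" "b * y \<ge> 0" "c * z \<ge> 0" using w nn by auto
    ultimately show ?thesis unfolding S_def by linarith
  qed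
  have "a * ln (x / S) + b * ln (y / S) + c * ln (z / S) \<le> a * (x / S - 1) + b * (y / S - 1) + c * (z / S - 1)"
    using p S w by (intro add_mono mult_left_mono ln_le_minus_one) auto
  also have "\<dots> = (a * x + b * y + c * z) / S - (a + b + c)"
    by (simp add: algebra_simps add_divide_distrib)
  also have "\<dots> = 0" using S w by (simp add: S_def)
  finally have "a * ln (x / S) + b * ln (y / S) + c * ln (z / S) \<le> 0" .
  then have "a * ln x + b * ln y + c * ln z \<le> (a + b + c) * ln S"
    using p S by (simp add: ln_div algebra_simps)
  then have "exp (a * ln x + b * ln y + c * ln z) \<le> exp (ln S)" using w by simp
  then show ?thesis using p S by (simp add: powr_def exp_add S_def)
qed

text \<open>Normalise the three functions by the bounds and integrate the weighted AM-GM inequality.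
  Stating it with bounds rather than with the integrals themselves allows overestimates; if some
  bound is 0, the product vanishes almost everywhere.\<close>

lemma nn_integral_Holder3:
  fixes A B C :: "'a \<Rightarrow> real" and a b c \<alpha> \<beta> \<gamma> :: real
  assumes [measurable]: "A \<in> borel_measurable M" "B \<in> borel_measurable M" "C \<in> borel_measurable M"
    and nn: "\<And>x. 0 \<le> A x" "\<And>x. 0 \<le> B x" "\<And>x. 0 \<le> C x"
    and w: "0 < a" "0 < b" "0 < c" "a + b + c = 1"
    and bd: "(\<integral>\<^sup>+x. ennreal (A x) \<partial>M) \<le> ennreal \<alpha>" "(\<integral>\<^sup>+x. ennreal (B x) \<partial>M) \<le> ennreal \<beta>" "(\<integral>\<^sup>+x. ennreal (C x) \<partial>M) \<le> ennreal \<gamma>"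
    and "0 \<le> \<alpha>" "0 \<le> \<beta>" "0 \<le> \<gamma>"
  shows "(\<integral>\<^sup>+x. ennreal (A x powr a * B x powr b * C x powr c) \<partial>M) \<le> ennreal (\<alpha> powr a * \<beta> powr b * \<gamma> powr c)"
proof (cases "\<alpha> = 0 \<or> \<beta> = 0 \<or> \<gamma> = 0")
  case True
  have zero: "AE x in M. F x = 0" if "(\<integral>\<^sup>+x. ennreal (F x) \<partial>M) \<le> ennreal 0" "\<And>x. F x \<ge> 0" "F \<in> borel_measurable M" for F :: "'a \<Rightarrow> real"
  proof -
    have "AE x in M. ennreal (F x) = 0"
      using that by (subst nn_integral_0_iff_AE[symmetric]) auto
    then show ?thesis using that(2) by (auto elim!: eventually_mono simp: ennreal_eq_0_iff order_antisym)
  qed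
  have "AE x in M. A x = 0 \<or> B x = 0 \<or> C x = 0"
    using True zero[of A] zero[of B] zero[of C] bd nn by (auto elim: eventually_mono)
  then have "(\<integral>\<^sup>+x. ennreal (A x powr a * B x powr b * C x powr c) \<partial>M) = 0"
    by (subst nn_integral_0_iff_AE) (auto elim!: eventually_mono)
  then show ?thesis by simp
next
  case False
  then have p: "\<alpha> > 0" "\<beta> > 0" "\<gamma> > 0" using assms by auto
  define k where "k = \<alpha> powr a * \<beta> powr b * \<gamma> powr c"
  have k: "k > 0" using p by (simp add: k_def)
  have "(\<integral>\<^sup>+x. ennreal (A x powr a * B x powr b * C x powr c) \<partial>M) \<le>
     (\<integral>\<^sup>+x. ennreal (k * a / \<alpha>) * ennreal (A x) + ennreal (k * b / \<beta>) * ennreal (B x) + ennreal (k * c / \<gamma>) * ennreal (C x) \<partial>M)"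
  proof (rule nn_integral_mono)
    fix x
    have "A x powr a * B x powr b * C x powr c = k * ((A x / \<alpha>) powr a * (B x / \<beta>) powr b * (C x / \<gamma>) powr c)"
      using p nn by (simp add: k_def powr_divide)
    also have "\<dots> \<le> k * (a * (A x / \<alpha>) + b * (B x / \<beta>) + c * (C x / \<gamma>))"
      using k p w nn by (intro mult_left_mono weighted_AM_GM3) auto
    also have "\<dots> = (k * a / \<alpha>) * A x + (k * b / \<beta>) * B x + (k * c / \<gamma>) * C x"
      by (simp add: distrib_left)
    finally have "ennreal (A x powr a * B x powr b * C x powr c) \<le> ennreal ((k * a / \<alpha>) * A x + (k * b / \<beta>) * B x + (k * c / \<gamma>) * C x)"
      by (rule ennreal_leI)
    also have "\<dots> = ennreal (k * a / \<alpha>) * ennreal (A x) + ennreal (k * b / \<beta>) * ennreal (B x) + ennreal (k * c / \<gamma>) * ennreal (C x)"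
    proof -
      have n: "0 \<le> k * a / \<alpha>" "0 \<le> k * b / \<beta>" "0 \<le> k * c / \<gamma>" using k p w by auto
      show ?thesis by (simp only: ennreal_plus ennreal_mult' n nn add_nonneg_nonneg mult_nonneg_nonneg)
    qed
    finally show "ennreal (A x powr a * B x powr b * C x powr c) \<le> \<dots>" .
  qed
  also have "\<dots> = ennreal (k * a / \<alpha>) * (\<integral>\<^sup>+x. ennreal (A x) \<partial>M) + ennreal (k * b / \<beta>) * (\<integral>\<^sup>+x. ennreal (B x) \<partial>M) + ennreal (k * c / \<gamma>) * (\<integral>\<^sup>+x. ennreal (C x) \<partial>M)"
    by (simp add: nn_integral_add nn_integral_cmult)
  also have "\<dots> \<le> ennreal (k * a / \<alpha>) * ennreal \<alpha> + ennreal (k * b / \<beta>) * ennreal \<beta> + ennreal (k * c / \<gamma>) * ennreal \<gamma>"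
    by (intro add_mono mult_left_mono bd) auto
  also have "\<dots> = ennreal (k * a + k * b + k * c)"
    using k p w by (simp add: ennreal_mult'[symmetric])
  also have "k * a + k * b + k * c = k" using w(4) by (metis distrib_left mult_1_right)
  finally show ?thesis by (simp add: k_def)
qed

lemma abs_convolution_le:
  fixes K f :: "real ^ 'n \<Rightarrow> real"
  assumes [measurable]: "K \<in> borel_measurable borel" "f \<in> borel_measurable borel" and K: "\<And>x. K x \<ge> 0"
  shows "ennreal \<bar>Defs.convolution K f x\<bar> \<le> (\<integral>\<^sup>+y. ennreal (K (x - y) * \<bar>f y\<bar>) \<partial>lborel)"
proof (cases "integrable lborel (\<lambda>y. K (x - y) * f y)")
  case True
  from integral_norm_bound_ennreal[OF this] show ?thesis
    using K by (simp add: Defs.convolution_def abs_mult)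
qed (simp add: Defs.convolution_def not_integrable_integral_eq)

lemma convolution_measurable [measurable]:
  fixes K f :: "real ^ 'n \<Rightarrow> real"
  assumes [measurable]: "K \<in> borel_measurable borel" "f \<in> borel_measurable borel"
  shows "Defs.convolution K f \<in> borel_measurable borel"
  unfolding Defs.convolution_def[abs_def] by measurable

lemma nn_integral_conv_swap:
  fixes f g :: "'a::euclidean_space \<Rightarrow> ennreal"
  assumes [measurable]: "f \<in> borel_measurable borel" "g \<in> borel_measurable borel"
  shows "(\<integral>\<^sup>+x. (\<integral>\<^sup>+y. f (x - y) * g y \<partial>lborel) \<partial>lborel) = (\<integral>\<^sup>+x. f x \<partial>lborel) * (\<integral>\<^sup>+x. g x \<partial>lborel)"
proof -
  have "(\<integral>\<^sup>+x. (\<integral>\<^sup>+y. f (x - y) * g y \<partial>lborel) \<partial>lborel) = (\<integral>\<^sup>+y. (\<integral>\<^sup>+x. f (x - y) * g y \<partial>lborel) \<partial>lborel)"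
    by (rule lborel_pair.Fubini') measurable
  also have "\<dots> = (\<integral>\<^sup>+y. (\<integral>\<^sup>+x. f x \<partial>lborel) * g y \<partial>lborel)"
    by (simp add: nn_integral_multc nn_integral_translate_diff)
  finally show ?thesis by (simp add: nn_integral_cmult)
qed

text \<open>K |f| is the product of K^r f^2, K^r and f^2 raised to 1/q, 1/2 and 1/2 - 1/q; these
  weights sum to 1, and r(1/q + 1/2) = 1 gives K the right power. After Hoelder and raising to the
  power q, only the integral S of K^r f^2 depends on x, and its integral over x factors.\<close>

lemma young_convolution_L2:
  fixes K f :: "real ^ 'n \<Rightarrow> real" and r q \<kappa> \<phi> :: real
  assumes [measurable]: "K \<in> borel_measurable borel" "f \<in> borel_measurable borel" and K: "\<And>x. K x \<ge> 0"
    and r: "r > 1" and q: "q > 2" and rq: "1 / r = 1 / q + 1 / 2"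
    and bK: "(\<integral>\<^sup>+x. ennreal (K x powr r) \<partial>lborel) \<le> ennreal (\<kappa> powr r)" and \<kappa>: "\<kappa> > 0"
    and bf: "sq_norm f \<le> ennreal (\<phi>\<^sup>2)" and \<phi>: "\<phi> > 0"
  shows "(\<integral>\<^sup>+x. ennreal (\<bar>Defs.convolution K f x\<bar> powr q) \<partial>lborel) \<le> ennreal ((\<kappa> * \<phi>) powr q)"
proof -
  define S where "S x = (\<integral>\<^sup>+y. ennreal (K (x - y) powr r) * ennreal (\<bar>f y\<bar>\<^sup>2) \<partial>lborel)" for x
  have [measurable]: "S \<in> borel_measurable borel" unfolding S_def by measurable
  have f2: "(\<integral>\<^sup>+y. ennreal (\<bar>f y\<bar>\<^sup>2) \<partial>lborel) \<le> ennreal (\<phi>\<^sup>2)" using bf by (simp add: sq_norm_def)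
  have intS: "(\<integral>\<^sup>+x. S x \<partial>lborel) \<le> ennreal (\<kappa> powr r * \<phi>\<^sup>2)"
  proof -
    have "(\<integral>\<^sup>+x. S x \<partial>lborel) = (\<integral>\<^sup>+x. ennreal (K x powr r) \<partial>lborel) * (\<integral>\<^sup>+y. ennreal (\<bar>f y\<bar>\<^sup>2) \<partial>lborel)"
      unfolding S_def by (rule nn_integral_conv_swap) measurable
    also have "\<dots> \<le> ennreal (\<kappa> powr r) * ennreal (\<phi>\<^sup>2)" by (intro mult_mono bK f2) auto
    finally show ?thesis by (simp add: ennreal_mult')
  qed
  have r1: "r * (1 / q + 1 / 2) = 1" using r unfolding rq[symmetric] by simp
  have pw: "ennreal (\<bar>Defs.convolution K f x\<bar> powr q) \<le> ennreal (\<kappa> powr (r * q / 2) * \<phi> powr (q - 2)) * S x" for x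
  proof (cases "S x = \<infinity>")
    case True
    then show ?thesis using \<kappa> \<phi> by (simp add: ennreal_mult_top)
  next
    case False
    define s where "s = enn2real (S x)"
    have s: "S x = ennreal s" "s \<ge> 0" using False by (auto simp: s_def less_top)
    have "ennreal \<bar>Defs.convolution K f x\<bar> \<le> (\<integral>\<^sup>+y. ennreal (K (x - y) * \<bar>f y\<bar>) \<partial>lborel)"
      by (rule abs_convolution_le) (use K in auto)
    also have "\<dots> = (\<integral>\<^sup>+y. ennreal ((K (x - y) powr r * \<bar>f y\<bar>\<^sup>2) powr (1 / q) * (K (x - y) powr r) powr (1 / 2) * (\<bar>f y\<bar>\<^sup>2) powr (1 / 2 - 1 / q)) \<partial>lborel)"
    proof (intro nn_integral_cong arg_cong[where f=ennreal])
      fix y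
      show "K (x - y) * \<bar>f y\<bar> = (K (x - y) powr r * \<bar>f y\<bar>\<^sup>2) powr (1 / q) * (K (x - y) powr r) powr (1 / 2) * (\<bar>f y\<bar>\<^sup>2) powr (1 / 2 - 1 / q)"
      proof (cases "K (x - y) = 0 \<or> f y = 0")
        case False
        then have p: "K (x - y) > 0" "\<bar>f y\<bar> > 0" using K[of "x - y"] by auto
        have f2: "\<bar>f y\<bar>\<^sup>2 = \<bar>f y\<bar> powr 2" using p by simp
        have "(K (x - y) powr r * \<bar>f y\<bar>\<^sup>2) powr (1 / q) * (K (x - y) powr r) powr (1 / 2) * (\<bar>f y\<bar>\<^sup>2) powr (1 / 2 - 1 / q)
           = K (x - y) powr (r * (1 / q) + r * (1 / 2)) * \<bar>f y\<bar> powr (2 * (1 / q) + 2 * (1 / 2 - 1 / q))"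
          unfolding f2 by (simp only: powr_mult powr_powr powr_add powr_ge_zero mult_ac)
        also have "r * (1 / q) + r * (1 / 2) = 1" using r1 by (simp add: distrib_left)
        also have "2 * (1 / q) + 2 * (1 / 2 - 1 / q) = 1" by simp
        finally show ?thesis using p by simp
      qed auto
    qed
    also have "\<dots> \<le> ennreal (s powr (1 / q) * (\<kappa> powr r) powr (1 / 2) * (\<phi>\<^sup>2) powr (1 / 2 - 1 / q))"
    proof (rule nn_integral_Holder3)
      show "(\<integral>\<^sup>+y. ennreal (K (x - y) powr r * \<bar>f y\<bar>\<^sup>2) \<partial>lborel) \<le> ennreal s"
        using s by (simp add: S_def ennreal_mult')
      show "(\<integral>\<^sup>+y. ennreal (K (x - y) powr r) \<partial>lborel) \<le> ennreal (\<kappa> powr r)"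
        using bK nn_integral_reflect[of "\<lambda>z. ennreal (K z powr r)" x] by simp
      show "(\<integral>\<^sup>+y. ennreal (\<bar>f y\<bar>\<^sup>2) \<partial>lborel) \<le> ennreal (\<phi>\<^sup>2)" by (rule f2)
      show "0 < 1 / 2 - 1 / q" "0 < 1 / q" using q by (auto simp: field_simps)
    qed (use s in auto)
    finally have "\<bar>Defs.convolution K f x\<bar> \<le> s powr (1 / q) * (\<kappa> powr r) powr (1 / 2) * (\<phi>\<^sup>2) powr (1 / 2 - 1 / q)"
      by (subst (asm) ennreal_le_iff) auto
    then have "\<bar>Defs.convolution K f x\<bar> powr q \<le> (s powr (1 / q) * (\<kappa> powr r) powr (1 / 2) * (\<phi>\<^sup>2) powr (1 / 2 - 1 / q)) powr q"
      using q by (intro powr_mono2) auto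
    also have "\<dots> = s * \<kappa> powr (r * q / 2) * \<phi> powr (q - 2)"
    proof -
      have "\<phi>\<^sup>2 = \<phi> powr 2" using \<phi> by simp
      moreover have "2 * (1 / 2 - 1 / q) * q = q - 2" using q by (simp add: field_simps)
      moreover have "1 / q * q = 1" using q by simp
      ultimately show ?thesis using s(2) by (simp only: powr_mult powr_powr powr_ge_zero) (simp add: powr_one_gt_zero_iff)
    qed
    finally show ?thesis unfolding s(1)
      by (subst ennreal_mult'[symmetric]) (auto intro!: ennreal_leI simp: mult_ac)
  qed
  have "(\<integral>\<^sup>+x. ennreal (\<bar>Defs.convolution K f x\<bar> powr q) \<partial>lborel) \<le> (\<integral>\<^sup>+x. ennreal (\<kappa> powr (r * q / 2) * \<phi> powr (q - 2)) * S x \<partial>lborel)"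
    by (rule nn_integral_mono) (rule pw)
  also have "\<dots> = ennreal (\<kappa> powr (r * q / 2) * \<phi> powr (q - 2)) * (\<integral>\<^sup>+x. S x \<partial>lborel)"
    by (rule nn_integral_cmult) simp
  also have "\<dots> \<le> ennreal (\<kappa> powr (r * q / 2) * \<phi> powr (q - 2)) * ennreal (\<kappa> powr r * \<phi>\<^sup>2)"
    by (rule mult_left_mono[OF intS]) simp
  also have "\<dots> = ennreal ((\<kappa> powr (r * q / 2) * \<phi> powr (q - 2)) * (\<kappa> powr r * \<phi>\<^sup>2))"
    by (rule ennreal_mult'[symmetric]) simp
  also have "(\<kappa> powr (r * q / 2) * \<phi> powr (q - 2)) * (\<kappa> powr r * \<phi>\<^sup>2) = (\<kappa> powr (r * q / 2) * \<kappa> powr r) * (\<phi> powr (q - 2) * \<phi> powr 2)"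
    using \<phi> by (simp add: mult_ac)
  also have "\<dots> = \<kappa> powr (r * q / 2 + r) * \<phi> powr q" by (simp flip: powr_add)
  also have "r * q / 2 + r = q"
  proof -
    have "r * q / 2 + r = (r * (1 / q + 1 / 2)) * q" using q by (simp add: field_simps)
    then show ?thesis using r1 by simp
  qed
  also have "\<kappa> powr q * \<phi> powr q = (\<kappa> * \<phi>) powr q" by (rule powr_mult[symmetric])
  finally show ?thesis .
qed

section \<open>Interaction energies of nonnegative functions\<close>

definition energy :: "('a::euclidean_space \<Rightarrow> real) \<Rightarrow> ('a \<Rightarrow> real) \<Rightarrow> ('a \<Rightarrow> real) \<Rightarrow> ennreal" where
  "energy K f g = (\<integral>\<^sup>+x. (\<integral>\<^sup>+y. ennreal (K (x - y) * f x * g y) \<partial>lborel) \<partial>lborel)"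

text \<open>Young's inequality for the bilinear form, where 1/\<rho> + 2/s = 2. The integrand splits
  into f(x)^s f(y)^s with weight 1 - 1/\<rho>, and K^\<rho> f(x)^s and K^\<rho> f(y)^s with weight
  1/(2\<rho>) each; all three have factorizing integrals.\<close>

lemma energy_young:
  fixes K f :: "'a::euclidean_space \<Rightarrow> real" and \<rho> s \<kappa> F :: real
  assumes [measurable]: "K \<in> borel_measurable borel" "f \<in> borel_measurable borel"
    and K: "\<And>x. K x \<ge> 0" and f: "\<And>x. f x \<ge> 0"
    and \<rho>: "\<rho> > 1" and s: "s * (1 - 1 / (2 * \<rho>)) = 1"
    and bK: "(\<integral>\<^sup>+x. ennreal (K x powr \<rho>) \<partial>lborel) \<le> ennreal (\<kappa> powr \<rho>)" and \<kappa>: "\<kappa> > 0"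
    and bf: "(\<integral>\<^sup>+x. ennreal (f x powr s) \<partial>lborel) \<le> ennreal (F powr s)" and F: "F > 0"
  shows "energy K f f \<le> ennreal (\<kappa> * F\<^sup>2)"
proof -
  define a where "a = 1 - 1 / \<rho>"
  define b where "b = 1 / (2 * \<rho>)"
  have ab: "a > 0" "b > 0" "a + b + b = 1" using \<rho> by (auto simp: a_def b_def field_simps)
  have sab: "s * a + s * b = 1" using s \<rho> by (simp add: a_def b_def field_simps)
  have rb: "\<rho> * b + \<rho> * b = 1" using \<rho> by (simp add: b_def)
  have "energy K f f = (\<integral>\<^sup>+z. ennreal (K (fst z - snd z) * f (fst z) * f (snd z)) \<partial>(lborel \<Otimes>\<^sub>M lborel))"
    unfolding energy_def by (subst lborel.nn_integral_fst[symmetric]) auto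
  also have "\<dots> = (\<integral>\<^sup>+z. ennreal ((f (fst z) powr s * f (snd z) powr s) powr a * (K (fst z - snd z) powr \<rho> * f (fst z) powr s) powr b
      * (K (fst z - snd z) powr \<rho> * f (snd z) powr s) powr b) \<partial>(lborel \<Otimes>\<^sub>M lborel))"
  proof (intro nn_integral_cong arg_cong[where f=ennreal])
    fix z :: "'a \<times> 'a"
    have "(f (fst z) powr s * f (snd z) powr s) powr a * (K (fst z - snd z) powr \<rho> * f (fst z) powr s) powr b
      * (K (fst z - snd z) powr \<rho> * f (snd z) powr s) powr b = K (fst z - snd z) powr (\<rho> * b + \<rho> * b) * f (fst z) powr (s * a + s * b) * f (snd z) powr (s * a + s * b)"
      by (simp only: powr_mult powr_powr powr_add powr_ge_zero mult_ac)
    then show "K (fst z - snd z) * f (fst z) * f (snd z) = (f (fst z) powr s * f (snd z) powr s) powr a * (K (fst z - snd z) powr \<rho> * f (fst z) powr s) powr b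
      * (K (fst z - snd z) powr \<rho> * f (snd z) powr s) powr b"
      unfolding sab rb using K f by (simp add: powr_one)
  qed
  also have "\<dots> \<le> ennreal ((F powr s * F powr s) powr a * (\<kappa> powr \<rho> * F powr s) powr b * (\<kappa> powr \<rho> * F powr s) powr b)"
  proof (rule nn_integral_Holder3)
    have "(\<integral>\<^sup>+z. ennreal (f (fst z) powr s * f (snd z) powr s) \<partial>(lborel \<Otimes>\<^sub>M lborel)) =
        (\<integral>\<^sup>+x. (\<integral>\<^sup>+y. ennreal (f x powr s) * ennreal (f y powr s) \<partial>lborel) \<partial>lborel)"
      by (subst lborel.nn_integral_fst[symmetric]) (auto simp: ennreal_mult')
    also have "\<dots> = (\<integral>\<^sup>+x. ennreal (f x powr s) \<partial>lborel) * (\<integral>\<^sup>+x. ennreal (f x powr s) \<partial>lborel)"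
      by (simp add: nn_integral_cmult nn_integral_multc)
    also have "\<dots> \<le> ennreal (F powr s) * ennreal (F powr s)" by (intro mult_mono bf) auto
    finally show "(\<integral>\<^sup>+z. ennreal (f (fst z) powr s * f (snd z) powr s) \<partial>(lborel \<Otimes>\<^sub>M lborel)) \<le> ennreal (F powr s * F powr s)"
      by (simp add: ennreal_mult')
    have "(\<integral>\<^sup>+z. ennreal (K (fst z - snd z) powr \<rho> * f (snd z) powr s) \<partial>(lborel \<Otimes>\<^sub>M lborel)) =
        (\<integral>\<^sup>+x. (\<integral>\<^sup>+y. ennreal (K (x - y) powr \<rho>) * ennreal (f y powr s) \<partial>lborel) \<partial>lborel)"
      by (subst lborel.nn_integral_fst[symmetric]) (auto simp: ennreal_mult')
    also have "\<dots> = (\<integral>\<^sup>+x. ennreal (K x powr \<rho>) \<partial>lborel) * (\<integral>\<^sup>+x. ennreal (f x powr s) \<partial>lborel)"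
      by (rule nn_integral_conv_swap) measurable
    also have "\<dots> \<le> ennreal (\<kappa> powr \<rho>) * ennreal (F powr s)" by (intro mult_mono bf bK) auto
    finally show "(\<integral>\<^sup>+z. ennreal (K (fst z - snd z) powr \<rho> * f (snd z) powr s) \<partial>(lborel \<Otimes>\<^sub>M lborel)) \<le> ennreal (\<kappa> powr \<rho> * F powr s)"
      by (simp add: ennreal_mult')
    have "(\<integral>\<^sup>+z. ennreal (K (fst z - snd z) powr \<rho> * f (fst z) powr s) \<partial>(lborel \<Otimes>\<^sub>M lborel)) =
        (\<integral>\<^sup>+x. (\<integral>\<^sup>+y. ennreal (K (x - y) powr \<rho>) * ennreal (f x powr s) \<partial>lborel) \<partial>lborel)"
      by (subst lborel.nn_integral_fst[symmetric]) (auto simp: ennreal_mult')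
    also have "\<dots> = (\<integral>\<^sup>+x. ennreal (K x powr \<rho>) \<partial>lborel) * (\<integral>\<^sup>+x. ennreal (f x powr s) \<partial>lborel)"
      by (simp add: nn_integral_cmult nn_integral_multc nn_integral_reflect[of "\<lambda>z. ennreal (K z powr \<rho>)"])
    also have "\<dots> \<le> ennreal (\<kappa> powr \<rho>) * ennreal (F powr s)" by (intro mult_mono bf bK) auto
    finally show "(\<integral>\<^sup>+z. ennreal (K (fst z - snd z) powr \<rho> * f (fst z) powr s) \<partial>(lborel \<Otimes>\<^sub>M lborel)) \<le> ennreal (\<kappa> powr \<rho> * F powr s)"
      by (simp add: ennreal_mult')
  qed (use ab in auto)
  also have "(F powr s * F powr s) powr a * (\<kappa> powr \<rho> * F powr s) powr b * (\<kappa> powr \<rho> * F powr s) powr b =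
     \<kappa> powr (\<rho> * b + \<rho> * b) * F powr (s * a + s * b) * F powr (s * a + s * b)"
    by (simp only: powr_mult powr_powr powr_add powr_ge_zero mult_ac)
  also have "\<dots> = \<kappa> * F\<^sup>2" unfolding sab rb using \<kappa> F by (simp add: power2_eq_square)
  finally show ?thesis .
qed

lemma energy_mono:
  assumes "\<And>x. K x \<ge> 0" "\<And>x. 0 \<le> f x" "\<And>x. f x \<le> f' x" "\<And>x. 0 \<le> g x" "\<And>x. g x \<le> g' x"
  shows "energy K f g \<le> energy K f' g'"
  unfolding energy_def
proof (intro nn_integral_mono ennreal_leI)
  fix x y
  have "0 \<le> f' x" using assms(2,3) order_trans by blast
  then show "K (x - y) * f x * g y \<le> K (x - y) * f' x * g' y"
    using assms by (intro mult_mono) auto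
qed

lemma energy_commute:
  fixes K :: "'a::euclidean_space \<Rightarrow> real"
  assumes [measurable]: "K \<in> borel_measurable borel" "f \<in> borel_measurable borel" "g \<in> borel_measurable borel"
    and even: "\<And>x. K (- x) = K x"
  shows "energy K f g = energy K g f"
proof -
  have "energy K f g = (\<integral>\<^sup>+y. (\<integral>\<^sup>+x. ennreal (K (x - y) * f x * g y) \<partial>lborel) \<partial>lborel)"
    unfolding energy_def by (rule lborel_pair.Fubini') measurable
  also have "\<dots> = energy K g f"
    unfolding energy_def
  proof (intro nn_integral_cong)
    fix x y
    have "K (y - x) = K (x - y)" using even[of "x - y"] by simp
    then show "ennreal (K (y - x) * f y * g x) = ennreal (K (x - y) * g x * f y)" by (simp add: mult_ac)
  qed
  finally show ?thesis .
qed

lemma energy_scale_right: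
  fixes K :: "'a::euclidean_space \<Rightarrow> real"
  assumes [measurable]: "K \<in> borel_measurable borel" "f \<in> borel_measurable borel" "g \<in> borel_measurable borel" and c: "c \<ge> 0"
  shows "energy K f (\<lambda>x. c * g x) = ennreal c * energy K f g"
proof -
  have "ennreal (K (x - y) * f x * (c * g y)) = ennreal c * ennreal (K (x - y) * f x * g y)" for x y
    using c by (simp add: ennreal_mult'[symmetric] mult_ac)
  then show ?thesis by (simp add: energy_def nn_integral_cmult)
qed

lemma energy_scale_left:
  fixes K :: "'a::euclidean_space \<Rightarrow> real"
  assumes [measurable]: "K \<in> borel_measurable borel" "f \<in> borel_measurable borel" "g \<in> borel_measurable borel" and c: "c \<ge> 0"
  shows "energy K (\<lambda>x. c * f x) g = ennreal c * energy K f g"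
proof -
  have "ennreal (K (x - y) * (c * f x) * g y) = ennreal c * ennreal (K (x - y) * f x * g y)" for x y
    using c by (simp add: ennreal_mult'[symmetric] mult_ac)
  then show ?thesis by (simp add: energy_def nn_integral_cmult)
qed

lemma energy_scale2:
  fixes K :: "'a::euclidean_space \<Rightarrow> real"
  assumes [measurable]: "K \<in> borel_measurable borel" "f \<in> borel_measurable borel" "g \<in> borel_measurable borel"
    and "c \<ge> 0" "d \<ge> 0"
  shows "energy K (\<lambda>x. c * f x) (\<lambda>x. d * g x) = ennreal c * (ennreal d * energy K f g)"
  using assms(4,5) by (subst energy_scale_left) (auto simp: energy_scale_right)

lemma energy_add_right:
  fixes K :: "'a::euclidean_space \<Rightarrow> real"
  assumes [measurable]: "K \<in> borel_measurable borel" "f \<in> borel_measurable borel" "g \<in> borel_measurable borel" "h \<in> borel_measurable borel"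
    and nn: "\<And>x. K x \<ge> 0" "\<And>x. f x \<ge> 0" "\<And>x. g x \<ge> 0" "\<And>x. h x \<ge> 0"
  shows "energy K f (\<lambda>x. g x + h x) = energy K f g + energy K f h"
proof -
  have "ennreal (K (x - y) * f x * (g y + h y)) = ennreal (K (x - y) * f x * g y) + ennreal (K (x - y) * f x * h y)" for x y
    using nn by (simp add: ennreal_plus[symmetric] distrib_left del: ennreal_plus)
  then show ?thesis by (simp add: energy_def nn_integral_add)
qed

lemma energy_add_left:
  fixes K :: "'a::euclidean_space \<Rightarrow> real"
  assumes [measurable]: "K \<in> borel_measurable borel" "f \<in> borel_measurable borel" "g \<in> borel_measurable borel" "h \<in> borel_measurable borel"
    and nn: "\<And>x. K x \<ge> 0" "\<And>x. f x \<ge> 0" "\<And>x. g x \<ge> 0" "\<And>x. h x \<ge> 0"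
  shows "energy K (\<lambda>x. g x + h x) f = energy K g f + energy K h f"
proof -
  have "ennreal (K (x - y) * (g x + h x) * f y) = ennreal (K (x - y) * g x * f y) + ennreal (K (x - y) * h x * f y)" for x y
    using nn by (simp add: ennreal_plus[symmetric] distrib_left distrib_right del: ennreal_plus)
  then show ?thesis by (simp add: energy_def nn_integral_add)
qed

text \<open>The last clause is positivity of \<open>energy K h h\<close> for \<open>h = f - g\<close>, written without subtraction since
  \<open>energy\<close> truncates negative integrands to \<open>0\<close>.\<close>

definition positive_definite_kernel :: "('a::euclidean_space \<Rightarrow> real) \<Rightarrow> bool" where
  "positive_definite_kernel K \<longleftrightarrow> K \<in> borel_measurable borel \<and> (\<forall>x. K x \<ge> 0) \<and> (\<forall>x. K (- x) = K x) \<and>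
     (\<forall>f g. f \<in> borel_measurable borel \<longrightarrow> g \<in> borel_measurable borel \<longrightarrow> (\<forall>x. f x \<ge> 0) \<longrightarrow> (\<forall>x. g x \<ge> 0) \<longrightarrow>
       2 * energy K f g \<le> energy K f f + energy K g g)"

text \<open>Cauchy-Schwarz, from the inequality 2 E(f, g) <= E(f, f) + E(g, g) applied to f/a and
  g/b.\<close>

lemma energy_cross_le:
  fixes K :: "'a::euclidean_space \<Rightarrow> real"
  assumes pd: "positive_definite_kernel K"
    and [measurable]: "f \<in> borel_measurable borel" "g \<in> borel_measurable borel"
    and nn: "\<And>x. f x \<ge> 0" "\<And>x. g x \<ge> 0"
    and ef: "energy K f f \<le> ennreal (a\<^sup>2)" and eg: "energy K g g \<le> ennreal (b\<^sup>2)" and ab: "a > 0" "b > 0"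
  shows "energy K f g \<le> ennreal (a * b)"
proof -
  have [measurable]: "K \<in> borel_measurable borel" using pd by (simp add: positive_definite_kernel_def)
  define f' where "f' x = (1 / a) * f x" for x
  define g' where "g' x = (1 / b) * g x" for x
  have [measurable]: "f' \<in> borel_measurable borel" "g' \<in> borel_measurable borel" unfolding f'_def g'_def by measurable
  have "energy K f' f' = ennreal (1 / a) * (ennreal (1 / a) * energy K f f)"
    unfolding f'_def[abs_def] by (rule energy_scale2) (use ab in auto)
  also have "\<dots> \<le> ennreal (1 / a) * (ennreal (1 / a) * ennreal (a\<^sup>2))" by (intro mult_left_mono ef) auto
  also have "\<dots> = 1" using ab by (simp add: ennreal_mult'[symmetric] power2_eq_square)
  finally have 1: "energy K f' f' \<le> 1" .
  have "energy K g' g' = ennreal (1 / b) * (ennreal (1 / b) * energy K g g)"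
    unfolding g'_def[abs_def] by (rule energy_scale2) (use ab in auto)
  also have "\<dots> \<le> ennreal (1 / b) * (ennreal (1 / b) * ennreal (b\<^sup>2))" by (intro mult_left_mono eg) auto
  also have "\<dots> = 1" using ab by (simp add: ennreal_mult'[symmetric] power2_eq_square)
  finally have 2: "energy K g' g' \<le> 1" .
  have "2 * energy K f' g' \<le> energy K f' f' + energy K g' g'"
    using pd nn ab unfolding positive_definite_kernel_def by (auto simp: f'_def g'_def)
  also have "\<dots> \<le> 1 + 1" by (intro add_mono 1 2)
  also have "1 + 1 = 2 * (1 :: ennreal)" by simp
  finally have 3: "energy K f' g' \<le> 1"
    by (subst (asm) ennreal_mult_le_mult_iff) auto
  have "energy K f g = energy K (\<lambda>x. a * f' x) (\<lambda>x. b * g' x)"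
    using ab by (simp add: f'_def g'_def)
  also have "\<dots> = ennreal a * (ennreal b * energy K f' g')"
    by (rule energy_scale2) (use ab in auto)
  also have "\<dots> \<le> ennreal a * (ennreal b * 1)" by (intro mult_left_mono 3) auto
  finally show ?thesis using ab by (simp add: ennreal_mult')
qed

lemma powr_mult_tangent:
  fixes p s t :: real
  assumes p: "p > 1" and "s \<ge> 0" "t \<ge> 0"
  shows "s powr (p - 1) * t \<le> (p - 1) / p * s powr p + 1 / p * t powr p"
proof (cases "s = 0 \<or> t = 0")
  case True
  then show ?thesis using p assms by auto
next
  case False
  then have st: "s > 0" "t > 0" using assms by auto
  have "(s powr p) powr ((p - 1) / p) * (t powr p) powr (1 / p) \<le> (p - 1) / p * s powr p + 1 / p * t powr p"
    by (rule Youngs_inequality_0) (use p st in \<open>auto simp: field_simps\<close>)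
  then show ?thesis using p st by (simp add: powr_powr)
qed

text \<open>Young's inequality in the form of a tangent line at the mean m, averaged over the two
  points with weights a and b.\<close>

lemma powr_convex_combination:
  fixes p s t a b :: real
  assumes p: "p > 1" and st: "s \<ge> 0" "t \<ge> 0" and ab: "a \<ge> 0" "b \<ge> 0" "a + b = 1"
  shows "(a * s + b * t) powr p \<le> a * s powr p + b * t powr p"
proof (cases "a * s + b * t = 0")
  case True
  then show ?thesis using ab by simp
next
  case False
  define m where "m = a * s + b * t"
  have "m \<ge> 0" using st ab by (simp add: m_def)
  then have m: "m > 0" using False by (simp add: m_def)
  have gen: "a * (k * M + l * S) + b * (k * M + l * T) = (a + b) * (k * M) + l * (a * S + b * T)" for k l M S T :: real
    by (simp add: algebra_simps)
  have "a * (m powr (p - 1) * s) + b * (m powr (p - 1) * t) \<le>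
      a * ((p - 1) / p * m powr p + 1 / p * s powr p) + b * ((p - 1) / p * m powr p + 1 / p * t powr p)"
    using powr_mult_tangent[OF p] m st ab by (intro add_mono mult_left_mono) auto
  also have "\<dots> = (a + b) * ((p - 1) / p * m powr p) + 1 / p * (a * s powr p + b * t powr p)"
    by (rule gen)
  also have "a * (m powr (p - 1) * s) + b * (m powr (p - 1) * t) = m powr (p - 1) * m"
    by (simp add: m_def algebra_simps)
  also have "m powr (p - 1) * m = m powr p" using m by (simp add: powr_diff)
  finally have "m powr p \<le> (p - 1) / p * m powr p + 1 / p * (a * s powr p + b * t powr p)" using ab by simp
  moreover have "(p - 1) / p * m powr p = m powr p - m powr p / p" using p by (simp add: field_simps)
  ultimately have "m powr p / p \<le> (a * s powr p + b * t powr p) / p" by simp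
  then show ?thesis using p by (simp add: m_def divide_le_cancel)
qed

lemma powr_double: "x powr (2 * p) = (x powr p)\<^sup>2" for x :: real
  by (simp only: power2_eq_square mult_2 powr_add)

text \<open>Cauchy-Schwarz on the stated pair would call for the energy of |u|^(p-1) |v|, which is
  not given. Young's inequality for |u|/U and |v|/V bounds this product pointwise by multiples of
  |u|^p and |v|^p; then Cauchy-Schwarz is applied only to these powers, and the scales U and V
  balance the two terms.\<close>

lemma energy_holder:
  fixes K u v :: "'a::euclidean_space \<Rightarrow> real"
  assumes pd: "positive_definite_kernel K" and p: "p > 1"
    and [measurable]: "u \<in> borel_measurable borel" "v \<in> borel_measurable borel"
    and eu: "energy K (\<lambda>x. \<bar>u x\<bar> powr p) (\<lambda>x. \<bar>u x\<bar> powr p) \<le> ennreal (U powr (2 * p))"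
    and ev: "energy K (\<lambda>x. \<bar>v x\<bar> powr p) (\<lambda>x. \<bar>v x\<bar> powr p) \<le> ennreal (V powr (2 * p))"
    and UV: "U > 0" "V > 0"
  shows "energy K (\<lambda>x. \<bar>u x\<bar> powr p) (\<lambda>x. \<bar>u x\<bar> powr (p - 1) * \<bar>v x\<bar>) \<le> ennreal (U powr (2 * p - 1) * V)"
proof -
  have [measurable]: "K \<in> borel_measurable borel" and K: "\<And>x. K x \<ge> 0" using pd by (auto simp: positive_definite_kernel_def)
  define c1 where "c1 = (p - 1) / p * (V / U)"
  define c2 where "c2 = 1 / p * (U powr (p - 1) * V powr (1 - p))"
  have c: "c1 \<ge> 0" "c2 \<ge> 0" using p UV by (auto simp: c1_def c2_def)
  have pw: "\<bar>u x\<bar> powr (p - 1) * \<bar>v x\<bar> \<le> c1 * \<bar>u x\<bar> powr p + c2 * \<bar>v x\<bar> powr p" for x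
  proof -
    have "\<bar>u x\<bar> powr (p - 1) * \<bar>v x\<bar> = (U powr (p - 1) * V) * ((\<bar>u x\<bar> / U) powr (p - 1) * (\<bar>v x\<bar> / V))"
      using UV by (simp add: powr_divide)
    also have "\<dots> \<le> (U powr (p - 1) * V) * ((p - 1) / p * (\<bar>u x\<bar> / U) powr p + 1 / p * (\<bar>v x\<bar> / V) powr p)"
      using UV p by (intro mult_left_mono powr_mult_tangent) auto
    also have "\<dots> = (U powr (p - 1) / U powr p * V) * ((p - 1) / p) * \<bar>u x\<bar> powr p + (U powr (p - 1) * (V / V powr p)) * (1 / p) * \<bar>v x\<bar> powr p"
    proof -
      have gen: "(A * D) * (k * (X / B) + l * (Y / C)) = (A / B * D) * k * X + (A * (D / C)) * l * Y" for A B C D X Y k l :: real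
        by (simp add: distrib_left)
      have e: "(\<bar>u x\<bar> / U) powr p = \<bar>u x\<bar> powr p / U powr p" "(\<bar>v x\<bar> / V) powr p = \<bar>v x\<bar> powr p / V powr p"
        using UV by (simp_all add: powr_divide)
      show ?thesis unfolding e by (rule gen)
    qed
    also have "U powr (p - 1) / U powr p = 1 / U" using UV by (simp add: powr_diff)
    also have "V / V powr p = V powr (1 - p)" using UV by (simp add: powr_diff)
    finally show ?thesis by (simp add: c1_def c2_def mult_ac)
  qed
  have cross: "energy K (\<lambda>x. \<bar>u x\<bar> powr p) (\<lambda>x. \<bar>v x\<bar> powr p) \<le> ennreal (U powr p * V powr p)"
    by (rule energy_cross_le[OF pd]) (use eu ev UV in \<open>auto simp: powr_double\<close>)
  have "energy K (\<lambda>x. \<bar>u x\<bar> powr p) (\<lambda>x. \<bar>u x\<bar> powr (p - 1) * \<bar>v x\<bar>) \<le>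
     energy K (\<lambda>x. \<bar>u x\<bar> powr p) (\<lambda>x. c1 * \<bar>u x\<bar> powr p + c2 * \<bar>v x\<bar> powr p)"
    by (rule energy_mono) (use K pw in auto)
  also have "\<dots> = ennreal c1 * energy K (\<lambda>x. \<bar>u x\<bar> powr p) (\<lambda>x. \<bar>u x\<bar> powr p) + ennreal c2 * energy K (\<lambda>x. \<bar>u x\<bar> powr p) (\<lambda>x. \<bar>v x\<bar> powr p)"
    using c K by (subst energy_add_right) (auto simp: energy_scale_right)
  also have "\<dots> \<le> ennreal c1 * ennreal (U powr (2 * p)) + ennreal c2 * ennreal (U powr p * V powr p)"
    by (intro add_mono mult_left_mono eu cross) auto
  also have "\<dots> = ennreal (c1 * U powr (2 * p) + c2 * (U powr p * V powr p))"
    using c by (simp add: ennreal_mult'[symmetric] flip: ennreal_plus)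
  also have "c1 * U powr (2 * p) + c2 * (U powr p * V powr p) = U powr (2 * p - 1) * V"
  proof -
    have 1: "U powr (2 * p) / U = U powr (2 * p - 1)" using UV by (simp add: powr_diff)
    have 2: "U powr (p - 1) * U powr p = U powr (2 * p - 1)"
      unfolding powr_add[symmetric] by (rule arg_cong[where f="\<lambda>a. U powr a"]) simp
    have 3: "V powr (1 - p) * V powr p = V" unfolding powr_add[symmetric] using UV by simp
    have "c1 * U powr (2 * p) + c2 * (U powr p * V powr p) = (p - 1) / p * (V * (U powr (2 * p) / U)) + 1 / p * ((U powr (p - 1) * U powr p) * (V powr (1 - p) * V powr p))"
      by (simp add: c1_def c2_def mult_ac)
    also have "\<dots> = ((p - 1) / p + 1 / p) * (U powr (2 * p - 1) * V)"
      unfolding 1 2 3 by (simp only: distrib_right mult.commute[of V "U powr (2 * p - 1)"])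
    also have "(p - 1) / p + 1 / p = 1" using p by (simp add: field_simps)
    finally show ?thesis by simp
  qed
  finally show ?thesis .
qed

text \<open>Minkowski's inequality for the energy. Convexity of the p-th power with weights U/(U+V)
  and V/(U+V) bounds |u+v|^p by c1 |u|^p + c2 |v|^p; expanding the form and using Cauchy-Schwarz on
  the mixed terms gives a perfect square.\<close>

lemma energy_triangle:
  fixes K u v :: "'a::euclidean_space \<Rightarrow> real"
  assumes pd: "positive_definite_kernel K" and p: "p > 1"
    and [measurable]: "u \<in> borel_measurable borel" "v \<in> borel_measurable borel"
    and eu: "energy K (\<lambda>x. \<bar>u x\<bar> powr p) (\<lambda>x. \<bar>u x\<bar> powr p) \<le> ennreal (U powr (2 * p))"
    and ev: "energy K (\<lambda>x. \<bar>v x\<bar> powr p) (\<lambda>x. \<bar>v x\<bar> powr p) \<le> ennreal (V powr (2 * p))"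
    and UV: "U > 0" "V > 0"
  shows "energy K (\<lambda>x. \<bar>u x + v x\<bar> powr p) (\<lambda>x. \<bar>u x + v x\<bar> powr p) \<le> ennreal ((U + V) powr (2 * p))"
proof -
  have [measurable]: "K \<in> borel_measurable borel" and K: "\<And>x. K x \<ge> 0" and even: "\<And>x. K (- x) = K x"
    using pd by (auto simp: positive_definite_kernel_def)
  define c1 where "c1 = (U + V) powr p * (U / (U + V)) / U powr p"
  define c2 where "c2 = (U + V) powr p * (V / (U + V)) / V powr p"
  have c: "c1 \<ge> 0" "c2 \<ge> 0" using UV by (auto simp: c1_def c2_def)
  have pw: "\<bar>u x + v x\<bar> powr p \<le> c1 * \<bar>u x\<bar> powr p + c2 * \<bar>v x\<bar> powr p" for x
  proof -
    have "\<bar>u x + v x\<bar> powr p \<le> (\<bar>u x\<bar> + \<bar>v x\<bar>) powr p" using p by (intro powr_mono2) auto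
    also have "\<bar>u x\<bar> + \<bar>v x\<bar> = (U + V) * ((U / (U + V)) * (\<bar>u x\<bar> / U) + (V / (U + V)) * (\<bar>v x\<bar> / V))"
      using UV by (simp add: distrib_left)
    also have "\<dots> powr p = (U + V) powr p * ((U / (U + V)) * (\<bar>u x\<bar> / U) + (V / (U + V)) * (\<bar>v x\<bar> / V)) powr p"
      by (rule powr_mult)
    also have "\<dots> \<le> (U + V) powr p * ((U / (U + V)) * (\<bar>u x\<bar> / U) powr p + (V / (U + V)) * (\<bar>v x\<bar> / V) powr p)"
      using UV by (intro mult_left_mono powr_convex_combination p) (auto simp: add_divide_distrib[symmetric])
    finally show ?thesis using UV by (simp add: c1_def c2_def powr_divide distrib_left mult_ac)
  qed
  define a where "a x = \<bar>u x\<bar> powr p" for x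
  define b where "b x = \<bar>v x\<bar> powr p" for x
  have [measurable]: "a \<in> borel_measurable borel" "b \<in> borel_measurable borel" unfolding a_def b_def by measurable
  have ab: "a x \<ge> 0" "b x \<ge> 0" for x by (auto simp: a_def b_def)
  have cross: "energy K a b \<le> ennreal (U powr p * V powr p)"
    by (rule energy_cross_le[OF pd]) (use eu ev UV ab in \<open>auto simp: powr_double a_def[abs_def] b_def[abs_def]\<close>)
  have cross': "energy K b a \<le> ennreal (U powr p * V powr p)"
    using cross energy_commute[of K a b] even by simp
  have ea: "energy K a a \<le> ennreal (U powr p * U powr p)" and eb: "energy K b b \<le> ennreal (V powr p * V powr p)"
    using eu ev by (simp_all add: a_def[abs_def] b_def[abs_def] powr_double power2_eq_square)
  have "energy K (\<lambda>x. \<bar>u x + v x\<bar> powr p) (\<lambda>x. \<bar>u x + v x\<bar> powr p) \<le>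
     energy K (\<lambda>x. c1 * a x + c2 * b x) (\<lambda>x. c1 * a x + c2 * b x)"
    by (rule energy_mono) (use K pw in \<open>auto simp: a_def b_def\<close>)
  also have "\<dots> = (ennreal c1 * (ennreal c1 * energy K a a + ennreal c2 * energy K a b)) + (ennreal c2 * (ennreal c1 * energy K b a + ennreal c2 * energy K b b))"
  proof -
    have r: "energy K f (\<lambda>x. c1 * a x + c2 * b x) = ennreal c1 * energy K f a + ennreal c2 * energy K f b"
      if [measurable]: "f \<in> borel_measurable borel" and "\<And>x. f x \<ge> 0" for f
      using c K ab that(2) by (subst energy_add_right) (auto simp: energy_scale_right)
    have l: "energy K (\<lambda>x. c1 * a x + c2 * b x) f = ennreal c1 * energy K a f + ennreal c2 * energy K b f"
      if [measurable]: "f \<in> borel_measurable borel" and "\<And>x. f x \<ge> 0" for f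
      using c K ab that(2) by (subst energy_add_left) (auto simp: energy_scale_left)
    show ?thesis using c ab by (subst l) (auto simp: r)
  qed
  also have "\<dots> \<le> (ennreal c1 * (ennreal c1 * ennreal (U powr p * U powr p) + ennreal c2 * ennreal (U powr p * V powr p))) + (ennreal c2 * (ennreal c1 * ennreal (U powr p * V powr p) + ennreal c2 * ennreal (V powr p * V powr p)))"
    by (intro add_mono mult_left_mono ea eb cross cross') auto
  also have "\<dots> = ennreal ((c1 * (c1 * (U powr p * U powr p) + c2 * (U powr p * V powr p))) + (c2 * (c1 * (U powr p * V powr p) + c2 * (V powr p * V powr p))))"
    using c by (simp add: ennreal_mult'[symmetric] flip: ennreal_plus)
  also have "(c1 * (c1 * (U powr p * U powr p) + c2 * (U powr p * V powr p))) + (c2 * (c1 * (U powr p * V powr p) + c2 * (V powr p * V powr p))) = (c1 * U powr p + c2 * V powr p)\<^sup>2"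
    by (simp add: power2_eq_square algebra_simps)
  also have "c1 * U powr p + c2 * V powr p = (U + V) powr p * (U / (U + V) + V / (U + V))"
    using UV by (simp add: c1_def c2_def distrib_left)
  also have "U / (U + V) + V / (U + V) = 1" using UV by (simp add: add_divide_distrib[symmetric])
  finally show ?thesis by (simp add: powr_double)
qed

section \<open>The Riesz energy\<close>

text \<open>The type argument carries the dimension, since no vector remains once the power of the
  norm is split off.\<close>

definition riesz_const :: "real \<Rightarrow> 'n::finite itself \<Rightarrow> real" where
  "riesz_const \<alpha> _ = Gamma ((real CARD('n) - \<alpha>) / 2) / (2 powr \<alpha> * pi powr (real CARD('n) / 2) * Gamma (\<alpha> / 2))"

lemma riesz_potential_eq:
  "riesz_potential \<alpha> (x :: real ^ 'n) = riesz_const \<alpha> TYPE('n) * norm x powr (- (real CARD('n) - \<alpha>))"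
  unfolding riesz_potential_def riesz_const_def by (simp only: powr_minus_divide times_divide_times_eq mult_1_right divide_divide_eq_left)

lemma riesz_const_pos:
  assumes "0 < \<alpha>" "\<alpha> < real CARD('n)"
  shows "riesz_const \<alpha> TYPE('n::finite) > 0"
  unfolding riesz_const_def using assms by (auto intro!: divide_pos_pos mult_pos_pos Gamma_real_pos)

lemma riesz_potential_measurable [measurable]:
  "(riesz_potential \<alpha> :: real ^ 'n \<Rightarrow> real) \<in> borel_measurable borel"
  unfolding riesz_potential_def[abs_def] by measurable

lemma riesz_potential_nonneg:
  assumes "0 < \<alpha>" "\<alpha> < real CARD('n)"
  shows "riesz_potential \<alpha> (x :: real ^ 'n) \<ge> 0"
  unfolding riesz_potential_eq using riesz_const_pos[OF assms] by simp

lemma riesz_potential_pos: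
  assumes "0 < \<alpha>" "\<alpha> < real CARD('n)" "x \<noteq> 0"
  shows "riesz_potential \<alpha> (x :: real ^ 'n) > 0"
  unfolding riesz_potential_eq using riesz_const_pos[OF assms(1,2)] assms(3) by simp

lemma riesz_potential_cong:
  fixes x y :: "real ^ 'n"
  shows "norm x = norm y \<Longrightarrow> riesz_potential \<alpha> x = riesz_potential \<alpha> y"
  by (simp add: riesz_potential_def)

text \<open>Completing the square at the midpoint m of x and y. Read from right to left, it writes a
  Gaussian in x - y as an integral over z of a function of x times the same function of y, the
  factorization behind positive definiteness.\<close>

lemma nn_integral_gaussian_product:
  fixes x y :: "'a::euclidean_space"
  assumes t: "t > 0"
  shows "(\<integral>\<^sup>+z. ennreal (exp (- (2 * t) * (norm (x - z))\<^sup>2)) * ennreal (exp (- (2 * t) * (norm (y - z))\<^sup>2)) \<partial>lborel) =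
    ennreal (exp (- t * (norm (x - y))\<^sup>2) * (pi / (4 * t)) powr (DIM('a) / 2))"
proof -
  define m where "m = (1 / 2) *\<^sub>R (x + y)"
  have id: "2 * (norm (x - z))\<^sup>2 + 2 * (norm (y - z))\<^sup>2 = (norm (x - y))\<^sup>2 + 4 * (norm (z - m))\<^sup>2" for z
    unfolding power2_norm_eq_inner m_def by (simp add: inner_simps inner_commute field_simps)
  have "ennreal (exp (- (2 * t) * (norm (x - z))\<^sup>2)) * ennreal (exp (- (2 * t) * (norm (y - z))\<^sup>2)) =
      ennreal (exp (- t * (norm (x - y))\<^sup>2)) * ennreal (exp (- (4 * t) * (norm (z - m))\<^sup>2))" for z
  proof -
    have "- (2 * t) * (norm (x - z))\<^sup>2 + - (2 * t) * (norm (y - z))\<^sup>2 = - t * (2 * (norm (x - z))\<^sup>2 + 2 * (norm (y - z))\<^sup>2)"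
      by (simp add: algebra_simps)
    also have "\<dots> = - t * (norm (x - y))\<^sup>2 + - (4 * t) * (norm (z - m))\<^sup>2"
      unfolding id by (simp add: algebra_simps)
    finally show ?thesis by (simp only: ennreal_mult'[symmetric] exp_ge_zero exp_add[symmetric])
  qed
  then have "(\<integral>\<^sup>+z. ennreal (exp (- (2 * t) * (norm (x - z))\<^sup>2)) * ennreal (exp (- (2 * t) * (norm (y - z))\<^sup>2)) \<partial>lborel) =
     ennreal (exp (- t * (norm (x - y))\<^sup>2)) * (\<integral>\<^sup>+z. ennreal (exp (- (4 * t) * (norm (z - m))\<^sup>2)) \<partial>lborel)"
    by (simp only:) (rule nn_integral_cmult, measurable)
  also have "(\<integral>\<^sup>+z. ennreal (exp (- (4 * t) * (norm (z - m))\<^sup>2)) \<partial>lborel) = (\<integral>\<^sup>+z. ennreal (exp (- (4 * t) * (norm (z :: 'a))\<^sup>2)) \<partial>lborel)"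
    by (rule nn_integral_translate_diff[of "\<lambda>z. ennreal (exp (- (4 * t) * (norm z)\<^sup>2))"]) measurable
  also have "\<dots> = ennreal ((pi / (4 * t)) powr (DIM('a) / 2))"
    by (rule nn_integral_gaussian) (use t in simp)
  finally show ?thesis by (simp add: ennreal_mult')
qed

lemma ennreal_two_mult_le: "2 * (a * b) \<le> a * a + b * (b :: ennreal)"
proof (cases a)
  case (real r)
  show ?thesis
  proof (cases b)
    case (real s)
    have "2 * (r * s) \<le> r * r + s * s" using sum_squares_bound[of r s] by (simp add: power2_eq_square)
    then have "ennreal (2 * (r * s)) \<le> ennreal (r * r + s * s)" by (rule ennreal_leI)
    then show ?thesis using real \<open>a = ennreal r\<close> \<open>0 \<le> r\<close> by (simp add: ennreal_mult')
  qed simp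
qed simp

lemma riesz_potential_positive_definite:
  assumes \<alpha>: "0 < \<alpha>" "\<alpha> < real CARD('n)"
  shows "positive_definite_kernel (riesz_potential \<alpha> :: real ^ 'n \<Rightarrow> real)"
proof -
  define c where "c = real CARD('n) - \<alpha>"
  have c: "c > 0" using \<alpha> by (simp add: c_def)
  have Gc: "Gamma (c / 2) > 0" using c by (intro Gamma_real_pos) simp
  define k where "k = riesz_const \<alpha> TYPE('n) / Gamma (c / 2)"
  have k: "k > 0" using riesz_const_pos[OF \<alpha>] Gc by (simp add: k_def)
  \<comment> \<open>The constant k divides out the Gamma function produced by the t-integral, and
    the power of 4t/\<pi> cancels the mass of the Gaussian in z.\<close>
  define W where "W t = indicator {0<..} t * (k * t powr (c / 2 - 1) * (4 * t / pi) powr (real CARD('n) / 2))" for t :: real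
  have W: "W t \<ge> 0" for t using k by (simp add: W_def)
  have [measurable]: "W \<in> borel_measurable borel" unfolding W_def by measurable
  define E where "E t x z = exp (- (2 * t) * (norm (x - z))\<^sup>2)" for t :: real and x z :: "real ^ 'n"
  have [measurable]: "(\<lambda>w. E (f w) (g w) (h w)) \<in> borel_measurable M"
    if [measurable]: "f \<in> borel_measurable M" "g \<in> borel_measurable M" "h \<in> borel_measurable M"
    for f g h and M :: "'z measure" unfolding E_def by measurable
  have rep: "ennreal (riesz_potential \<alpha> (x - y)) = (\<integral>\<^sup>+t. (\<integral>\<^sup>+z. ennreal (W t) * (ennreal (E t x z) * ennreal (E t y z)) \<partial>lborel) \<partial>lborel)"
    if "x \<noteq> y" for x y :: "real ^ 'n"
  proof -
    have n: "(norm (x - y))\<^sup>2 > 0" using that by simp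
    have "(\<integral>\<^sup>+z. ennreal (W t) * (ennreal (E t x z) * ennreal (E t y z)) \<partial>lborel) =
       ennreal k * ennreal (indicator {0<..} t * (t powr (c / 2 - 1) * exp (- ((norm (x - y))\<^sup>2 * t))))" for t
    proof (cases "t > 0")
      case True
      have "(\<integral>\<^sup>+z. ennreal (W t) * (ennreal (E t x z) * ennreal (E t y z)) \<partial>lborel) =
        ennreal (W t) * ennreal (exp (- t * (norm (x - y))\<^sup>2) * (pi / (4 * t)) powr (CARD('n) / 2))"
        unfolding E_def using nn_integral_gaussian_product[OF True, of x y] by (subst nn_integral_cmult) simp_all
      also have "\<dots> = ennreal (k * (t powr (c / 2 - 1) * exp (- ((norm (x - y))\<^sup>2 * t))))"
      proof (subst ennreal_mult'[OF W, symmetric], rule arg_cong[where f=ennreal])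
        have "(4 * t / pi) powr (real CARD('n) / 2) * (pi / (4 * t)) powr (real CARD('n) / 2) = 1"
          using True by (simp flip: powr_mult)
        moreover have "W t * (exp (- t * (norm (x - y))\<^sup>2) * (pi / (4 * t)) powr (CARD('n) / 2)) =
           (k * t powr (c / 2 - 1)) * ((4 * t / pi) powr (real CARD('n) / 2) * (pi / (4 * t)) powr (real CARD('n) / 2)) * exp (- t * (norm (x - y))\<^sup>2)"
          using True by (simp add: W_def mult_ac)
        ultimately have "W t * (exp (- t * (norm (x - y))\<^sup>2) * (pi / (4 * t)) powr (CARD('n) / 2)) = (k * t powr (c / 2 - 1)) * 1 * exp (- t * (norm (x - y))\<^sup>2)"
          by simp
        then show "W t * (exp (- t * (norm (x - y))\<^sup>2) * (pi / (4 * t)) powr (CARD('n) / 2)) = k * (t powr (c / 2 - 1) * exp (- ((norm (x - y))\<^sup>2 * t)))"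
          by (simp add: mult_ac)
      qed
      finally show ?thesis using True k by (simp add: ennreal_mult')
    qed (simp add: W_def)
    then have "(\<integral>\<^sup>+t. (\<integral>\<^sup>+z. ennreal (W t) * (ennreal (E t x z) * ennreal (E t y z)) \<partial>lborel) \<partial>lborel) =
      ennreal k * (\<integral>\<^sup>+t. ennreal (indicator {0<..} t * (t powr (c / 2 - 1) * exp (- ((norm (x - y))\<^sup>2 * t)))) \<partial>lborel)"
      by (simp only:) (rule nn_integral_cmult, measurable)
    also have "\<dots> = ennreal k * ennreal (Gamma (c / 2) * (norm (x - y))\<^sup>2 powr (- (c / 2)))"
      by (subst nn_integral_powr_exp) (use c n in auto)
    also have "\<dots> = ennreal (k * Gamma (c / 2) * (norm (x - y))\<^sup>2 powr (- (c / 2)))"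
      using k by (simp add: ennreal_mult'[symmetric] mult.assoc)
    also have "(norm (x - y))\<^sup>2 powr (- (c / 2)) = norm (x - y) powr (- c)"
      using that by (simp add: powr_powr flip: powr_numeral)
    also have "k * Gamma (c / 2) = riesz_const \<alpha> TYPE('n)" using Gc by (simp add: k_def)
    finally show ?thesis by (simp add: riesz_potential_eq c_def)
  qed
  define \<Phi> where "\<Phi> f t z = (\<integral>\<^sup>+x. ennreal (E t x z * f x) \<partial>lborel)" for f :: "real ^ 'n \<Rightarrow> real" and t z
  have en: "energy (riesz_potential \<alpha>) f g = (\<integral>\<^sup>+t. (\<integral>\<^sup>+z. ennreal (W t) * (\<Phi> f t z * \<Phi> g t z) \<partial>lborel) \<partial>lborel)"
    if [measurable]: "f \<in> borel_measurable borel" "g \<in> borel_measurable borel" and nn: "\<And>x. f x \<ge> 0" "\<And>x. g x \<ge> 0" for f g :: "real ^ 'n \<Rightarrow> real"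
  proof -
    define P where "P t z x y = ennreal (W t) * (ennreal (E t x z * f x) * ennreal (E t y z * g y))" for t z x y
    have E0: "E t x z \<ge> 0" for t x z by (simp add: E_def)
    have 1: "(\<integral>\<^sup>+y. ennreal (riesz_potential \<alpha> (x - y) * f x * g y) \<partial>lborel) = (\<integral>\<^sup>+y. (\<integral>\<^sup>+t. (\<integral>\<^sup>+z. P t z x y \<partial>lborel) \<partial>lborel) \<partial>lborel)" for x
    proof (rule nn_integral_cong_AE)
      show "AE y in lborel. ennreal (riesz_potential \<alpha> (x - y) * f x * g y) = (\<integral>\<^sup>+t. (\<integral>\<^sup>+z. P t z x y \<partial>lborel) \<partial>lborel)"
        using AE_lborel_singleton[of x]
      proof eventually_elim
        case (elim y)
        have "ennreal (riesz_potential \<alpha> (x - y) * f x * g y) = ennreal (riesz_potential \<alpha> (x - y)) * ennreal (f x * g y)"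
          using riesz_potential_nonneg[OF \<alpha>] by (simp add: ennreal_mult' mult.assoc)
        also have "\<dots> = (\<integral>\<^sup>+t. (\<integral>\<^sup>+z. ennreal (W t) * (ennreal (E t x z) * ennreal (E t y z)) * ennreal (f x * g y) \<partial>lborel) \<partial>lborel)"
          using elim by (subst rep) (auto simp: nn_integral_multc)
        also have "\<dots> = (\<integral>\<^sup>+t. (\<integral>\<^sup>+z. P t z x y \<partial>lborel) \<partial>lborel)"
          unfolding P_def using nn E0 by (intro nn_integral_cong) (simp add: ennreal_mult' mult_ac)
        finally show ?case .
      qed
    qed
    have [measurable]: "(\<lambda>w. P (a w) (b w) (d w) (e w)) \<in> borel_measurable M"
      if [measurable]: "a \<in> borel_measurable M" "b \<in> borel_measurable M" "d \<in> borel_measurable M" "e \<in> borel_measurable M"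
      for a b d e and M :: "'z measure" unfolding P_def by measurable
    have "energy (riesz_potential \<alpha>) f g = (\<integral>\<^sup>+x. (\<integral>\<^sup>+y. (\<integral>\<^sup>+t. (\<integral>\<^sup>+z. P t z x y \<partial>lborel) \<partial>lborel) \<partial>lborel) \<partial>lborel)"
      unfolding energy_def 1 ..
    \<comment> \<open>Four exchanges bring x and y to the inside, where the integrand factors into a
      function of x and a function of y.\<close>
    also have "\<dots> = (\<integral>\<^sup>+x. (\<integral>\<^sup>+t. (\<integral>\<^sup>+y. (\<integral>\<^sup>+z. P t z x y \<partial>lborel) \<partial>lborel) \<partial>lborel) \<partial>lborel)"
      by (intro nn_integral_cong lborel_pair.Fubini') measurable
    also have "\<dots> = (\<integral>\<^sup>+t. (\<integral>\<^sup>+x. (\<integral>\<^sup>+y. (\<integral>\<^sup>+z. P t z x y \<partial>lborel) \<partial>lborel) \<partial>lborel) \<partial>lborel)"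
      by (intro lborel_pair.Fubini') measurable
    also have "\<dots> = (\<integral>\<^sup>+t. (\<integral>\<^sup>+x. (\<integral>\<^sup>+z. (\<integral>\<^sup>+y. P t z x y \<partial>lborel) \<partial>lborel) \<partial>lborel) \<partial>lborel)"
      by (intro nn_integral_cong lborel_pair.Fubini') measurable
    also have "\<dots> = (\<integral>\<^sup>+t. (\<integral>\<^sup>+z. (\<integral>\<^sup>+x. (\<integral>\<^sup>+y. P t z x y \<partial>lborel) \<partial>lborel) \<partial>lborel) \<partial>lborel)"
      by (intro nn_integral_cong lborel_pair.Fubini') measurable
    also have "\<dots> = (\<integral>\<^sup>+t. (\<integral>\<^sup>+z. ennreal (W t) * (\<Phi> f t z * \<Phi> g t z) \<partial>lborel) \<partial>lborel)"
      unfolding P_def \<Phi>_def by (simp add: nn_integral_cmult nn_integral_multc)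
    finally show ?thesis .
  qed
  show ?thesis
    unfolding positive_definite_kernel_def
  proof (intro conjI allI impI)
    show "(riesz_potential \<alpha> :: real ^ 'n \<Rightarrow> real) \<in> borel_measurable borel" by simp
    show "riesz_potential \<alpha> x \<ge> 0" for x :: "real ^ 'n" by (rule riesz_potential_nonneg[OF \<alpha>])
    show "riesz_potential \<alpha> (- x) = riesz_potential \<alpha> x" for x :: "real ^ 'n" by (rule riesz_potential_cong) simp
    fix f g :: "real ^ 'n \<Rightarrow> real"
    assume [measurable]: "f \<in> borel_measurable borel" "g \<in> borel_measurable borel" and "\<forall>x. f x \<ge> 0" "\<forall>x. g x \<ge> 0"
    then have nn: "\<And>x. f x \<ge> 0" "\<And>x. g x \<ge> 0" by auto
    have [measurable]: "(\<lambda>w. \<Phi> f (a w) (b w)) \<in> borel_measurable M" "(\<lambda>w. \<Phi> g (a w) (b w)) \<in> borel_measurable M"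
      if [measurable]: "a \<in> borel_measurable M" "b \<in> borel_measurable M" for a b and M :: "'z measure"
      unfolding \<Phi>_def by measurable
    have "2 * energy (riesz_potential \<alpha>) f g = (\<integral>\<^sup>+t. (\<integral>\<^sup>+z. ennreal (W t) * (2 * (\<Phi> f t z * \<Phi> g t z)) \<partial>lborel) \<partial>lborel)"
      using nn by (subst en) (auto simp: nn_integral_cmult[symmetric] mult.left_commute)
    also have "\<dots> \<le> (\<integral>\<^sup>+t. (\<integral>\<^sup>+z. ennreal (W t) * (\<Phi> f t z * \<Phi> f t z) + ennreal (W t) * (\<Phi> g t z * \<Phi> g t z) \<partial>lborel) \<partial>lborel)"
      unfolding distrib_left[symmetric] by (intro nn_integral_mono mult_left_mono ennreal_two_mult_le) simp
    also have "\<dots> = energy (riesz_potential \<alpha>) f f + energy (riesz_potential \<alpha>) g g"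
      using nn by (simp add: en nn_integral_add)
    finally show "2 * energy (riesz_potential \<alpha>) f g \<le> energy (riesz_potential \<alpha>) f f + energy (riesz_potential \<alpha>) g g" .
  qed
qed

text \<open>Young's inequality with \<rho> = 1/\<theta>, which forces s = 2/(2-\<theta>); for |u|^p
  this is a bound in terms of u in L^(2p/(2-\<theta>)).\<close>

lemma energy_power_bound:
  fixes K u :: "'a::euclidean_space \<Rightarrow> real" and \<theta> p :: real
  assumes [measurable]: "K \<in> borel_measurable borel" "u \<in> borel_measurable borel"
    and K: "\<And>x. K x \<ge> 0" and \<theta>: "0 < \<theta>" "\<theta> < 1" and p: "p > 1"
    and bK: "(\<integral>\<^sup>+x. ennreal (K x powr (1 / \<theta>)) \<partial>lborel) \<le> ennreal (\<kappa> powr (1 / \<theta>))" and \<kappa>: "\<kappa> > 0"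
    and bu: "(\<integral>\<^sup>+x. ennreal (\<bar>u x\<bar> powr (2 * p / (2 - \<theta>))) \<partial>lborel) \<le> ennreal (V powr (2 * p / (2 - \<theta>)))" and V: "V > 0"
  shows "energy K (\<lambda>x. \<bar>u x\<bar> powr p) (\<lambda>x. \<bar>u x\<bar> powr p) \<le> ennreal (\<kappa> * V powr (2 * p))"
proof -
  have "energy K (\<lambda>x. \<bar>u x\<bar> powr p) (\<lambda>x. \<bar>u x\<bar> powr p) \<le> ennreal (\<kappa> * (V powr p)\<^sup>2)"
  proof (rule energy_young[where \<rho>="1 / \<theta>" and s="2 / (2 - \<theta>)"])
    show "2 / (2 - \<theta>) * (1 - 1 / (2 * (1 / \<theta>))) = 1" using \<theta> by (simp add: field_simps)
    show "(\<integral>\<^sup>+x. ennreal ((\<bar>u x\<bar> powr p) powr (2 / (2 - \<theta>))) \<partial>lborel) \<le> ennreal ((V powr p) powr (2 / (2 - \<theta>)))"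
      using bu by (simp add: powr_powr mult.commute[of 2 p])
  qed (use assms in auto)
  then show ?thesis by (simp add: powr_double)
qed

lemma finite_powr_bound:
  fixes g :: "'a \<Rightarrow> real"
  assumes "(\<integral>\<^sup>+x. ennreal (g x) \<partial>M) < \<infinity>" and r: "r > 0"
  obtains \<kappa> where "\<kappa> > 0" "(\<integral>\<^sup>+x. ennreal (g x) \<partial>M) \<le> ennreal (\<kappa> powr r)"
proof -
  define I where "I = enn2real (\<integral>\<^sup>+x. ennreal (g x) \<partial>M)"
  have I: "(\<integral>\<^sup>+x. ennreal (g x) \<partial>M) = ennreal I" "I \<ge> 0" using assms by (auto simp: I_def)
  define \<kappa> where "\<kappa> = (I + 1) powr (1 / r)"
  have "\<kappa> powr r = I + 1" using I r by (simp add: \<kappa>_def powr_powr)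
  moreover have "\<kappa> > 0" using I by (simp add: \<kappa>_def)
  ultimately show ?thesis using I(1) by (intro that[of \<kappa>]) (auto intro: ennreal_leI)
qed

section \<open>Exponents, and the energy bound for the Riesz kernel\<close>

text \<open>At \<theta> = (N-\<alpha>)/N one has 2 - \<theta> = (N+\<alpha>)/N, and the last two
  conditions are exactly the lower and upper bounds on p. All four conditions are open in \<theta>,
  so they persist in a neighbourhood.\<close>

lemma choquard_exponents:
  fixes N \<alpha> p :: real
  assumes N: "N \<ge> 2" and \<alpha>: "0 < \<alpha>" "\<alpha> < N" and p: "(N + \<alpha>) / N < p" "p < (N + \<alpha>) / (N - 1)"
  obtains \<delta> where "\<delta> > 0" "\<And>\<theta>. \<bar>\<theta> - (N - \<alpha>) / N\<bar> \<le> \<delta> \<Longrightarrow> 0 < \<theta> \<and> \<theta> < 1 \<and> 2 - \<theta> < p \<and> p * (N - 1) < N * (2 - \<theta>)"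
proof -
  define a where "a = (N - \<alpha>) / N"
  define m where "m = (N * (2 - a) - p * (N - 1)) / N"
  \<comment> \<open>Half the least of the four gaps; m is the gap in the upper bound divided by N,
    since moving \<theta> by \<delta> changes N(2-\<theta>) by N \<delta>.\<close>
  define \<delta> where "\<delta> = min (min a (1 - a)) (min (p - (2 - a)) m) / 2"
  have Na: "N * a = N - \<alpha>" using N by (simp add: a_def)
  have a: "a > 0" "1 - a > 0" using N \<alpha> by (auto simp: a_def field_simps)
  have "p - (2 - a) > 0" using N p by (simp add: a_def field_simps)
  moreover have "p * (N - 1) < N + \<alpha>" using p N by (simp add: field_simps)
  then have "m > 0" using N Na by (simp add: m_def right_diff_distrib)
  ultimately have d: "\<delta> > 0" using a by (simp add: \<delta>_def)
  have le: "\<delta> < a" "\<delta> < 1 - a" "\<delta> < p - (2 - a)" "\<delta> < m" 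
  proof -
    have "2 * \<delta> \<le> a" "2 * \<delta> \<le> 1 - a" "2 * \<delta> \<le> p - (2 - a)" "2 * \<delta> \<le> m"
      unfolding \<delta>_def by (auto simp: min.coboundedI1 min.coboundedI2)
    then show "\<delta> < a" "\<delta> < 1 - a" "\<delta> < p - (2 - a)" "\<delta> < m" using d by linarith+
  qed
  show ?thesis
  proof (rule that[OF d])
    fix \<theta> assume "\<bar>\<theta> - (N - \<alpha>) / N\<bar> \<le> \<delta>"
    then have t: "\<theta> \<le> a + \<delta>" "\<theta> \<ge> a - \<delta>" by (auto simp: a_def)
    have "N * \<theta> \<le> N * (a + \<delta>)" using t N by (intro mult_left_mono) auto
    moreover have "N * \<delta> < N * m" using le N by (intro mult_strict_left_mono) auto
    moreover have "N * m = N * (2 - a) - p * (N - 1)" using N by (simp add: m_def)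
    ultimately have "p * (N - 1) < N * (2 - \<theta>)" by (simp add: algebra_simps)
    then show "0 < \<theta> \<and> \<theta> < 1 \<and> 2 - \<theta> < p \<and> p * (N - 1) < N * (2 - \<theta>)" using t le by auto
  qed
qed

text \<open>\<open>L\<^sup>r * L\<^sup>2 \<subseteq> L\<^sup>q\<close> by Young, and the last condition puts the Bessel kernel, of order \<open>|x|\<^sup>1\<^sup>/\<^sup>2\<^sup>-\<^sup>N\<close> at \<open>0\<close>,
  into \<open>L\<^sup>r\<close>.\<close>

definition admissible_exponents :: "real \<Rightarrow> real \<Rightarrow> real \<Rightarrow> bool" where
  "admissible_exponents N q r \<longleftrightarrow> q > 2 \<and> r > 1 \<and> 1 / r = 1 / q + 1 / 2 \<and> r * (2 * N - 1) < 2 * N"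

text \<open>Here q > 2 amounts to 2 - \<theta> < p, and the integrability condition on r amounts to
  p(N-1) < N(2-\<theta>): lower and upper bound on p have separate roles.\<close>

lemma admissible_exponents_of_theta:
  fixes N p \<theta> :: real
  assumes N: "N \<ge> 2" and \<theta>: "0 < \<theta>" "\<theta> < 1" "2 - \<theta> < p" "p * (N - 1) < N * (2 - \<theta>)"
  shows "admissible_exponents N (2 * p / (2 - \<theta>)) (1 / (1 / (2 * p / (2 - \<theta>)) + 1 / 2))"
proof -
  define q where "q = 2 * p / (2 - \<theta>)"
  define h where "h = 1 / q + 1 / 2"
  have q: "q > 2" using \<theta> by (simp add: q_def field_simps)
  have h: "h > 0" "h < 1" using q by (auto simp: h_def field_simps)
  have "2 * N * (1 / q) = N * (2 - \<theta>) / p" using \<theta> by (simp add: q_def)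
  moreover have "N - 1 < N * (2 - \<theta>) / p" using \<theta> by (simp add: field_simps)
  ultimately have "2 * N - 1 < 2 * N * h" by (simp add: h_def distrib_left)
  then have "1 / h * (2 * N - 1) < 2 * N" using h by (simp add: field_simps)
  moreover have "1 / h > 1" using h by simp
  moreover have "1 / (1 / h) = 1 / q + 1 / 2" by (simp add: h_def)
  ultimately show ?thesis using q unfolding admissible_exponents_def q_def[symmetric] h_def[symmetric] by blast
qed

text \<open>|x|^(-(N-\<alpha>)) just fails to be integrable to the power N/(N-\<alpha>), both at 0
  and at infinity. The part in the unit ball is integrable to a slightly smaller power and the part
  outside to a slightly larger one, and Young's inequality for each part yields one Lebesgue
  exponent for u.\<close>

lemma riesz_energy_bound:
  fixes \<alpha> p :: real
  assumes N: "CARD('n::finite) \<ge> 2" and \<alpha>: "0 < \<alpha>" "\<alpha> < real CARD('n)"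
    and p: "(real CARD('n) + \<alpha>) / real CARD('n) < p" "p < (real CARD('n) + \<alpha>) / (real CARD('n) - 1)"
  obtains q1 r1 q2 r2 C where "admissible_exponents (real CARD('n)) q1 r1" "admissible_exponents (real CARD('n)) q2 r2" "C > 0"
    "\<And>(u :: real ^ 'n \<Rightarrow> real) V. u \<in> borel_measurable borel \<Longrightarrow> V > 0 \<Longrightarrow>
       (\<integral>\<^sup>+x. ennreal (\<bar>u x\<bar> powr q1) \<partial>lborel) \<le> ennreal (V powr q1) \<Longrightarrow>
       (\<integral>\<^sup>+x. ennreal (\<bar>u x\<bar> powr q2) \<partial>lborel) \<le> ennreal (V powr q2) \<Longrightarrow>
       energy (riesz_potential \<alpha>) (\<lambda>x. \<bar>u x\<bar> powr p) (\<lambda>x. \<bar>u x\<bar> powr p) \<le> ennreal (C * V powr (2 * p))"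
proof -
  define n where "n = real CARD('n)"
  have n: "n \<ge> 2" using N by (simp add: n_def)
  have p1: "p > 1"
  proof -
    have "1 < (n + \<alpha>) / n" using n \<alpha> by (simp add: field_simps)
    also have "\<dots> < p" using p(1) by (simp only: n_def)
    finally show ?thesis .
  qed
  obtain \<delta> where \<delta>: "\<delta> > 0" and th: "\<And>\<theta>. \<bar>\<theta> - (n - \<alpha>) / n\<bar> \<le> \<delta> \<Longrightarrow> 0 < \<theta> \<and> \<theta> < 1 \<and> 2 - \<theta> < p \<and> p * (n - 1) < n * (2 - \<theta>)"
    using choquard_exponents[of n \<alpha> p] n \<alpha> p unfolding n_def by blast
  \<comment> \<open>The kernel exponents are 1/\<theta>1 and 1/\<theta>2: the larger \<theta> goes
    with the singularity, the smaller one with the tail.\<close>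
  define \<theta>1 where "\<theta>1 = (n - \<alpha>) / n + \<delta>"
  define \<theta>2 where "\<theta>2 = (n - \<alpha>) / n - \<delta>"
  have t1: "0 < \<theta>1" "\<theta>1 < 1" "2 - \<theta>1 < p" "p * (n - 1) < n * (2 - \<theta>1)" using th[of \<theta>1] \<delta> by (auto simp: \<theta>1_def)
  have t2: "0 < \<theta>2" "\<theta>2 < 1" "2 - \<theta>2 < p" "p * (n - 1) < n * (2 - \<theta>2)" using th[of \<theta>2] \<delta> by (auto simp: \<theta>2_def)
  have nt1: "n - \<alpha> < n * \<theta>1" using n \<delta> by (simp add: \<theta>1_def distrib_left)
  have nt2: "n * \<theta>2 < n - \<alpha>" 
  proof -
    have "n * ((n - \<alpha>) / n) = n - \<alpha>" using n by simp
    then have "n * \<theta>2 = n - \<alpha> - n * \<delta>" unfolding \<theta>2_def right_diff_distrib by (simp only:)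
    then show ?thesis using n \<delta> by simp
  qed
  define q1 where "q1 = 2 * p / (2 - \<theta>1)"
  define q2 where "q2 = 2 * p / (2 - \<theta>2)"
  define K1 :: "real ^ 'n \<Rightarrow> real" where "K1 x = indicator (ball 0 1) x * riesz_potential \<alpha> x" for x
  define K2 :: "real ^ 'n \<Rightarrow> real" where "K2 x = indicator (- ball 0 1) x * riesz_potential \<alpha> x" for x
  have im: "(indicator A :: real ^ 'n \<Rightarrow> real) \<in> borel_measurable borel" if "A \<in> sets borel" for A
    using that by (rule borel_measurable_indicator)
  have [measurable]: "K1 \<in> borel_measurable borel" "K2 \<in> borel_measurable borel"
    unfolding K1_def[abs_def] K2_def[abs_def] by (auto intro!: borel_measurable_times im)
  have K: "K1 x \<ge> 0" "K2 x \<ge> 0" for x using riesz_potential_nonneg[OF \<alpha>, of x] by (auto simp: K1_def K2_def)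
  have Ksum: "riesz_potential \<alpha> x = K1 x + K2 x" for x by (auto simp: K1_def K2_def indicator_def)
  define A where "A = riesz_const \<alpha> TYPE('n)"
  have A: "A > 0" unfolding A_def by (rule riesz_const_pos[OF \<alpha>])
  have pw: "(indicator S x * riesz_potential \<alpha> x) powr s = A powr s * (indicator S x * norm x powr (- ((n - \<alpha>) * s)))"
    if "s > 0" for S s and x :: "real ^ 'n"
  proof (cases "x \<in> S")
    case True
    have "riesz_potential \<alpha> x powr s = (A * norm x powr (- (n - \<alpha>))) powr s" by (simp only: riesz_potential_eq A_def n_def)
    also have "\<dots> = A powr s * norm x powr (- ((n - \<alpha>) * s))" by (simp only: powr_mult powr_powr mult_minus_left)
    finally show ?thesis using True by simp
  qed (use that in simp)
  have cm: "(\<lambda>x. ennreal (indicator S x * norm x powr c)) \<in> borel_measurable (lborel :: (real ^ 'n) measure)" if "S \<in> sets borel" for S and c :: real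
    using im[OF that] by (auto intro!: measurable_compose[OF _ measurable_ennreal] borel_measurable_times)
  have fin1: "(\<integral>\<^sup>+x. ennreal (K1 x powr (1 / \<theta>1)) \<partial>lborel) < \<infinity>"
  proof -
    have "(\<integral>\<^sup>+x. ennreal (K1 x powr (1 / \<theta>1)) \<partial>lborel) = (\<integral>\<^sup>+x. ennreal (A powr (1 / \<theta>1)) * ennreal (indicator (ball 0 1) (x :: real ^ 'n) * norm x powr (- ((n - \<alpha>) * (1 / \<theta>1)))) \<partial>lborel)"
      unfolding K1_def using t1 by (intro nn_integral_cong) (simp add: pw ennreal_mult')
    also have "\<dots> = ennreal (A powr (1 / \<theta>1)) * (\<integral>\<^sup>+x. ennreal (indicator (ball 0 1) (x :: real ^ 'n) * norm x powr (- ((n - \<alpha>) * (1 / \<theta>1)))) \<partial>lborel)"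
      by (rule nn_integral_cmult) (rule cm, simp)
    also have "\<dots> < \<infinity>"
    proof -
      have "0 \<le> (n - \<alpha>) * (1 / \<theta>1)" "(n - \<alpha>) * (1 / \<theta>1) < DIM(real ^ 'n)"
        using nt1 t1 \<alpha> by (auto simp: n_def field_simps)
      from nn_integral_norm_powr_near[OF this] show ?thesis by (simp add: ennreal_mult_less_top)
    qed
    finally show ?thesis .
  qed
  have fin2: "(\<integral>\<^sup>+x. ennreal (K2 x powr (1 / \<theta>2)) \<partial>lborel) < \<infinity>"
  proof -
    have "(\<integral>\<^sup>+x. ennreal (K2 x powr (1 / \<theta>2)) \<partial>lborel) = (\<integral>\<^sup>+x. ennreal (A powr (1 / \<theta>2)) * ennreal (indicator (- ball 0 1) (x :: real ^ 'n) * norm x powr (- ((n - \<alpha>) * (1 / \<theta>2)))) \<partial>lborel)"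
      unfolding K2_def using t2 by (intro nn_integral_cong) (simp add: pw ennreal_mult')
    also have "\<dots> = ennreal (A powr (1 / \<theta>2)) * (\<integral>\<^sup>+x. ennreal (indicator (- ball 0 1) (x :: real ^ 'n) * norm x powr (- ((n - \<alpha>) * (1 / \<theta>2)))) \<partial>lborel)"
      by (rule nn_integral_cmult) (rule cm, simp)
    also have "\<dots> < \<infinity>"
    proof -
      have "DIM(real ^ 'n) < (n - \<alpha>) * (1 / \<theta>2)"
        using nt2 t2 by (auto simp: n_def field_simps)
      from nn_integral_norm_powr_far[OF this] show ?thesis by (simp add: ennreal_mult_less_top)
    qed
    finally show ?thesis .
  qed
  obtain \<kappa>1 where \<kappa>1: "\<kappa>1 > 0" "(\<integral>\<^sup>+x. ennreal (K1 x powr (1 / \<theta>1)) \<partial>lborel) \<le> ennreal (\<kappa>1 powr (1 / \<theta>1))"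
    using finite_powr_bound[OF fin1, of "1 / \<theta>1"] t1 by auto
  obtain \<kappa>2 where \<kappa>2: "\<kappa>2 > 0" "(\<integral>\<^sup>+x. ennreal (K2 x powr (1 / \<theta>2)) \<partial>lborel) \<le> ennreal (\<kappa>2 powr (1 / \<theta>2))"
    using finite_powr_bound[OF fin2, of "1 / \<theta>2"] t2 by auto
  have split: "energy (riesz_potential \<alpha>) f f = energy K1 f f + energy K2 f f"
    if [measurable]: "f \<in> borel_measurable borel" and nn: "\<And>x. f x \<ge> 0" for f :: "real ^ 'n \<Rightarrow> real"
  proof -
    have "ennreal (riesz_potential \<alpha> (x - y) * f x * f y) = ennreal (K1 (x - y) * f x * f y) + ennreal (K2 (x - y) * f x * f y)" for x y
      unfolding Ksum using K nn by (simp add: distrib_right)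
    then show ?thesis by (simp add: energy_def nn_integral_add)
  qed
  show ?thesis
  proof (rule that)
    show "admissible_exponents (real CARD('n)) q1 (1 / (1 / q1 + 1 / 2))"
      using admissible_exponents_of_theta[OF n t1] by (simp add: q1_def n_def)
    show "admissible_exponents (real CARD('n)) q2 (1 / (1 / q2 + 1 / 2))"
      using admissible_exponents_of_theta[OF n t2] by (simp add: q2_def n_def)
    show "\<kappa>1 + \<kappa>2 > 0" using \<kappa>1 \<kappa>2 by simp
    fix u :: "real ^ 'n \<Rightarrow> real" and V :: real
    assume [measurable]: "u \<in> borel_measurable borel" and V: "V > 0"
      and b1: "(\<integral>\<^sup>+x. ennreal (\<bar>u x\<bar> powr q1) \<partial>lborel) \<le> ennreal (V powr q1)"
      and b2: "(\<integral>\<^sup>+x. ennreal (\<bar>u x\<bar> powr q2) \<partial>lborel) \<le> ennreal (V powr q2)"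
    have "energy K1 (\<lambda>x. \<bar>u x\<bar> powr p) (\<lambda>x. \<bar>u x\<bar> powr p) \<le> ennreal (\<kappa>1 * V powr (2 * p))"
      by (rule energy_power_bound[where \<theta>=\<theta>1]) (use K t1 p1 \<kappa>1 b1 V in \<open>auto simp: q1_def\<close>)
    moreover have "energy K2 (\<lambda>x. \<bar>u x\<bar> powr p) (\<lambda>x. \<bar>u x\<bar> powr p) \<le> ennreal (\<kappa>2 * V powr (2 * p))"
      by (rule energy_power_bound[where \<theta>=\<theta>2]) (use K t2 p1 \<kappa>2 b2 V in \<open>auto simp: q2_def\<close>)
    ultimately have "energy (riesz_potential \<alpha>) (\<lambda>x. \<bar>u x\<bar> powr p) (\<lambda>x. \<bar>u x\<bar> powr p) \<le> ennreal (\<kappa>1 * V powr (2 * p)) + ennreal (\<kappa>2 * V powr (2 * p))"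
      by (subst split) (auto intro: add_mono)
    also have "\<dots> = ennreal ((\<kappa>1 + \<kappa>2) * V powr (2 * p))"
      using \<kappa>1 \<kappa>2 by (simp add: distrib_right)
    finally show "energy (riesz_potential \<alpha>) (\<lambda>x. \<bar>u x\<bar> powr p) (\<lambda>x. \<bar>u x\<bar> powr p) \<le> ennreal ((\<kappa>1 + \<kappa>2) * V powr (2 * p))" .
  qed
qed

section \<open>Weak compactness in \<open>L2\<close>\<close>

lemma L2_mult_integrable:
  fixes f g :: "real ^ 'n \<Rightarrow> real"
  assumes "f \<in> L2" "g \<in> L2"
  shows "integrable lborel (\<lambda>x. f x * g x)"
proof (rule Bochner_Integration.integrable_bound)
  have [measurable]: "f \<in> borel_measurable borel" "g \<in> borel_measurable borel" using assms by (auto simp: L2_iff)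
  show "integrable lborel (\<lambda>x. (f x)\<^sup>2 + (g x)\<^sup>2)"
    using assms by (intro Bochner_Integration.integrable_add) (auto simp: L2_def)
  show "AE x in lborel. norm (f x * g x) \<le> norm ((f x)\<^sup>2 + (g x)\<^sup>2)"
  proof (rule AE_I2)
    fix x
    have "\<bar>f x\<bar> * \<bar>g x\<bar> \<le> (f x)\<^sup>2 + (g x)\<^sup>2"
    proof -
      have "2 * (\<bar>f x\<bar> * \<bar>g x\<bar>) \<le> (f x)\<^sup>2 + (g x)\<^sup>2"
        using sum_squares_bound[of "\<bar>f x\<bar>" "\<bar>g x\<bar>"] by simp
      moreover have "0 \<le> \<bar>f x\<bar> * \<bar>g x\<bar>" by simp
      ultimately show ?thesis by linarith
    qed
    then show "norm (f x * g x) \<le> norm ((f x)\<^sup>2 + (g x)\<^sup>2)" by (simp add: abs_mult)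
  qed
  show "(\<lambda>x. f x * g x) \<in> borel_measurable lborel" by measurable
qed

lemma L2_add: "f \<in> L2 \<Longrightarrow> g \<in> L2 \<Longrightarrow> (\<lambda>x. f x + g x) \<in> L2"
  for f g :: "real ^ 'n \<Rightarrow> real"
  using sq_norm_add_le[of f g] by (auto simp: L2_iff ennreal_mult_less_top intro: le_less_trans)

lemma L2_diff: "f \<in> L2 \<Longrightarrow> g \<in> L2 \<Longrightarrow> (\<lambda>x. f x - g x) \<in> L2"
  for f g :: "real ^ 'n \<Rightarrow> real"
  using sq_norm_diff_le[of f g] by (auto simp: L2_iff ennreal_mult_less_top intro: le_less_trans)

lemma sq_norm_scale:
  fixes f :: "'a::euclidean_space \<Rightarrow> real"
  assumes [measurable]: "f \<in> borel_measurable borel"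
  shows "sq_norm (\<lambda>x. c * f x) = ennreal (c\<^sup>2) * sq_norm f"
  unfolding sq_norm_def by (subst nn_integral_cmult[symmetric]) (auto simp: ennreal_mult'[symmetric] abs_mult power_mult_distrib)

lemma L2_scale: "f \<in> L2 \<Longrightarrow> (\<lambda>x. c * f x) \<in> L2"
  for f :: "real ^ 'n \<Rightarrow> real"
  by (auto simp: L2_iff sq_norm_scale ennreal_mult_less_top)

definition L2_inner :: "(real ^ 'n \<Rightarrow> real) \<Rightarrow> (real ^ 'n \<Rightarrow> real) \<Rightarrow> real" where
  "L2_inner f g = (\<integral>x. f x * g x \<partial>lborel)"

lemma L2_inner_commute: "L2_inner f g = L2_inner g f"
  by (simp add: L2_inner_def mult.commute)

lemma L2_inner_diff:
  assumes "f \<in> L2" "g \<in> L2" "h \<in> L2"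
  shows "L2_inner h (\<lambda>x. f x - g x) = L2_inner h f - L2_inner h g"
  unfolding L2_inner_def right_diff_distrib by (intro Bochner_Integration.integral_diff L2_mult_integrable assms)

lemma L2_inner_diff_left:
  assumes "f \<in> L2" "g \<in> L2" "h \<in> L2"
  shows "L2_inner (\<lambda>x. f x - g x) h = L2_inner f h - L2_inner g h"
  using L2_inner_diff[OF assms] by (simp add: L2_inner_commute)

lemma L2_inner_scale: "L2_inner h (\<lambda>x. c * f x) = c * L2_inner h f"
  unfolding L2_inner_def by (simp add: mult.left_commute)

lemma L2_inner_scale_left: "L2_inner (\<lambda>x. c * f x) h = c * L2_inner f h"
  unfolding L2_inner_def by (simp add: mult.assoc)

lemma L2_inner_self_nonneg: "L2_inner f f \<ge> 0"
  unfolding L2_inner_def by (intro integral_nonneg_AE) simp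

lemma ennreal_L2_inner_self:
  assumes "f \<in> L2"
  shows "ennreal (L2_inner f f) = sq_norm f"
  unfolding L2_inner_def sq_norm_def
  by (subst nn_integral_eq_integral[symmetric]) (use L2_mult_integrable[OF assms assms] in \<open>auto simp: power2_eq_square\<close>)

lemma L2_inner_self_le:
  assumes "f \<in> L2" "sq_norm f \<le> ennreal B" "B \<ge> 0"
  shows "L2_inner f f \<le> B"
  using assms ennreal_L2_inner_self[OF assms(1)] by (metis ennreal_le_iff)

lemma L2_inner_minus_scale_sq:
  assumes "f \<in> L2" "g \<in> L2"
  shows "L2_inner (\<lambda>x. f x - t * g x) (\<lambda>x. f x - t * g x) = L2_inner f f - 2 * t * L2_inner f g + t\<^sup>2 * L2_inner g g"
proof -
  have s: "(\<lambda>x. t * g x) \<in> L2" by (rule L2_scale[OF assms(2)])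
  have d: "(\<lambda>x. f x - t * g x) \<in> L2" by (rule L2_diff[OF assms(1) s])
  have "L2_inner (\<lambda>x. f x - t * g x) (\<lambda>x. f x - t * g x) = L2_inner (\<lambda>x. f x - t * g x) f - t * L2_inner (\<lambda>x. f x - t * g x) g"
    by (simp add: L2_inner_diff[OF assms(1) s d] L2_inner_scale)
  also have "L2_inner (\<lambda>x. f x - t * g x) f = L2_inner f f - t * L2_inner f g"
    by (simp add: L2_inner_diff_left[OF assms(1) s assms(1)] L2_inner_commute[of g f] L2_inner_scale_left)
  also have "L2_inner (\<lambda>x. f x - t * g x) g = L2_inner f g - t * L2_inner g g"
    by (simp add: L2_inner_diff_left[OF assms(1) s assms(2)] L2_inner_scale_left)
  finally show ?thesis by (simp add: algebra_simps power2_eq_square)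
qed

lemma L2_inner_le:
  assumes "f \<in> L2" "g \<in> L2" and fB: "L2_inner f f \<le> a\<^sup>2" and gB: "L2_inner g g \<le> b\<^sup>2" and ab: "a > 0" "b > 0"
  shows "\<bar>L2_inner f g\<bar> \<le> a * b"
proof -
  have *: "2 * t * L2_inner f g \<le> a\<^sup>2 + t\<^sup>2 * b\<^sup>2" for t
  proof -
    have "0 \<le> L2_inner f f - 2 * t * L2_inner f g + t\<^sup>2 * L2_inner g g"
      unfolding L2_inner_minus_scale_sq[OF assms(1,2), symmetric] by (rule L2_inner_self_nonneg)
    moreover have "t\<^sup>2 * L2_inner g g \<le> t\<^sup>2 * b\<^sup>2" by (rule mult_left_mono[OF gB]) simp
    ultimately show ?thesis using fB by linarith
  qed
  have key: "J \<le> a * b" if "2 * (a / b) * J \<le> 2 * a\<^sup>2" for J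
    using that ab by (simp add: field_simps power2_eq_square)
  have "L2_inner f g \<le> a * b" by (rule key) (use *[of "a / b"] ab in \<open>simp add: power_divide\<close>)
  moreover have "- L2_inner f g \<le> a * b" by (rule key) (use *[of "- (a / b)"] ab in \<open>simp add: power_divide\<close>)
  ultimately show ?thesis by (simp add: abs_le_iff)
qed

text \<open>Convergence is known only against the sequence itself, hence against the linear space S
  of functions whose pairings converge. An arbitrary \<psi> is split into an element v of S at
  nearly minimal distance and a remainder g, which is almost orthogonal to S and therefore pairs
  weakly with the differences F m - F n. An approximate minimizer is enough, so no orthogonal
  projection is constructed.\<close>

lemma L2_weakly_cauchy_of_self:
  fixes F :: "nat \<Rightarrow> real ^ 'n \<Rightarrow> real"
  assumes F: "\<And>n. F n \<in> L2" and B: "\<And>n. L2_inner (F n) (F n) \<le> B\<^sup>2" "B > 0"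
    and conv: "\<And>m. convergent (\<lambda>n. L2_inner (F n) (F m))" and \<psi>: "\<psi> \<in> L2"
  shows "Cauchy (\<lambda>n. L2_inner (F n) \<psi>)"
proof -
  define S where "S = {v \<in> L2. convergent (\<lambda>n. L2_inner (F n) v)}"
  have SF: "F m \<in> S" for m using F conv by (simp add: S_def)
  have SL: "v \<in> L2" if "v \<in> S" for v using that by (simp add: S_def)
  have Ssc: "(\<lambda>x. v x - t * w x) \<in> S" if "v \<in> S" "w \<in> S" for v w t
    using that F unfolding S_def
    by (auto simp: L2_inner_diff L2_scale L2_inner_scale intro!: L2_diff L2_scale convergent_diff convergent_mult convergent_const)
  have Sadd: "(\<lambda>x. v x + t * w x) \<in> S" if "v \<in> S" "w \<in> S" for v w t
    using Ssc[OF that, of "- t"] by simp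
  define X where "X = (\<lambda>v. L2_inner (\<lambda>x. \<psi> x - v x) (\<lambda>x. \<psi> x - v x)) ` S"
  define d where "d = Inf X"
  have X0: "X \<noteq> {}" using SF by (auto simp: X_def)
  have Xb: "bdd_below X" unfolding X_def by (rule bdd_belowI[of _ 0]) (auto intro: L2_inner_self_nonneg)
  show ?thesis
  proof (rule metric_CauchyI)
    fix e :: real assume e: "e > 0"
    \<comment> \<open>Differences F m - F n have norm at most 2B, so a slack \<epsilon>^2 in the
      minimal squared distance makes their pairings with g at most 2B \<epsilon> = e/2.\<close>
    define \<epsilon> where "\<epsilon> = e / (4 * B)"
    have \<epsilon>: "\<epsilon> > 0" using e B by (simp add: \<epsilon>_def)
    have "Inf X < d + \<epsilon>\<^sup>2" using \<epsilon> by (simp add: d_def)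
    then obtain v where v: "v \<in> S" "L2_inner (\<lambda>x. \<psi> x - v x) (\<lambda>x. \<psi> x - v x) < d + \<epsilon>\<^sup>2"
      unfolding cInf_less_iff[OF X0 Xb] by (auto simp: X_def)
    define g where "g x = \<psi> x - v x" for x
    have g: "g \<in> L2" unfolding g_def by (rule L2_diff[OF \<psi> SL[OF v(1)]])
    have small: "\<bar>L2_inner g w\<bar> \<le> e / 2" if w: "w \<in> S" "L2_inner w w \<le> (2 * B)\<^sup>2" for w
    proof -
      \<comment> \<open>Moving from v to v + t w stays in S and so cannot lower the squared distance
        by more than the slack; near-orthogonality follows by taking t = \<epsilon>/(2B) with either
        sign.\<close>
      have *: "2 * t * L2_inner g w \<le> \<epsilon>\<^sup>2 + t\<^sup>2 * (2 * B)\<^sup>2" for t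
      proof -
        have "L2_inner (\<lambda>x. \<psi> x - (v x + t * w x)) (\<lambda>x. \<psi> x - (v x + t * w x)) \<in> X"
          unfolding X_def by (rule imageI) (rule Sadd[OF v(1) w(1)])
        then have "d \<le> L2_inner (\<lambda>x. \<psi> x - (v x + t * w x)) (\<lambda>x. \<psi> x - (v x + t * w x))"
          unfolding d_def by (rule cInf_lower[OF _ Xb])
        also have "(\<lambda>x. \<psi> x - (v x + t * w x)) = (\<lambda>x. g x - t * w x)" by (auto simp: g_def)
        also have "L2_inner (\<lambda>x. g x - t * w x) (\<lambda>x. g x - t * w x) = L2_inner g g - 2 * t * L2_inner g w + t\<^sup>2 * L2_inner w w"
          by (rule L2_inner_minus_scale_sq[OF g SL[OF w(1)]])
        finally have "d \<le> L2_inner g g - 2 * t * L2_inner g w + t\<^sup>2 * L2_inner w w" .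
        moreover have "t\<^sup>2 * L2_inner w w \<le> t\<^sup>2 * (2 * B)\<^sup>2" by (rule mult_left_mono[OF w(2)]) simp
        moreover have "L2_inner g g < d + \<epsilon>\<^sup>2" using v(2) by (simp add: g_def[abs_def])
        ultimately show ?thesis by linarith
      qed
      have tB: "(\<epsilon> / (2 * B))\<^sup>2 * (2 * B)\<^sup>2 = \<epsilon>\<^sup>2" using B by (simp add: power_divide)
      have "2 * (\<epsilon> / (2 * B)) * \<bar>L2_inner g w\<bar> \<le> 2 * \<epsilon>\<^sup>2"
        using *[of "\<epsilon> / (2 * B)"] *[of "- (\<epsilon> / (2 * B))"] tB by (auto simp: abs_if)
      then have "\<bar>L2_inner g w\<bar> \<le> \<epsilon> * (2 * B)" using \<epsilon> B by (simp add: field_simps power2_eq_square)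
      also have "\<dots> = e / 2" using B by (simp add: \<epsilon>_def)
      finally show ?thesis .
    qed
    have "convergent (\<lambda>n. L2_inner (F n) v)" using v by (simp add: S_def)
    then have "Cauchy (\<lambda>n. L2_inner (F n) v)" by (rule convergent_Cauchy)
    then obtain M where M: "\<And>m n. m \<ge> M \<Longrightarrow> n \<ge> M \<Longrightarrow> dist (L2_inner (F m) v) (L2_inner (F n) v) < e / 2"
      using e unfolding Cauchy_def by (metis half_gt_zero)
    show "\<exists>M. \<forall>m\<ge>M. \<forall>n\<ge>M. dist (L2_inner (F m) \<psi>) (L2_inner (F n) \<psi>) < e"
    proof (intro exI allI impI)
      fix m n assume mn: "m \<ge> M" "n \<ge> M"
      define w where "w x = F m x - F n x" for x
      have wS: "w \<in> S" using Ssc[OF SF[of m] SF[of n], of 1] by (simp add: w_def[abs_def])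
      have w: "w \<in> L2" by (rule SL[OF wS])
      have "\<bar>L2_inner (F m) (F n)\<bar> \<le> B * B" by (rule L2_inner_le[OF F F B(1) B(1) B(2) B(2)])
      moreover have "L2_inner w w = L2_inner (F m) (F m) - 2 * L2_inner (F m) (F n) + L2_inner (F n) (F n)"
        using L2_inner_minus_scale_sq[OF F[of m] F[of n], of 1] by (simp add: w_def[abs_def])
      ultimately have "L2_inner w w \<le> B\<^sup>2 + 2 * (B * B) + B\<^sup>2"
        using B(1)[of m] B(1)[of n] by linarith
      then have "L2_inner w w \<le> (2 * B)\<^sup>2" by (simp add: power2_eq_square)
      from small[OF wS this] have "\<bar>L2_inner g w\<bar> \<le> e / 2" .
      moreover have "L2_inner g w = L2_inner \<psi> w - L2_inner v w"
        unfolding g_def[abs_def] by (rule L2_inner_diff_left[OF \<psi> SL[OF v(1)] w])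
      moreover have "L2_inner \<psi> w = L2_inner (F m) \<psi> - L2_inner (F n) \<psi>"
        unfolding w_def[abs_def] using L2_inner_diff[OF F[of m] F[of n] \<psi>] by (simp add: L2_inner_commute)
      moreover have "L2_inner v w = L2_inner (F m) v - L2_inner (F n) v"
        unfolding w_def[abs_def] using L2_inner_diff[OF F[of m] F[of n] SL[OF v(1)]] by (simp add: L2_inner_commute)
      ultimately show "dist (L2_inner (F m) \<psi>) (L2_inner (F n) \<psi>) < e"
        using M[OF mn] unfolding dist_real_def by linarith
    qed
  qed
qed

text \<open>The pairings with each member of the sequence are bounded real sequences; a diagonal
  subsequence makes all of them converge, and the preceding lemma extends this to every test
  function.\<close>

lemma L2_weakly_cauchy_subsequence:
  fixes f :: "nat \<Rightarrow> real ^ 'n \<Rightarrow> real"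
  assumes f: "\<And>n. f n \<in> L2" and B: "\<And>n. L2_inner (f n) (f n) \<le> B\<^sup>2" "B > 0"
  obtains s where "strict_mono s" "\<And>\<psi>. \<psi> \<in> L2 \<Longrightarrow> Cauchy (\<lambda>n. L2_inner (f (s n)) \<psi>)"
proof -
  interpret subseqs "\<lambda>m s. convergent (\<lambda>n. L2_inner (f (s n)) (f m))"
  proof
    fix m and s :: "nat \<Rightarrow> nat" assume "strict_mono s"
    have "bounded (range (\<lambda>n. L2_inner (f (s n)) (f m)))"
      using L2_inner_le[OF f f B(1) B(1) B(2) B(2)] by (auto simp: bounded_iff)
    then obtain l r where "strict_mono r" "((\<lambda>n. L2_inner (f (s n)) (f m)) \<circ> r) \<longlonglongrightarrow> l"
      using bounded_imp_convergent_subsequence by blast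
    then show "\<exists>r'. strict_mono r' \<and> convergent (\<lambda>n. L2_inner (f ((s \<circ> r') n)) (f m))"
      by (auto simp: o_def convergent_def)
  qed
  have conv: "convergent (\<lambda>n. L2_inner (f (diagseq n)) (f m))" for m
  proof -
    \<comment> \<open>Only from index m + 1 on is the diagonal sequence a subsequence of the stage
      chosen for m; the finitely many earlier terms do not affect convergence.\<close>
    have "convergent (\<lambda>n. L2_inner (f ((diagseq \<circ> (+) (Suc m)) n)) (f m))"
    proof (rule diagseq_holds)
      fix s r :: "nat \<Rightarrow> nat" and n assume "strict_mono r" "convergent (\<lambda>k. L2_inner (f (s k)) (f n))"
      then show "convergent (\<lambda>k. L2_inner (f ((s \<circ> r) k)) (f n))"
        using convergent_subseq_convergent[of "\<lambda>k. L2_inner (f (s k)) (f n)" r] by (simp add: o_def)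
    qed
    then have "convergent (\<lambda>n. L2_inner (f (diagseq (n + Suc m))) (f m))" by (simp add: o_def add.commute)
    then show ?thesis by (subst (asm) convergent_ignore_initial_segment[of "\<lambda>n. L2_inner (f (diagseq n)) (f m)"])
  qed
  show ?thesis
  proof (rule that[OF subseq_diagseq])
    fix \<psi> :: "real ^ 'n \<Rightarrow> real" assume "\<psi> \<in> L2"
    then show "Cauchy (\<lambda>n. L2_inner (f (diagseq n)) \<psi>)"
      by (rule L2_weakly_cauchy_of_self[where F="\<lambda>n. f (diagseq n)", OF f B conv])
  qed
qed

section \<open>Radial functions and compactness\<close>

text \<open>Both \<open>\<integral> g\<close> and \<open>\<integral> g \<circ> Q\<close> are translation invariant, so they are proportional; a Gaussian,
  which is not changed by \<open>Q\<close>, shows that the factor is 1.\<close>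

lemma nn_integral_orthogonal:
  fixes Q :: "'a::euclidean_space \<Rightarrow> 'a" and g :: "'a \<Rightarrow> ennreal"
  assumes Q: "orthogonal_transformation Q" and [measurable]: "g \<in> borel_measurable borel"
  shows "(\<integral>\<^sup>+y. g (Q y) \<partial>lborel) = (\<integral>\<^sup>+y. g y \<partial>lborel)"
proof -
  have lin: "linear Q" using Q by (rule orthogonal_transformation_linear)
  have [measurable]: "Q \<in> borel_measurable borel"
  proof (rule borel_measurable_continuous_onI)
    show "continuous_on UNIV Q" using lin by (simp add: linear_continuous_on linear_linear)
  qed
  define R where "R = inv Q"
  have QR: "Q (R x) = x" for x unfolding R_def by (rule surj_f_inv_f[OF orthogonal_transformation_surj[OF Q]])
  have add: "Q (x + y) = Q x + Q y" for x y by (rule linear_add[OF lin])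
  have nQ: "norm (Q x) = norm x" for x by (rule orthogonal_transformation_norm[OF Q])
  define f :: "'a \<Rightarrow> ennreal" where "f x = ennreal (exp (- 1 * (norm x)\<^sup>2))" for x
  have [measurable]: "f \<in> borel_measurable borel" unfolding f_def by measurable
  define I where "I = (\<integral>\<^sup>+x. f x \<partial>lborel)"
  have I: "I = ennreal (pi powr (DIM('a) / 2))"
    unfolding I_def f_def using nn_integral_gaussian[OF zero_less_one, where 'a='a] by simp
  have "I * (\<integral>\<^sup>+y. g (Q y) \<partial>lborel) = (\<integral>\<^sup>+x. (\<integral>\<^sup>+y. f x * g (Q y) \<partial>lborel) \<partial>lborel)"
    unfolding I_def by (simp add: nn_integral_cmult nn_integral_multc)
  also have "\<dots> = (\<integral>\<^sup>+x. (\<integral>\<^sup>+y. f x * g (Q y + x) \<partial>lborel) \<partial>lborel)"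
  proof (rule nn_integral_cong)
    fix x
    have "(\<integral>\<^sup>+y. f x * g (Q (y + R x)) \<partial>lborel) = (\<integral>\<^sup>+y. f x * g (Q y) \<partial>lborel)"
      by (rule nn_integral_translate[of "\<lambda>y. f x * g (Q y)"]) measurable
    then show "(\<integral>\<^sup>+y. f x * g (Q y) \<partial>lborel) = (\<integral>\<^sup>+y. f x * g (Q y + x) \<partial>lborel)" by (simp add: add QR)
  qed
  also have "\<dots> = (\<integral>\<^sup>+y. (\<integral>\<^sup>+x. f x * g (Q y + x) \<partial>lborel) \<partial>lborel)"
    by (rule lborel_pair.Fubini') measurable
  also have "\<dots> = (\<integral>\<^sup>+y. (\<integral>\<^sup>+x. f (x - Q y) * g x \<partial>lborel) \<partial>lborel)"
  proof (rule nn_integral_cong)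
    fix y
    have "(\<integral>\<^sup>+x. f (x + Q y - Q y) * g (x + Q y) \<partial>lborel) = (\<integral>\<^sup>+x. f (x - Q y) * g x \<partial>lborel)"
      by (rule nn_integral_translate[of "\<lambda>x. f (x - Q y) * g x"]) measurable
    then show "(\<integral>\<^sup>+x. f x * g (Q y + x) \<partial>lborel) = (\<integral>\<^sup>+x. f (x - Q y) * g x \<partial>lborel)" by (simp add: add.commute)
  qed
  also have "\<dots> = (\<integral>\<^sup>+x. (\<integral>\<^sup>+y. f (x - Q y) * g x \<partial>lborel) \<partial>lborel)"
    by (rule lborel_pair.Fubini'[symmetric]) measurable
  also have "\<dots> = (\<integral>\<^sup>+x. I * g x \<partial>lborel)"
  proof (rule nn_integral_cong)
    fix x
    have "(\<integral>\<^sup>+y. f (x - Q y) \<partial>lborel) = (\<integral>\<^sup>+y. f (x - Q (y + R x)) \<partial>lborel)"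
      by (rule nn_integral_translate[of "\<lambda>y. f (x - Q y)", symmetric]) measurable
    also have "\<dots> = I"
    proof -
      have "f (x - Q (y + R x)) = f y" for y by (simp add: add QR f_def nQ)
      then show ?thesis unfolding I_def by (simp only:)
    qed
    finally show "(\<integral>\<^sup>+y. f (x - Q y) * g x \<partial>lborel) = I * g x" by (simp add: nn_integral_multc)
  qed
  also have "\<dots> = I * (\<integral>\<^sup>+x. g x \<partial>lborel)" by (rule nn_integral_cmult) simp
  finally show ?thesis
    unfolding ennreal_mult_cancel_left by (auto simp: I)
qed

section \<open>Radial functions and their mass on distant balls\<close>

text \<open>Demanded at every point rather than almost everywhere: convolution with radial kernels
  and pointwise \<open>lim\<close> preserve it in this literal form.\<close>

definition radial :: "('a::real_normed_vector \<Rightarrow> 'b) \<Rightarrow> bool" where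
  "radial f \<longleftrightarrow> (\<forall>x y. norm x = norm y \<longrightarrow> f x = f y)"

lemma radialD: "radial f \<Longrightarrow> norm x = norm y \<Longrightarrow> f x = f y"
  unfolding radial_def by blast

lemma integral_orthogonal:
  fixes Q :: "'a::euclidean_space \<Rightarrow> 'a" and g :: "'a \<Rightarrow> real"
  assumes Q: "orthogonal_transformation Q" and [measurable]: "g \<in> borel_measurable borel"
  shows "(\<integral>y. g (Q y) \<partial>lborel) = (\<integral>y. g y \<partial>lborel)"
proof -
  have lin: "linear Q" using Q by (rule orthogonal_transformation_linear)
  have [measurable]: "Q \<in> borel_measurable borel"
  proof (rule borel_measurable_continuous_onI)
    show "continuous_on UNIV Q" using lin by (simp add: linear_continuous_on linear_linear)
  qed
  have "distr lborel borel Q = lborel"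
  proof (rule measure_eqI)
    fix A assume "A \<in> sets (distr lborel borel Q)"
    then have [measurable]: "A \<in> sets borel" by simp
    have "emeasure (distr lborel borel Q) A = (\<integral>\<^sup>+y. indicator A y \<partial>distr lborel borel Q)" by simp
    also have "\<dots> = (\<integral>\<^sup>+y. indicator A (Q y) \<partial>lborel)" by (subst nn_integral_distr) auto
    also have "\<dots> = (\<integral>\<^sup>+y. indicator A y \<partial>lborel)" by (rule nn_integral_orthogonal[OF Q]) simp
    finally show "emeasure (distr lborel borel Q) A = emeasure lborel A" by simp
  qed simp
  then have "(\<integral>y. g y \<partial>lborel) = (\<integral>y. g y \<partial>distr lborel borel Q)" by simp
  also have "\<dots> = (\<integral>y. g (Q y) \<partial>lborel)" by (rule integral_distr) auto
  finally show ?thesis by simp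
qed

lemma radial_convolution:
  fixes K f :: "real ^ 'n \<Rightarrow> real"
  assumes K: "radial K" and f: "radial f" and [measurable]: "K \<in> borel_measurable borel" "f \<in> borel_measurable borel"
  shows "radial (Defs.convolution K f)"
  unfolding radial_def
proof (intro allI impI)
  fix x y :: "real ^ 'n" assume "norm x = norm y"
  then obtain Q where Q: "orthogonal_transformation Q" "Q x = y" by (rule orthogonal_transformation_exists)
  have lin: "linear Q" using Q(1) by (rule orthogonal_transformation_linear)
  have nQ: "norm (Q z) = norm z" for z by (rule orthogonal_transformation_norm[OF Q(1)])
  have "Defs.convolution K f y = (\<integral>z. K (y - Q z) * f (Q z) \<partial>lborel)"
    unfolding Defs.convolution_def by (rule integral_orthogonal[OF Q(1), symmetric]) measurable
  also have "\<dots> = Defs.convolution K f x"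
    unfolding Defs.convolution_def
  proof (intro Bochner_Integration.integral_cong refl)
    fix z
    have "norm (y - Q z) = norm (x - z)" using nQ[of "x - z"] Q(2) by (simp add: linear_diff[OF lin])
    then show "K (y - Q z) * f (Q z) = K (x - z) * f z"
      using radialD[OF K, of "y - Q z" "x - z"] radialD[OF f, of "Q z" z] nQ by simp
  qed
  finally show "Defs.convolution K f x = Defs.convolution K f y" by simp
qed

lemma radial_ball_mass:
  fixes f :: "real ^ 'n \<Rightarrow> real"
  assumes f: "radial f" and [measurable]: "f \<in> borel_measurable borel" and xy: "norm x = norm y"
  shows "(\<integral>\<^sup>+z. ennreal ((f z)\<^sup>2) * indicator (ball y \<rho>) z \<partial>lborel) = (\<integral>\<^sup>+z. ennreal ((f z)\<^sup>2) * indicator (ball x \<rho>) z \<partial>lborel)"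
proof -
  obtain Q where Q: "orthogonal_transformation Q" "Q x = y" using xy by (rule orthogonal_transformation_exists)
  have lin: "linear Q" using Q(1) by (rule orthogonal_transformation_linear)
  have nQ: "norm (Q z) = norm z" for z by (rule orthogonal_transformation_norm[OF Q(1)])
  have m: "(\<lambda>z. ennreal ((f z)\<^sup>2) * indicator (ball y \<rho>) z) \<in> borel_measurable borel"
    by (intro borel_measurable_times_ennreal borel_measurable_indicator) auto
  have "ennreal ((f (Q z))\<^sup>2) * indicator (ball y \<rho>) (Q z) = ennreal ((f z)\<^sup>2) * (indicator (ball x \<rho>) z :: ennreal)" for z
  proof -
    have "norm (y - Q z) = norm (x - z)" using nQ[of "x - z"] Q(2) by (simp add: linear_diff[OF lin])
    then have "(Q z \<in> ball y \<rho>) = (z \<in> ball x \<rho>)" by (simp add: dist_norm)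
    then show ?thesis using radialD[OF f, of "Q z" z] nQ by (simp add: indicator_def)
  qed
  then show ?thesis using nn_integral_orthogonal[OF Q(1) m] by simp
qed

text \<open>With two coordinate axes available there is a unit circle. Its points with first
  coordinate i/m, for i < m, are at least 1/m apart, as that coordinate alone shows; a line would
  offer only two unit vectors.\<close>

lemma separated_unit_vectors:
  assumes N: "CARD('n::finite) \<ge> 2" and m: "m \<ge> 1"
  obtains v :: "nat \<Rightarrow> real ^ 'n" where "\<And>i. i < m \<Longrightarrow> norm (v i) = 1"
    "\<And>i j. i < m \<Longrightarrow> j < m \<Longrightarrow> i \<noteq> j \<Longrightarrow> dist (v i) (v j) \<ge> 1 / real m"
proof -
  obtain k l :: 'n where kl: "k \<noteq> l"
  proof -
    have "\<not> (\<forall>k l :: 'n. k = l)"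
    proof
      assume "\<forall>k l :: 'n. k = l"
      then have "(UNIV :: 'n set) = {undefined}" by auto
      then have "CARD('n) = 1" by (metis card_1_singleton_iff One_nat_def)
      then show False using N by simp
    qed
    then show ?thesis using that by blast
  qed
  define a where "a i = real i / real m" for i
  define v :: "nat \<Rightarrow> real ^ 'n" where "v i = a i *\<^sub>R axis k 1 + sqrt (1 - (a i)\<^sup>2) *\<^sub>R axis l 1" for i
  have a: "0 \<le> a i" "a i \<le> 1" if "i < m" for i using that by (auto simp: a_def)
  have comp: "v i $ k = a i" for i using kl by (simp add: v_def axis_def)
  show ?thesis
  proof (rule that[of v])
    fix i assume i: "i < m"
    have a2: "(a i)\<^sup>2 \<le> 1" using a[OF i] by (simp add: power_le_one)
    have kl0: "inner (axis k (1::real)) (axis l (1::real)) = 0" using kl by (simp add: inner_axis_axis)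
    have "v i \<bullet> v i = (a i)\<^sup>2 + (sqrt (1 - (a i)\<^sup>2))\<^sup>2"
      unfolding v_def using kl0 by (simp add: inner_simps inner_axis_axis inner_commute power2_eq_square)
    also have "\<dots> = 1" using a2 by simp
    finally show "norm (v i) = 1" by (simp add: norm_eq_sqrt_inner)
  next
    fix i j assume ij: "i < m" "j < m" "i \<noteq> j"
    have "1 \<le> \<bar>real i - real j\<bar>" using ij(3) by (cases "i < j") auto
    then have "1 / real m \<le> \<bar>a i - a j\<bar>" using m by (simp add: a_def divide_right_mono flip: diff_divide_distrib)
    also have "\<dots> = \<bar>(v i - v j) $ k\<bar>" by (simp add: comp)
    also have "\<dots> \<le> norm (v i - v j)" by (rule component_le_norm_cart)
    finally show "dist (v i) (v j) \<ge> 1 / real m" by (simp add: dist_norm)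
  qed
qed

text \<open>The centres are arbitrary because two situations use it: rotated copies of a ball for
  radial functions, and translated copies for periodic ones.\<close>

lemma disjoint_balls_mass:
  fixes f :: "real ^ 'n \<Rightarrow> real" and y :: "nat \<Rightarrow> real ^ 'n"
  assumes [measurable]: "f \<in> borel_measurable borel"
    and sep: "\<And>i j. i < m \<Longrightarrow> j < m \<Longrightarrow> i \<noteq> j \<Longrightarrow> dist (y i) (y j) \<ge> 2 * \<rho>"
    and eq: "\<And>i. i < m \<Longrightarrow> (\<integral>\<^sup>+z. ennreal ((f z)\<^sup>2) * indicator (ball (y i) \<rho>) z \<partial>lborel) = c"
  shows "of_nat m * c \<le> sq_norm f"
proof -
  define M where "M = density lborel (\<lambda>z. ennreal ((f z)\<^sup>2))"
  have e: "emeasure M (ball (y i) \<rho>) = c" if "i < m" for i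
    unfolding M_def using eq[OF that] by (subst emeasure_density) auto
  have disj: "disjoint_family_on (\<lambda>i. ball (y i) \<rho>) {..<m}"
    unfolding disjoint_family_on_def
  proof (intro ballI impI)
    fix i j assume ij: "i \<in> {..<m}" "j \<in> {..<m}" "i \<noteq> j"
    have "False" if "z \<in> ball (y i) \<rho>" "z \<in> ball (y j) \<rho>" for z
      using that sep[of i j] ij dist_triangle[of "y i" "y j" z] by (simp add: dist_commute)
    then show "ball (y i) \<rho> \<inter> ball (y j) \<rho> = {}" by blast
  qed
  have "of_nat m * c = (\<Sum>i<m. emeasure M (ball (y i) \<rho>))" by (simp add: e)
  also have "\<dots> = emeasure M (\<Union>i<m. ball (y i) \<rho>)"
    by (rule sum_emeasure[OF _ disj]) (auto simp: M_def)
  also have "\<dots> \<le> emeasure M (space M)" by (rule emeasure_space)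
  also have "\<dots> = sq_norm f" unfolding M_def sq_norm_def by (subst emeasure_density) auto
  finally show ?thesis .
qed

text \<open>The sphere through x carries m centres at mutual distance at least |x|/m >= 2\<rho>, and
  by symmetry their balls all have the same mass.\<close>

lemma radial_ball_mass_decay:
  fixes f :: "real ^ 'n \<Rightarrow> real"
  assumes N: "CARD('n) \<ge> 2" and f: "radial f" and [measurable]: "f \<in> borel_measurable borel"
    and B: "sq_norm f \<le> ennreal B" and m: "m \<ge> 1" and \<rho>: "\<rho> > 0" and x: "norm x \<ge> 2 * \<rho> * real m"
  shows "(\<integral>\<^sup>+z. ennreal ((f z)\<^sup>2) * indicator (ball x \<rho>) z \<partial>lborel) \<le> ennreal (B / real m)"
proof -
  obtain v :: "nat \<Rightarrow> real ^ 'n" where v: "\<And>i. i < m \<Longrightarrow> norm (v i) = 1"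
    "\<And>i j. i < m \<Longrightarrow> j < m \<Longrightarrow> i \<noteq> j \<Longrightarrow> dist (v i) (v j) \<ge> 1 / real m"
    using separated_unit_vectors[OF N m] by blast
  define c where "c = (\<integral>\<^sup>+z. ennreal ((f z)\<^sup>2) * indicator (ball x \<rho>) z \<partial>lborel)"
  have "of_nat m * c \<le> sq_norm f"
  proof (rule disjoint_balls_mass[where y="\<lambda>i. norm x *\<^sub>R v i"])
    fix i j assume ij: "i < m" "j < m" "i \<noteq> j"
    have "2 * \<rho> \<le> norm x * (1 / real m)" using x m by (simp add: field_simps)
    also have "\<dots> \<le> norm x * dist (v i) (v j)" by (intro mult_left_mono v(2) ij) simp
    also have "\<dots> = dist (norm x *\<^sub>R v i) (norm x *\<^sub>R v j)" by (simp add: dist_norm flip: scaleR_diff_right)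
    finally show "dist (norm x *\<^sub>R v i) (norm x *\<^sub>R v j) \<ge> 2 * \<rho>" .
  next
    fix i assume "i < m"
    then show "(\<integral>\<^sup>+z. ennreal ((f z)\<^sup>2) * indicator (ball (norm x *\<^sub>R v i) \<rho>) z \<partial>lborel) = c"
      unfolding c_def by (intro radial_ball_mass f) (auto simp: v)
  qed simp
  also have "\<dots> \<le> ennreal B" by (rule B)
  finally have le: "of_nat m * c \<le> ennreal B" .
  have "ennreal (1 / real m) * (of_nat m * c) \<le> ennreal (1 / real m) * ennreal B" by (rule mult_left_mono[OF le]) simp
  moreover have "ennreal (1 / real m) * (of_nat m * c) = c"
  proof -
    have "ennreal (1 / real m) * of_nat m = 1"
      using m by (simp add: ennreal_of_nat_eq_real_of_nat ennreal_mult'[symmetric])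
    then show ?thesis by (simp only: mult.assoc[symmetric] mult_1_left)
  qed
  ultimately show ?thesis unfolding c_def by (simp add: ennreal_mult'[symmetric])
qed

section \<open>Compactness for the truncated Bessel kernel\<close>

text \<open>Bounded and of bounded support: its translates are L2 test functions, so weak
  convergence of g yields pointwise convergence of the convolution, and a value of the convolution
  sees g only on one ball.\<close>

definition truncated_bessel :: "real \<Rightarrow> 'a::euclidean_space \<Rightarrow> real" where
  "truncated_bessel k x = (if norm x < k \<and> bessel_kernel x \<le> k then bessel_kernel x else 0)"

lemma truncated_bessel_measurable [measurable]: "truncated_bessel k \<in> borel_measurable borel"
  unfolding truncated_bessel_def[abs_def] by measurable

lemma truncated_bessel_nonneg [simp]: "truncated_bessel k x \<ge> 0"
  by (simp add: truncated_bessel_def)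

lemma truncated_bessel_le: "truncated_bessel k x \<le> bessel_kernel x"
  by (simp add: truncated_bessel_def)

lemma truncated_bessel_le_indicator: "k \<ge> 0 \<Longrightarrow> truncated_bessel k x \<le> k * indicator (ball 0 k) x"
  by (auto simp: truncated_bessel_def indicator_def)

lemma bessel_truncation_tendsto:
  fixes r :: real
  assumes r: "1 \<le> r" "r * (2 * real DIM('a::euclidean_space) - 1) < 2 * real DIM('a)"
  shows "(\<lambda>k. \<integral>\<^sup>+x. ennreal ((bessel_kernel (x::'a) - truncated_bessel (real k) x) powr r) \<partial>lborel) \<longlonglongrightarrow> 0"
proof -
  have "(\<lambda>k. \<integral>\<^sup>+x. ennreal ((bessel_kernel (x::'a) - truncated_bessel (real k) x) powr r) \<partial>lborel) \<longlonglongrightarrow> (\<integral>\<^sup>+x. 0 \<partial>(lborel :: 'a measure))"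
  proof (rule nn_integral_dominated_convergence[where w="\<lambda>x. ennreal (bessel_kernel x powr r)"])
    show "AE x in lborel. ennreal ((bessel_kernel (x::'a) - truncated_bessel (real k) x) powr r) \<le> ennreal (bessel_kernel x powr r)" for k
      using r by (intro AE_I2 ennreal_leI powr_mono2) (auto simp: truncated_bessel_le)
    show "(\<integral>\<^sup>+x. ennreal (bessel_kernel (x::'a) powr r) \<partial>lborel) < \<infinity>" by (rule nn_integral_bessel_kernel_powr[OF r])
    show "AE x in lborel. (\<lambda>k. ennreal ((bessel_kernel (x::'a) - truncated_bessel (real k) x) powr r)) \<longlonglongrightarrow> 0"
    proof (rule AE_I2, rule tendsto_eventually)
      fix x :: 'a
      obtain k0 :: nat where k0: "max (norm x) (bessel_kernel x) < real k0" using reals_Archimedean2 by blast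
      show "\<forall>\<^sub>F k in sequentially. ennreal ((bessel_kernel x - truncated_bessel (real k) x) powr r) = 0"
        using eventually_ge_at_top[of k0] by eventually_elim (use k0 in \<open>auto simp: truncated_bessel_def\<close>)
    qed
  qed measurable
  then show ?thesis by simp
qed

lemma truncated_bessel_shift_L2: "k \<ge> 0 \<Longrightarrow> (\<lambda>y. truncated_bessel k (x - y)) \<in> L2"
  for x :: "real ^ 'n"
proof -
  assume k: "k \<ge> 0"
  have "sq_norm (\<lambda>y. truncated_bessel k (x - y)) = (\<integral>\<^sup>+y. ennreal ((truncated_bessel k y)\<^sup>2) \<partial>(lborel :: (real ^ 'n) measure))"
    unfolding sq_norm_def using nn_integral_reflect[of "\<lambda>y. ennreal ((truncated_bessel k y)\<^sup>2)" x] by simp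
  also have "\<dots> \<le> (\<integral>\<^sup>+y. ennreal (k\<^sup>2) * indicator (ball 0 k) y \<partial>(lborel :: (real ^ 'n) measure))"
  proof (rule nn_integral_mono)
    fix y :: "real ^ 'n"
    have "(truncated_bessel k y)\<^sup>2 \<le> (k * indicator (ball 0 k) y)\<^sup>2"
      by (intro power_mono truncated_bessel_le_indicator k) simp
    also have "\<dots> = k\<^sup>2 * indicator (ball 0 k) y" by (simp add: indicator_def)
    finally show "ennreal ((truncated_bessel k y)\<^sup>2) \<le> ennreal (k\<^sup>2) * indicator (ball 0 k) y"
      by (auto simp: indicator_def intro: ennreal_leI split: if_splits)
  qed
  also have "\<dots> = ennreal (k\<^sup>2) * emeasure lborel (ball (0 :: real ^ 'n) k)" by (rule nn_integral_cmult_indicator) simp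
  also have "\<dots> < \<infinity>" using emeasure_bounded_finite[of "ball (0 :: real ^ 'n) k"] by (simp add: ennreal_mult_less_top)
  finally show ?thesis by (simp add: L2_iff)
qed

lemma convolution_truncated_eq_inner:
  "Defs.convolution (truncated_bessel k) g x = L2_inner g (\<lambda>y. truncated_bessel k (x - y))"
  by (simp add: Defs.convolution_def L2_inner_def mult.commute)

text \<open>Cauchy-Schwarz on the ball of radius k around x, outside which the kernel vanishes. This
  turns decay of the mass of g on distant balls into uniform decay of the convolution.\<close>

lemma convolution_truncated_sq_le:
  fixes g :: "real ^ 'n \<Rightarrow> real"
  assumes [measurable]: "g \<in> borel_measurable borel" and k: "k \<ge> 0"
  shows "ennreal ((Defs.convolution (truncated_bessel k) g x)\<^sup>2) \<le>
     ennreal (k\<^sup>2) * emeasure lborel (ball (0 :: real ^ 'n) k) * (\<integral>\<^sup>+z. ennreal ((g z)\<^sup>2) * indicator (ball x k) z \<partial>lborel)"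
proof -
  have im: "(indicator (ball x k) :: real ^ 'n \<Rightarrow> ennreal) \<in> borel_measurable lborel" for x by (rule borel_measurable_indicator) simp
  have "ennreal \<bar>Defs.convolution (truncated_bessel k) g x\<bar> \<le> (\<integral>\<^sup>+y. ennreal (truncated_bessel k (x - y) * \<bar>g y\<bar>) \<partial>lborel)"
    by (rule abs_convolution_le) auto
  also have "\<dots> \<le> (\<integral>\<^sup>+y. (ennreal k * indicator (ball x k) y) * (ennreal \<bar>g y\<bar> * indicator (ball x k) y) \<partial>lborel)"
  proof (rule nn_integral_mono)
    fix y
    have i: "indicator (ball 0 k) (x - y) = (indicator (ball x k) y :: real)" by (simp add: indicator_def dist_norm norm_minus_commute[of x y])
    have "truncated_bessel k (x - y) * \<bar>g y\<bar> \<le> (k * indicator (ball x k) y) * \<bar>g y\<bar>"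
      using truncated_bessel_le_indicator[OF k, of "x - y"] unfolding i by (intro mult_right_mono) auto
    then have "ennreal (truncated_bessel k (x - y) * \<bar>g y\<bar>) \<le> ennreal ((k * indicator (ball x k) y) * \<bar>g y\<bar>)" by (rule ennreal_leI)
    also have "\<dots> = (ennreal k * indicator (ball x k) y) * (ennreal \<bar>g y\<bar> * indicator (ball x k) y)"
      using k by (simp add: indicator_def ennreal_mult')
    finally show "ennreal (truncated_bessel k (x - y) * \<bar>g y\<bar>) \<le> \<dots>" .
  qed
  finally have "(ennreal \<bar>Defs.convolution (truncated_bessel k) g x\<bar>)\<^sup>2 \<le> (\<integral>\<^sup>+y. (ennreal k * indicator (ball x k) y) * (ennreal \<bar>g y\<bar> * indicator (ball x k) y) \<partial>lborel)\<^sup>2"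
    by (rule power_mono) simp
  also have "\<dots> \<le> (\<integral>\<^sup>+y. (ennreal k * indicator (ball x k) y)\<^sup>2 \<partial>lborel) * (\<integral>\<^sup>+y. (ennreal \<bar>g y\<bar> * indicator (ball x k) y)\<^sup>2 \<partial>lborel)"
    by (intro Cauchy_Schwarz_nn_integral borel_measurable_times_ennreal im) auto
  also have "(\<integral>\<^sup>+y. (ennreal k * indicator (ball x k) y)\<^sup>2 \<partial>lborel) = (\<integral>\<^sup>+y. ennreal (k\<^sup>2) * indicator (ball x k) y \<partial>lborel)"
    using k by (intro nn_integral_cong) (simp add: indicator_def ennreal_power)
  also have "\<dots> = ennreal (k\<^sup>2) * emeasure lborel (ball x k)" by (rule nn_integral_cmult_indicator) simp
  also have "emeasure lborel (ball x k) = emeasure lborel (ball (0 :: real ^ 'n) k)" using k by (simp add: emeasure_ball)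
  also have "(\<integral>\<^sup>+y. (ennreal \<bar>g y\<bar> * indicator (ball x k) y)\<^sup>2 \<partial>lborel) = (\<integral>\<^sup>+z. ennreal ((g z)\<^sup>2) * indicator (ball x k) z \<partial>lborel)"
    by (intro nn_integral_cong) (simp add: indicator_def ennreal_power)
  finally show ?thesis by (simp add: ennreal_power)
qed

lemma sq_norm_convolution_truncated_le:
  fixes g :: "real ^ 'n \<Rightarrow> real"
  assumes [measurable]: "g \<in> borel_measurable borel"
  shows "sq_norm (Defs.convolution (truncated_bessel k) g) \<le> sq_norm g"
proof -
  have "ennreal ((norm (Defs.convolution (truncated_bessel k) g x))\<^sup>2) \<le> (\<integral>\<^sup>+y. ennreal (bessel_kernel (x - y)) * ennreal ((\<bar>g y\<bar>)\<^sup>2) \<partial>lborel)" for x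
  proof -
    have "ennreal \<bar>Defs.convolution (truncated_bessel k) g x\<bar> \<le> (\<integral>\<^sup>+y. ennreal (truncated_bessel k (x - y) * \<bar>g y\<bar>) \<partial>lborel)"
      by (rule abs_convolution_le) auto
    also have "\<dots> \<le> (\<integral>\<^sup>+y. ennreal (bessel_kernel (x - y) * \<bar>g y\<bar>) \<partial>lborel)"
      by (intro nn_integral_mono ennreal_leI mult_right_mono truncated_bessel_le) simp
    finally have "(ennreal \<bar>Defs.convolution (truncated_bessel k) g x\<bar>)\<^sup>2 \<le> (\<integral>\<^sup>+y. ennreal (bessel_kernel (x - y) * \<bar>g y\<bar>) \<partial>lborel)\<^sup>2"
      by (rule power_mono) simp
    also have "\<dots> \<le> (\<integral>\<^sup>+y. ennreal (bessel_kernel (x - y)) * ennreal ((\<bar>g y\<bar>)\<^sup>2) \<partial>lborel)"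
      by (rule bessel_kernel_conv_sq_le) auto
    finally show ?thesis by (simp add: ennreal_power)
  qed
  then have "sq_norm (Defs.convolution (truncated_bessel k) g) \<le> (\<integral>\<^sup>+x. (\<integral>\<^sup>+y. ennreal (bessel_kernel (x - y)) * ennreal ((\<bar>g y\<bar>)\<^sup>2) \<partial>lborel) \<partial>lborel)"
    unfolding sq_norm_def[of "Defs.convolution (truncated_bessel k) g"] by (intro nn_integral_mono)
  also have "\<dots> = (\<integral>\<^sup>+y. ennreal ((\<bar>g y\<bar>)\<^sup>2) \<partial>lborel)" by (rule nn_integral_bessel_kernel_conv) measurable
  finally show ?thesis by (simp add: sq_norm_def)
qed

text \<open>Inside a large ball the convolutions converge to 0 pointwise and boundedly, so dominated
  convergence applies. Outside they are uniformly at most \<eta> by radial decay, and |h|^q <=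
  \<eta>^(q-2) |h|^2 uses q > 2 and the L2 bound. Without radial symmetry a sequence escaping to
  infinity would be a counterexample.\<close>

lemma truncated_bessel_potential_compact:
  fixes g :: "nat \<Rightarrow> real ^ 'n \<Rightarrow> real"
  assumes N: "CARD('n) \<ge> 2" and rad: "\<And>j. radial (g j)" and g: "\<And>j. g j \<in> L2" and B: "\<And>j. sq_norm (g j) \<le> ennreal (B\<^sup>2)" "B > 0"
    and weak: "\<And>\<psi>. \<psi> \<in> L2 \<Longrightarrow> (\<lambda>j. L2_inner (g j) \<psi>) \<longlonglongrightarrow> 0" and k: "k > 0" and q: "q > 2"
  shows "(\<lambda>j. \<integral>\<^sup>+x. ennreal (\<bar>Defs.convolution (truncated_bessel k) (g j) x\<bar> powr q) \<partial>lborel) \<longlonglongrightarrow> 0"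
proof -
  have [measurable]: "g j \<in> borel_measurable borel" for j using g by (auto simp: L2_iff)
  define h where "h j = Defs.convolution (truncated_bessel k) (g j)" for j
  have [measurable]: "h j \<in> borel_measurable borel" for j unfolding h_def by measurable
  have h2: "sq_norm (h j) \<le> ennreal (B\<^sup>2)" for j
    unfolding h_def using sq_norm_convolution_truncated_le[of "g j" k] B(1)[of j] by simp
  define V where "V = measure lborel (ball (0 :: real ^ 'n) k)"
  have V: "emeasure lborel (ball (0 :: real ^ 'n) k) = ennreal V"
    unfolding V_def by (rule emeasure_eq_ennreal_measure) (use emeasure_bounded_finite[of "ball (0 :: real ^ 'n) k"] in auto)
  have V0: "V \<ge> 0" by (simp add: V_def)
  have bd: "(h j x)\<^sup>2 \<le> k\<^sup>2 * V * c" if "(\<integral>\<^sup>+z. ennreal ((g j z)\<^sup>2) * indicator (ball x k) z \<partial>lborel) \<le> ennreal c" "c \<ge> 0" for j x c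
  proof -
    have "ennreal ((h j x)\<^sup>2) \<le> ennreal (k\<^sup>2) * ennreal V * (\<integral>\<^sup>+z. ennreal ((g j z)\<^sup>2) * indicator (ball x k) z \<partial>lborel)"
      unfolding h_def V[symmetric] by (rule convolution_truncated_sq_le) (use k in auto)
    also have "\<dots> \<le> ennreal (k\<^sup>2) * ennreal V * ennreal c" by (intro mult_left_mono that) auto
    also have "\<dots> = ennreal (k\<^sup>2 * V * c)" using V0 that by (simp add: ennreal_mult)
    finally show ?thesis using V0 that by (subst (asm) ennreal_le_iff) auto
  qed
  define S where "S = k * sqrt V * B"
  have S: "\<bar>h j x\<bar> \<le> S" for j x
  proof -
    have "(\<integral>\<^sup>+z. ennreal ((g j z)\<^sup>2) * indicator (ball x k) z \<partial>lborel) \<le> sq_norm (g j)"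
      unfolding sq_norm_def by (intro nn_integral_mono) (auto simp: indicator_def)
    then have "(h j x)\<^sup>2 \<le> k\<^sup>2 * V * B\<^sup>2" using B(1)[of j] by (intro bd) auto
    also have "\<dots> = S\<^sup>2" using V0 by (simp add: S_def power_mult_distrib)
    finally have "\<bar>h j x\<bar>\<^sup>2 \<le> S\<^sup>2" by simp
    moreover have "S \<ge> 0" using k V0 B by (simp add: S_def)
    ultimately show ?thesis by (rule power2_le_imp_le)
  qed
  have pt: "(\<lambda>j. h j x) \<longlonglongrightarrow> 0" for x
    unfolding h_def convolution_truncated_eq_inner by (rule weak) (rule truncated_bessel_shift_L2, use k in simp)
  show ?thesis unfolding h_def[symmetric]
  proof (rule tendsto_ennreal_zeroI)
    fix e :: real assume e: "e > 0"
    \<comment> \<open>Chosen so that \<eta>^(q-2) B^2 = e/2 bounds the outer contribution.\<close>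
    define \<eta> where "\<eta> = (e / (2 * B\<^sup>2)) powr (1 / (q - 2))"
    have \<eta>: "\<eta> > 0" using e B by (simp add: \<eta>_def)
    have \<eta>q: "\<eta> powr (q - 2) * B\<^sup>2 = e / 2" using e B q by (simp add: \<eta>_def powr_powr)
    \<comment> \<open>The number m of disjoint copies is so large that the local mass B^2/m forces
      |h| <= \<eta>; the radius R = 2km is where m disjoint balls of radius k fit.\<close>
    obtain m0 :: nat where "k\<^sup>2 * V * B\<^sup>2 / \<eta>\<^sup>2 < real m0" using reals_Archimedean2 by blast
    then obtain m :: nat where m: "m \<ge> 1" "k\<^sup>2 * V * B\<^sup>2 / \<eta>\<^sup>2 \<le> real m"
      by (intro that[of "Suc m0"]) auto
    define R where "R = 2 * k * real m"
    have far: "\<bar>h j x\<bar> \<le> \<eta>" if "norm x \<ge> R" for j x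
    proof -
      have "(\<integral>\<^sup>+z. ennreal ((g j z)\<^sup>2) * indicator (ball x k) z \<partial>lborel) \<le> ennreal (B\<^sup>2 / real m)"
        by (rule radial_ball_mass_decay[OF N rad _ B(1) m(1) k]) (use that in \<open>auto simp: R_def\<close>)
      then have "(h j x)\<^sup>2 \<le> k\<^sup>2 * V * (B\<^sup>2 / real m)" by (intro bd) auto
      also have "\<dots> \<le> \<eta>\<^sup>2" using m \<eta> by (simp add: field_simps)
      finally have "\<bar>h j x\<bar>\<^sup>2 \<le> \<eta>\<^sup>2" by simp
      then show ?thesis by (rule power2_le_imp_le) (use \<eta> in simp)
    qed
    define A where "A j = (\<integral>\<^sup>+x. ennreal (\<bar>h j x\<bar> powr q) * indicator (ball 0 R) x \<partial>lborel)" for j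
    have im: "(indicator (ball 0 R) :: real ^ 'n \<Rightarrow> ennreal) \<in> borel_measurable lborel" by (rule borel_measurable_indicator) simp
    have split: "(\<integral>\<^sup>+x. ennreal (\<bar>h j x\<bar> powr q) \<partial>lborel) \<le> A j + ennreal (e / 2)" for j
    proof -
      have "(\<integral>\<^sup>+x. ennreal (\<bar>h j x\<bar> powr q) \<partial>lborel) \<le> (\<integral>\<^sup>+x. ennreal (\<bar>h j x\<bar> powr q) * indicator (ball 0 R) x + ennreal (\<eta> powr (q - 2)) * ennreal ((norm (h j x))\<^sup>2) \<partial>lborel)"
      proof (rule nn_integral_mono)
        fix x
        show "ennreal (\<bar>h j x\<bar> powr q) \<le> ennreal (\<bar>h j x\<bar> powr q) * indicator (ball 0 R) x + ennreal (\<eta> powr (q - 2)) * ennreal ((norm (h j x))\<^sup>2)"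
        proof (cases "norm x < R")
          case True
          then show ?thesis by (simp add: indicator_def)
        next
          case False
          have "\<bar>h j x\<bar> powr q = \<bar>h j x\<bar> powr (q - 2) * \<bar>h j x\<bar> powr 2" unfolding powr_add[symmetric] by simp
          also have "\<dots> \<le> \<eta> powr (q - 2) * \<bar>h j x\<bar> powr 2"
            using far[of x j] False q by (intro mult_right_mono powr_mono2) auto
          also have "\<dots> = \<eta> powr (q - 2) * (norm (h j x))\<^sup>2" by (cases "h j x = 0") auto
          finally have "ennreal (\<bar>h j x\<bar> powr q) \<le> ennreal (\<eta> powr (q - 2)) * ennreal ((norm (h j x))\<^sup>2)"
            by (subst ennreal_mult'[symmetric]) (auto intro: ennreal_leI)
          then show ?thesis by (simp add: add_increasing)
        qed
      qed
      also have "\<dots> = A j + ennreal (\<eta> powr (q - 2)) * sq_norm (h j)"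
        unfolding A_def sq_norm_def using im by (subst nn_integral_add) (auto simp: nn_integral_cmult)
      also have "\<dots> \<le> A j + ennreal (\<eta> powr (q - 2)) * ennreal (B\<^sup>2)" by (intro add_left_mono mult_left_mono h2) simp
      also have "ennreal (\<eta> powr (q - 2)) * ennreal (B\<^sup>2) = ennreal (e / 2)" by (subst ennreal_mult'[symmetric]) (auto simp: \<eta>q)
      finally show ?thesis .
    qed
    have "A \<longlonglongrightarrow> (\<integral>\<^sup>+x. 0 \<partial>(lborel :: (real ^ 'n) measure))"
      unfolding A_def
    proof (rule nn_integral_dominated_convergence[where w="\<lambda>x. ennreal (S powr q) * indicator (ball 0 R) x"])
      show "AE x in lborel. ennreal (\<bar>h j x\<bar> powr q) * indicator (ball 0 R) x \<le> ennreal (S powr q) * indicator (ball 0 R) x" for j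
        using S q by (intro AE_I2 mult_right_mono ennreal_leI powr_mono2) auto
      show "AE x in lborel. (\<lambda>j. ennreal (\<bar>h j x\<bar> powr q) * indicator (ball 0 R) x) \<longlonglongrightarrow> 0"
      proof (rule AE_I2)
        fix x :: "real ^ 'n"
        have "(\<lambda>j. \<bar>h j x\<bar> powr q) \<longlonglongrightarrow> \<bar>0\<bar> powr q"
          using q by (intro tendsto_powr' tendsto_rabs pt tendsto_const) auto
        then have "(\<lambda>j. ennreal (\<bar>h j x\<bar> powr q)) \<longlonglongrightarrow> ennreal 0" by (intro tendsto_ennrealI) simp
        then show "(\<lambda>j. ennreal (\<bar>h j x\<bar> powr q) * indicator (ball 0 R) x) \<longlonglongrightarrow> 0"
          by (cases "x \<in> ball 0 R") auto
      qed
      show "(\<integral>\<^sup>+x. ennreal (S powr q) * indicator (ball 0 R) x \<partial>(lborel :: (real ^ 'n) measure)) < \<infinity>"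
        using emeasure_bounded_finite[of "ball (0 :: real ^ 'n) R"]
        by (subst nn_integral_cmult_indicator) (auto simp: ennreal_mult_less_top)
    qed (use im in \<open>auto intro!: borel_measurable_times_ennreal\<close>)
    then have "A \<longlonglongrightarrow> 0" by simp
    then have "eventually (\<lambda>j. A j < ennreal (e / 2)) sequentially" by (rule order_tendstoD) (use e in auto)
    then show "eventually (\<lambda>j. (\<integral>\<^sup>+x. ennreal (\<bar>h j x\<bar> powr q) \<partial>lborel) \<le> ennreal e) sequentially"
    proof eventually_elim
      case (elim j)
      have "(\<integral>\<^sup>+x. ennreal (\<bar>h j x\<bar> powr q) \<partial>lborel) \<le> ennreal (e / 2) + ennreal (e / 2)"
        by (rule order_trans[OF split add_right_mono]) (use elim in simp)
      also have "\<dots> = ennreal e" using e by (simp flip: ennreal_plus)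
      finally show ?case .
    qed
  qed
qed

lemma energy_cong_AE:
  fixes K :: "'a::euclidean_space \<Rightarrow> real"
  assumes f: "AE x in lborel. f x = f' x" and g: "AE x in lborel. g x = g' x"
  shows "energy K f g = energy K f' g'"
  unfolding energy_def
proof (rule nn_integral_cong_AE, use f in eventually_elim)
  fix x assume "f x = f' x"
  then show "(\<integral>\<^sup>+y. ennreal (K (x - y) * f x * g y) \<partial>lborel) = (\<integral>\<^sup>+y. ennreal (K (x - y) * f' x * g' y) \<partial>lborel)"
    by (intro nn_integral_cong_AE, use g in eventually_elim) simp
qed

lemma energy_mono_AE:
  fixes K :: "'a::euclidean_space \<Rightarrow> real"
  assumes K: "\<And>x. K x \<ge> 0" and f: "AE x in lborel. 0 \<le> f x \<and> f x \<le> f' x" and g: "AE x in lborel. 0 \<le> g x \<and> g x \<le> g' x"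
  shows "energy K f g \<le> energy K f' g'"
  unfolding energy_def
proof (rule nn_integral_mono_AE, use f in eventually_elim)
  fix x assume fx: "0 \<le> f x \<and> f x \<le> f' x"
  show "(\<integral>\<^sup>+y. ennreal (K (x - y) * f x * g y) \<partial>lborel) \<le> (\<integral>\<^sup>+y. ennreal (K (x - y) * f' x * g' y) \<partial>lborel)"
  proof (rule nn_integral_mono_AE, use g in eventually_elim)
    fix y assume gy: "0 \<le> g y \<and> g y \<le> g' y"
    show "ennreal (K (x - y) * f x * g y) \<le> ennreal (K (x - y) * f' x * g' y)"
      using K fx gy by (intro ennreal_leI mult_mono mult_left_mono) auto
  qed
qed

lemma bessel_potential_eq_convolution:
  "bessel_potential f = Defs.convolution bessel_kernel f" for f :: "real ^ 'n \<Rightarrow> real"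
  by (auto simp: bessel_potential_def Defs.convolution_def)

section \<open>Maximizing the energy\<close>

text \<open>The conclusion of \<open>riesz_energy_bound\<close> taken as an assumption: from here on
  the Riesz kernel's size enters only through control of the energy by two Lebesgue norms with
  admissible exponents. The argument \<open>type_n\<close> fixes the dimension.\<close>

locale choquard_energy =
  fixes \<alpha> p C q1 r1 q2 r2 :: real and type_n :: "'n::finite itself"
  assumes N: "CARD('n) \<ge> 2" and \<alpha>: "0 < \<alpha>" "\<alpha> < real CARD('n)" and p: "p > 1"
    and adm1: "admissible_exponents (real CARD('n)) q1 r1" and adm2: "admissible_exponents (real CARD('n)) q2 r2" and C: "C > 0"
    and bound: "\<And>(u :: real ^ 'n \<Rightarrow> real) V. u \<in> borel_measurable borel \<Longrightarrow> V > 0 \<Longrightarrow>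
       (\<integral>\<^sup>+x. ennreal (\<bar>u x\<bar> powr q1) \<partial>lborel) \<le> ennreal (V powr q1) \<Longrightarrow>
       (\<integral>\<^sup>+x. ennreal (\<bar>u x\<bar> powr q2) \<partial>lborel) \<le> ennreal (V powr q2) \<Longrightarrow>
       energy (riesz_potential \<alpha>) (\<lambda>x. \<bar>u x\<bar> powr p) (\<lambda>x. \<bar>u x\<bar> powr p) \<le> ennreal (C * V powr (2 * p))"
begin

definition E :: "(real ^ 'n \<Rightarrow> real) \<Rightarrow> ennreal" where
  "E u = energy (riesz_potential \<alpha>) (\<lambda>x. \<bar>u x\<bar> powr p) (\<lambda>x. \<bar>u x\<bar> powr p)"

lemma riesz_pd: "positive_definite_kernel (riesz_potential \<alpha> :: real ^ 'n \<Rightarrow> real)"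
  by (rule riesz_potential_positive_definite[OF \<alpha>])

lemma E_cong_AE: "AE x in lborel. u x = v x \<Longrightarrow> E u = E v"
  unfolding E_def by (rule energy_cong_AE) (auto elim: eventually_mono)

lemma E_mono_AE: "AE x in lborel. \<bar>u x\<bar> \<le> \<bar>v x\<bar> \<Longrightarrow> E u \<le> E v"
  unfolding E_def using p riesz_potential_nonneg[OF \<alpha>]
  by (intro energy_mono_AE) (auto elim!: eventually_mono intro!: powr_mono2)

lemma E_triangle:
  assumes "u \<in> borel_measurable borel" "v \<in> borel_measurable borel" "E u \<le> ennreal (U powr (2 * p))" "E v \<le> ennreal (V powr (2 * p))" "U > 0" "V > 0"
  shows "E (\<lambda>x. u x + v x) \<le> ennreal ((U + V) powr (2 * p))"
  using energy_triangle[OF riesz_pd p, of u v U V] assms by (simp add: E_def)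

lemma E_scale:
  assumes [measurable]: "u \<in> borel_measurable borel"
  shows "E (\<lambda>x. c * u x) = ennreal (\<bar>c\<bar> powr (2 * p)) * E u"
proof -
  have "(\<lambda>x. \<bar>c * u x\<bar> powr p) = (\<lambda>x. \<bar>c\<bar> powr p * \<bar>u x\<bar> powr p)" by (simp add: abs_mult powr_mult)
  then show ?thesis unfolding E_def
    by (simp add: energy_scale2 powr_double power2_eq_square ennreal_mult' mult.assoc)
qed

lemma E_convolution_le:
  assumes [measurable]: "K \<in> borel_measurable borel" "f \<in> borel_measurable borel" and K: "\<And>x. K x \<ge> 0"
    and bK: "(\<integral>\<^sup>+x. ennreal (K x powr r1) \<partial>lborel) \<le> ennreal (\<kappa> powr r1)" "(\<integral>\<^sup>+x. ennreal (K x powr r2) \<partial>lborel) \<le> ennreal (\<kappa> powr r2)" and \<kappa>: "\<kappa> > 0"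
    and f: "sq_norm f \<le> ennreal (\<phi>\<^sup>2)" "\<phi> > 0"
  shows "E (Defs.convolution K f) \<le> ennreal (C * (\<kappa> * \<phi>) powr (2 * p))"
  unfolding E_def
proof (rule bound)
  show "(\<integral>\<^sup>+x. ennreal (\<bar>Defs.convolution K f x\<bar> powr q1) \<partial>lborel) \<le> ennreal ((\<kappa> * \<phi>) powr q1)"
    by (rule young_convolution_L2[where r=r1]) (use K bK \<kappa> f adm1 in \<open>auto simp: admissible_exponents_def\<close>)
  show "(\<integral>\<^sup>+x. ennreal (\<bar>Defs.convolution K f x\<bar> powr q2) \<partial>lborel) \<le> ennreal ((\<kappa> * \<phi>) powr q2)"
    by (rule young_convolution_L2[where r=r2]) (use K bK \<kappa> f adm2 in \<open>auto simp: admissible_exponents_def\<close>)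
qed (use \<kappa> f in auto)

lemma E_bessel_potential_bounded:
  obtains D where "D > 0" "\<And>f \<phi>. f \<in> borel_measurable borel \<Longrightarrow> sq_norm f \<le> ennreal (\<phi>\<^sup>2) \<Longrightarrow> \<phi> > 0 \<Longrightarrow> E (bessel_potential f) \<le> ennreal ((D * \<phi>) powr (2 * p))"
proof -
  have f1: "(\<integral>\<^sup>+x. ennreal (bessel_kernel (x :: real ^ 'n) powr r1) \<partial>lborel) < \<infinity>"
    by (rule nn_integral_bessel_kernel_powr) (use adm1 in \<open>auto simp: admissible_exponents_def\<close>)
  have f2: "(\<integral>\<^sup>+x. ennreal (bessel_kernel (x :: real ^ 'n) powr r2) \<partial>lborel) < \<infinity>"
    by (rule nn_integral_bessel_kernel_powr) (use adm2 in \<open>auto simp: admissible_exponents_def\<close>)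
  have r: "r1 > 0" "r2 > 0" using adm1 adm2 by (auto simp: admissible_exponents_def)
  obtain k1 where k1: "k1 > 0" "(\<integral>\<^sup>+x. ennreal (bessel_kernel (x :: real ^ 'n) powr r1) \<partial>lborel) \<le> ennreal (k1 powr r1)"
    by (rule finite_powr_bound[OF f1 r(1)])
  obtain k2 where k2: "k2 > 0" "(\<integral>\<^sup>+x. ennreal (bessel_kernel (x :: real ^ 'n) powr r2) \<partial>lborel) \<le> ennreal (k2 powr r2)"
    by (rule finite_powr_bound[OF f2 r(2)])
  define k where "k = max k1 k2"
  have k: "k > 0" using k1 by (simp add: k_def)
  have b1: "(\<integral>\<^sup>+x. ennreal (bessel_kernel (x :: real ^ 'n) powr r1) \<partial>lborel) \<le> ennreal (k powr r1)"
    by (rule order_trans[OF k1(2) ennreal_leI[OF powr_mono2]]) (use r k1 in \<open>auto simp: k_def\<close>)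
  have b2: "(\<integral>\<^sup>+x. ennreal (bessel_kernel (x :: real ^ 'n) powr r2) \<partial>lborel) \<le> ennreal (k powr r2)"
    by (rule order_trans[OF k2(2) ennreal_leI[OF powr_mono2]]) (use r k2 in \<open>auto simp: k_def\<close>)
  define D where "D = C powr (1 / (2 * p)) * k"
  show ?thesis
  proof (rule that)
    show "D > 0" using C k by (simp add: D_def)
    fix f :: "real ^ 'n \<Rightarrow> real" and \<phi> :: real
    assume [measurable]: "f \<in> borel_measurable borel" and f: "sq_norm f \<le> ennreal (\<phi>\<^sup>2)" "\<phi> > 0"
    have "E (bessel_potential f) \<le> ennreal (C * (k * \<phi>) powr (2 * p))"
      unfolding bessel_potential_eq_convolution by (rule E_convolution_le[OF _ _ _ b1 b2 k f]) auto
    also have "C * (k * \<phi>) powr (2 * p) = (D * \<phi>) powr (2 * p)"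
      using C p by (simp add: D_def powr_mult powr_powr)
    finally show "E (bessel_potential f) \<le> ennreal ((D * \<phi>) powr (2 * p))" .
  qed
qed

text \<open>The kernel is split into a truncation and a rest H that is small in both L^r1 and L^r2.
  The rest contributes little energy uniformly in j by Young's inequality, the truncation
  contributes little for large j by compactness, and the triangle inequality for the energy adds the
  two.\<close>

lemma E_bessel_potential_compact:
  fixes g :: "nat \<Rightarrow> real ^ 'n \<Rightarrow> real"
  assumes rad: "\<And>j. radial (g j)" and g: "\<And>j. g j \<in> L2" and B: "\<And>j. sq_norm (g j) \<le> ennreal (B\<^sup>2)" "B > 0"
    and weak: "\<And>\<psi>. \<psi> \<in> L2 \<Longrightarrow> (\<lambda>j. L2_inner (g j) \<psi>) \<longlonglongrightarrow> 0" and e: "e > 0"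
  shows "eventually (\<lambda>j. E (bessel_potential (g j)) \<le> ennreal (e powr (2 * p))) sequentially"
proof -
  have [measurable]: "g j \<in> borel_measurable borel" for j using g by (auto simp: L2_iff)
  \<comment> \<open>Solves C V^(2p) = (e/2)^(2p), so that Lebesgue bounds by V make the energy at
    most half the target in the homogeneous scale.\<close>
  define V where "V = C powr (- 1 / (2 * p)) * (e / 2)"
  have V: "V > 0" using C e by (simp add: V_def)
  have CV: "C * V powr (2 * p) = (e / 2) powr (2 * p)"
  proof -
    have a: "(C powr (- 1 / (2 * p))) powr (2 * p) = C powr (- 1)" using p by (simp add: powr_powr)
    have "C * C powr (- 1) = 1" using C by (simp add: powr_minus)
    then show ?thesis unfolding V_def powr_mult a mult.assoc[symmetric] by simp
  qed
  define \<kappa> where "\<kappa> = V / B"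
  have \<kappa>: "\<kappa> > 0" "\<kappa> * B = V" using V B by (auto simp: \<kappa>_def)
  have ev: "eventually (\<lambda>k. (\<integral>\<^sup>+x. ennreal ((bessel_kernel (x :: real ^ 'n) - truncated_bessel (real k) x) powr r) \<partial>lborel) < ennreal (\<kappa> powr r)) sequentially"
    if "admissible_exponents (real CARD('n)) q r" for q r
    by (rule order_tendstoD(2)[OF bessel_truncation_tendsto]) (use that \<kappa> in \<open>auto simp: admissible_exponents_def\<close>)
  have "eventually (\<lambda>k. (\<integral>\<^sup>+x. ennreal ((bessel_kernel (x :: real ^ 'n) - truncated_bessel (real k) x) powr r1) \<partial>lborel) < ennreal (\<kappa> powr r1) \<and>
      (\<integral>\<^sup>+x. ennreal ((bessel_kernel (x :: real ^ 'n) - truncated_bessel (real k) x) powr r2) \<partial>lborel) < ennreal (\<kappa> powr r2) \<and> k \<ge> 1) sequentially"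
    by (intro eventually_conj ev[OF adm1] ev[OF adm2] eventually_ge_at_top)
  then obtain k0 :: nat where k0: "(\<integral>\<^sup>+x. ennreal ((bessel_kernel (x :: real ^ 'n) - truncated_bessel (real k0) x) powr r1) \<partial>lborel) < ennreal (\<kappa> powr r1)"
      "(\<integral>\<^sup>+x. ennreal ((bessel_kernel (x :: real ^ 'n) - truncated_bessel (real k0) x) powr r2) \<partial>lborel) < ennreal (\<kappa> powr r2)" "k0 \<ge> 1"
    unfolding eventually_sequentially by blast
  define k where "k = real k0"
  have k: "k > 0" using k0 by (simp add: k_def)
  define H :: "real ^ 'n \<Rightarrow> real" where "H x = bessel_kernel x - truncated_bessel k x" for x
  have [measurable]: "H \<in> borel_measurable borel" unfolding H_def by measurable
  have H: "H x \<ge> 0" for x by (simp add: H_def truncated_bessel_le)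
  have far: "E (Defs.convolution H (g j)) \<le> ennreal ((e / 2) powr (2 * p))" for j
  proof -
    have "E (Defs.convolution H (g j)) \<le> ennreal (C * (\<kappa> * B) powr (2 * p))"
      by (rule E_convolution_le) (use H k0 \<kappa> B in \<open>auto simp: H_def[abs_def] k_def\<close>)
    then show ?thesis by (simp add: \<kappa> CV)
  qed
  have evj: "eventually (\<lambda>j. (\<integral>\<^sup>+x. ennreal (\<bar>Defs.convolution (truncated_bessel k) (g j) x\<bar> powr q) \<partial>lborel) < ennreal (V powr q)) sequentially"
    if "q > 2" for q
    by (rule order_tendstoD(2)[OF truncated_bessel_potential_compact[OF N rad g B weak k that]]) (use V in auto)
  have q: "q1 > 2" "q2 > 2" using adm1 adm2 by (auto simp: admissible_exponents_def)
  show ?thesis using evj[OF q(1)] evj[OF q(2)]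
  proof eventually_elim
    case (elim j)
    have near: "E (Defs.convolution (truncated_bessel k) (g j)) \<le> ennreal ((e / 2) powr (2 * p))"
      unfolding E_def CV[symmetric] by (rule bound) (use elim V in auto)
    have fin: "sq_norm (g j) < \<infinity>" using g[of j] by (simp add: L2_iff)
    have "AE x in lborel. bessel_potential (g j) x = Defs.convolution (truncated_bessel k) (g j) x + Defs.convolution H (g j) x"
      using AE_integrable_bessel_potential[OF \<open>g j \<in> borel_measurable borel\<close> fin]
    proof eventually_elim
      case (elim x)
      then have i: "integrable lborel (\<lambda>y. bessel_kernel (x - y) * g j y)" by simp
      have i1: "integrable lborel (\<lambda>y. truncated_bessel k (x - y) * g j y)"
        by (rule Bochner_Integration.integrable_bound[OF i])
          (auto simp: abs_mult truncated_bessel_le intro!: AE_I2 mult_right_mono)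
      have "integrable lborel (\<lambda>y. bessel_kernel (x - y) * g j y - truncated_bessel k (x - y) * g j y)"
        by (rule Bochner_Integration.integrable_diff[OF i i1])
      then have i2: "integrable lborel (\<lambda>y. H (x - y) * g j y)" by (simp add: H_def left_diff_distrib)
      show ?case
        unfolding bessel_potential_eq_convolution Defs.convolution_def Bochner_Integration.integral_add[OF i1 i2, symmetric]
        by (intro Bochner_Integration.integral_cong) (auto simp: H_def algebra_simps)
    qed
    then have "E (bessel_potential (g j)) = E (\<lambda>x. Defs.convolution (truncated_bessel k) (g j) x + Defs.convolution H (g j) x)"
      by (rule E_cong_AE)
    also have "\<dots> \<le> ennreal ((e / 2 + e / 2) powr (2 * p))"
      by (rule E_triangle[OF _ _ near far]) (use e in auto)
    finally show ?case by simp
  qed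
qed

lemma radial_diff: "radial f \<Longrightarrow> radial g \<Longrightarrow> radial (\<lambda>x. f x - g x)" for f g :: "real ^ 'n \<Rightarrow> real"
  unfolding radial_def by metis

text \<open>If the energy of differences did not become small, differences at offending indices a j,
  b j >= j would form a radial sequence of norm at most 2. It is weakly null because the subsequence
  is weakly Cauchy, which contradicts compactness.\<close>

lemma E_cauchy_subsequence:
  fixes f :: "nat \<Rightarrow> real ^ 'n \<Rightarrow> real"
  assumes rad: "\<And>j. radial (f j)" and f: "\<And>j. f j \<in> L2" and B: "\<And>j. sq_norm (f j) \<le> 1"
  obtains s :: "nat \<Rightarrow> nat" where "strict_mono s"
    "\<And>e. e > 0 \<Longrightarrow> \<exists>M. \<forall>m\<ge>M. \<forall>n\<ge>M. E (bessel_potential (\<lambda>x. f (s m) x - f (s n) x)) \<le> ennreal (e powr (2 * p))"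
proof -
  have "L2_inner (f n) (f n) \<le> 1\<^sup>2" for n
    using L2_inner_self_le[OF f, of n 1] B by simp
  then obtain s where s: "strict_mono s" "\<And>\<psi>. \<psi> \<in> L2 \<Longrightarrow> Cauchy (\<lambda>n. L2_inner (f (s n)) \<psi>)"
    using L2_weakly_cauchy_subsequence[of f 1] f by auto
  show ?thesis
  proof (rule that[OF s(1)])
    fix e :: real assume e: "e > 0"
    show "\<exists>M. \<forall>m\<ge>M. \<forall>n\<ge>M. E (bessel_potential (\<lambda>x. f (s m) x - f (s n) x)) \<le> ennreal (e powr (2 * p))"
    proof (rule ccontr)
      assume "\<not> ?thesis"
      then have "\<forall>j. \<exists>m n. m \<ge> j \<and> n \<ge> j \<and> \<not> E (bessel_potential (\<lambda>x. f (s m) x - f (s n) x)) \<le> ennreal (e powr (2 * p))"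
        by blast
      then obtain a b where ab: "\<And>j. a j \<ge> j" "\<And>j. b j \<ge> j" "\<And>j. \<not> E (bessel_potential (\<lambda>x. f (s (a j)) x - f (s (b j)) x)) \<le> ennreal (e powr (2 * p))"
        by metis
      define g where "g j x = f (s (a j)) x - f (s (b j)) x" for j x
      have "eventually (\<lambda>j. E (bessel_potential (g j)) \<le> ennreal (e powr (2 * p))) sequentially"
      proof (rule E_bessel_potential_compact[where B=2])
        show "radial (g j)" for j unfolding g_def by (intro radial_diff rad)
        show "g j \<in> L2" for j unfolding g_def by (intro L2_diff f)
        show "sq_norm (g j) \<le> ennreal (2\<^sup>2)" for j
        proof -
          have "sq_norm (g j) \<le> 2 * sq_norm (f (s (a j))) + 2 * sq_norm (f (s (b j)))"
            unfolding g_def by (rule sq_norm_diff_le) (use f in \<open>auto simp: L2_iff\<close>)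
          also have "\<dots> \<le> 2 * 1 + 2 * 1" by (intro add_mono mult_left_mono B) auto
          finally show ?thesis by simp
        qed
        fix \<psi> :: "real ^ 'n \<Rightarrow> real" assume \<psi>: "\<psi> \<in> L2"
        show "(\<lambda>j. L2_inner (g j) \<psi>) \<longlonglongrightarrow> 0"
        proof (rule LIMSEQ_I)
          fix d :: real assume d: "d > 0"
          then obtain M where M: "\<And>m n. m \<ge> M \<Longrightarrow> n \<ge> M \<Longrightarrow> dist (L2_inner (f (s m)) \<psi>) (L2_inner (f (s n)) \<psi>) < d"
            using s(2)[OF \<psi>] unfolding Cauchy_def by blast
          have "norm (L2_inner (g j) \<psi> - 0) < d" if "j \<ge> M" for j
            using M[of "a j" "b j"] ab(1)[of j] ab(2)[of j] that
            by (simp add: g_def[abs_def] L2_inner_diff_left[OF f f \<psi>] dist_real_def)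
          then show "\<exists>no. \<forall>n\<ge>no. norm (L2_inner (g n) \<psi> - 0) < d" by blast
        qed
      qed (use e in auto)
      then obtain j where "E (bessel_potential (g j)) \<le> ennreal (e powr (2 * p))" by (auto simp: eventually_sequentially)
      then show False using ab(3)[of j] by (simp add: g_def[abs_def])
    qed
  qed
qed

end

section \<open>Positivity, and the maximal energy on the radial unit ball\<close>

lemma bessel_potential_scale:
  fixes f :: "real ^ 'n \<Rightarrow> real"
  shows "bessel_potential (\<lambda>x. c * f x) = (\<lambda>x. c * bessel_potential f x)"
  unfolding bessel_potential_def by (simp add: mult.left_commute)

lemma bessel_potential_add_AE:
  fixes f g :: "real ^ 'n \<Rightarrow> real"
  assumes "f \<in> L2" "g \<in> L2"
  shows "AE x in lborel. bessel_potential (\<lambda>y. f y + g y) x = bessel_potential f x + bessel_potential g x"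
proof -
  have m: "f \<in> borel_measurable borel" "g \<in> borel_measurable borel" "sq_norm f < \<infinity>" "sq_norm g < \<infinity>"
    using assms by (auto simp: L2_iff)
  show ?thesis
    using AE_integrable_bessel_potential[OF m(1,3)] AE_integrable_bessel_potential[OF m(2,4)]
    by eventually_elim (simp add: bessel_potential_def distrib_left)
qed

lemma bessel_potential_pos_AE:
  fixes f :: "real ^ 'n \<Rightarrow> real"
  assumes f: "f \<in> L2" "\<And>x. f x \<ge> 0" and nz: "\<not> (AE x in lborel. f x = 0)"
  shows "AE x in lborel. bessel_potential f x > 0"
proof -
  have m[measurable]: "f \<in> borel_measurable borel" and fin: "sq_norm f < \<infinity>" using f by (auto simp: L2_iff)
  show ?thesis using AE_integrable_bessel_potential[OF m fin]
  proof eventually_elim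
    case (elim x)
    then have i: "integrable lborel (\<lambda>y. bessel_kernel (x - y) * f y)" by simp
    have "bessel_potential f x \<ge> 0" unfolding bessel_potential_def using f(2) by (intro integral_nonneg_AE) auto
    moreover have "bessel_potential f x \<noteq> 0"
    proof
      assume "bessel_potential f x = 0"
      then have "AE y in lborel. bessel_kernel (x - y) * f y = 0"
        using integral_nonneg_eq_0_iff_AE[OF i] f(2) by (simp add: bessel_potential_def)
      then have "AE y in lborel. f y = 0"
        using AE_lborel_singleton[of x]
      proof eventually_elim
        case (elim y)
        then show ?case using bessel_kernel_pos[of "x - y"] by auto
      qed
      then show False using nz by simp
    qed
    ultimately show ?case by simp
  qed
qed

lemma abs_bessel_potential_le_AE:
  fixes f :: "real ^ 'n \<Rightarrow> real"
  assumes f: "f \<in> L2"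
  shows "AE x in lborel. \<bar>bessel_potential f x\<bar> \<le> bessel_potential (\<lambda>y. \<bar>f y\<bar>) x"
proof (rule AE_I2)
  fix x
  have "\<bar>\<integral>y. bessel_kernel (x - y) * f y \<partial>lborel\<bar> \<le> (\<integral>y. \<bar>bessel_kernel (x - y) * f y\<bar> \<partial>lborel)"
    by (rule integral_abs_bound)
  then show "\<bar>bessel_potential f x\<bar> \<le> bessel_potential (\<lambda>y. \<bar>f y\<bar>) x"
    by (simp add: bessel_potential_def abs_mult)
qed

lemma not_AE_False_lborel: "\<not> (AE x in (lborel :: 'a::euclidean_space measure). False)"
  by (subst AE_iff_measurable[OF _ refl]) auto

context choquard_energy
begin

text \<open>The ball rather than the sphere, since Fatou's lemma keeps limits in it; that the
  maximizer has full norm is not imposed.\<close>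

definition unit_radial :: "(real ^ 'n \<Rightarrow> real) set" where
  "unit_radial = {f \<in> L2. radial f \<and> sq_norm f \<le> 1}"

definition max_energy :: ennreal where
  "max_energy = (SUP f\<in>unit_radial. E (bessel_potential f))"

lemma E_pos:
  assumes [measurable]: "u \<in> borel_measurable borel" and pos: "AE x in lborel. u x > 0"
  shows "E u > 0"
proof (rule ccontr)
  assume "\<not> E u > 0"
  then have z: "E u = 0" by simp
  have "AE x in lborel. (\<integral>\<^sup>+y. ennreal (riesz_potential \<alpha> (x - y) * \<bar>u x\<bar> powr p * \<bar>u y\<bar> powr p) \<partial>lborel) = 0"
    using z unfolding E_def energy_def by (subst (asm) nn_integral_0_iff_AE) auto
  then have "AE x in (lborel :: (real ^ 'n) measure). False"
    using pos
  proof eventually_elim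
    case (elim x)
    then have "AE y in lborel. ennreal (riesz_potential \<alpha> (x - y) * \<bar>u x\<bar> powr p * \<bar>u y\<bar> powr p) = 0"
      by (subst (asm) nn_integral_0_iff_AE) auto
    then have "AE y in (lborel :: (real ^ 'n) measure). False"
      using pos AE_lborel_singleton[of x]
    proof eventually_elim
      case (elim y)
      have "riesz_potential \<alpha> (x - y) * \<bar>u x\<bar> powr p * \<bar>u y\<bar> powr p > 0"
        using riesz_potential_pos[OF \<alpha>, of "x - y"] elim(2,3) \<open>u x > 0\<close> by auto
      then show False using elim(1) by (simp add: ennreal_eq_0_iff)
    qed
    then show False by (simp add: not_AE_False_lborel)
  qed
  then show False by (simp add: not_AE_False_lborel)
qed

lemma max_energy_finite: "max_energy < \<infinity>"
proof -
  obtain D where D: "D > 0" "\<And>f \<phi>. f \<in> borel_measurable borel \<Longrightarrow> sq_norm f \<le> ennreal (\<phi>\<^sup>2) \<Longrightarrow> \<phi> > 0 \<Longrightarrow> E (bessel_potential f) \<le> ennreal ((D * \<phi>) powr (2 * p))"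
    by (rule E_bessel_potential_bounded) blast
  have "max_energy \<le> ennreal ((D * 1) powr (2 * p))"
    unfolding max_energy_def by (rule SUP_least) (rule D(2), auto simp: unit_radial_def L2_iff)
  then show ?thesis by (rule le_less_trans) simp
qed

lemma max_energy_pos: "max_energy > 0"
proof -
  define V where "V = measure lborel (ball (0 :: real ^ 'n) 1)"
  have V: "emeasure lborel (ball (0 :: real ^ 'n) 1) = ennreal V"
    unfolding V_def by (rule emeasure_eq_ennreal_measure) (use emeasure_bounded_finite[of "ball (0 :: real ^ 'n) 1"] in auto)
  have V0: "V \<ge> 0" by (simp add: V_def)
  \<comment> \<open>Any positive multiple of the indicator of the unit ball has positive energy;
    this one satisfies c^2 V <= 1, also if V < 1.\<close>
  define c where "c = 1 / (V + 1)"
  have c: "c > 0" using V0 by (simp add: c_def)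
  define f :: "real ^ 'n \<Rightarrow> real" where "f x = c * indicator (ball 0 1) x" for x
  have [measurable]: "f \<in> borel_measurable borel" unfolding f_def
    by (intro borel_measurable_times borel_measurable_const borel_measurable_indicator) simp
  have f0: "f x \<ge> 0" for x using c by (simp add: f_def)
  have "sq_norm f = (\<integral>\<^sup>+x. ennreal (c\<^sup>2) * indicator (ball 0 1) x \<partial>(lborel :: (real ^ 'n) measure))"
    unfolding sq_norm_def f_def by (intro nn_integral_cong) (simp add: indicator_def)
  also have "\<dots> = ennreal (c\<^sup>2) * ennreal V" unfolding V[symmetric] by (rule nn_integral_cmult_indicator) simp
  also have "\<dots> = ennreal (c\<^sup>2 * V)" by (rule ennreal_mult'[symmetric]) simp
  also have "c\<^sup>2 * V \<le> 1"
  proof -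
    have "c * V \<le> 1" "c \<le> 1" using V0 by (auto simp: c_def)
    then have "c * (c * V) \<le> 1 * 1" using c V0 by (intro mult_mono) auto
    then show ?thesis by (simp add: power2_eq_square mult.assoc)
  qed
  finally have f1: "sq_norm f \<le> 1" by (simp add: ennreal_leI)
  have fL: "f \<in> L2" using le_less_trans[OF f1] by (simp add: L2_iff)
  have "radial f" unfolding radial_def f_def by (simp add: indicator_def)
  then have fA: "f \<in> unit_radial" using fL f1 by (simp add: unit_radial_def)
  have "\<not> (AE x in lborel. f x = 0)"
  proof
    assume "AE x in lborel. f x = 0"
    then have "AE x in lborel. x \<notin> ball (0 :: real ^ 'n) 1"
      by eventually_elim (use c in \<open>auto simp: f_def\<close>)
    then have "emeasure lborel (ball (0 :: real ^ 'n) 1) = 0"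
      by (subst (asm) AE_iff_measurable[OF _ refl]) (auto simp: ball_def)
    then show False using unit_ball_vol_pos[of "real CARD('n)"] by (simp add: emeasure_ball)
  qed
  then have "AE x in lborel. bessel_potential f x > 0" by (rule bessel_potential_pos_AE[OF fL f0])
  then have "E (bessel_potential f) > 0" by (intro E_pos) auto
  also have "E (bessel_potential f) \<le> max_energy" unfolding max_energy_def by (rule SUP_upper[OF fA])
  finally show ?thesis .
qed

text \<open>The exponent makes \<open>E\<^sup>1\<^sup>/\<^sup>2\<^sup>p\<close> homogeneous of degree \<open>1\<close>.\<close>

definition max_level :: real where
  "max_level = (enn2real max_energy) powr (1 / (2 * p))"

lemma max_level_pos: "max_level > 0"
proof -
  have "enn2real max_energy > 0" using max_energy_pos max_energy_finite by (simp add: enn2real_positive_iff)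
  then show ?thesis unfolding max_level_def by (simp only: powr_gt_zero)
qed

lemma max_energy_eq: "max_energy = ennreal (max_level powr (2 * p))"
proof -
  have "max_level powr (2 * p) = enn2real max_energy" using p by (simp add: max_level_def powr_powr)
  then show ?thesis using max_energy_finite by simp
qed

lemma E_radial_le:
  assumes f: "f \<in> L2" "radial f" and \<phi>: "sq_norm f \<le> ennreal (\<phi>\<^sup>2)" "\<phi> > 0"
  shows "E (bessel_potential f) \<le> ennreal ((max_level * \<phi>) powr (2 * p))"
proof -
  have [measurable]: "f \<in> borel_measurable borel" using f by (simp add: L2_iff)
  define g where "g x = (1 / \<phi>) * f x" for x
  have "sq_norm g \<le> ennreal ((1 / \<phi>)\<^sup>2) * ennreal (\<phi>\<^sup>2)"
    unfolding g_def by (subst sq_norm_scale) (auto intro!: mult_left_mono \<phi>)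
  also have "\<dots> = 1" using \<phi> by (simp add: ennreal_mult'[symmetric] power_divide)
  finally have g1: "sq_norm g \<le> 1" .
  have gL: "g \<in> L2" unfolding g_def by (rule L2_scale[OF f(1)])
  have "radial g" unfolding radial_def g_def using radialD[OF f(2)] by metis
  then have gA: "g \<in> unit_radial" using gL g1 by (simp add: unit_radial_def)
  have [measurable]: "g \<in> borel_measurable borel" using gL by (simp add: L2_iff)
  have "bessel_potential f = (\<lambda>x. \<phi> * bessel_potential g x)"
    unfolding bessel_potential_scale[symmetric] using \<phi> by (simp add: g_def)
  then have "E (bessel_potential f) = ennreal (\<bar>\<phi>\<bar> powr (2 * p)) * E (bessel_potential g)"
    by (simp add: E_scale)
  also have "\<dots> \<le> ennreal (\<bar>\<phi>\<bar> powr (2 * p)) * ennreal (max_level powr (2 * p))"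
    unfolding max_energy_eq[symmetric] max_energy_def by (intro mult_left_mono SUP_upper gA) simp
  also have "\<dots> = ennreal ((max_level * \<phi>) powr (2 * p))"
    using \<phi> by (simp add: ennreal_mult'[symmetric] powr_mult mult.commute)
  finally show ?thesis .
qed

lemma powr_less_cancel_base:
  assumes "a powr (2 * p) \<le> b powr (2 * p)" "a \<ge> 0" "b \<ge> 0"
  shows "a \<le> b"
  using assms p powr_less_mono2[of "2 * p" b a] by (cases "a \<le> b") auto

section \<open>Strong convergence of a maximizing sequence\<close>

lemma L2_dist_parallelogram:
  fixes f g :: "real ^ 'n \<Rightarrow> real"
  assumes f: "f \<in> L2" "g \<in> L2"
  shows "L2_inner (\<lambda>x. f x - g x) (\<lambda>x. f x - g x) = 2 * L2_inner f f + 2 * L2_inner g g - 4 * L2_inner (\<lambda>x. (1/2) * f x + (1/2) * g x) (\<lambda>x. (1/2) * f x + (1/2) * g x)"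
proof -
  have h: "(\<lambda>x. (1/2) * f x) \<in> L2" "(\<lambda>x. (1/2) * g x) \<in> L2" by (rule L2_scale[OF f(1)], rule L2_scale[OF f(2)])
  have sc: "L2_inner (\<lambda>x. c * u x) (\<lambda>x. c * v x) = c * (c * L2_inner u v)" for c and u v :: "real ^ 'n \<Rightarrow> real"
    by (simp only: L2_inner_scale L2_inner_scale_left)
  have eq: "(\<lambda>x. (1/2) * f x + (1/2) * g x) = (\<lambda>x. (1/2) * f x - (-1) * ((1/2) * g x))" by simp
  have "L2_inner (\<lambda>x. (1/2) * f x + (1/2) * g x) (\<lambda>x. (1/2) * f x + (1/2) * g x) = 1/4 * L2_inner f f + 1/2 * L2_inner f g + 1/4 * L2_inner g g"
    unfolding eq L2_inner_minus_scale_sq[OF h] sc by simp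
  moreover have "L2_inner (\<lambda>x. f x - g x) (\<lambda>x. f x - g x) = L2_inner f f - 2 * L2_inner f g + L2_inner g g"
    using L2_inner_minus_scale_sq[OF f, of 1] by simp
  ultimately show ?thesis by simp
qed

text \<open>Two late terms of the weakly Cauchy maximizing sequence differ by little energy, so by
  the triangle inequality the midpoint h has almost maximal energy and, by homogeneity, norm almost
  1. The parallelogram law in the unit ball then makes the two terms close in L2, and the energy
  passes to the strong limit. Replacing the limit by its absolute value does not lower the energy,
  the kernel being nonnegative.\<close>

lemma maximizer_exists:
  obtains f where "f \<in> unit_radial" "\<And>x. f x \<ge> 0" "E (bessel_potential f) = ennreal (max_level powr (2 * p))"
proof -
  define m where "m = max_level"
  have m: "m > 0" unfolding m_def by (rule max_level_pos)
  define c where "c n = 1 - 1 / (real n + 2)" for n :: nat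
  have c: "0 < c n" "c n < 1" for n by (auto simp: c_def)
  have cmono: "c a \<le> c b" if "a \<le> b" for a b using that by (auto simp: c_def intro!: divide_left_mono)
  have "\<exists>f\<in>unit_radial. ennreal ((m * c n) powr (2 * p)) < E (bessel_potential f)" for n
  proof -
    have "(m * c n) powr (2 * p) < m powr (2 * p)"
      using m c[of n] p by (intro powr_less_mono2) auto
    then have "ennreal ((m * c n) powr (2 * p)) < max_energy" unfolding max_energy_eq m_def[symmetric] by (intro ennreal_lessI) auto
    then show ?thesis unfolding max_energy_def less_SUP_iff .
  qed
  then obtain f where f: "\<And>n. f n \<in> unit_radial" "\<And>n. ennreal ((m * c n) powr (2 * p)) < E (bessel_potential (f n))" by metis
  have fL: "f n \<in> L2" and frad: "radial (f n)" and f1: "sq_norm (f n) \<le> 1" for n using f(1)[of n] by (auto simp: unit_radial_def)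
  obtain s :: "nat \<Rightarrow> nat" where s: "strict_mono s" "\<And>e. e > 0 \<Longrightarrow> \<exists>M. \<forall>m\<ge>M. \<forall>n\<ge>M. E (bessel_potential (\<lambda>x. f (s m) x - f (s n) x)) \<le> ennreal (e powr (2 * p))"
    by (rule E_cauchy_subsequence[of f, OF frad fL f1]) blast
  define F where "F n = f (s n)" for n
  have FL: "F n \<in> L2" and Frad: "radial (F n)" and F1: "sq_norm (F n) \<le> 1" for n by (auto simp: F_def fL frad f1)
  have Fm[measurable]: "F n \<in> borel_measurable borel" for n using FL by (simp add: L2_iff)
  have FE: "ennreal ((m * c n) powr (2 * p)) \<le> E (bessel_potential (F n))" for n
  proof -
    have "(m * c n) powr (2 * p) \<le> (m * c (s n)) powr (2 * p)"
      using m c[of n] p cmono[OF seq_suble[OF s(1)], of n] by (intro powr_mono2 mult_left_mono) auto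
    then show ?thesis using f(2)[of "s n"] unfolding F_def by (meson ennreal_leI less_imp_le order_trans)
  qed
  have cauchy: "\<exists>M. \<forall>i\<ge>M. \<forall>j\<ge>M. sq_norm (\<lambda>x. F i x - F j x) \<le> ennreal e" if e: "e > 0" for e
  proof -
    \<comment> \<open>The final estimate is 4 - 4(1-2d)^2 <= 16d <= e; the cap 1/8 keeps 1 - 2d
      positive.\<close>
    define d where "d = min (e / 16) (1 / 8)"
    have d: "d > 0" "d \<le> 1 / 8" "16 * d \<le> e" using e by (auto simp: d_def)
    obtain M0 where M0: "\<And>i j. i \<ge> M0 \<Longrightarrow> j \<ge> M0 \<Longrightarrow> E (bessel_potential (\<lambda>x. F i x - F j x)) \<le> ennreal ((2 * d * m) powr (2 * p))"
      using s(2)[of "2 * d * m"] d m unfolding F_def by auto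
    obtain M1 :: nat where M1: "1 / d < real M1" using reals_Archimedean2 by blast
    have cd: "c n \<ge> 1 - d" if "n \<ge> M1" for n
    proof -
      have "1 / d < real n + 2" using M1 that by linarith
      then have "1 / (real n + 2) \<le> d" using d by (simp add: field_simps)
      then show ?thesis by (simp add: c_def)
    qed
    show ?thesis
    proof (intro exI[of _ "max M0 M1"] allI impI)
      fix i j assume "max M0 M1 \<le> i" "max M0 M1 \<le> j"
      then have ij: "M0 \<le> i" "M1 \<le> i" "M0 \<le> j" by auto
      define h where "h x = (1/2) * F i x + (1/2) * F j x" for x
      define g where "g x = (1/2) * (F i x - F j x)" for x
      have hL: "h \<in> L2" unfolding h_def by (intro L2_add L2_scale FL)
      have gL: "g \<in> L2" unfolding g_def by (intro L2_scale L2_diff FL)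
      have [measurable]: "h \<in> borel_measurable borel" "g \<in> borel_measurable borel" using hL gL by (auto simp: L2_iff)
      have hrad: "radial h" unfolding radial_def h_def using radialD[OF Frad[of i]] radialD[OF Frad[of j]] by metis
      have Eg: "E (bessel_potential g) \<le> ennreal ((d * m) powr (2 * p))"
      proof -
        have "E (bessel_potential g) = ennreal (\<bar>1/2\<bar> powr (2 * p)) * E (bessel_potential (\<lambda>x. F i x - F j x))"
          unfolding g_def bessel_potential_scale by (rule E_scale) measurable
        also have "\<dots> \<le> ennreal (\<bar>1/2\<bar> powr (2 * p)) * ennreal ((2 * d * m) powr (2 * p))"
          by (intro mult_left_mono M0 ij) simp
        also have "\<dots> = ennreal ((1/2) powr (2 * p) * (2 * d * m) powr (2 * p))" by (simp add: ennreal_mult'[symmetric])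
        also have "(1/2) powr (2 * p) * (2 * d * m) powr (2 * p) = (d * m) powr (2 * p)"
          unfolding powr_mult[symmetric] by simp
        finally show ?thesis .
      qed
      \<comment> \<open>With F i = h + g, near-maximality of F i and the small energy of g = (F i -
        F j)/2 bound the norm of h from below. It is stated for upper bounds H > 0 of that norm
        because the energy estimates require positive constants.\<close>
      have hlow: "c i - d \<le> H" if H: "sq_norm h \<le> ennreal (H\<^sup>2)" "H > 0" for H
      proof -
        have "AE x in lborel. bessel_potential (F i) x = bessel_potential h x + bessel_potential g x"
        proof -
          have "F i = (\<lambda>x. h x + g x)" by (auto simp: h_def g_def field_simps)
          then show ?thesis using bessel_potential_add_AE[OF hL gL] by simp
        qed
        then have "E (bessel_potential (F i)) = E (\<lambda>x. bessel_potential h x + bessel_potential g x)" by (rule E_cong_AE)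
        also have "\<dots> \<le> ennreal ((m * H + d * m) powr (2 * p))"
          by (rule E_triangle[OF _ _ E_radial_le[OF hL hrad H, folded m_def] Eg]) (use m d H in auto)
        finally have "ennreal ((m * c i) powr (2 * p)) \<le> ennreal ((m * H + d * m) powr (2 * p))"
          by (rule order_trans[OF FE])
        then have "(m * c i) powr (2 * p) \<le> (m * H + d * m) powr (2 * p)" by (subst (asm) ennreal_le_iff) auto
        then have "m * c i \<le> m * H + d * m"
          by (rule powr_less_cancel_base) (use m d H c[of i] in auto)
        then have "m * c i \<le> m * (H + d)" by (simp add: distrib_left mult.commute)
        then show ?thesis using m by simp
      qed
      have "(1 - 2 * d)\<^sup>2 \<le> L2_inner h h"
      proof (rule ccontr)
        assume "\<not> ?thesis"
        then have lt: "L2_inner h h < (1 - 2 * d)\<^sup>2" by simp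
        \<comment> \<open>H^2 is halfway between the squared norm of h and (1-2d)^2: a positive
          upper bound for the norm of h, even if h vanishes, yet below 1 - 2d.\<close>
        define H where "H = sqrt ((L2_inner h h + (1 - 2 * d)\<^sup>2) / 2)"
        have pos: "(1 - 2 * d)\<^sup>2 > 0" using d by simp
        have "L2_inner h h + (1 - 2 * d)\<^sup>2 > 0" by (rule add_nonneg_pos[OF L2_inner_self_nonneg pos])
        then have H0: "H > 0" unfolding H_def by (rule real_sqrt_gt_zero[OF divide_pos_pos]) simp
        have H2: "H\<^sup>2 = (L2_inner h h + (1 - 2 * d)\<^sup>2) / 2" unfolding H_def using L2_inner_self_nonneg[of h] by simp
        have "sq_norm h \<le> ennreal (H\<^sup>2)"
          unfolding ennreal_L2_inner_self[OF hL, symmetric] H2 using lt by (intro ennreal_leI) simp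
        from hlow[OF this H0] have "1 - 2 * d \<le> H" using cd[OF ij(2)] by simp
        then have "(1 - 2 * d)\<^sup>2 \<le> H\<^sup>2" using d by (intro power_mono) auto
        then show False unfolding H2 using lt by simp
      qed
      moreover have "L2_inner (F n) (F n) \<le> 1" for n by (rule L2_inner_self_le[OF FL]) (use F1 in auto)
      ultimately have "L2_inner (\<lambda>x. F i x - F j x) (\<lambda>x. F i x - F j x) \<le> 4 - 4 * (1 - 2 * d)\<^sup>2"
        unfolding L2_dist_parallelogram[OF FL FL] h_def[symmetric] by (smt (verit))
      also have "\<dots> \<le> 16 * d" using d by (simp add: power2_eq_square algebra_simps)
      also have "\<dots> \<le> e" by (rule d)
      finally show "sq_norm (\<lambda>x. F i x - F j x) \<le> ennreal e"
        unfolding ennreal_L2_inner_self[OF L2_diff[OF FL FL], symmetric] by (rule ennreal_leI)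
    qed
  qed
  obtain r where r: "strict_mono r" "(\<lambda>x. lim (\<lambda>k. F (r k) x)) \<in> borel_measurable borel"
    "(\<lambda>n. sq_norm (\<lambda>x. F n x - lim (\<lambda>k. F (r k) x))) \<longlonglongrightarrow> 0" "AE x in lborel. convergent (\<lambda>k. F (r k) x)"
    by (rule sq_norm_cauchy_limit[OF Fm cauchy]) blast+
  define f0 where "f0 x = lim (\<lambda>k. F (r k) x)" for x
  have [measurable]: "f0 \<in> borel_measurable borel" unfolding f0_def by (rule r(2))
  have lim0: "(\<lambda>n. sq_norm (\<lambda>x. F n x - f0 x)) \<longlonglongrightarrow> 0" unfolding f0_def by (rule r(3))
  have rad0: "radial f0"
    unfolding radial_def
  proof (intro allI impI)
    fix x y :: "real ^ 'n" assume "norm x = norm y"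
    then have "F (r k) x = F (r k) y" for k by (rule radialD[OF Frad])
    then show "f0 x = f0 y" by (simp add: f0_def)
  qed
  have norm0: "sq_norm f0 \<le> 1"
  proof -
    have "sq_norm f0 = (\<integral>\<^sup>+x. liminf (\<lambda>k. ennreal ((norm (F (r k) x))\<^sup>2)) \<partial>lborel)"
      unfolding sq_norm_def
    proof (rule nn_integral_cong_AE, use r(4) in eventually_elim)
      fix x assume "convergent (\<lambda>k. F (r k) x)"
      then have "(\<lambda>k. F (r k) x) \<longlonglongrightarrow> f0 x" by (simp add: convergent_LIMSEQ_iff f0_def)
      then have "(\<lambda>k. ennreal ((norm (F (r k) x))\<^sup>2)) \<longlonglongrightarrow> ennreal ((norm (f0 x))\<^sup>2)" by (intro tendsto_intros)
      from lim_imp_Liminf[OF sequentially_bot this]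
      show "ennreal ((norm (f0 x))\<^sup>2) = liminf (\<lambda>k. ennreal ((norm (F (r k) x))\<^sup>2))" by (rule sym)
    qed
    also have "\<dots> \<le> liminf (\<lambda>k. sq_norm (F (r k)))" unfolding sq_norm_def by (rule nn_integral_liminf) simp
    also have "\<dots> \<le> liminf (\<lambda>k. 1)" by (rule Liminf_mono) (use F1 in auto)
    finally show ?thesis by (simp add: Liminf_const)
  qed
  have f0L: "f0 \<in> L2" using le_less_trans[OF norm0] by (simp add: L2_iff)
  have f0A: "f0 \<in> unit_radial" using f0L rad0 norm0 by (simp add: unit_radial_def)
  have low: "ennreal (m powr (2 * p)) \<le> E (bessel_potential f0)"
  proof (rule ccontr)
    assume "\<not> ?thesis"
    then have lt: "E (bessel_potential f0) < ennreal (m powr (2 * p))" by simp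
    define Q where "Q = enn2real (E (bessel_potential f0))"
    have Q: "E (bessel_potential f0) = ennreal Q" "Q \<ge> 0" unfolding Q_def using lt by (auto simp: less_top order_less_trans[OF lt])
    have Qm: "Q < m powr (2 * p)" using lt Q by (simp add: ennreal_less_iff)
    \<comment> \<open>The energy level of f0 in the homogeneous scale, raised to m/2 if necessary so
      that it is positive but still below m.\<close>
    define U where "U = max (Q powr (1 / (2 * p))) (m / 2)"
    have U: "U > 0" using m by (simp add: U_def)
    have "Q powr (1 / (2 * p)) < (m powr (2 * p)) powr (1 / (2 * p))" using Q(2) Qm p by (intro powr_less_mono2) auto
    then have "Q powr (1 / (2 * p)) < m" using m p by (simp add: powr_powr)
    then have Um: "U < m" using m by (simp add: U_def)
    have EU: "E (bessel_potential f0) \<le> ennreal (U powr (2 * p))"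
    proof -
      have "Q = (Q powr (1 / (2 * p))) powr (2 * p)" using Q(2) p by (simp add: powr_powr)
      also have "\<dots> \<le> U powr (2 * p)" using p by (intro powr_mono2) (auto simp: U_def)
      finally show ?thesis unfolding Q(1) by (rule ennreal_leI)
    qed
    \<comment> \<open>Both the deficit of F n from m and the energy level of F n - f0 are then at
      most a quarter of m - U, so F n cannot reach its level from U.\<close>
    define \<phi> where "\<phi> = (m - U) / (4 * m)"
    have \<phi>: "\<phi> > 0" "m * \<phi> = (m - U) / 4" using Um m by (auto simp: \<phi>_def)
    have "eventually (\<lambda>n. sq_norm (\<lambda>x. F n x - f0 x) < ennreal (\<phi>\<^sup>2)) sequentially"
      by (rule order_tendstoD(2)[OF lim0]) (use \<phi> in auto)
    then obtain n0 where n0: "\<And>n. n \<ge> n0 \<Longrightarrow> sq_norm (\<lambda>x. F n x - f0 x) < ennreal (\<phi>\<^sup>2)" by (auto simp: eventually_sequentially)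
    obtain n1 :: nat where n1: "1 / \<phi> < real n1" using reals_Archimedean2 by blast
    define n where "n = max n0 n1"
    have n: "n \<ge> n0" "1 / \<phi> < real n + 2" using n1 by (auto simp: n_def max_def)
    have "1 / (real n + 2) \<le> \<phi>" using n(2) \<phi>(1) by (simp add: field_simps)
    then have cn: "c n \<ge> 1 - \<phi>" by (simp add: c_def)
    define g where "g x = F n x - f0 x" for x
    have gL: "g \<in> L2" unfolding g_def by (rule L2_diff[OF FL f0L])
    have grad: "radial g" unfolding g_def by (rule radial_diff[OF Frad rad0])
    have [measurable]: "g \<in> borel_measurable borel" using gL by (simp add: L2_iff)
    have Eg: "E (bessel_potential g) \<le> ennreal ((m * \<phi>) powr (2 * p))"
      unfolding m_def by (rule E_radial_le[OF gL grad]) (use n0[OF n(1)] \<phi> in \<open>auto simp: g_def[abs_def]\<close>)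
    have "F n = (\<lambda>x. f0 x + g x)" by (auto simp: g_def)
    then have "AE x in lborel. bessel_potential (F n) x = bessel_potential f0 x + bessel_potential g x"
      using bessel_potential_add_AE[OF f0L gL] by simp
    then have "E (bessel_potential (F n)) = E (\<lambda>x. bessel_potential f0 x + bessel_potential g x)" by (rule E_cong_AE)
    also have "\<dots> \<le> ennreal ((U + m * \<phi>) powr (2 * p))"
      by (rule E_triangle[OF _ _ EU Eg]) (use U m \<phi> in auto)
    finally have "ennreal ((m * c n) powr (2 * p)) \<le> ennreal ((U + m * \<phi>) powr (2 * p))" by (rule order_trans[OF FE])
    then have "(m * c n) powr (2 * p) \<le> (U + m * \<phi>) powr (2 * p)" by (subst (asm) ennreal_le_iff) auto
    then have a: "m * c n \<le> U + m * \<phi>" by (rule powr_less_cancel_base) (use m \<phi> U c[of n] in auto)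
    have b: "m * (1 - \<phi>) \<le> m * c n" using cn m by (intro mult_left_mono) auto
    have "m * (1 - \<phi>) = m - (m - U) / 4" unfolding right_diff_distrib \<phi>(2) by simp
    then have "m - (m - U) / 4 \<le> U + (m - U) / 4" using order_trans[OF b a] unfolding \<phi>(2) by (simp only:)
    then show False using Um by (simp add: field_simps)
  qed
  define f1 where "f1 x = \<bar>f0 x\<bar>" for x
  have [measurable]: "f1 \<in> borel_measurable borel" unfolding f1_def by measurable
  have sq1: "sq_norm f1 = sq_norm f0" by (simp add: sq_norm_def f1_def)
  have "radial f1" unfolding radial_def
  proof (intro allI impI)
    fix x y :: "real ^ 'n" assume "norm x = norm y"
    from radialD[OF rad0 this] show "f1 x = f1 y" by (simp add: f1_def)
  qed
  moreover have "f1 \<in> L2" using norm0 le_less_trans[OF norm0] by (simp add: L2_iff sq1)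
  ultimately have f1A: "f1 \<in> unit_radial" using norm0 by (simp add: unit_radial_def sq1)
  have "E (bessel_potential f0) \<le> E (bessel_potential f1)"
  proof (rule E_mono_AE)
    show "AE x in lborel. \<bar>bessel_potential f0 x\<bar> \<le> \<bar>bessel_potential f1 x\<bar>"
      using abs_bessel_potential_le_AE[OF f0L] unfolding f1_def[abs_def] by (auto elim: eventually_mono)
  qed
  then have low1: "ennreal (m powr (2 * p)) \<le> E (bessel_potential f1)" using low by (rule order_trans[rotated])
  have "E (bessel_potential f1) \<le> ennreal (m powr (2 * p))"
    unfolding m_def max_energy_eq[symmetric] max_energy_def by (rule SUP_upper[OF f1A])
  then have "E (bessel_potential f1) = ennreal (max_level powr (2 * p))" using low1 by (simp add: m_def)
  then show ?thesis using f1A by (intro that[of f1]) (auto simp: f1_def)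
qed

end

section \<open>The Euler-Lagrange equation\<close>

lemma ennreal_bessel_potential_AE:
  fixes \<psi> :: "real ^ 'n \<Rightarrow> real"
  assumes \<psi>: "\<psi> \<in> L2" "\<And>x. \<psi> x \<ge> 0"
  shows "AE y in lborel. ennreal (bessel_potential \<psi> y) = (\<integral>\<^sup>+x. ennreal (bessel_kernel (y - x)) * ennreal (\<psi> x) \<partial>lborel)"
proof -
  have m[measurable]: "\<psi> \<in> borel_measurable borel" and fin: "sq_norm \<psi> < \<infinity>" using \<psi> by (auto simp: L2_iff)
  show ?thesis using AE_integrable_bessel_potential[OF m fin]
  proof eventually_elim
    case (elim y)
    then have i: "integrable lborel (\<lambda>x. bessel_kernel (y - x) * \<psi> x)" by simp
    have "ennreal (bessel_potential \<psi> y) = (\<integral>\<^sup>+x. ennreal (bessel_kernel (y - x) * \<psi> x) \<partial>lborel)"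
      unfolding bessel_potential_def using nn_integral_eq_integral[OF i] \<psi>(2) by simp
    then show ?case using \<psi>(2) by (simp add: ennreal_mult')
  qed
qed

text \<open>Convolution with an even kernel is symmetric, by Tonelli. R is extended-valued so that
  this applies to the nonlinearity before it is known to be finite.\<close>

lemma bessel_duality:
  fixes \<psi> :: "real ^ 'n \<Rightarrow> real" and R :: "real ^ 'n \<Rightarrow> ennreal"
  assumes \<psi>: "\<psi> \<in> L2" "\<And>x. \<psi> x \<ge> 0" and [measurable]: "R \<in> borel_measurable borel"
  shows "(\<integral>\<^sup>+y. R y * ennreal (bessel_potential \<psi> y) \<partial>lborel) =
    (\<integral>\<^sup>+x. ennreal (\<psi> x) * (\<integral>\<^sup>+y. ennreal (bessel_kernel (x - y)) * R y \<partial>lborel) \<partial>lborel)"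
proof -
  have [measurable]: "\<psi> \<in> borel_measurable borel" using \<psi> by (auto simp: L2_iff)
  have "(\<integral>\<^sup>+y. R y * ennreal (bessel_potential \<psi> y) \<partial>lborel) =
      (\<integral>\<^sup>+y. (\<integral>\<^sup>+x. R y * (ennreal (bessel_kernel (y - x)) * ennreal (\<psi> x)) \<partial>lborel) \<partial>lborel)"
    by (rule nn_integral_cong_AE, use ennreal_bessel_potential_AE[OF \<psi>] in eventually_elim) (simp add: nn_integral_cmult)
  also have "\<dots> = (\<integral>\<^sup>+x. (\<integral>\<^sup>+y. R y * (ennreal (bessel_kernel (y - x)) * ennreal (\<psi> x)) \<partial>lborel) \<partial>lborel)"
    by (rule lborel_pair.Fubini') measurable
  also have "\<dots> = (\<integral>\<^sup>+x. (\<integral>\<^sup>+y. ennreal (\<psi> x) * (ennreal (bessel_kernel (x - y)) * R y) \<partial>lborel) \<partial>lborel)"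
  proof (intro nn_integral_cong)
    fix x y
    show "R y * (ennreal (bessel_kernel (y - x)) * ennreal (\<psi> x)) = ennreal (\<psi> x) * (ennreal (bessel_kernel (x - y)) * R y)"
      unfolding bessel_kernel_minus[of y x] by (simp only: mult_ac)
  qed
  also have "\<dots> = (\<integral>\<^sup>+x. ennreal (\<psi> x) * (\<integral>\<^sup>+y. ennreal (bessel_kernel (x - y)) * R y \<partial>lborel) \<partial>lborel)"
    by (simp add: nn_integral_cmult)
  finally show ?thesis .
qed

lemma radial_nn_convolution:
  fixes K :: "real ^ 'n \<Rightarrow> real" and g :: "real ^ 'n \<Rightarrow> ennreal"
  assumes K: "radial K" and g: "radial g" and [measurable]: "K \<in> borel_measurable borel" "g \<in> borel_measurable borel"
  shows "radial (\<lambda>x. \<integral>\<^sup>+y. ennreal (K (x - y)) * g y \<partial>lborel)"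
  unfolding radial_def
proof (intro allI impI)
  fix x y :: "real ^ 'n" assume "norm x = norm y"
  then obtain Q where Q: "orthogonal_transformation Q" "Q x = y" by (rule orthogonal_transformation_exists)
  have lin: "linear Q" using Q(1) by (rule orthogonal_transformation_linear)
  have nQ: "norm (Q z) = norm z" for z by (rule orthogonal_transformation_norm[OF Q(1)])
  have "(\<integral>\<^sup>+z. ennreal (K (y - z)) * g z \<partial>lborel) = (\<integral>\<^sup>+z. ennreal (K (y - Q z)) * g (Q z) \<partial>lborel)"
    by (rule nn_integral_orthogonal[OF Q(1), symmetric]) measurable
  also have "\<dots> = (\<integral>\<^sup>+z. ennreal (K (x - z)) * g z \<partial>lborel)"
  proof (intro nn_integral_cong)
    fix z
    have "norm (y - Q z) = norm (x - z)" using nQ[of "x - z"] Q(2) by (simp add: linear_diff[OF lin])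
    then show "ennreal (K (y - Q z)) * g (Q z) = ennreal (K (x - z)) * g z"
      using radialD[OF K, of "y - Q z" "x - z"] radialD[OF g, of "Q z" z] nQ by simp
  qed
  finally show "(\<integral>\<^sup>+z. ennreal (K (x - z)) * g z \<partial>lborel) = (\<integral>\<^sup>+z. ennreal (K (y - z)) * g z \<partial>lborel)" by simp
qed

lemma radial_bessel_kernel: "radial (bessel_kernel :: real ^ 'n \<Rightarrow> real)"
  unfolding radial_def using bessel_kernel_cong by blast

lemma radial_riesz_potential: "radial (riesz_potential \<alpha> :: real ^ 'n \<Rightarrow> real)"
  unfolding radial_def using riesz_potential_cong by blast

text \<open>The L2 norm by duality, testing W against its own truncations. Truncations in |x| and in
  height of a radial W are radial, so the dual bound on radial test functions is enough; monotone
  convergence removes the truncation.\<close>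

lemma nn_integral_square_le_of_dual:
  fixes W :: "real ^ 'n \<Rightarrow> ennreal"
  assumes [measurable]: "W \<in> borel_measurable borel" and rad: "radial W" and L: "L > 0"
    and dual: "\<And>\<psi> \<phi>. \<psi> \<in> L2 \<Longrightarrow> radial \<psi> \<Longrightarrow> (\<And>x. \<psi> x \<ge> 0) \<Longrightarrow> \<phi> > 0 \<Longrightarrow> sq_norm \<psi> \<le> ennreal (\<phi>\<^sup>2) \<Longrightarrow>
      (\<integral>\<^sup>+x. ennreal (\<psi> x) * W x \<partial>lborel) \<le> ennreal (L * \<phi>)"
  shows "(\<integral>\<^sup>+x. W x * W x \<partial>lborel) \<le> ennreal (L\<^sup>2)"
proof -
  define P where "P k x = (if norm x \<le> real k then min (W x) (of_nat k) else 0)" for k :: nat and x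
  have [measurable]: "P k \<in> borel_measurable borel" for k unfolding P_def by measurable
  have Pk: "P k x \<le> of_nat k" and PW: "P k x \<le> W x" for k x by (auto simp: P_def)
  have bd: "(\<integral>\<^sup>+x. P k x * P k x \<partial>lborel) \<le> ennreal (L\<^sup>2)" for k
  proof -
    define \<psi> where "\<psi> x = enn2real (P k x)" for x
    have [measurable]: "\<psi> \<in> borel_measurable borel" unfolding \<psi>_def by measurable
    have eP: "ennreal (\<psi> x) = P k x" for x
      unfolding \<psi>_def using Pk[of k x] by (intro ennreal_enn2real) (auto simp: less_top[symmetric] top_unique)
    have \<psi>0: "\<psi> x \<ge> 0" for x by (simp add: \<psi>_def)
    have \<psi>k: "\<psi> x \<le> real k" for x
    proof -
      have "ennreal (\<psi> x) \<le> ennreal (real k)" unfolding eP using Pk[of k x] by (simp add: ennreal_of_nat_eq_real_of_nat)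
      then show ?thesis by simp
    qed
    have "sq_norm \<psi> \<le> (\<integral>\<^sup>+x. ennreal ((real k)\<^sup>2) * indicator (cball 0 (real k)) x \<partial>(lborel :: (real ^ 'n) measure))"
      unfolding sq_norm_def
    proof (rule nn_integral_mono)
      fix x :: "real ^ 'n"
      show "ennreal ((norm (\<psi> x))\<^sup>2) \<le> ennreal ((real k)\<^sup>2) * indicator (cball 0 (real k)) x"
      proof (cases "norm x \<le> real k")
        case True
        have "(norm (\<psi> x))\<^sup>2 \<le> (real k)\<^sup>2" using \<psi>k[of x] \<psi>0[of x] by (intro power_mono) auto
        from ennreal_leI[OF this] show ?thesis using True by (simp add: indicator_def)
      qed (simp add: \<psi>_def P_def)
    qed
    also have "\<dots> = ennreal ((real k)\<^sup>2) * emeasure lborel (cball (0 :: real ^ 'n) (real k))" by (rule nn_integral_cmult_indicator) simp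
    also have "\<dots> < \<infinity>" using emeasure_bounded_finite[of "cball (0 :: real ^ 'n) (real k)"] by (simp add: ennreal_mult_less_top)
    finally have \<psi>L: "\<psi> \<in> L2" by (simp add: L2_iff)
    have \<psi>r: "radial \<psi>" unfolding radial_def
    proof (intro allI impI)
      fix x y :: "real ^ 'n" assume xy: "norm x = norm y"
      then show "\<psi> x = \<psi> y" using radialD[OF rad xy] by (simp add: \<psi>_def P_def)
    qed
    define S where "S = L2_inner \<psi> \<psi>"
    have S: "sq_norm \<psi> = ennreal S" "S \<ge> 0" unfolding S_def using ennreal_L2_inner_self[OF \<psi>L] L2_inner_self_nonneg by auto
    have sq: "(\<integral>\<^sup>+x. P k x * P k x \<partial>lborel) = sq_norm \<psi>"
      unfolding sq_norm_def eP[symmetric] using \<psi>0 by (intro nn_integral_cong) (simp add: ennreal_mult'[symmetric] power2_eq_square)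
    have "S \<le> L\<^sup>2"
    proof (cases "S = 0")
      case False
      then have s: "sqrt S > 0" using S(2) by simp
      have "ennreal S = (\<integral>\<^sup>+x. P k x * P k x \<partial>lborel)" by (simp add: sq S(1))
      also have "\<dots> \<le> (\<integral>\<^sup>+x. ennreal (\<psi> x) * W x \<partial>lborel)"
        unfolding eP by (intro nn_integral_mono mult_left_mono PW) simp
      also have "\<dots> \<le> ennreal (L * sqrt S)" by (rule dual[OF \<psi>L \<psi>r \<psi>0 s]) (use S in simp)
      finally have "S \<le> L * sqrt S" using L S(2) by (subst (asm) ennreal_le_iff) auto
      then have "sqrt S * sqrt S \<le> L * sqrt S" using S(2) by simp
      then have "sqrt S \<le> L" by (rule mult_right_le_imp_le[OF _ s])
      then have "(sqrt S)\<^sup>2 \<le> L\<^sup>2" using s by (intro power_mono) auto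
      then show ?thesis using S(2) by simp
    qed simp
    then show ?thesis unfolding sq S(1) by (rule ennreal_leI)
  qed
  have "(\<lambda>k. \<integral>\<^sup>+x. P k x * P k x \<partial>lborel) \<longlonglongrightarrow> (\<integral>\<^sup>+x. W x * W x \<partial>lborel)"
  proof (rule nn_integral_LIMSEQ)
    have "P k x \<le> P (Suc k) x" for k x
    proof -
      have "(of_nat k :: ennreal) \<le> of_nat (Suc k)" by (rule of_nat_mono) simp
      then have "min (W x) (of_nat k) \<le> min (W x) (of_nat (Suc k))" by (intro min.mono) auto
      then show ?thesis by (auto simp: P_def simp del: of_nat_Suc)
    qed
    then show "incseq (\<lambda>k x. P k x * P k x)" by (intro incseq_SucI le_funI mult_mono) auto
    fix x :: "real ^ 'n"
    have "(\<lambda>k. min (W x) (of_nat k)) \<longlonglongrightarrow> min (W x) top"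
      by (intro tendsto_min tendsto_const of_nat_tendsto_top_ennreal)
    moreover have "eventually (\<lambda>k. min (W x) (of_nat k) = P k x) sequentially"
    proof -
      obtain k0 :: nat where k0: "norm x \<le> real k0" using real_arch_simple by blast
      show ?thesis
      proof (rule eventually_mono[OF eventually_ge_at_top[of k0]])
        fix k assume "k0 \<le> k"
        then have "norm x \<le> real k" using k0 by (meson of_nat_mono order_trans)
        then show "min (W x) (of_nat k) = P k x" by (simp add: P_def)
      qed
    qed
    ultimately have "(\<lambda>k. P k x) \<longlonglongrightarrow> min (W x) top" by (rule Lim_transform_eventually)
    then have "(\<lambda>k. P k x) \<longlonglongrightarrow> W x" by simp
    then show "(\<lambda>k. P k x * P k x) \<longlonglongrightarrow> W x * W x"
      by (intro tendsto_mult_ennreal) auto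
  qed measurable
  then show ?thesis by (rule LIMSEQ_le_const2) (use bd in auto)
qed

text \<open>With \<open>u = bessel_potential f\<close>, the equation with a quarter power inverted on both sides:
  \<open>f = (- \<Delta> + id)\<^sup>1\<^sup>/\<^sup>4 u\<close> and \<open>bessel_potential (choquard_rhs \<alpha> p u) = f\<close>. The nonnegative integral avoids
  any integrability side condition.\<close>

definition choquard_strong :: "real \<Rightarrow> real \<Rightarrow> (real ^ 'n \<Rightarrow> real) \<Rightarrow> bool" where
  "choquard_strong \<alpha> p f \<longleftrightarrow> f \<in> L2 \<and> (\<forall>x. f x \<ge> 0) \<and>
     (AE x in lborel. integrable lborel (\<lambda>y. riesz_potential \<alpha> (x - y) * \<bar>bessel_potential f y\<bar> powr p)) \<and>
     (AE x in lborel. (\<integral>\<^sup>+y. ennreal (bessel_kernel (x - y)) * ennreal (choquard_rhs \<alpha> p (bessel_potential f) y) \<partial>lborel) = ennreal (f x))"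

lemma bessel_potential_nonneg: "(\<And>x. f x \<ge> 0) \<Longrightarrow> bessel_potential f x \<ge> 0" for f :: "real ^ 'n \<Rightarrow> real"
  unfolding bessel_potential_def by (intro integral_nonneg_AE) auto

lemma powr_abs_mult_self:
  fixes x p :: real
  assumes "x \<ge> 0"
  shows "\<bar>x\<bar> powr (p - 2) * x = \<bar>x\<bar> powr (p - 1)"
proof (cases "x = 0")
  case False
  then have "x powr (p - 2) * x powr 1 = x powr (p - 1)" unfolding powr_add[symmetric] by simp
  then show ?thesis using False assms by simp
qed simp

section \<open>The nonlinearity at the maximizer\<close>

context choquard_energy
begin

text \<open>Extended-valued counterpart of \<open>choquard_rhs\<close> for u >= 0. It records
  divergence of the Riesz integral as infinity, where the Bochner integral would silently give
  0.\<close>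

definition nonlinearity :: "(real ^ 'n \<Rightarrow> real) \<Rightarrow> real ^ 'n \<Rightarrow> ennreal" where
  "nonlinearity u y = (\<integral>\<^sup>+x. ennreal (riesz_potential \<alpha> (y - x)) * ennreal (\<bar>u x\<bar> powr p) \<partial>lborel) * ennreal (\<bar>u y\<bar> powr (p - 1))"

lemma nonlinearity_measurable [measurable]:
  assumes [measurable]: "u \<in> borel_measurable borel"
  shows "nonlinearity u \<in> borel_measurable borel"
  unfolding nonlinearity_def[abs_def] by measurable

lemma energy_nonlinearity:
  assumes [measurable]: "u \<in> borel_measurable borel" "v \<in> borel_measurable borel"
  shows "energy (riesz_potential \<alpha>) (\<lambda>x. \<bar>u x\<bar> powr p) (\<lambda>x. \<bar>u x\<bar> powr (p - 1) * \<bar>v x\<bar>) = (\<integral>\<^sup>+y. nonlinearity u y * ennreal \<bar>v y\<bar> \<partial>lborel)"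
proof -
  have "energy (riesz_potential \<alpha>) (\<lambda>x. \<bar>u x\<bar> powr p) (\<lambda>x. \<bar>u x\<bar> powr (p - 1) * \<bar>v x\<bar>) =
     energy (riesz_potential \<alpha>) (\<lambda>x. \<bar>u x\<bar> powr (p - 1) * \<bar>v x\<bar>) (\<lambda>x. \<bar>u x\<bar> powr p)"
    by (rule energy_commute) (use riesz_pd in \<open>auto simp: positive_definite_kernel_def\<close>)
  also have "\<dots> = (\<integral>\<^sup>+y. nonlinearity u y * ennreal \<bar>v y\<bar> \<partial>lborel)"
    unfolding energy_def
  proof (rule nn_integral_cong)
    fix x
    have "ennreal (riesz_potential \<alpha> (x - y) * (\<bar>u x\<bar> powr (p - 1) * \<bar>v x\<bar>) * \<bar>u y\<bar> powr p) =
      (ennreal (\<bar>u x\<bar> powr (p - 1)) * ennreal \<bar>v x\<bar>) * (ennreal (riesz_potential \<alpha> (x - y)) * ennreal (\<bar>u y\<bar> powr p))" for y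
      using riesz_potential_nonneg[OF \<alpha>] by (simp add: ennreal_mult'[symmetric] mult_ac)
    then have "(\<integral>\<^sup>+y. ennreal (riesz_potential \<alpha> (x - y) * (\<bar>u x\<bar> powr (p - 1) * \<bar>v x\<bar>) * \<bar>u y\<bar> powr p) \<partial>lborel) =
      (ennreal (\<bar>u x\<bar> powr (p - 1)) * ennreal \<bar>v x\<bar>) * (\<integral>\<^sup>+y. ennreal (riesz_potential \<alpha> (x - y)) * ennreal (\<bar>u y\<bar> powr p) \<partial>lborel)"
      by (simp only:) (rule nn_integral_cmult, measurable)
    then show "(\<integral>\<^sup>+y. ennreal (riesz_potential \<alpha> (x - y) * (\<bar>u x\<bar> powr (p - 1) * \<bar>v x\<bar>) * \<bar>u y\<bar> powr p) \<partial>lborel) = nonlinearity u x * ennreal \<bar>v x\<bar>"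
      by (simp only: nonlinearity_def mult_ac)
  qed
  finally show ?thesis .
qed

lemma radial_nonlinearity:
  assumes [measurable]: "u \<in> borel_measurable borel" and u: "radial u"
  shows "radial (nonlinearity u)"
proof -
  have up: "radial (\<lambda>x. ennreal (\<bar>u x\<bar> powr p))" unfolding radial_def
  proof (intro allI impI)
    fix x y :: "real ^ 'n" assume "norm x = norm y"
    from radialD[OF u this] show "ennreal (\<bar>u x\<bar> powr p) = ennreal (\<bar>u y\<bar> powr p)" by simp
  qed
  have r: "radial (\<lambda>y. \<integral>\<^sup>+x. ennreal (riesz_potential \<alpha> (y - x)) * ennreal (\<bar>u x\<bar> powr p) \<partial>lborel)"
    by (rule radial_nn_convolution[OF radial_riesz_potential up]) auto
  show ?thesis unfolding radial_def
  proof (intro allI impI)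
    fix x y :: "real ^ 'n" assume "norm x = norm y"
    from radialD[OF r this] radialD[OF u this] show "nonlinearity u x = nonlinearity u y" by (simp add: nonlinearity_def)
  qed
qed

text \<open>Put L = m^(2p) and let W be the potential of the nonlinearity. Hoelder's inequality for
  the energy, with \<open>E_radial_le\<close> for the test potential, gives |W| <= L in L2 norm,
  while the pairing of W with f is the energy itself, L. As f has norm at most 1, the squared
  distance of W and L f is at most L^2 - 2L^2 + L^2 = 0.\<close>

lemma euler_lagrange:
  assumes f: "f \<in> unit_radial" "\<And>x. f x \<ge> 0" and max: "E (bessel_potential f) = ennreal (max_level powr (2 * p))"
  shows "AE x in lborel. (\<integral>\<^sup>+y. ennreal (bessel_kernel (x - y)) * nonlinearity (bessel_potential f) y \<partial>lborel) = ennreal (max_level powr (2 * p) * f x)"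
proof -
  define m where "m = max_level"
  have m: "m > 0" unfolding m_def by (rule max_level_pos)
  define L where "L = m powr (2 * p)"
  have L: "L > 0" using m by (simp add: L_def)
  have fL: "f \<in> L2" and frad: "radial f" and f1: "sq_norm f \<le> 1" using f(1) by (auto simp: unit_radial_def)
  have [measurable]: "f \<in> borel_measurable borel" using fL by (simp add: L2_iff)
  define u where "u = bessel_potential f"
  have [measurable]: "u \<in> borel_measurable borel" unfolding u_def by measurable
  have urad: "radial u" unfolding u_def bessel_potential_eq_convolution by (rule radial_convolution[OF radial_bessel_kernel frad]) auto
  define R where "R = nonlinearity u"
  have [measurable]: "R \<in> borel_measurable borel" unfolding R_def by measurable
  have Rrad: "radial R" unfolding R_def by (rule radial_nonlinearity[OF _ urad]) simp
  define W where "W x = (\<integral>\<^sup>+y. ennreal (bessel_kernel (x - y)) * R y \<partial>lborel)" for x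
  have [measurable]: "W \<in> borel_measurable borel" unfolding W_def by measurable
  have Wrad: "radial W" unfolding W_def by (rule radial_nn_convolution[OF radial_bessel_kernel Rrad]) auto
  have dual: "(\<integral>\<^sup>+x. ennreal (\<psi> x) * W x \<partial>lborel) = energy (riesz_potential \<alpha>) (\<lambda>x. \<bar>u x\<bar> powr p) (\<lambda>x. \<bar>u x\<bar> powr (p - 1) * \<bar>bessel_potential \<psi> x\<bar>)"
    if \<psi>: "\<psi> \<in> L2" "\<And>x. \<psi> x \<ge> 0" for \<psi>
  proof -
    have [measurable]: "\<psi> \<in> borel_measurable borel" using \<psi> by (simp add: L2_iff)
    have "(\<integral>\<^sup>+x. ennreal (\<psi> x) * W x \<partial>lborel) = (\<integral>\<^sup>+y. R y * ennreal (bessel_potential \<psi> y) \<partial>lborel)"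
      unfolding W_def by (rule bessel_duality[OF \<psi>, symmetric]) simp
    also have "\<dots> = (\<integral>\<^sup>+y. R y * ennreal \<bar>bessel_potential \<psi> y\<bar> \<partial>lborel)"
      using bessel_potential_nonneg[of \<psi>, OF \<psi>(2)] by simp
    also have "\<dots> = energy (riesz_potential \<alpha>) (\<lambda>x. \<bar>u x\<bar> powr p) (\<lambda>x. \<bar>u x\<bar> powr (p - 1) * \<bar>bessel_potential \<psi> x\<bar>)"
      unfolding R_def by (rule energy_nonlinearity[symmetric]) auto
    finally show ?thesis .
  qed
  have Eu: "E u = ennreal (m powr (2 * p))" using max by (simp add: u_def m_def)
  have W2: "(\<integral>\<^sup>+x. W x * W x \<partial>lborel) \<le> ennreal (L\<^sup>2)"
  proof (rule nn_integral_square_le_of_dual[OF _ Wrad L])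
    fix \<psi> :: "real ^ 'n \<Rightarrow> real" and \<phi> :: real
    assume \<psi>: "\<psi> \<in> L2" "radial \<psi>" "\<And>x. \<psi> x \<ge> 0" and \<phi>: "\<phi> > 0" "sq_norm \<psi> \<le> ennreal (\<phi>\<^sup>2)"
    have [measurable]: "\<psi> \<in> borel_measurable borel" using \<psi> by (simp add: L2_iff)
    have "(\<integral>\<^sup>+x. ennreal (\<psi> x) * W x \<partial>lborel) \<le> ennreal (m powr (2 * p - 1) * (m * \<phi>))"
      unfolding dual[OF \<psi>(1,3)]
      by (rule energy_holder[OF riesz_pd p]) (use Eu E_radial_le[OF \<psi>(1,2) \<phi>(2,1)] m \<phi> in \<open>auto simp: E_def m_def\<close>)
    also have "m powr (2 * p - 1) * (m * \<phi>) = L * \<phi>"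
    proof -
      have "m powr (2 * p - 1) * m powr 1 = L" unfolding powr_add[symmetric] L_def by simp
      then show ?thesis using m by (simp flip: mult.assoc)
    qed
    finally show "(\<integral>\<^sup>+x. ennreal (\<psi> x) * W x \<partial>lborel) \<le> ennreal (L * \<phi>)" .
  qed simp
  define w where "w x = enn2real (W x)" for x
  have [measurable]: "w \<in> borel_measurable borel" unfolding w_def by measurable
  have w0: "w x \<ge> 0" for x by (simp add: w_def)
  have Wfin: "(\<integral>\<^sup>+x. W x * W x \<partial>lborel) < \<infinity>" by (rule le_less_trans[OF W2]) simp
  have "AE x in lborel. W x * W x \<noteq> \<infinity>"
    by (rule nn_integral_PInf_AE) (use Wfin in auto)
  then have Ww: "AE x in lborel. W x = ennreal (w x)"
    by eventually_elim (auto simp: w_def less_top[symmetric] ennreal_mult_eq_top_iff)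
  have w2: "sq_norm w \<le> ennreal (L\<^sup>2)"
  proof -
    have "sq_norm w = (\<integral>\<^sup>+x. W x * W x \<partial>lborel)"
      unfolding sq_norm_def
      by (rule nn_integral_cong_AE, use Ww in eventually_elim) (use w0 in \<open>simp add: ennreal_mult'[symmetric] power2_eq_square\<close>)
    then show ?thesis using W2 by simp
  qed
  have wL: "w \<in> L2" using le_less_trans[OF w2] by (simp add: L2_iff)
  have fw: "L2_inner w f = L"
  proof -
    have "(\<integral>\<^sup>+x. ennreal (f x) * W x \<partial>lborel) = E u"
    proof -
      have "\<bar>u x\<bar> powr (p - 1) * \<bar>bessel_potential f x\<bar> = \<bar>u x\<bar> powr p" for x
      proof (cases "u x = 0")
        case False
        then have "\<bar>u x\<bar> powr (p - 1) * \<bar>u x\<bar> powr 1 = \<bar>u x\<bar> powr p" unfolding powr_add[symmetric] by simp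
        then show ?thesis using False by (simp add: u_def)
      qed (simp add: u_def)
      then show ?thesis unfolding dual[OF fL f(2)] E_def by simp
    qed
    then have "ennreal L = (\<integral>\<^sup>+x. ennreal (f x) * W x \<partial>lborel)" using Eu by (simp add: L_def)
    also have "\<dots> = (\<integral>\<^sup>+x. ennreal (w x * f x) \<partial>lborel)"
      by (rule nn_integral_cong_AE, use Ww in eventually_elim) (use f(2) w0 in \<open>simp add: ennreal_mult'[symmetric] mult.commute\<close>)
    also have "\<dots> = ennreal (L2_inner w f)"
      unfolding L2_inner_def by (rule nn_integral_eq_integral[OF L2_mult_integrable[OF wL fL]]) (use f(2) w0 in auto)
    finally show ?thesis
      using L f(2) w0 by (subst (asm) ennreal_inj) (auto simp: L2_inner_def intro!: integral_nonneg_AE)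
  qed
  have "L2_inner (\<lambda>x. w x - L * f x) (\<lambda>x. w x - L * f x) = L2_inner w w - 2 * L * L + L\<^sup>2 * L2_inner f f"
    unfolding L2_inner_minus_scale_sq[OF wL fL] fw ..
  also have "\<dots> \<le> L\<^sup>2 - 2 * L * L + L\<^sup>2 * 1"
    by (intro add_mono diff_right_mono mult_left_mono L2_inner_self_le[OF wL w2] L2_inner_self_le[OF fL]) (use f1 in auto)
  also have "\<dots> = 0" by (simp add: power2_eq_square)
  finally have "sq_norm (\<lambda>x. w x - L * f x) \<le> 0"
    unfolding ennreal_L2_inner_self[OF L2_diff[OF wL L2_scale[OF fL]], symmetric] by (simp add: ennreal_eq_0_iff)
  then have "AE x in lborel. w x - L * f x = 0"
    by (subst sq_norm_eq_0[symmetric]) auto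
  then show ?thesis using Ww
    unfolding W_def R_def u_def L_def m_def by eventually_elim simp
qed

text \<open>The finite energy is the integral of the nonlinearity times u; since u > 0 almost
  everywhere, the inner Riesz integral must be finite almost everywhere. Positivity of u uses that f
  is not almost everywhere 0, its energy being positive.\<close>

lemma nonlinearity_finite_AE:
  assumes f: "f \<in> unit_radial" "\<And>x. f x \<ge> 0" and max: "E (bessel_potential f) = ennreal (max_level powr (2 * p))"
  shows "AE x in lborel. bessel_potential f x > 0"
    "AE x in lborel. (\<integral>\<^sup>+y. ennreal (riesz_potential \<alpha> (x - y)) * ennreal (\<bar>bessel_potential f y\<bar> powr p) \<partial>lborel) < \<infinity>"
proof -
  define u where "u = bessel_potential f"
  have fL: "f \<in> L2" using f by (simp add: unit_radial_def)
  have uL: "u \<in> L2" unfolding u_def by (rule bessel_potential_L2[OF fL])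
  have [measurable]: "u \<in> borel_measurable borel" "f \<in> borel_measurable borel" using uL fL by (auto simp: L2_iff)
  have nz: "\<not> (AE x in lborel. f x = 0)"
  proof
    assume z: "AE x in lborel. f x = 0"
    have "u = bessel_potential (\<lambda>x. 0)" unfolding u_def
      by (rule bessel_potential_cong_AE) (use z in auto)
    then have "u = (\<lambda>x. 0)" by (simp add: bessel_potential_def[abs_def])
    then have "E u = 0" by (simp add: E_def energy_def)
    moreover have "max_level powr (2 * p) > 0" using max_level_pos by (simp only: powr_gt_zero)
    ultimately show False using max unfolding u_def[symmetric] by simp
  qed
  show pos: "AE x in lborel. bessel_potential f x > 0" by (rule bessel_potential_pos_AE[OF fL f(2) nz])
  have "(\<lambda>x. \<bar>u x\<bar> powr (p - 1) * \<bar>u x\<bar>) = (\<lambda>x. \<bar>u x\<bar> powr p)"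
  proof
    fix x
    show "\<bar>u x\<bar> powr (p - 1) * \<bar>u x\<bar> = \<bar>u x\<bar> powr p"
    proof (cases "u x = 0")
      case False
      then have "\<bar>u x\<bar> powr (p - 1) * \<bar>u x\<bar> powr 1 = \<bar>u x\<bar> powr p" unfolding powr_add[symmetric] by simp
      then show ?thesis using False by simp
    qed simp
  qed
  then have "(\<integral>\<^sup>+y. nonlinearity u y * ennreal \<bar>u y\<bar> \<partial>lborel) = E u"
    using energy_nonlinearity[of u u] by (simp add: E_def)
  then have fin: "(\<integral>\<^sup>+y. nonlinearity u y * ennreal \<bar>u y\<bar> \<partial>lborel) < \<infinity>" using max by (simp add: u_def)
  have "AE y in lborel. nonlinearity u y * ennreal \<bar>u y\<bar> \<noteq> \<infinity>"
    by (rule nn_integral_PInf_AE) (use fin in auto)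
  then show "AE x in lborel. (\<integral>\<^sup>+y. ennreal (riesz_potential \<alpha> (x - y)) * ennreal (\<bar>bessel_potential f y\<bar> powr p) \<partial>lborel) < \<infinity>"
    using pos
  proof eventually_elim
    case (elim x)
    have u0: "u x > 0" using elim(2) by (simp add: u_def)
    have "(\<integral>\<^sup>+y. ennreal (riesz_potential \<alpha> (x - y)) * ennreal (\<bar>u y\<bar> powr p) \<partial>lborel) \<noteq> \<infinity>"
    proof
      assume "(\<integral>\<^sup>+y. ennreal (riesz_potential \<alpha> (x - y)) * ennreal (\<bar>u y\<bar> powr p) \<partial>lborel) = \<infinity>"
      then have "nonlinearity u x * ennreal \<bar>u x\<bar> = \<infinity>" using u0 by (simp add: nonlinearity_def ennreal_top_mult)
      then show False using elim(1) by simp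
    qed
    then show ?case unfolding u_def[symmetric] by (simp add: less_top)
  qed
qed

lemma choquard_strong_exists:
  obtains f where "choquard_strong \<alpha> p (f :: real ^ 'n \<Rightarrow> real)" "\<not> (AE x in lborel. bessel_potential f x = 0)"
proof -
  obtain f :: "real ^ 'n \<Rightarrow> real" where f: "f \<in> unit_radial" "\<And>x. f x \<ge> 0" and max: "E (bessel_potential f) = ennreal (max_level powr (2 * p))"
    by (rule maximizer_exists) blast
  define u where "u = bessel_potential f"
  define m where "m = max_level"
  have m: "m > 0" unfolding m_def by (rule max_level_pos)
  \<comment> \<open>The nonlinearity is homogeneous of degree 2p - 1, so c f solves the equation
    exactly when c^(2p-1) m^(2p) = c.\<close>
  define c where "c = m powr (- p / (p - 1))"
  have c: "c > 0" using m by (simp add: c_def)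
  have fL: "f \<in> L2" using f by (simp add: unit_radial_def)
  have uL: "u \<in> L2" unfolding u_def by (rule bessel_potential_L2[OF fL])
  have [measurable]: "u \<in> borel_measurable borel" using uL by (auto simp: L2_iff)
  note pos = nonlinearity_finite_AE(1)[OF f max] and fin = nonlinearity_finite_AE(2)[OF f max]
  define g where "g x = c * f x" for x
  have gu: "bessel_potential g = (\<lambda>x. c * u x)" unfolding g_def u_def by (rule bessel_potential_scale)
  have int: "AE x in lborel. integrable lborel (\<lambda>y. riesz_potential \<alpha> (x - y) * \<bar>c * u y\<bar> powr p)
     \<and> ennreal (choquard_rhs \<alpha> p (\<lambda>x. c * u x) x) = ennreal (c powr (2 * p - 1)) * nonlinearity u x"
    using pos fin
  proof eventually_elim
    case (elim x)
    let ?A = "\<integral>\<^sup>+y. ennreal (riesz_potential \<alpha> (x - y)) * ennreal (\<bar>u y\<bar> powr p) \<partial>lborel"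
    have Aeq: "?A = (\<integral>\<^sup>+y. ennreal (riesz_potential \<alpha> (x - y) * \<bar>u y\<bar> powr p) \<partial>lborel)"
      by (intro nn_integral_cong) (simp add: ennreal_mult'')
    have i: "integrable lborel (\<lambda>y. riesz_potential \<alpha> (x - y) * \<bar>u y\<bar> powr p)"
      using elim(2) riesz_potential_nonneg[OF \<alpha>] unfolding u_def[symmetric] Aeq
      by (intro integrableI_nonneg) auto
    have A: "ennreal (\<integral>y. riesz_potential \<alpha> (x - y) * \<bar>u y\<bar> powr p \<partial>lborel) = ?A"
      unfolding Aeq by (rule nn_integral_eq_integral[OF i, symmetric]) (use riesz_potential_nonneg[OF \<alpha>] in auto)
    have eq: "riesz_potential \<alpha> (x - y) * \<bar>c * u y\<bar> powr p = c powr p * (riesz_potential \<alpha> (x - y) * \<bar>u y\<bar> powr p)" for y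
      using c by (simp add: abs_mult powr_mult)
    have ux: "u x > 0" using elim(1) by (simp add: u_def)
    have "choquard_rhs \<alpha> p (\<lambda>x. c * u x) x = c powr p * (\<integral>y. riesz_potential \<alpha> (x - y) * \<bar>u y\<bar> powr p \<partial>lborel) * (\<bar>c * u x\<bar> powr (p - 2) * (c * u x))"
      unfolding choquard_rhs_def Defs.convolution_def eq by simp
    also have "\<bar>c * u x\<bar> powr (p - 2) * (c * u x) = c powr (p - 1) * \<bar>u x\<bar> powr (p - 1)"
      using powr_abs_mult_self[of "c * u x" p] c ux by (simp add: abs_mult powr_mult)
    also have "c powr p * (\<integral>y. riesz_potential \<alpha> (x - y) * \<bar>u y\<bar> powr p \<partial>lborel) * (c powr (p - 1) * \<bar>u x\<bar> powr (p - 1)) =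
       c powr (2 * p - 1) * ((\<integral>y. riesz_potential \<alpha> (x - y) * \<bar>u y\<bar> powr p \<partial>lborel) * \<bar>u x\<bar> powr (p - 1))"
    proof -
      have e: "c powr (2 * p - 1) = c powr p * c powr (p - 1)" unfolding powr_add[symmetric] by simp
      show ?thesis unfolding e by (simp only: mult_ac)
    qed
    finally have "ennreal (choquard_rhs \<alpha> p (\<lambda>x. c * u x) x) = ennreal (c powr (2 * p - 1)) * (?A * ennreal (\<bar>u x\<bar> powr (p - 1)))"
      unfolding A[symmetric] by (simp add: ennreal_mult' ennreal_mult'')
    then show ?case using i unfolding eq nonlinearity_def by simp
  qed
  have sc: "c powr (2 * p - 1) * m powr (2 * p) = c"
  proof -
    have "c powr (2 * p - 2) = m powr (- p / (p - 1) * (2 * p - 2))" by (simp add: c_def powr_powr)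
    also have "- p / (p - 1) * (2 * p - 2) = - (2 * p)" using p by (simp add: field_simps)
    finally have "c powr (2 * p - 2) * m powr (2 * p) = 1" using m by (simp add: powr_minus)
    moreover have "c powr (2 * p - 1) = c * c powr (2 * p - 2)" using c powr_add[of c 1 "2 * p - 2"] by simp
    ultimately show ?thesis by simp
  qed
  have eq: "AE x in lborel. (\<integral>\<^sup>+y. ennreal (bessel_kernel (x - y)) * ennreal (choquard_rhs \<alpha> p (bessel_potential g) y) \<partial>lborel) = ennreal (g x)"
    using euler_lagrange[OF f max]
  proof eventually_elim
    case (elim x)
    have "(\<integral>\<^sup>+y. ennreal (bessel_kernel (x - y)) * ennreal (choquard_rhs \<alpha> p (bessel_potential g) y) \<partial>lborel) =
       (\<integral>\<^sup>+y. ennreal (c powr (2 * p - 1)) * (ennreal (bessel_kernel (x - y)) * nonlinearity u y) \<partial>lborel)"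
      by (rule nn_integral_cong_AE, use int in eventually_elim) (simp add: gu mult.left_commute)
    also have "\<dots> = ennreal (c powr (2 * p - 1)) * (\<integral>\<^sup>+y. ennreal (bessel_kernel (x - y)) * nonlinearity u y \<partial>lborel)"
      by (rule nn_integral_cmult) measurable
    also have "\<dots> = ennreal (c powr (2 * p - 1)) * ennreal (m powr (2 * p) * f x)" using elim by (simp add: u_def m_def)
    also have "\<dots> = ennreal (c powr (2 * p - 1) * m powr (2 * p) * f x)" by (simp add: ennreal_mult'[symmetric] mult.assoc)
    finally show ?case by (simp add: sc g_def)
  qed
  show thesis
  proof (rule that)
    show "choquard_strong \<alpha> p g"
      unfolding choquard_strong_def
    proof (intro conjI allI)
      show "g \<in> L2" unfolding g_def by (rule L2_scale[OF fL])
      show "0 \<le> g x" for x using c f(2) by (simp add: g_def)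
      show "AE x in lborel. integrable lborel (\<lambda>y. riesz_potential \<alpha> (x - y) * \<bar>bessel_potential g y\<bar> powr p)"
        unfolding gu using int by (rule eventually_mono) simp
    qed (rule eq)
    show "\<not> (AE x in lborel. bessel_potential g x = 0)"
    proof
      assume "AE x in lborel. bessel_potential g x = 0"
      then have "AE x in (lborel :: (real ^ 'n) measure). False" using pos
        by eventually_elim (use c in \<open>simp add: gu u_def\<close>)
      then show False using not_AE_False_lborel by blast
    qed
  qed
qed

end

section \<open>Solutions and their translates\<close>

lemma choquard_rhs_measurable [measurable]:
  fixes u :: "real ^ 'n \<Rightarrow> real"
  assumes [measurable]: "u \<in> borel_measurable borel"
  shows "choquard_rhs \<alpha> p u \<in> borel_measurable borel"
  unfolding choquard_rhs_def[abs_def] Defs.convolution_def by measurable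

text \<open>Tonelli moves the Bessel kernel from \<psi> to the right-hand side, where the strong
  equation turns it into f. Integrability of the product is read off from the finite value, as
  everything is nonnegative.\<close>

lemma choquard_strong_integral:
  fixes f \<psi> :: "real ^ 'n \<Rightarrow> real"
  assumes \<alpha>: "0 < \<alpha>" "\<alpha> < real CARD('n)" and f: "choquard_strong \<alpha> p f" and \<psi>: "\<psi> \<in> L2" "\<And>x. \<psi> x \<ge> 0"
  defines "R \<equiv> choquard_rhs \<alpha> p (bessel_potential f)"
  shows "integrable lborel (\<lambda>x. R x * bessel_potential \<psi> x)"
    "(\<integral>x. R x * bessel_potential \<psi> x \<partial>lborel) = (\<integral>x. f x * \<psi> x \<partial>lborel)"
proof -
  have fL: "f \<in> L2" and f0: "\<And>x. f x \<ge> 0" using f by (auto simp: choquard_strong_def)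
  have u0: "bessel_potential f x \<ge> 0" for x by (rule bessel_potential_nonneg[OF f0])
  have [measurable]: "bessel_potential f \<in> borel_measurable borel" using bessel_potential_L2[OF fL] by (auto simp: L2_iff)
  have [measurable]: "bessel_potential \<psi> \<in> borel_measurable borel" using bessel_potential_L2[OF \<psi>(1)] by (auto simp: L2_iff)
  have [measurable]: "R \<in> borel_measurable borel" unfolding R_def by measurable
  have R0: "R x \<ge> 0" for x unfolding R_def choquard_rhs_def Defs.convolution_def
    using u0 riesz_potential_nonneg[OF \<alpha>] by (intro mult_nonneg_nonneg integral_nonneg_AE) auto
  have \<psi>0: "bessel_potential \<psi> x \<ge> 0" for x by (rule bessel_potential_nonneg[OF \<psi>(2)])
  have i: "integrable lborel (\<lambda>x. f x * \<psi> x)" by (rule L2_mult_integrable[OF fL \<psi>(1)])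
  have "(\<integral>\<^sup>+x. ennreal (R x * bessel_potential \<psi> x) \<partial>lborel) = (\<integral>\<^sup>+x. ennreal (R x) * ennreal (bessel_potential \<psi> x) \<partial>lborel)"
    using R0 by (simp add: ennreal_mult')
  also have "\<dots> = (\<integral>\<^sup>+x. ennreal (\<psi> x) * (\<integral>\<^sup>+y. ennreal (bessel_kernel (x - y)) * ennreal (R y) \<partial>lborel) \<partial>lborel)"
    by (rule bessel_duality[OF \<psi>]) measurable
  also have "\<dots> = (\<integral>\<^sup>+x. ennreal (f x * \<psi> x) \<partial>lborel)"
  proof (rule nn_integral_cong_AE)
    have "AE x in lborel. (\<integral>\<^sup>+y. ennreal (bessel_kernel (x - y)) * ennreal (R y) \<partial>lborel) = ennreal (f x)"
      using f unfolding choquard_strong_def R_def by blast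
    then show "AE x in lborel. ennreal (\<psi> x) * (\<integral>\<^sup>+y. ennreal (bessel_kernel (x - y)) * ennreal (R y) \<partial>lborel) = ennreal (f x * \<psi> x)"
      by eventually_elim (simp only: ennreal_mult'[OF f0] mult.commute[of "ennreal (\<psi> _)"])
  qed
  also have "\<dots> = ennreal (\<integral>x. f x * \<psi> x \<partial>lborel)"
    by (rule nn_integral_eq_integral[OF i]) (use f0 \<psi> in auto)
  finally have e: "(\<integral>\<^sup>+x. ennreal (R x * bessel_potential \<psi> x) \<partial>lborel) = ennreal (\<integral>x. f x * \<psi> x \<partial>lborel)" .
  show "integrable lborel (\<lambda>x. R x * bessel_potential \<psi> x)"
    using e R0 \<psi>0 by (intro integrableI_nonneg) auto
  show "(\<integral>x. R x * bessel_potential \<psi> x \<partial>lborel) = (\<integral>x. f x * \<psi> x \<partial>lborel)"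
  proof (rule integral_eq_nn_integral[THEN trans])
    show "enn2real (\<integral>\<^sup>+x. ennreal (R x * bessel_potential \<psi> x) \<partial>lborel) = (\<integral>x. f x * \<psi> x \<partial>lborel)"
      unfolding e using f0 \<psi> by (intro enn2real_ennreal integral_nonneg_AE) auto
  qed (use R0 \<psi>0 in auto)
qed

lemma choquard_strong_imp_solution:
  fixes f :: "real ^ 'n \<Rightarrow> real"
  assumes \<alpha>: "0 < \<alpha>" "\<alpha> < real CARD('n)" and f: "choquard_strong \<alpha> p f"
  shows "choquard_solution \<alpha> p (bessel_potential f)"
proof -
  define R where "R = choquard_rhs \<alpha> p (bessel_potential f)"
  have fL: "f \<in> L2" using f by (auto simp: choquard_strong_def)
  have [measurable]: "f \<in> borel_measurable borel" using fL by (auto simp: L2_iff)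
  have uL: "bessel_potential f \<in> L2" by (rule bessel_potential_L2[OF fL])
  have [measurable]: "bessel_potential f \<in> borel_measurable borel" using uL by (auto simp: L2_iff)
  have [measurable]: "R \<in> borel_measurable borel" unfolding R_def by measurable
  note uH = bessel_op_AE_eq[OF uL fL AE_I2[OF refl]]
  have uB: "bessel_op (1 / 4) (bessel_potential f) \<in> L2" by (rule bessel_op_L2_potential(1)[OF uH(1)])
  have main: "integrable lborel (\<lambda>x. R x * \<phi> x) \<and>
      (\<integral>x. bessel_op (1 / 4) (bessel_potential f) x * bessel_op (1 / 4) \<phi> x \<partial>lborel) = (\<integral>x. R x * \<phi> x \<partial>lborel)" if \<phi>: "\<phi> \<in> H_half" for \<phi>
  proof -
    define \<psi> where "\<psi> = bessel_op (1 / 4) \<phi>"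
    have \<psi>L: "\<psi> \<in> L2" and \<phi>\<psi>: "AE x in lborel. \<phi> x = bessel_potential \<psi> x"
      unfolding \<psi>_def using bessel_op_L2_potential[OF \<phi>] by auto
    have [measurable]: "\<psi> \<in> borel_measurable borel" using \<psi>L by (auto simp: L2_iff)
    have [measurable]: "\<phi> \<in> borel_measurable borel" using \<phi> by (auto simp: H_half_def L2_iff)
    \<comment> \<open>The strong equation is tested with nonnegative functions only; the positive
      and negative parts of \<psi> reach every element of \<open>H_half\<close>.\<close>
    define \<psi>1 \<psi>2 where "\<psi>1 x = max (\<psi> x) 0" and "\<psi>2 x = max (- \<psi> x) 0" for x
    have [measurable]: "\<psi>1 \<in> borel_measurable borel" "\<psi>2 \<in> borel_measurable borel" unfolding \<psi>1_def \<psi>2_def by measurable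
    have "sq_norm \<psi>1 \<le> sq_norm \<psi>" "sq_norm \<psi>2 \<le> sq_norm \<psi>" unfolding sq_norm_def \<psi>1_def \<psi>2_def
      by (intro nn_integral_mono ennreal_leI power_mono; simp add: max_def)+
    then have L: "\<psi>1 \<in> L2" "\<psi>2 \<in> L2" using \<psi>L by (auto simp: L2_iff intro: le_less_trans)
    have nn: "\<psi>1 x \<ge> 0" "\<psi>2 x \<ge> 0" for x by (auto simp: \<psi>1_def \<psi>2_def)
    have \<psi>eq: "\<psi> = (\<lambda>x. \<psi>1 x - \<psi>2 x)" by (auto simp: \<psi>1_def \<psi>2_def max_def)
    have fin: "sq_norm \<psi>1 < \<infinity>" "sq_norm \<psi>2 < \<infinity>" using L by (auto simp: L2_iff)
    have T: "AE x in lborel. \<phi> x = bessel_potential \<psi>1 x - bessel_potential \<psi>2 x"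
      using \<phi>\<psi> bessel_potential_diff_AE[OF _ _ fin] unfolding \<psi>eq by (auto elim: eventually_elim2)
    have [measurable]: "bessel_potential \<psi>1 \<in> borel_measurable borel" "bessel_potential \<psi>2 \<in> borel_measurable borel"
      using L bessel_potential_L2[of \<psi>1] bessel_potential_L2[of \<psi>2] by (auto simp: L2_iff)
    have s1: "integrable lborel (\<lambda>x. R x * bessel_potential \<psi>1 x)" "(\<integral>x. R x * bessel_potential \<psi>1 x \<partial>lborel) = (\<integral>x. f x * \<psi>1 x \<partial>lborel)"
      unfolding R_def by (rule choquard_strong_integral[OF \<alpha> f L(1) nn(1)])+
    have s2: "integrable lborel (\<lambda>x. R x * bessel_potential \<psi>2 x)" "(\<integral>x. R x * bessel_potential \<psi>2 x \<partial>lborel) = (\<integral>x. f x * \<psi>2 x \<partial>lborel)"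
      unfolding R_def by (rule choquard_strong_integral[OF \<alpha> f L(2) nn(2)])+
    have ae: "AE x in lborel. R x * \<phi> x = R x * bessel_potential \<psi>1 x - R x * bessel_potential \<psi>2 x"
      using T by eventually_elim (simp add: right_diff_distrib)
    have "integrable lborel (\<lambda>x. R x * bessel_potential \<psi>1 x - R x * bessel_potential \<psi>2 x)"
      using s1 s2 by (intro Bochner_Integration.integrable_diff)
    then have i: "integrable lborel (\<lambda>x. R x * \<phi> x)"
      by (subst integrable_cong_AE[OF _ _ ae]) auto
    have "(\<integral>x. R x * \<phi> x \<partial>lborel) = (\<integral>x. R x * bessel_potential \<psi>1 x - R x * bessel_potential \<psi>2 x \<partial>lborel)"
      by (rule integral_cong_AE[OF _ _ ae]) auto
    also have "\<dots> = (\<integral>x. f x * \<psi>1 x \<partial>lborel) - (\<integral>x. f x * \<psi>2 x \<partial>lborel)"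
      using s1 s2 by simp
    also have "\<dots> = (\<integral>x. f x * \<psi>1 x - f x * \<psi>2 x \<partial>lborel)"
      by (rule Bochner_Integration.integral_diff[symmetric]; rule L2_mult_integrable[OF fL]; rule L)
    also have "\<dots> = (\<integral>x. f x * \<psi> x \<partial>lborel)" unfolding \<psi>eq by (simp add: right_diff_distrib)
    also have "\<dots> = (\<integral>x. bessel_op (1 / 4) (bessel_potential f) x * \<psi> x \<partial>lborel)"
    proof (rule integral_cong_AE)
      show "(\<lambda>x. bessel_op (1 / 4) (bessel_potential f) x * \<psi> x) \<in> borel_measurable lborel"
        using uB by (intro borel_measurable_times) (auto simp: L2_iff)
      show "AE x in lborel. f x * \<psi> x = bessel_op (1 / 4) (bessel_potential f) x * \<psi> x"
        using uH(2) by eventually_elim simp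
    qed simp
    finally show ?thesis using i by (simp add: \<psi>_def)
  qed
  show ?thesis
    unfolding choquard_solution_def R_def[symmetric] using uH(1) f main by (auto simp: choquard_strong_def)
qed

section \<open>Translates of a solution are distinct\<close>

lemma convolution_translate:
  fixes K g :: "real ^ 'n \<Rightarrow> real"
  assumes [measurable]: "K \<in> borel_measurable borel" "g \<in> borel_measurable borel"
  shows "Defs.convolution K (\<lambda>y. g (y + a)) x = Defs.convolution K g (x + a)"
proof -
  have "Defs.convolution K (\<lambda>y. g (y + a)) x = (\<integral>y. (\<lambda>z. K (x + a - z) * g z) (y + a) \<partial>lborel)"
    unfolding Defs.convolution_def by simp
  also have "\<dots> = (\<integral>z. K (x + a - z) * g z \<partial>lborel)" by (rule integral_translate) measurable
  finally show ?thesis by (simp add: Defs.convolution_def)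
qed

lemma choquard_strong_translate:
  fixes f :: "real ^ 'n \<Rightarrow> real"
  assumes f: "choquard_strong \<alpha> p f"
  shows "choquard_strong \<alpha> p (\<lambda>x. f (x + a))" "bessel_potential (\<lambda>x. f (x + a)) = (\<lambda>x. bessel_potential f (x + a))"
proof -
  define u where "u = bessel_potential f"
  have fL: "f \<in> L2" using f by (auto simp: choquard_strong_def)
  have [measurable]: "f \<in> borel_measurable borel" using fL by (auto simp: L2_iff)
  have [measurable]: "u \<in> borel_measurable borel" using bessel_potential_L2[OF fL] by (auto simp: L2_iff u_def)
  show T: "bessel_potential (\<lambda>x. f (x + a)) = (\<lambda>x. bessel_potential f (x + a))"
    unfolding bessel_potential_eq_convolution by (rule ext, rule convolution_translate) measurable
  have R: "choquard_rhs \<alpha> p (\<lambda>x. u (x + a)) y = choquard_rhs \<alpha> p u (y + a)" for y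
    using convolution_translate[of "riesz_potential \<alpha>" "\<lambda>y. \<bar>u y\<bar> powr p" a y] unfolding choquard_rhs_def by simp
  have sq: "sq_norm (\<lambda>x. f (x + a)) = sq_norm f" unfolding sq_norm_def
    by (rule nn_integral_translate) measurable
  show "choquard_strong \<alpha> p (\<lambda>x. f (x + a))"
    unfolding choquard_strong_def T u_def[symmetric] R
  proof (intro conjI allI)
    show "(\<lambda>x. f (x + a)) \<in> L2" using fL sq by (simp add: L2_iff)
    show "f (x + a) \<ge> 0" for x using f by (simp add: choquard_strong_def)
    have "AE x in lborel. integrable lborel (\<lambda>y. riesz_potential \<alpha> (x + a - y) * \<bar>u y\<bar> powr p)"
      by (rule AE_translate) (use f in \<open>auto simp: choquard_strong_def u_def\<close>)
    then show "AE x in lborel. integrable lborel (\<lambda>y. riesz_potential \<alpha> (x - y) * \<bar>u (y + a)\<bar> powr p)"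
      by (rule eventually_mono) (drule integrable_translate[where a=a], simp)
    have "AE x in lborel. (\<integral>\<^sup>+y. ennreal (bessel_kernel (x + a - y)) * ennreal (choquard_rhs \<alpha> p u y) \<partial>lborel) = ennreal (f (x + a))"
      by (rule AE_translate) (use f in \<open>auto simp: choquard_strong_def u_def\<close>)
    then show "AE x in lborel. (\<integral>\<^sup>+y. ennreal (bessel_kernel (x - y)) * ennreal (choquard_rhs \<alpha> p u (y + a)) \<partial>lborel) = ennreal (f (x + a))"
    proof (rule eventually_mono)
      fix x
      have "(\<integral>\<^sup>+y. (\<lambda>z. ennreal (bessel_kernel (x + a - z)) * ennreal (choquard_rhs \<alpha> p u z)) (y + a) \<partial>lborel) =
          (\<integral>\<^sup>+y. ennreal (bessel_kernel (x + a - y)) * ennreal (choquard_rhs \<alpha> p u y) \<partial>lborel)"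
        by (rule nn_integral_translate) measurable
      moreover assume "(\<integral>\<^sup>+y. ennreal (bessel_kernel (x + a - y)) * ennreal (choquard_rhs \<alpha> p u y) \<partial>lborel) = ennreal (f (x + a))"
      ultimately show "(\<integral>\<^sup>+y. ennreal (bessel_kernel (x - y)) * ennreal (choquard_rhs \<alpha> p u (y + a)) \<partial>lborel) = ennreal (f (x + a))" by simp
    qed
  qed
qed

text \<open>Translates of a ball by widely spaced multiples of the period are disjoint and carry the
  same mass, so m times that mass is bounded by the finite \<open>sq_norm u\<close> for every
  m.\<close>

lemma L2_periodic_AE_zero:
  fixes u :: "real ^ 'n \<Rightarrow> real"
  assumes u: "u \<in> L2" and d: "d \<noteq> 0" and per: "AE x in lborel. u (x + d) = u x"
  shows "AE x in lborel. u x = 0"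
proof -
  have [measurable]: "u \<in> borel_measurable borel" using u by (simp add: L2_iff)
  have per': "AE x in lborel. u (x + of_nat k *\<^sub>R d) = u x" for k :: nat
  proof (induction k)
    case (Suc k)
    have "AE x in lborel. u (x + of_nat k *\<^sub>R d + d) = u (x + of_nat k *\<^sub>R d)" by (rule AE_translate[OF per])
    with Suc show ?case by eventually_elim (simp add: algebra_simps)
  qed simp
  have ball0: "(\<integral>\<^sup>+z. ennreal ((u z)\<^sup>2) * indicator (ball 0 \<rho>) z \<partial>lborel) = 0" if \<rho>: "\<rho> > 0" for \<rho> :: real
  proof -
    let ?c = "\<integral>\<^sup>+z. ennreal ((u z)\<^sup>2) * indicator (ball 0 \<rho>) z \<partial>lborel"
    \<comment> \<open>Steps of M periods are at least a diameter 2\<rho> long, which makes the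
      translated balls disjoint.\<close>
    obtain M :: nat where M: "2 * \<rho> / norm d \<le> of_nat M" using real_arch_simple by blast
    have M': "2 * \<rho> \<le> of_nat M * norm d" using M d by (simp add: field_simps)
    define y where "y k = of_nat (k * M) *\<^sub>R d" for k :: nat
    have b: "of_nat m * ?c \<le> sq_norm u" for m
    proof (rule disjoint_balls_mass[where y=y and \<rho>=\<rho>])
      fix i j :: nat assume ij: "i \<noteq> j"
      have "dist (y i) (y j) = \<bar>real i - real j\<bar> * (real M * norm d)"
        unfolding y_def dist_norm scaleR_diff_left[symmetric] by (simp add: abs_mult left_diff_distrib[symmetric])
      moreover have "\<bar>real i - real j\<bar> \<ge> 1" using ij by linarith
      moreover have "real M * norm d \<ge> 0" by simp
      ultimately have "dist (y i) (y j) \<ge> 1 * (real M * norm d)" by (simp only: mult_right_mono)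
      then show "2 * \<rho> \<le> dist (y i) (y j)" using M' by simp
    next
      fix i
      have [measurable]: "(indicator (ball (y i) \<rho>) :: _ \<Rightarrow> ennreal) \<in> borel_measurable borel"
        by (rule borel_measurable_indicator) simp
      have "(\<integral>\<^sup>+z. ennreal ((u z)\<^sup>2) * indicator (ball (y i) \<rho>) z \<partial>lborel) =
        (\<integral>\<^sup>+z. (\<lambda>z. ennreal ((u z)\<^sup>2) * indicator (ball (y i) \<rho>) z) (z + y i) \<partial>lborel)"
        by (rule nn_integral_translate[symmetric]) measurable
      also have "\<dots> = ?c"
      proof (rule nn_integral_cong_AE, use per'[of "i * M"] in eventually_elim)
        fix z assume "u (z + of_nat (i * M) *\<^sub>R d) = u z"
        then have "u (z + y i) = u z" by (simp only: y_def)
        moreover have "z + y i \<in> ball (y i) \<rho> \<longleftrightarrow> z \<in> ball 0 \<rho>" by (simp add: dist_norm)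
        ultimately show "ennreal ((u (z + y i))\<^sup>2) * indicator (ball (y i) \<rho>) (z + y i) = ennreal ((u z)\<^sup>2) * indicator (ball 0 \<rho>) z"
          by (simp add: indicator_def)
      qed
      finally show "(\<integral>\<^sup>+z. ennreal ((u z)\<^sup>2) * indicator (ball (y i) \<rho>) z \<partial>lborel) = ?c" .
    qed simp
    show "?c = 0"
    proof (rule ccontr)
      assume nz: "?c \<noteq> 0"
      have "(\<lambda>m. of_nat m * ?c) \<longlonglongrightarrow> top * ?c"
        by (intro tendsto_mult_ennreal of_nat_tendsto_top_ennreal tendsto_const) (use nz in auto)
      then have "top * ?c \<le> sq_norm u" by (rule LIMSEQ_le_const2) (use b in auto)
      then show False using nz u by (simp add: ennreal_top_mult L2_iff)
    qed
  qed
  have "AE z in lborel. \<forall>k::nat. ennreal ((u z)\<^sup>2) * indicator (ball 0 (real k + 1)) z = 0"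
  proof (subst AE_all_countable, rule allI)
    fix k :: nat
    have [measurable]: "(indicator (ball 0 (real k + 1)) :: real ^ 'n \<Rightarrow> ennreal) \<in> borel_measurable borel"
      by (rule borel_measurable_indicator) simp
    have m: "(\<lambda>z. ennreal ((u z)\<^sup>2) * indicator (ball 0 (real k + 1)) z) \<in> borel_measurable lborel" by measurable
    show "AE z in lborel. ennreal ((u z)\<^sup>2) * indicator (ball 0 (real k + 1)) z = 0"
      by (rule iffD1[OF nn_integral_0_iff_AE[OF m]]) (rule ball0, simp)
  qed
  then show ?thesis
  proof (rule eventually_mono)
    fix z assume z: "\<forall>k::nat. ennreal ((u z)\<^sup>2) * indicator (ball 0 (real k + 1)) z = 0"
    obtain k :: nat where "norm z \<le> real k" using real_arch_simple by blast
    then have "z \<in> ball 0 (real k + 1)" by simp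
    then show "u z = 0" using spec[OF z, of k] by (simp add: ennreal_eq_0_iff)
  qed
qed

theorem theorem1p2:
  fixes \<alpha> p :: real
  assumes "CARD('n::finite) \<ge> 2"
    and "0 < \<alpha>" and "\<alpha> < real CARD('n)"
    and "(real CARD('n) + \<alpha>) / real CARD('n) < p"
    and "p < (real CARD('n) + \<alpha>) / (real CARD('n) - 1)"
  shows "infinite ({u :: real ^ 'n \<Rightarrow> real. choquard_solution \<alpha> p u} // ae_equal_H_half)"
proof -
  obtain q1 r1 q2 r2 C where adm: "admissible_exponents (real CARD('n)) q1 r1" "admissible_exponents (real CARD('n)) q2 r2" "C > 0"
    "\<And>(u :: real ^ 'n \<Rightarrow> real) V. u \<in> borel_measurable borel \<Longrightarrow> V > 0 \<Longrightarrow>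
       (\<integral>\<^sup>+x. ennreal (\<bar>u x\<bar> powr q1) \<partial>lborel) \<le> ennreal (V powr q1) \<Longrightarrow>
       (\<integral>\<^sup>+x. ennreal (\<bar>u x\<bar> powr q2) \<partial>lborel) \<le> ennreal (V powr q2) \<Longrightarrow>
       energy (riesz_potential \<alpha>) (\<lambda>x. \<bar>u x\<bar> powr p) (\<lambda>x. \<bar>u x\<bar> powr p) \<le> ennreal (C * V powr (2 * p))"
    by (rule riesz_energy_bound[OF assms]) blast
  have "1 < (real CARD('n) + \<alpha>) / real CARD('n)" using assms(2) by (simp add: field_simps)
  then have p: "p > 1" using assms(4) by linarith
  interpret choquard_energy \<alpha> p C q1 r1 q2 r2 "TYPE('n)"
    by unfold_locales (use assms p adm in auto)
  obtain f :: "real ^ 'n \<Rightarrow> real" where f: "choquard_strong \<alpha> p f" and nz: "\<not> (AE x in lborel. bessel_potential f x = 0)"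
    by (rule choquard_strong_exists)
  define u where "u = bessel_potential f"
  have "f \<in> L2" using f by (simp add: choquard_strong_def)
  then have uL: "u \<in> L2" unfolding u_def by (rule bessel_potential_L2)
  obtain d :: "real ^ 'n" where d: "d \<noteq> 0" using vector_choose_size[of 1] by force
  define v where "v k x = u (x + of_nat k *\<^sub>R d)" for k :: nat and x
  have sol: "choquard_solution \<alpha> p (v k)" for k
    using choquard_strong_imp_solution[OF assms(2,3) choquard_strong_translate(1)[OF f, of "of_nat k *\<^sub>R d"]]
    unfolding choquard_strong_translate(2)[OF f] by (simp add: v_def[abs_def] u_def)
  have inj: "inj (\<lambda>k. ae_equal_H_half `` {v k})"
  proof (rule injI, rule ccontr)
    fix j k assume eq: "ae_equal_H_half `` {v j} = ae_equal_H_half `` {v k}" and jk: "j \<noteq> k"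
    have "v k \<in> H_half" using sol[of k] by (simp add: choquard_solution_def)
    then have "v k \<in> ae_equal_H_half `` {v k}" by (simp add: ae_equal_H_half_def)
    then have "v k \<in> ae_equal_H_half `` {v j}" by (simp only: eq)
    then have "AE x in lborel. v j x = v k x" by (simp add: ae_equal_H_half_def)
    \<comment> \<open>Shifting back by k d turns the coincidence of two translates into the period
      (j - k) d of u.\<close>
    then have ae: "AE x in lborel. v j (x + (- (of_nat k *\<^sub>R d))) = v k (x + (- (of_nat k *\<^sub>R d)))" by (rule AE_translate)
    have "AE x in lborel. u (x + (real j - real k) *\<^sub>R d) = u x"
      using ae by (rule eventually_mono) (simp add: v_def algebra_simps)
    moreover have "(real j - real k) *\<^sub>R d \<noteq> 0" using jk d by simp
    ultimately have "AE x in lborel. u x = 0" using L2_periodic_AE_zero[OF uL] by blast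
    then show False using nz by (simp add: u_def)
  qed
  have "range (\<lambda>k. ae_equal_H_half `` {v k}) \<subseteq> {u. choquard_solution \<alpha> p u} // ae_equal_H_half"
    using sol by (auto intro!: quotientI)
  then show ?thesis using range_inj_infinite[OF inj] finite_subset by blast
qed

end
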